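(* Let $\mathfrak{g}$ be a seven dimensional decomposable nilpotent real Lie algebra. The following are equivalent: (i) $\mathfrak{g}$ admits a cocalibrated $\mathbf{G}_2$-structure; (ii) $\mathfrak{g}$ is isomorphic, as a Lie algebra, to a direct sum $\mathfrak{h}\oplus\mathbb{R}$, where $\mathfrak{h}$ is a six dimensional nilpotent real Lie algebra admitting a half-flat $\mathbf{SU}(3)$-structure; (iii) $\mathfrak{g}$ is isomorphic to $\mathfrak{h}\oplus\mathbb{R}$, where $\mathfrak{h}$ is one of the following 24 six dimensional nilpotent Lie algebras: $(0,0,0,0,0,0)$; $(0,0,0,12,13,23)$, $(0,0,0,0,13-24,14+23)$, $(0,0,0,0,12,14+23)$, $(0,0,0,0,12,13)$, $(0,0,0,0,12,34)$, $(0,0,0,0,0,12+34)$, $(0,0,0,0,0,12)$; $(0,0,0,0,12,15+34)$, $(0,0,0,0,12,14+25)$, $(0,0,0,12,23,14+35)$, $(0,0,0,12,23,14-35)$, $(0,0,0,12,13,14+35)$, $(0,0,0,12,13,14+23)$, $(0,0,0,12,13,24)$; $(0,0,12,13,23,14)$, $(0,0,12,13,23,14+25)$, $(0,0,12,13,23,14-25)$, $(0,0,0,12,14,15+23)$, $(0,0,0,12,14-23,15+34)$, $(0,0,0,12,14,15)$, $(0,0,0,12,14,15+24)$, $(0,0,0,12,14,15+23+24)$; $(0,0,12,13,14+23,24+15)$.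
   Context: Notation for Lie algebras: $\mathfrak{h}=(de^1,\dots,de^6)$ means that $\mathfrak{h}^*$ has a basis $e^1,\dots,e^6$ whose Chevalley–Eilenberg differentials are the listed 2-forms, where $ij$ abbreviates $e^{ij}=e^i\wedge e^j$. For example, $(0,0,0,12,13,24)$ means $de^1=de^2=de^3=0$, $de^4=e^{12}$, $de^5=e^{13}$, $de^6=e^{24}$. Multi-indices denote wedge products, $e^{ijk}=e^i\wedge e^j\wedge e^k$, etc. A Lie algebra is decomposable if it is the direct sum of two non-zero ideals. In $\mathfrak{h}\oplus\mathbb{R}$ the sum is a direct sum of Lie algebras. A 4-form $\phi$ on a seven dimensional real vector space is positive if in some coframe $f^1,\dots,f^7$ it equals $$f^{1234}+f^{1256}+f^{3456}+f^{2467}-f^{1367}-f^{1457}-f^{2357}.$$ A $\mathbf{G}_2$-structure on a seven dimensional Lie algebra $\mathfrak{g}$ is given by a positive $\phi\in\Lambda^4\mathfrak{g}^*$ together with an orientation. It is cocalibrated if $d\phi=0$, where $d$ is the Chevalley–Eilenberg differential. So $\mathfrak{g}$ admits a cocalibrated $\mathbf{G}_2$-structure if and only if it admits a closed positive 4-form. An $\mathbf{SU}(3)$-structure on a six dimensional Lie algebra $\mathfrak{h}$ is a pair $(\omega,\Psi)$, with $\omega$ a real 2-form (the fundamental 2-form) and $\Psi$ a complex 3-form (the complex volume form), such that for some coframe $f^1,\dots,f^6$ of $\mathfrak{h}^*$ and some constant $c>0$ one has $\omega=f^{12}+f^{34}+f^{56}$ and $\Psi=c\,(f^1+if^2)\wedge(f^3+if^4)\wedge(f^5+if^6)$.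 It is half-flat if $d(\omega\wedge\omega)=0$ and $d(\mathrm{Re}\,\Psi)=0$. *)

theory Defs
  imports "HOL-Analysis.Analysis"
begin

section \<open>Real Lie algebras\<close>

definition lie_algebra :: "('a::real_vector \<Rightarrow> 'a \<Rightarrow> 'a) \<Rightarrow> bool" where
  "lie_algebra br \<longleftrightarrow> bilinear br \<and> (\<forall>x. br x x = 0) \<and>
     (\<forall>x y z. br x (br y z) + br y (br z x) + br z (br x y) = 0)"

primrec lower_central :: "('a::real_vector \<Rightarrow> 'a \<Rightarrow> 'a) \<Rightarrow> nat \<Rightarrow> 'a set" where
  "lower_central br 0 = UNIV"
| "lower_central br (Suc n) = span {br x y | x y. y \<in> lower_central br n}"

definition nilpotent_lie :: "('a::real_vector \<Rightarrow> 'a \<Rightarrow> 'a) \<Rightarrow> bool" where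
  "nilpotent_lie br \<longleftrightarrow> (\<exists>n. lower_central br n = {0})"

definition lie_ideal :: "('a::real_vector \<Rightarrow> 'a \<Rightarrow> 'a) \<Rightarrow> 'a set \<Rightarrow> bool" where
  "lie_ideal br I \<longleftrightarrow> subspace I \<and> (\<forall>x. \<forall>y\<in>I. br x y \<in> I)"

definition decomposable_lie :: "('a::real_vector \<Rightarrow> 'a \<Rightarrow> 'a) \<Rightarrow> bool" where
  "decomposable_lie br \<longleftrightarrow>
     (\<exists>I J. lie_ideal br I \<and> lie_ideal br J \<and> I \<noteq> {0} \<and> J \<noteq> {0} \<and>
            I \<inter> J = {0} \<and> {x + y | x y. x \<in> I \<and> y \<in> J} = UNIV)"

definition lie_isomorphic ::
    "('a::real_vector \<Rightarrow> 'a \<Rightarrow> 'a) \<Rightarrow> ('b::real_vector \<Rightarrow> 'b \<Rightarrow> 'b) \<Rightarrow> bool" where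
  "lie_isomorphic br br' \<longleftrightarrow>
     (\<exists>F. linear F \<and> bij F \<and> (\<forall>x y. F (br x y) = br' (F x) (F y)))"

definition lie_sum ::
    "('a \<Rightarrow> 'a \<Rightarrow> 'a) \<Rightarrow> ('b \<Rightarrow> 'b \<Rightarrow> 'b) \<Rightarrow> 'a \<times> 'b \<Rightarrow> 'a \<times> 'b \<Rightarrow> 'a \<times> 'b" where
  "lie_sum br br' p q = (br (fst p) (fst q), br' (snd p) (snd q))"

definition abelian_bracket :: "'a \<Rightarrow> 'a \<Rightarrow> 'a::zero" where
  "abelian_bracket x y = 0"


section \<open>Exterior forms and the Chevalley--Eilenberg differential\<close>

text \<open>
  A \<open>k\<close>-form on \<open>'a\<close> is represented by a function on lists of vectors that is multilinear
  and alternating on lists of length \<open>k\<close> and vanishes on lists of every other length.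
  Because of the latter, the operations below need no degree argument.
\<close>

type_synonym ('a, 'b) form = "'a list \<Rightarrow> 'b"

definition unit_form :: "('a, 'b::comm_ring_1) form" where
  "unit_form xs = (if xs = [] then 1 else 0)"

definition one_form :: "('a \<Rightarrow> 'b::comm_ring_1) \<Rightarrow> ('a, 'b) form" where
  "one_form f xs = (if length xs = 1 then f (hd xs) else 0)"

text \<open>
  The shuffle formula for the wedge product, normalised such that
  \<open>(\<alpha> \<and> \<beta>)(x, y) = \<alpha>(x) \<beta>(y) - \<alpha>(y) \<beta>(x)\<close> for 1-forms. The set \<open>S\<close> selects the positions
  of the arguments passed to the first factor; the exponent counts the inversions of the
  corresponding shuffle.
\<close>

definition wedge :: "('a, 'b::comm_ring_1) form \<Rightarrow> ('a, 'b) form \<Rightarrow> ('a, 'b) form" where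
  "wedge \<alpha> \<beta> xs =
     (\<Sum>S\<in>Pow {..<length xs}.
        (-1) ^ card {(i, j). i \<in> S \<and> j \<in> {..<length xs} - S \<and> j < i} *
        \<alpha> (nths xs S) * \<beta> (nths xs (- S)))"

definition wedge_list :: "(nat \<Rightarrow> 'a \<Rightarrow> 'b::comm_ring_1) \<Rightarrow> nat list \<Rightarrow> ('a, 'b) form" where
  "wedge_list f is = foldr (\<lambda>i. wedge (one_form (f i))) is unit_form"

text \<open>
  On a 1-form \<open>f\<close> this is \<open>(df)(x, y) = - f [x, y]\<close>. The sign \<open>(-1)^(i + j)\<close> is the same for
  numbering of the arguments from 0 and from 1.
\<close>

definition ce_d :: "('a \<Rightarrow> 'a \<Rightarrow> 'a) \<Rightarrow> ('a, 'b::comm_ring_1) form \<Rightarrow> ('a, 'b) form" where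
  "ce_d br \<alpha> xs =
     (\<Sum>j<length xs. \<Sum>i<j.
        (-1) ^ (i + j) * \<alpha> (br (xs ! i) (xs ! j) # nths xs (- {i, j})))"

definition closed_form :: "('a \<Rightarrow> 'a \<Rightarrow> 'a) \<Rightarrow> ('a, 'b::comm_ring_1) form \<Rightarrow> bool" where
  "closed_form br \<alpha> \<longleftrightarrow> (\<forall>xs. ce_d br \<alpha> xs = 0)"

text \<open>A basis \<open>f 1, \<dots>, f n\<close> of the dual space.\<close>

definition coframe :: "nat \<Rightarrow> (nat \<Rightarrow> 'a::real_vector \<Rightarrow> real) \<Rightarrow> bool" where
  "coframe n f \<longleftrightarrow>
     (\<forall>i\<in>{1..n}. linear (f i)) \<and>
     (\<forall>c. (\<forall>v. (\<Sum>i=1..n. c i * f i v) = 0) \<longrightarrow> (\<forall>i\<in>{1..n}. c i = 0)) \<and>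
     (\<forall>g. linear g \<longrightarrow> (\<exists>c. \<forall>v. g v = (\<Sum>i=1..n. c i * f i v)))"


section \<open>Cocalibrated \<open>G\<^sub>2\<close>-structures\<close>

definition positive_4form :: "('a::real_vector, real) form \<Rightarrow> bool" where
  "positive_4form \<phi> \<longleftrightarrow>
     (\<exists>f. coframe 7 f \<and>
        (\<forall>xs. \<phi> xs =
             wedge_list f [1,2,3,4] xs + wedge_list f [1,2,5,6] xs
           + wedge_list f [3,4,5,6] xs + wedge_list f [2,4,6,7] xs
           - wedge_list f [1,3,6,7] xs - wedge_list f [1,4,5,7] xs
           - wedge_list f [2,3,5,7] xs))"

text \<open>An orientation is a ray of non-zero top-degree forms.\<close>

definition orientation :: "nat \<Rightarrow> ('a::real_vector, real) form set \<Rightarrow> bool" where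
  "orientation n Or \<longleftrightarrow>
     (\<exists>f. coframe n f \<and> Or = {\<lambda>xs. c * wedge_list f [1..<Suc n] xs | c. c > 0})"

definition G2_structure ::
    "('a::real_vector, real) form \<Rightarrow> ('a, real) form set \<Rightarrow> bool" where
  "G2_structure \<phi> Or \<longleftrightarrow> positive_4form \<phi> \<and> orientation 7 Or"

definition admits_cocalibrated_G2 :: "('a::real_vector \<Rightarrow> 'a \<Rightarrow> 'a) \<Rightarrow> bool" where
  "admits_cocalibrated_G2 br \<longleftrightarrow> (\<exists>\<phi> Or. G2_structure \<phi> Or \<and> closed_form br \<phi>)"


section \<open>Half-flat \<open>SU(3)\<close>-structures\<close>

definition SU3_structure ::
    "('a::real_vector, real) form \<Rightarrow> ('a, complex) form \<Rightarrow> bool" where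
  "SU3_structure \<omega> \<Psi> \<longleftrightarrow>
     (\<exists>f c. coframe 6 f \<and> c > 0 \<and>
        (\<forall>xs. \<omega> xs = wedge_list f [1,2] xs + wedge_list f [3,4] xs + wedge_list f [5,6] xs) \<and>
        (\<forall>xs. \<Psi> xs = complex_of_real c *
           wedge (one_form (\<lambda>v. complex_of_real (f 1 v) + \<i> * complex_of_real (f 2 v)))
             (wedge (one_form (\<lambda>v. complex_of_real (f 3 v) + \<i> * complex_of_real (f 4 v)))
               (one_form (\<lambda>v. complex_of_real (f 5 v) + \<i> * complex_of_real (f 6 v)))) xs))"

definition admits_half_flat_SU3 :: "('a::real_vector \<Rightarrow> 'a \<Rightarrow> 'a) \<Rightarrow> bool" where
  "admits_half_flat_SU3 br \<longleftrightarrow>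
     (\<exists>\<omega> \<Psi>. SU3_structure \<omega> \<Psi> \<and>
        closed_form br (wedge \<omega> \<omega>) \<and> closed_form br (\<lambda>xs. Re (\<Psi> xs)))"


section \<open>Lie algebras given by structure equations\<close>

text \<open>
  A tuple \<open>(de\<^sup>1, \<dots>, de\<^sup>n)\<close> is encoded by a list whose \<open>k\<close>-th entry lists the signed summands
  of \<open>de\<^sup>k\<close>, where the integer with decimal digits \<open>i j\<close> stands for \<open>e\<^sup>i \<and> e\<^sup>j\<close>; for example
  \<open>[[], [], [], [], [13, -24], [14, 23]]\<close> encodes \<open>(0, 0, 0, 0, 13 - 24, 14 + 23)\<close>.
\<close>

definition signed_term :: "(nat \<Rightarrow> 'a \<Rightarrow> real) \<Rightarrow> int \<Rightarrow> ('a, real) form" where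
  "signed_term e t xs =
     of_int (sgn t) * wedge_list e [nat \<bar>t\<bar> div 10, nat \<bar>t\<bar> mod 10] xs"

definition has_structure_equations ::
    "('a::real_vector \<Rightarrow> 'a \<Rightarrow> 'a) \<Rightarrow> int list list \<Rightarrow> bool" where
  "has_structure_equations br L \<longleftrightarrow>
     (\<exists>e. coframe (length L) e \<and>
        (\<forall>k<length L. \<forall>xs. ce_d br (one_form (e (Suc k))) xs =
           (\<Sum>t\<leftarrow>L ! k. signed_term e t xs)))"

definition half_flat_list :: "int list list list" where
  "half_flat_list =
    [[[], [], [], [], [], []],

     [[], [], [], [12], [13], [23]],
     [[], [], [], [], [13, -24], [14, 23]],
     [[], [], [], [], [12], [14, 23]],
     [[], [], [], [], [12], [13]],
     [[], [], [], [], [12], [34]],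
     [[], [], [], [], [], [12, 34]],
     [[], [], [], [], [], [12]],

     [[], [], [], [], [12], [15, 34]],
     [[], [], [], [], [12], [14, 25]],
     [[], [], [], [12], [23], [14, 35]],
     [[], [], [], [12], [23], [14, -35]],
     [[], [], [], [12], [13], [14, 35]],
     [[], [], [], [12], [13], [14, 23]],
     [[], [], [], [12], [13], [24]],

     [[], [], [12], [13], [23], [14]],
     [[], [], [12], [13], [23], [14, 25]],
     [[], [], [12], [13], [23], [14, -25]],
     [[], [], [], [12], [14], [15, 23]],
     [[], [], [], [12], [14, -23], [15, 34]],
     [[], [], [], [12], [14], [15]],
     [[], [], [], [12], [14], [15, 24]],
     [[], [], [], [12], [14], [15, 23, 24]],

     [[], [], [12], [13], [14, 23], [24, 15]]]"

end

theory Submission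
  imports Defs
begin

text \<open>
  If \<open>(\<omega>, \<Psi>)\<close> is a half-flat structure on \<open>h\<close> and \<open>\<eta>\<close> is the coordinate of the summand \<open>\<real>\<close>, then
  \<open>\<omega>\<^sup>2 / 2 + Re \<Psi> \<and> \<eta>\<close> is a closed positive 4-form on \<open>h \<oplus> \<real>\<close>.

  Conversely, a positive 4-form does not vanish on any five-dimensional subspace. If \<open>[g, g]\<close> misses a central
  element, then \<open>g = h \<oplus> \<real>\<close>, and the six-dimensional nilpotent Lie algebras \<open>h\<close> are classified by
  the dimensions of their lower central series. For those which are not on the list, closedness forces
  the 4-form to vanish on a five-dimensional subspace. If the centre lies in \<open>[g, g]\<close>, then the two
  ideals have dimensions 3 and 4 and are the Heisenberg algebra and the filiform algebra; their sum
  is excluded in the same way. For the algebras on the list, explicit coframes give half-flat structures.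
\<close>

section \<open>Exterior forms\<close>

text \<open>Why five-dimensional subspaces: \<phi> vanishes on the common kernel of two independent
  functionals \<alpha>, \<beta> exactly when \<alpha> \<and> \<beta> \<and> \<phi> = 0. The seven
  coefficients of this 6-form are, up to sign, the components of the seven-dimensional cross product
  of \<alpha> and \<beta>, whose norm is that of \<alpha> \<and> \<beta>. Hence every exclusion
  comes down to finding five vectors on which five values of \<phi> vanish.

  The classification is elementary: modulo the next term of the lower central series the brackets
  become a skew form, a symmetric form or an operator on a plane, and its rank and signature select
  the algebra. Digits in names such as \<open>case_411\<close> or \<open>excluded_312\<close> are
  the dimensions of the successive quotients of that series. The excluded algebras keep free
  parameters, because the obstruction does not depend on normalising them.

  Since df(x, y) = - f [x, y], bracket tables are read in the negative of the dual basis; then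
  bracket coefficients and structure equations agree without signs.\<close>

lemma length_nths_insert_compl:
  assumes "i < length xs"
  shows "length (nths xs (- {i})) = length xs - 1"
proof -
  have "{j. j < length xs \<and> j \<in> - {i}} = {..<length xs} - {i}" by auto
  then show ?thesis using assms by (simp add: length_nths)
qed

lemma length_nths_compl2:
  assumes "i < j" "j < length xs"
  shows "length (nths xs (- {i, j})) = length xs - 2"
proof -
  have "{k. k < length xs \<and> k \<in> - {i, j}} = {..<length xs} - {i, j}" by auto
  moreover have "card ({..<length xs} - {i, j}) = length xs - 2"
    using assms by (subst card_Diff_subset) auto
  ultimately show ?thesis by (simp add: length_nths)
qed

lemma nths_singleton:
  assumes "i < length xs"
  shows "nths xs {i} = [xs ! i]"
  using assms
proof (induction xs arbitrary: i)
  case (Cons x xs)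
  show ?case
  proof (cases i)
    case 0
    then have "{j. Suc j \<in> {i}} = {}" by auto
    then show ?thesis using 0 by (simp add: nths_Cons)
  next
    case (Suc m)
    then have "{j. Suc j \<in> {i}} = {m}" by auto
    then show ?thesis using Suc Cons by (simp add: nths_Cons)
  qed
qed simp

text \<open>A 1-form kills lists of length other than one, so only singletons survive in the shuffle
  sum; moving position i to the front costs i inversions. This is the Laplace expansion from which
  all explicit wedge products are computed.\<close>

lemma wedge_one_form:
  "wedge (one_form f) \<beta> xs =
     (\<Sum>i<length xs. (-1) ^ i * f (xs ! i) * \<beta> (nths xs (- {i})))"
proof -
  let ?n = "length xs"
  let ?g = "\<lambda>S. (-1) ^ card {(i, j). i \<in> S \<and> j \<in> {..<?n} - S \<and> j < i} *
        one_form f (nths xs S) * \<beta> (nths xs (- S))"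
  have "wedge (one_form f) \<beta> xs = sum ?g ((\<lambda>i. {i}) ` {..<?n})"
    unfolding wedge_def
  proof (rule sum.mono_neutral_right)
    show "\<forall>S\<in>Pow {..<?n} - (\<lambda>i. {i}) ` {..<?n}. ?g S = 0"
    proof
      fix S assume S: "S \<in> Pow {..<?n} - (\<lambda>i. {i}) ` {..<?n}"
      then have "{i. i < ?n \<and> i \<in> S} = S" by auto
      then have "length (nths xs S) = card S" by (simp add: length_nths)
      moreover have "card S \<noteq> 1" using S by (auto simp: card_1_singleton_iff)
      ultimately show "?g S = 0" by (simp add: one_form_def)
    qed
  qed auto
  also have "\<dots> = (\<Sum>i<?n. ?g {i})"
    by (subst sum.reindex) (auto simp: inj_on_def)
  also have "\<dots> = (\<Sum>i<?n. (-1) ^ i * f (xs ! i) * \<beta> (nths xs (- {i})))"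
  proof (rule sum.cong)
    fix i assume i: "i \<in> {..<?n}"
    have "{(a, j). a \<in> {i} \<and> j \<in> {..<?n} - {i} \<and> j < a} = Pair i ` {..<i}"
      using i by auto
    moreover have "card (Pair i ` {..<i}) = i"
      by (subst card_image) (auto simp: inj_on_def)
    ultimately show "?g {i} = (-1) ^ i * f (xs ! i) * \<beta> (nths xs (- {i}))"
      using i by (simp add: nths_singleton one_form_def)
  qed simp
  finally show ?thesis .
qed

lemma wedge_list_Nil: "wedge_list f [] = unit_form"
  and wedge_list_Cons: "wedge_list f (i # is) = wedge (one_form (f i)) (wedge_list f is)"
  by (simp_all add: wedge_list_def)

lemma wedge_list_length:
  "length xs \<noteq> length is \<Longrightarrow> wedge_list f is xs = 0"
proof (induction "is" arbitrary: xs)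
  case (Cons i "is")
  show ?case unfolding wedge_list_Cons wedge_one_form
  proof (rule sum.neutral, rule ballI)
    fix k assume k: "k \<in> {..<length xs}"
    then have "wedge_list f is (nths xs (- {k})) = 0"
      using Cons.prems by (intro Cons.IH) (auto simp: length_nths_insert_compl)
    then show "(- 1) ^ k * f i (xs ! k) * wedge_list f is (nths xs (- {k})) = 0" by simp
  qed
qed (simp add: wedge_list_Nil unit_form_def)

lemmas expand_lists = nths_Cons lessThan_Suc numeral_eq_Suc

lemma wedge_list_2:
  "wedge_list f [i, j] [a, b] = f i a * f j b - f i b * f j a"
  by (simp add: wedge_list_Cons wedge_list_Nil wedge_one_form unit_form_def expand_lists)

lemma wedge_list_3:
  "wedge_list f [i, j, k] [a, b, c] =
     f i a * (f j b * f k c - f j c * f k b) - f i b * (f j a * f k c - f j c * f k a)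
     + f i c * (f j a * f k b - f j b * f k a)"
  unfolding wedge_list_Cons[of f i] wedge_one_form
  by (simp add: wedge_list_2 expand_lists)

lemma wedge_list_4:
  "wedge_list f [i, j, k, l] [a, b, c, d] =
     f i a * wedge_list f [j, k, l] [b, c, d] - f i b * wedge_list f [j, k, l] [a, c, d]
     + f i c * wedge_list f [j, k, l] [a, b, d] - f i d * wedge_list f [j, k, l] [a, b, c]"
  unfolding wedge_list_Cons[of f i] wedge_one_form
  by (simp add: expand_lists)

lemma ce_d_length:
  assumes "\<And>xs. length xs \<noteq> k \<Longrightarrow> \<alpha> xs = 0" "length xs \<noteq> Suc k"
  shows "ce_d br \<alpha> xs = 0"
  unfolding ce_d_def
proof (intro sum.neutral ballI)
  fix j i assume "j \<in> {..<length xs}" "i \<in> {..<j}"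
  then have "length (br (xs ! i) (xs ! j) # nths xs (- {i, j})) \<noteq> k"
    using assms(2) by (auto simp: length_nths_compl2)
  then show "(- 1) ^ (i + j) * \<alpha> (br (xs ! i) (xs ! j) # nths xs (- {i, j})) = 0"
    using assms(1) by simp
qed

lemma ce_d_2: "ce_d br \<alpha> [a, b] = - \<alpha> [br a b]"
  by (simp add: ce_d_def expand_lists)

lemma ce_d_4:
  "ce_d br \<alpha> [a, b, c, d] =
     - \<alpha> [br a b, c, d] + \<alpha> [br a c, b, d] - \<alpha> [br a d, b, c]
     - \<alpha> [br b c, a, d] + \<alpha> [br b d, a, c] - \<alpha> [br c d, a, b]"
  by (simp add: ce_d_def expand_lists)

lemma ce_d_5:
  "ce_d br \<alpha> [a, b, c, d, e] =
     - \<alpha> [br a b, c, d, e] + \<alpha> [br a c, b, d, e] - \<alpha> [br a d, b, c, e] + \<alpha> [br a e, b, c, d]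
     - \<alpha> [br b c, a, d, e] + \<alpha> [br b d, a, c, e] - \<alpha> [br b e, a, c, d]
     - \<alpha> [br c d, a, b, e] + \<alpha> [br c e, a, b, d] - \<alpha> [br d e, a, b, c]"
  by (simp add: ce_d_def expand_lists)

text \<open>The differential raises the degree by one, so lists of any other length impose no
  condition.\<close>

lemma closed_form_3_iff:
  assumes "\<And>xs. length xs \<noteq> 3 \<Longrightarrow> \<alpha> xs = 0"
  shows "closed_form br \<alpha> \<longleftrightarrow> (\<forall>a b c d. ce_d br \<alpha> [a, b, c, d] = 0)"
proof
  assume R: "\<forall>a b c d. ce_d br \<alpha> [a, b, c, d] = 0"
  show "closed_form br \<alpha>" unfolding closed_form_def
  proof
    fix xs :: "'a list"
    show "ce_d br \<alpha> xs = 0"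
    proof (cases "length xs = 4")
      case True
      then obtain a b c d where "xs = [a, b, c, d]"
        by (auto simp: length_Suc_conv numeral_eq_Suc)
      then show ?thesis using R by simp
    qed (auto intro!: ce_d_length[of 3] assms)
  qed
qed (auto simp: closed_form_def)

lemma closed_form_4_iff:
  assumes "\<And>xs. length xs \<noteq> 4 \<Longrightarrow> \<alpha> xs = 0"
  shows "closed_form br \<alpha> \<longleftrightarrow> (\<forall>a b c d e. ce_d br \<alpha> [a, b, c, d, e] = 0)"
proof
  assume R: "\<forall>a b c d e. ce_d br \<alpha> [a, b, c, d, e] = 0"
  show "closed_form br \<alpha>" unfolding closed_form_def
  proof
    fix xs :: "'a list"
    show "ce_d br \<alpha> xs = 0"
    proof (cases "length xs = 5")
      case True
      then obtain a b c d e where "xs = [a, b, c, d, e]"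
        by (auto simp: length_Suc_conv numeral_eq_Suc)
      then show ?thesis using R by simp
    qed (auto intro!: ce_d_length[of 4] assms)
  qed
qed (auto simp: closed_form_def)

lemma wedge_length:
  assumes "\<And>xs. length xs \<noteq> k \<Longrightarrow> \<alpha> xs = 0" "\<And>xs. length xs \<noteq> l \<Longrightarrow> \<beta> xs = 0"
    and "length xs \<noteq> k + l"
  shows "wedge \<alpha> \<beta> xs = 0"
  unfolding wedge_def
proof (intro sum.neutral ballI)
  fix S assume S: "S \<in> Pow {..<length xs}"
  have "{i. i < length xs \<and> i \<in> S} = S" "{i. i < length xs \<and> i \<in> - S} = {..<length xs} - S"
    using S by auto
  then have "length (nths xs S) = card S" "length (nths xs (- S)) = length xs - card S"
    using S by (auto simp: length_nths card_Diff_subset finite_subset)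
  moreover have "card S \<le> length xs"
    using S card_mono[of "{..<length xs}" S] by auto
  ultimately have "length (nths xs S) \<noteq> k \<or> length (nths xs (- S)) \<noteq> l"
    using assms(3) by auto
  then show "(- 1) ^ card {(i, j). i \<in> S \<and> j \<in> {..<length xs} - S \<and> j < i} *
         \<alpha> (nths xs S) * \<beta> (nths xs (- S)) = 0"
    using assms(1,2) by auto
qed

section \<open>Dual bases and coframes\<close>

lemma linear_functional_nonzero:
  fixes x :: "'a::real_vector"
  assumes "x \<noteq> 0"
  shows "\<exists>g :: 'a \<Rightarrow> real. linear g \<and> g x = 1"
  using linear_independent_extend[of "{x}" "\<lambda>_. 1"] assms by auto

text \<open>A Gram-Schmidt induction on the number of functionals, which works before anything is
  known about the dimension of the space.\<close>

lemma dual_vectors_exist: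
  fixes f :: "nat \<Rightarrow> 'a::real_vector \<Rightarrow> real"
  assumes "\<forall>i\<in>{1..n}. linear (f i)"
    and "\<forall>c. (\<forall>v. (\<Sum>i=1..n. c i * f i v) = 0) \<longrightarrow> (\<forall>i\<in>{1..n}. c i = 0)"
  shows "\<exists>u. \<forall>i\<in>{1..n}. \<forall>j\<in>{1..n}. f i (u j) = (if i = j then 1 else 0)"
  using assms
proof (induction n)
  case (Suc n)
  have lin: "linear (f i)" if "i \<in> {1..Suc n}" for i using Suc.prems(1) that by blast
  have "\<forall>c. (\<forall>v. (\<Sum>i=1..n. c i * f i v) = 0) \<longrightarrow> (\<forall>i\<in>{1..n}. c i = 0)"
  proof (intro allI impI ballI)
    fix c i assume c: "\<forall>v. (\<Sum>i=1..n. c i * f i v) = 0" and i: "i \<in> {1..n}"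
    let ?c = "\<lambda>k. if k = Suc n then 0 else c k"
    have "(\<Sum>i=1..Suc n. ?c i * f i v) = 0" for v
    proof -
      have "(\<Sum>i=1..n. ?c i * f i v) = (\<Sum>i=1..n. c i * f i v)" by (rule sum.cong) auto
      then show ?thesis using c by simp
    qed
    then have "?c i = 0" using Suc.prems(2)[rule_format, of ?c i] i by auto
    then show "c i = 0" using i by auto
  qed
  then obtain u where u: "\<And>i j. i \<in> {1..n} \<Longrightarrow> j \<in> {1..n} \<Longrightarrow> f i (u j) = (if i = j then 1 else 0)"
    using Suc.IH lin by fastforce
  \<comment> \<open>The part of the new functional that the dual vectors found so far do not account
    for; independence prevents it from being zero.\<close>
  define g where "g = (\<lambda>v. f (Suc n) v - (\<Sum>j=1..n. f (Suc n) (u j) * f j v))"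
  have "\<exists>w. g w \<noteq> 0"
  proof (rule ccontr)
    assume "\<nexists>w. g w \<noteq> 0"
    then have g0: "g w = 0" for w by blast
    let ?c = "\<lambda>k. if k = Suc n then 1 else - f (Suc n) (u k)"
    have "(\<Sum>i=1..Suc n. ?c i * f i v) = 0" for v
    proof -
      have "(\<Sum>i=1..n. ?c i * f i v) = (\<Sum>i=1..n. - (f (Suc n) (u i) * f i v))"
        by (rule sum.cong) auto
      then show ?thesis using g0[of v] by (simp add: g_def sum_negf)
    qed
    then have "?c (Suc n) = 0" using Suc.prems(2)[rule_format, of ?c "Suc n"] by auto
    then show False by simp
  qed
  then obtain w where w: "g w \<noteq> 0" by blast
  \<comment> \<open>Killed by the earlier functionals and normalised to give 1 under the new one;
    the old dual vectors are then corrected by multiples of p.\<close>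
  define p where "p = (1 / g w) *\<^sub>R (w - (\<Sum>j=1..n. f j w *\<^sub>R u j))"
  have fp: "f i p = (f i w - (\<Sum>j=1..n. f j w * f i (u j))) / g w" if "i \<in> {1..Suc n}" for i
    using lin[OF that] by (simp add: p_def linear_scale[OF lin[OF that]] linear_diff[OF lin[OF that]] linear_sum[OF lin[OF that]])
  have p0: "f i p = 0" if "i \<in> {1..n}" for i
  proof -
    have "(\<Sum>j=1..n. f j w * f i (u j)) = (\<Sum>j=1..n. if j = i then f j w else 0)"
      using u that by (intro sum.cong) auto
    also have "\<dots> = f i w" using that by simp
    finally show ?thesis using fp[of i] that by simp
  qed
  have p1: "f (Suc n) p = 1"
    using fp[of "Suc n"] w by (simp add: g_def mult.commute)
  define u' where "u' = (\<lambda>j. if j = Suc n then p else u j - f (Suc n) (u j) *\<^sub>R p)"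
  have "f i (u' j) = (if i = j then 1 else 0)" if ij: "i \<in> {1..Suc n}" "j \<in> {1..Suc n}" for i j
  proof -
    have d: "f i (u j - f (Suc n) (u j) *\<^sub>R p) = f i (u j) - f (Suc n) (u j) * f i p"
      by (simp add: linear_diff[OF lin[OF ij(1)]] linear_scale[OF lin[OF ij(1)]])
    show ?thesis
    proof (cases "i = Suc n")
      case True
      then show ?thesis using p1 d by (auto simp: u'_def)
    next
      case False
      then have "i \<in> {1..n}" using ij by auto
      then show ?thesis using p0[of i] u[of i j] ij d False by (cases "j = Suc n") (auto simp: u'_def)
    qed
  qed
  then show ?case by blast
qed simp

text \<open>The functionals span the whole dual, so a vector killed by all of them is killed by
  every functional and is zero; this is applied to x minus its expansion.\<close>

lemma coframe_dual_basis:
  assumes "coframe n f"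
  obtains u where "\<And>i j. i \<in> {1..n} \<Longrightarrow> j \<in> {1..n} \<Longrightarrow> f i (u j) = (if i = j then 1 else 0)"
    and "\<And>x. (\<Sum>i=1..n. f i x *\<^sub>R u i) = x"
proof -
  obtain u where u: "\<And>i j. i \<in> {1..n} \<Longrightarrow> j \<in> {1..n} \<Longrightarrow> f i (u j) = (if i = j then 1 else 0)"
    using dual_vectors_exist[of n f] assms unfolding coframe_def by blast
  moreover have "x = (\<Sum>i=1..n. f i x *\<^sub>R u i)" for x
  proof (rule ccontr)
    let ?y = "x - (\<Sum>i=1..n. f i x *\<^sub>R u i)"
    assume "x \<noteq> (\<Sum>i=1..n. f i x *\<^sub>R u i)"
    then have "?y \<noteq> 0" by simp
    from linear_functional_nonzero[OF this] obtain g :: "'a \<Rightarrow> real" where g: "linear g \<and> g ?y = 1" ..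
    then obtain c where c: "\<forall>v. g v = (\<Sum>i=1..n. c i * f i v)"
      using assms unfolding coframe_def by blast
    have "f i ?y = 0" if i: "i \<in> {1..n}" for i
    proof -
      have "linear (f i)" using assms i unfolding coframe_def by blast
      note l = this
      have "f i ?y = f i x - (\<Sum>j=1..n. f j x * f i (u j))"
        by (simp add: linear_diff[OF l] linear_sum[OF l] linear_scale[OF l])
      also have "(\<Sum>j=1..n. f j x * f i (u j)) = (\<Sum>j=1..n. if j = i then f j x else 0)"
        using u i by (intro sum.cong) auto
      finally show ?thesis using i by simp
    qed
    then have "g ?y = 0" using c by simp
    then show False using g by simp
  qed
  ultimately show thesis by (rule that[OF _ sym])
qed

lemma spanning_family_basis:
  fixes u :: "nat \<Rightarrow> 'a::real_vector"
  assumes "span (u ` {1..n}) = UNIV" "dim (UNIV :: 'a set) = n"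
  shows "inj_on u {1..n}" "independent (u ` {1..n})"
proof -
  have fin: "finite (u ` {1..n})" by simp
  obtain B where B: "B \<subseteq> u ` {1..n}" "independent B" "u ` {1..n} \<subseteq> span B"
    using maximal_independent_subset by blast
  have "span B = UNIV"
    using B(3) assms(1) by (metis span_mono span_span subset_UNIV subset_antisym)
  then have "dim (UNIV :: 'a set) = card B"
    using B(2) by (metis dim_eq_card span_UNIV)
  then have cB: "card B = n" using assms(2) by simp
  have "card B \<le> card (u ` {1..n})" by (rule card_mono[OF fin B(1)])
  then have c: "card (u ` {1..n}) = n"
    using cB card_image_le[of "{1..n}" u] by simp
  then show "inj_on u {1..n}" by (intro eq_card_imp_inj_on) auto
  have "B = u ` {1..n}" using card_subset_eq[OF fin B(1)] c cB by simp
  then show "independent (u ` {1..n})" using B(2) by simp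
qed

lemma dual_coframe_exists:
  fixes u :: "nat \<Rightarrow> 'a::real_vector"
  assumes sp: "span (u ` {1..n}) = UNIV" and dm: "dim (UNIV :: 'a set) = n"
  obtains f where "coframe n f"
    and "\<And>i j. j \<in> {1..n} \<Longrightarrow> f i (u j) = (if i = j then 1 else 0)"
    and "\<And>x. (\<Sum>i=1..n. f i x *\<^sub>R u i) = x"
proof -
  note bas = spanning_family_basis[OF sp dm]
  \<comment> \<open>The condition on i matters: outside \<open>{1..n}\<close> the vector
    \<open>u i\<close> may repeat a basis vector, and \<open>f i\<close> must vanish there all the
    same.\<close>
  define e where "e = (\<lambda>i x. if u i = x \<and> i \<in> {1..n} then 1 else (0::real))"
  define f where "f = (\<lambda>i. SOME g. linear g \<and> (\<forall>x\<in>u ` {1..n}. g x = e i x))"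
  have f': "linear (f i) \<and> (\<forall>x\<in>u ` {1..n}. f i x = e i x)" for i
    unfolding f_def using linear_independent_extend[OF bas(2), of "e i"] by (rule someI_ex)
  have f: "linear (f i)" "x \<in> u ` {1..n} \<Longrightarrow> f i x = e i x" for i x
    using f'[of i] by auto
  have d: "f i (u j) = (if i = j then 1 else 0)" if "j \<in> {1..n}" for i j
  proof -
    have "u i = u j \<and> i \<in> {1..n} \<longleftrightarrow> i = j" using that inj_onD[OF bas(1)] by blast
    moreover have "f i (u j) = e i (u j)" using that by (intro f(2)) auto
    ultimately show ?thesis by (simp add: e_def)
  qed
  have ex: "x = (\<Sum>i=1..n. f i x *\<^sub>R u i)" for x
  proof -
    have l: "linear (\<lambda>x. \<Sum>i=1..n. f i x *\<^sub>R u i)"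
    proof (rule linearI)
      fix a b :: 'a and r :: real
      show "(\<Sum>i=1..n. f i (a + b) *\<^sub>R u i) = (\<Sum>i=1..n. f i a *\<^sub>R u i) + (\<Sum>i=1..n. f i b *\<^sub>R u i)"
        by (simp only: linear_add[OF f(1)] scaleR_left_distrib sum.distrib)
      show "(\<Sum>i=1..n. f i (r *\<^sub>R a) *\<^sub>R u i) = r *\<^sub>R (\<Sum>i=1..n. f i a *\<^sub>R u i)"
        by (simp add: linear_scale[OF f(1)] scaleR_sum_right)
    qed
    have b: "id y = (\<Sum>i=1..n. f i y *\<^sub>R u i)" if y: "y \<in> u ` {1..n}" for y
    proof -
      obtain j where j: "j \<in> {1..n}" "y = u j" using y by blast
      have "(\<Sum>i=1..n. f i y *\<^sub>R u i) = (\<Sum>i=1..n. if i = j then u i else 0)"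
        using j d by (intro sum.cong) auto
      then show ?thesis using j by simp
    qed
    have xs: "x \<in> span (u ` {1..n})" using sp by blast
    have "id x = (\<Sum>i=1..n. f i x *\<^sub>R u i)"
      by (rule linear_eq_on_span[OF linear_id l b xs])
    then show ?thesis unfolding id_apply .
  qed
  have "coframe n f"
    unfolding coframe_def
  proof (intro conjI ballI allI impI)
    fix c i assume c: "\<forall>v. (\<Sum>i=1..n. c i * f i v) = 0" and i: "i \<in> {1..n}"
    have "(\<Sum>k=1..n. c k * f k (u i)) = (\<Sum>k=1..n. if k = i then c k else 0)"
      using d i by (intro sum.cong) auto
    then show "c i = 0" using c i by simp
  next
    fix g :: "'a \<Rightarrow> real" assume g: "linear g"
    have "g v = (\<Sum>i=1..n. g (u i) * f i v)" for v
    proof -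
      have "g v = g (\<Sum>i=1..n. f i v *\<^sub>R u i)" by (rule arg_cong[where f = g, OF ex[of v]])
      also have "\<dots> = (\<Sum>i=1..n. f i v * g (u i))"
        by (simp add: linear_sum[OF g] linear_scale[OF g])
      finally show ?thesis by (simp add: mult.commute)
    qed
    then show "\<exists>c. \<forall>v. g v = (\<Sum>i=1..n. c i * f i v)" by (intro exI[of _ "\<lambda>i. g (u i)"] allI)
  qed (use f(1) in auto)
  then show thesis using d ex[symmetric] by (rule that[of f])
qed

section \<open>Positive 4-forms\<close>

text \<open>Insertion sort on indices, with Z standing for "the form vanishes on these basis
  vectors". Antisymmetry makes Z stable under adjacent swaps and true for repeated indices, so only
  increasing tuples have to be computed.\<close>

lemma sorting_induct_4:
  fixes Z :: "nat \<Rightarrow> nat \<Rightarrow> nat \<Rightarrow> nat \<Rightarrow> bool"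
  assumes s: "\<And>i j k l. Z i j k l \<Longrightarrow> Z j i k l" "\<And>i j k l. Z i j k l \<Longrightarrow> Z i k j l"
      "\<And>i j k l. Z i j k l \<Longrightarrow> Z i j l k"
    and e: "\<And>i k l. Z i i k l" "\<And>i j l. Z i j j l" "\<And>i j k. Z i j k k"
    and inc: "\<And>i j k l. i < j \<Longrightarrow> j < k \<Longrightarrow> k < l \<Longrightarrow> Z i j k l"
  shows "Z i j k l"
proof -
  have A: "Z i j k l" if "j < k" "k < l" for i j k l
  proof -
    consider "i < j" | "i = j" | "j < i" "i < k" | "i = k" | "k < i" "i < l" | "i = l" | "l < i"
      by linarith
    then show ?thesis
    proof cases
      case 5
      then show ?thesis using that by (intro s(1)[OF s(2)[OF inc]])
    next
      case 7
      then show ?thesis using that by (intro s(1)[OF s(2)[OF s(3)[OF inc]]])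
    qed (use that e s(1)[OF s(2)[OF e(3)]] in \<open>auto intro: inc s(1)\<close>)
  qed
  have B: "Z i j k l" if "k < l" for i j k l
  proof -
    consider "j < k" | "j = k" | "k < j" "j < l" | "j = l" | "l < j" by linarith
    then show ?thesis
    proof cases
      case 5
      then show ?thesis using that by (intro s(2)[OF s(3)[OF A]])
    qed (use that e in \<open>auto intro: A s(2)\<close>)
  qed
  show ?thesis using B[of k l i j] B[of l k i j] e(3) s(3) by (metis linorder_neqE_nat)
qed

text \<open>The first index is inserted into four sorted ones; the remaining four are sorted by the
  previous lemma with the first one fixed.\<close>

lemma sorting_induct_5:
  fixes Z :: "nat \<Rightarrow> nat \<Rightarrow> nat \<Rightarrow> nat \<Rightarrow> nat \<Rightarrow> bool"
  assumes s: "\<And>i j k l m. Z i j k l m \<Longrightarrow> Z j i k l m" "\<And>i j k l m. Z i j k l m \<Longrightarrow> Z i k j l m"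
      "\<And>i j k l m. Z i j k l m \<Longrightarrow> Z i j l k m" "\<And>i j k l m. Z i j k l m \<Longrightarrow> Z i j k m l"
    and e: "\<And>i k l m. Z i i k l m" "\<And>i j l m. Z i j j l m" "\<And>i j k m. Z i j k k m" 
      "\<And>i j k l. Z i j k l l"
    and inc: "\<And>i j k l m. i < j \<Longrightarrow> j < k \<Longrightarrow> k < l \<Longrightarrow> l < m \<Longrightarrow> Z i j k l m"
  shows "Z i j k l m"
proof -
  have A: "Z i j k l m" if "j < k" "k < l" "l < m" for i j k l m
  proof -
    consider "i < j" | "i = j" | "j < i" "i < k" | "i = k" | "k < i" "i < l" | "i = l"
      | "l < i" "i < m" | "i = m" | "m < i"
      by linarith
    then show ?thesis
    proof cases
      case 5
      then show ?thesis using that by (intro s(1)[OF s(2)[OF inc]])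
    next
      case 7
      then show ?thesis using that by (intro s(1)[OF s(2)[OF s(3)[OF inc]]])
    next
      case 9
      then show ?thesis using that by (intro s(1)[OF s(2)[OF s(3)[OF s(4)[OF inc]]]])
    qed (use that e s(1)[OF s(2)[OF e(3)]] s(1)[OF s(2)[OF s(3)[OF e(4)]]] in \<open>auto intro: inc s(1)\<close>)
  qed
  show ?thesis
    by (rule sorting_induct_4[of "Z i", OF s(2,3,4) e(2,3,4) A])
qed

text \<open>A 4-form in curried shape, so that linearity in each slot can be used for rewriting; the
  swaps carry linearity from the first slot to the others.\<close>

locale alternating4 =
  fixes F :: "'a::real_vector \<Rightarrow> 'a \<Rightarrow> 'a \<Rightarrow> 'a \<Rightarrow> real"
  assumes lin1: "linear (\<lambda>x. F x b c d)"
    and swap12: "F b a c d = - F a b c d"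
    and swap23: "F a c b d = - F a b c d"
    and swap34: "F a b d c = - F a b c d"
begin

lemma lin2: "linear (\<lambda>x. F a x c d)"
  using linear_compose_neg[OF lin1[of a c d]] by (simp add: swap12[of _ a])

lemma lin3: "linear (\<lambda>x. F a b x d)"
  using linear_compose_neg[OF lin2[of a b d]] by (simp add: swap23[of _ _ b])

lemma lin4: "linear (\<lambda>x. F a b c x)"
  using linear_compose_neg[OF lin3[of a b c]] by (simp add: swap34[of _ _ _ c])

lemmas expand =
  linear_add[OF lin1] linear_add[OF lin2] linear_add[OF lin3] linear_add[OF lin4]
  linear_diff[OF lin1] linear_diff[OF lin2] linear_diff[OF lin3] linear_diff[OF lin4]
  linear_scale[OF lin1, simplified] linear_scale[OF lin2, simplified]
  linear_scale[OF lin3, simplified] linear_scale[OF lin4, simplified]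
  linear_neg[OF lin1] linear_neg[OF lin2] linear_neg[OF lin3] linear_neg[OF lin4]
  linear_0[OF lin1] linear_0[OF lin2] linear_0[OF lin3] linear_0[OF lin4]

lemma repeated [simp]:
  "F a a c d = 0" "F a b b d = 0" "F a b c c = 0" "F a b a d = 0" "F a b c b = 0" "F a b c a = 0"
proof -
  show *: "F a a c d = 0" for a c d using swap12[of a a c d] by simp
  show "F a b b d = 0" for a b d using swap23[of a b b d] by simp
  show "F a b c c = 0" for a b c using swap34[of a b c c] by simp
  show **: "F a b a d = 0" for a b d using swap23[of a b a d] * by simp
  show "F a b c b = 0" for a b c using swap34[of a b c b] \<open>\<And>a b d. F a b b d = 0\<close> by simp
  show "F a b c a = 0" for a b c using swap34[of a b c a] ** by simp
qed

lemma zero_on_span: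
  assumes B: "\<And>a b c d. a \<in> B \<Longrightarrow> b \<in> B \<Longrightarrow> c \<in> B \<Longrightarrow> d \<in> B \<Longrightarrow> F a b c d = 0"
    and x: "x \<in> span B" "y \<in> span B" "z \<in> span B" "w \<in> span B"
  shows "F x y z w = 0"
proof -
  have 1: "F x b c d = 0" if "b \<in> B" "c \<in> B" "d \<in> B" for b c d
    by (rule linear_eq_0_on_span[OF lin1 _ x(1)]) (use B that in auto)
  have 2: "F x y c d = 0" if "c \<in> B" "d \<in> B" for c d
    by (rule linear_eq_0_on_span[OF lin2 _ x(2)]) (use 1 that in auto)
  have 3: "F x y z d = 0" if "d \<in> B" for d
    by (rule linear_eq_0_on_span[OF lin3 _ x(3)]) (use 2 that in auto)
  show ?thesis by (rule linear_eq_0_on_span[OF lin4 _ x(4)]) (use 3 in auto)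
qed

text \<open>Up to sign, a tuple from the family either repeats a member or has increasing indices;
  multilinearity then reaches the span.\<close>

lemma zero_on_family:
  fixes v :: "nat \<Rightarrow> 'a"
  assumes inc: "\<And>i j k l. i < j \<Longrightarrow> j < k \<Longrightarrow> k < l \<Longrightarrow> {i, j, k, l} \<subseteq> I \<Longrightarrow> F (v i) (v j) (v k) (v l) = 0"
    and x: "x \<in> span (v ` I)" "y \<in> span (v ` I)" "z \<in> span (v ` I)" "w \<in> span (v ` I)"
  shows "F x y z w = 0"
proof -
  let ?Z = "\<lambda>i j k l. {i, j, k, l} \<subseteq> I \<longrightarrow> F (v i) (v j) (v k) (v l) = 0"
  have "?Z i j k l" for i j k l :: nat
  proof (rule sorting_induct_4[of ?Z])
    fix i j k l :: nat
    show "?Z i j k l \<Longrightarrow> ?Z j i k l" using swap12[of "v j" "v i"] by auto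
    show "?Z i j k l \<Longrightarrow> ?Z i k j l" using swap23[of "v i" "v k" "v j"] by auto
    show "?Z i j k l \<Longrightarrow> ?Z i j l k" using swap34[of "v i" "v j" "v l" "v k"] by auto
  qed (use inc in auto)
  then show ?thesis by (intro zero_on_span[OF _ x]) auto
qed

text \<open>Terms with two copies of c vanish, so the pullback of F along x \<mapsto> x -
  \<gamma>(x) c is F minus \<gamma> wedged with the contraction of F by c.\<close>

lemma project:
  "F (x - \<gamma> x *\<^sub>R c) (y - \<gamma> y *\<^sub>R c) (z - \<gamma> z *\<^sub>R c) (w - \<gamma> w *\<^sub>R c) =
     F x y z w - \<gamma> x * F c y z w + \<gamma> y * F c x z w - \<gamma> z * F c x y w + \<gamma> w * F c x y z"
proof -
  have "F x c z w = - F c x z w" "F x y c w = F c x y w" "F x y z c = - F c x y z"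
    using swap12[of x c] swap23[of x y c] swap34[of x y z c] swap12[of x c] swap23[of x y c] by simp_all
  then show ?thesis by (simp add: expand)
qed

end

text \<open>The 5-form \<gamma> \<and> F, in curried shape.\<close>

definition wedge14 :: "('a \<Rightarrow> real) \<Rightarrow> ('a \<Rightarrow> 'a \<Rightarrow> 'a \<Rightarrow> 'a \<Rightarrow> real) \<Rightarrow> 'a \<Rightarrow> 'a \<Rightarrow> 'a \<Rightarrow> 'a \<Rightarrow> 'a \<Rightarrow> real" where
  "wedge14 \<gamma> F p q r s t = \<gamma> p * F q r s t - \<gamma> q * F p r s t + \<gamma> r * F p q s t - \<gamma> s * F p q r t
     + \<gamma> t * F p q r s"

text \<open>The projection changes F only by a multiple of \<gamma>, and \<gamma> \<and> \<gamma> =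
  0.\<close>

lemma (in alternating4) wedge14_project:
  "wedge14 \<gamma> (\<lambda>x y z w. F (x - \<gamma> x *\<^sub>R c) (y - \<gamma> y *\<^sub>R c) (z - \<gamma> z *\<^sub>R c) (w - \<gamma> w *\<^sub>R c)) p q r s t =
   wedge14 \<gamma> F p q r s t"
  unfolding wedge14_def project by (simp add: algebra_simps)

lemma alternating4_project:
  assumes "alternating4 F" "linear \<gamma>"
  shows "alternating4 (\<lambda>x y z w. F (x - \<gamma> x *\<^sub>R c) (y - \<gamma> y *\<^sub>R c) (z - \<gamma> z *\<^sub>R c) (w - \<gamma> w *\<^sub>R c))"
proof -
  interpret alternating4 F by fact
  have l: "linear (\<lambda>x. x - \<gamma> x *\<^sub>R c)"
    by (rule linearI)
      (simp_all add: linear_add[OF assms(2)] linear_scale[OF assms(2)] algebra_simps)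
  show ?thesis
  proof (rule alternating4.intro)
    fix y z w
    show "linear (\<lambda>x. F (x - \<gamma> x *\<^sub>R c) (y - \<gamma> y *\<^sub>R c) (z - \<gamma> z *\<^sub>R c) (w - \<gamma> w *\<^sub>R c))"
      using linear_compose[OF l lin1] by (simp add: o_def)
  qed (rule swap12 swap23 swap34)+
qed

text \<open>
  The hypothesis says that \<open>F\<close> vanishes on the common kernel of \<open>\<alpha>\<close> and \<open>\<beta>\<close>; the
  conclusion is \<open>\<alpha> \<and> \<beta> \<and> F = 0\<close>, evaluated on six vectors.
\<close>

lemma (in alternating4) wedge_vanishing:
  assumes "linear \<beta>" "\<beta> a = 0"
    and 0: "\<And>x y z w. F (x - \<alpha> x *\<^sub>R a - \<beta> x *\<^sub>R b) (y - \<alpha> y *\<^sub>R a - \<beta> y *\<^sub>R b)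
      (z - \<alpha> z *\<^sub>R a - \<beta> z *\<^sub>R b) (w - \<alpha> w *\<^sub>R a - \<beta> w *\<^sub>R b) = 0"
  defines "m \<equiv> \<lambda>x y. \<alpha> x * \<beta> y - \<alpha> y * \<beta> x"
  shows "m p q * F r s t u - m p r * F q s t u + m p s * F q r t u - m p t * F q r s u
    + m p u * F q r s t + m q r * F p s t u - m q s * F p r t u + m q t * F p r s u
    - m q u * F p r s t + m r s * F p q t u - m r t * F p q s u + m r u * F p q s t
    + m s t * F p q r u - m s u * F p q r t + m t u * F p q r s = 0" (is "?G = 0")
proof -
  \<comment> \<open>With F' the projection of F along b one has \<beta> \<and> F = \<beta> \<and> F'
    and \<alpha> \<and> F' = 0, whence \<alpha> \<and> \<beta> \<and> F = 0. The condition
    \<open>\<beta> a = 0\<close> makes the projections along a and b compose to the one in the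
    hypothesis.\<close>
  define F' where "F' = (\<lambda>x y z w. F (x - \<beta> x *\<^sub>R b) (y - \<beta> y *\<^sub>R b) (z - \<beta> z *\<^sub>R b) (w - \<beta> w *\<^sub>R b))"
  interpret F': alternating4 F'
    unfolding F'_def by (rule alternating4_project[OF alternating4_axioms assms(1)])
  have "wedge14 \<alpha> F' p q r s t = 0" for p q r s t
  proof -
    have "\<beta> (x - \<alpha> x *\<^sub>R a) = \<beta> x" for x
      by (simp add: linear_diff[OF assms(1)] linear_scale[OF assms(1)] assms(2))
    then have "F' (x - \<alpha> x *\<^sub>R a) (y - \<alpha> y *\<^sub>R a) (z - \<alpha> z *\<^sub>R a) (w - \<alpha> w *\<^sub>R a) = 0" for x y z w
      using 0[of x y z w] by (simp add: F'_def)
    then show ?thesis using F'.wedge14_project[of \<alpha> a p q r s t] by (simp add: wedge14_def)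
  qed
  note z = this
  have w: "wedge14 \<beta> F p q r s t = wedge14 \<beta> F' p q r s t" for p q r s t
    using wedge14_project[of \<beta> b p q r s t] by (simp add: F'_def)
  have "?G = \<alpha> p * wedge14 \<beta> F q r s t u - \<alpha> q * wedge14 \<beta> F p r s t u + \<alpha> r * wedge14 \<beta> F p q s t u
      - \<alpha> s * wedge14 \<beta> F p q r t u + \<alpha> t * wedge14 \<beta> F p q r s u - \<alpha> u * wedge14 \<beta> F p q r s t"
    by (simp add: wedge14_def m_def algebra_simps)
  also have "\<dots> = - (\<beta> p * wedge14 \<alpha> F' q r s t u - \<beta> q * wedge14 \<alpha> F' p r s t u + \<beta> r * wedge14 \<alpha> F' p q s t u
      - \<beta> s * wedge14 \<alpha> F' p q r t u + \<beta> t * wedge14 \<alpha> F' p q r s u - \<beta> u * wedge14 \<alpha> F' p q r s t)"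
    unfolding w by (simp add: wedge14_def algebra_simps)
  finally show ?thesis by (simp add: z)
qed

section \<open>The normal form of a positive 4-form as an alternating map\<close>

lemma alternating4_wedge_list:
  assumes "linear (f i)" "linear (f j)" "linear (f k)" "linear (f l)"
  shows "alternating4 (\<lambda>a b c d. wedge_list f [i, j, k, l] [a, b, c, d])"
proof (rule alternating4.intro)
  fix b c d
  show "linear (\<lambda>x. wedge_list f [i, j, k, l] [x, b, c, d])"
    by (rule linearI) (simp_all add: wedge_list_4 wedge_list_3 assms[THEN linear_add]
        assms[THEN linear_scale] algebra_simps)
qed (simp_all add: wedge_list_4 wedge_list_3 algebra_simps)

lemma alternating4_add:
  assumes "alternating4 F" "alternating4 G"
  shows "alternating4 (\<lambda>a b c d. F a b c d + G a b c d)"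
proof -
  interpret F: alternating4 F by fact
  interpret G: alternating4 G by fact
  show ?thesis
  proof (rule alternating4.intro)
    fix a b c d
    show "F b a c d + G b a c d = - (F a b c d + G a b c d)" using F.swap12[of b a] G.swap12[of b a] by simp
    show "F a c b d + G a c b d = - (F a b c d + G a b c d)" using F.swap23[of a c b] G.swap23[of a c b] by simp
    show "F a b d c + G a b d c = - (F a b c d + G a b c d)" using F.swap34[of a b d c] G.swap34[of a b d c] by simp
  qed (intro linear_compose_add F.lin1 G.lin1)
qed

lemma alternating4_minus:
  assumes "alternating4 F"
  shows "alternating4 (\<lambda>a b c d. - F a b c d)"
proof -
  interpret F: alternating4 F by fact
  show ?thesis
  proof (rule alternating4.intro)
    fix a b c d
    show "- F b a c d = - (- F a b c d)" using F.swap12[of b a] by simp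
    show "- F a c b d = - (- F a b c d)" using F.swap23[of a c b] by simp
    show "- F a b d c = - (- F a b c d)" using F.swap34[of a b d c] by simp
  qed (intro linear_compose_neg F.lin1)
qed

lemma positive_4form_alternating4:
  assumes "positive_4form \<phi>"
  shows "alternating4 (\<lambda>a b c d. \<phi> [a, b, c, d])"
proof -
  obtain f where f: "coframe 7 f" and phi: "\<And>xs. \<phi> xs =
             wedge_list f [1,2,3,4] xs + wedge_list f [1,2,5,6] xs
           + wedge_list f [3,4,5,6] xs + wedge_list f [2,4,6,7] xs
           - wedge_list f [1,3,6,7] xs - wedge_list f [1,4,5,7] xs
           - wedge_list f [2,3,5,7] xs"
    using assms unfolding positive_4form_def by blast
  have lin: "i \<in> {1..7} \<Longrightarrow> linear (f i)" for i using f unfolding coframe_def by blast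
  show ?thesis unfolding phi diff_conv_add_uminus
    by (intro alternating4_add alternating4_minus alternating4_wedge_list lin) simp_all
qed

text \<open>The Lagrange identity for the cross product in dimension seven: the seven brackets on
  the right are, up to sign, its components for the 3-form dual to the normal form, and the left
  side is the squared norm of the bivector.\<close>

lemma cross_product_norm:
  fixes a1 a2 a3 a4 a5 a6 a7 b1 b2 b3 b4 b5 b6 b7 :: real
  shows "(a1 * b2 - a2 * b1)\<^sup>2 + (a1 * b3 - a3 * b1)\<^sup>2 + (a1 * b4 - a4 * b1)\<^sup>2 + (a1 * b5 - a5 * b1)\<^sup>2
      + (a1 * b6 - a6 * b1)\<^sup>2 + (a1 * b7 - a7 * b1)\<^sup>2 + (a2 * b3 - a3 * b2)\<^sup>2 + (a2 * b4 - a4 * b2)\<^sup>2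
      + (a2 * b5 - a5 * b2)\<^sup>2 + (a2 * b6 - a6 * b2)\<^sup>2 + (a2 * b7 - a7 * b2)\<^sup>2 + (a3 * b4 - a4 * b3)\<^sup>2
      + (a3 * b5 - a5 * b3)\<^sup>2 + (a3 * b6 - a6 * b3)\<^sup>2 + (a3 * b7 - a7 * b3)\<^sup>2 + (a4 * b5 - a5 * b4)\<^sup>2
      + (a4 * b6 - a6 * b4)\<^sup>2 + (a4 * b7 - a7 * b4)\<^sup>2 + (a5 * b6 - a6 * b5)\<^sup>2 + (a5 * b7 - a7 * b5)\<^sup>2
      + (a6 * b7 - a7 * b6)\<^sup>2 =
    ((a1 * b2 - a2 * b1) + (a3 * b4 - a4 * b3) + (a5 * b6 - a6 * b5))\<^sup>2 + ((a1 * b4 - a4 * b1)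
      + (a2 * b3 - a3 * b2) - (a5 * b7 - a7 * b5))\<^sup>2 + ((a1 * b3 - a3 * b1) - (a2 * b4 - a4 * b2) - (a6 * b7 - a7 * b6))\<^sup>2
      + ((a1 * b6 - a6 * b1) + (a2 * b5 - a5 * b2) + (a3 * b7 - a7 * b3))\<^sup>2 + ((a1 * b5 - a5 * b1) - (a2 * b6 - a6 * b2)
      + (a4 * b7 - a7 * b4))\<^sup>2 + ((a1 * b7 - a7 * b1) - (a3 * b6 - a6 * b3) - (a4 * b5 - a5 * b4))\<^sup>2
      + ((a2 * b7 - a7 * b2) - (a3 * b5 - a5 * b3) + (a4 * b6 - a6 * b4))\<^sup>2"
  by (simp add: power2_eq_square algebra_simps)

text \<open>Vanishing on the span of \<open>v 3\<close>, ..., \<open>v 7\<close> means \<alpha>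
  \<and> \<beta> \<and> \<phi> = 0 for the functionals dual to \<open>v 1\<close> and
  \<open>v 2\<close>. The cross product of \<alpha> and \<beta> is then zero, so \<alpha> \<and>
  \<beta> = 0, although its value on \<open>v 1\<close>, \<open>v 2\<close> is 1.\<close>

lemma positive_4form_nonvanishing:
  fixes v :: "nat \<Rightarrow> 'a::real_vector"
  assumes pos: "positive_4form \<phi>" and sp: "span (v ` {1..7}) = UNIV" and dm: "dim (UNIV :: 'a set) = 7"
    and van: "\<And>i j k l. i < j \<Longrightarrow> j < k \<Longrightarrow> k < l \<Longrightarrow> {i, j, k, l} \<subseteq> {3..7} \<Longrightarrow> \<phi> [v i, v j, v k, v l] = 0"
  shows False
proof -
  obtain f where f: "coframe 7 f" and phi: "\<And>xs. \<phi> xs =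
             wedge_list f [1,2,3,4] xs + wedge_list f [1,2,5,6] xs
           + wedge_list f [3,4,5,6] xs + wedge_list f [2,4,6,7] xs
           - wedge_list f [1,3,6,7] xs - wedge_list f [1,4,5,7] xs
           - wedge_list f [2,3,5,7] xs"
    using pos unfolding positive_4form_def by blast
  obtain u where u: "\<And>i j. i \<in> {1..7} \<Longrightarrow> j \<in> {1..7} \<Longrightarrow> f i (u j) = (if i = j then 1 else 0)"
    and ux: "\<And>x. (\<Sum>i=1..7. f i x *\<^sub>R u i) = x"
    using coframe_dual_basis[OF f] by blast
  obtain e where e: "coframe 7 e"
    and ev: "\<And>i j. j \<in> {1..7} \<Longrightarrow> e i (v j) = (if i = j then 1 else 0)"
    and ex: "\<And>x. (\<Sum>i=1..7. e i x *\<^sub>R v i) = x"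
    using dual_coframe_exists[OF sp dm] by blast
  \<comment> \<open>Their common kernel is the span of \<open>v 3\<close>, ...,
    \<open>v 7\<close>.\<close>
  define \<alpha> \<beta> where "\<alpha> = e 1" and "\<beta> = e 2"
  have lin: "linear \<alpha>" "linear \<beta>" using e unfolding coframe_def \<alpha>_def \<beta>_def by simp_all
  define F where "F = (\<lambda>a b c d. \<phi> [a, b, c, d])"
  interpret alternating4 F unfolding F_def by (rule positive_4form_alternating4[OF pos])
  have P: "x - \<alpha> x *\<^sub>R v 1 - \<beta> x *\<^sub>R v 2 \<in> span (v ` {3..7})" for x
  proof -
    have "{1..7} = insert 1 (insert 2 {3..7::nat})" by auto
    then have "x = \<alpha> x *\<^sub>R v 1 + (\<beta> x *\<^sub>R v 2 + (\<Sum>i=3..7. e i x *\<^sub>R v i))"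
      using ex[of x, symmetric] unfolding \<alpha>_def \<beta>_def by simp
    then have "x - \<alpha> x *\<^sub>R v 1 - \<beta> x *\<^sub>R v 2 = (\<Sum>i=3..7. e i x *\<^sub>R v i)"
      by (metis (no_types, lifting) add_diff_cancel_left' diff_diff_add)
    then show ?thesis by (simp only:) (intro span_sum span_scale span_base imageI)
  qed
  define m where "m = (\<lambda>x y. \<alpha> x * \<beta> y - \<alpha> y * \<beta> x)"
  have b0: "\<beta> (v 1) = 0" unfolding \<beta>_def using ev[of 1 2] by simp
  have "F (x - \<alpha> x *\<^sub>R v 1 - \<beta> x *\<^sub>R v 2) (y - \<alpha> y *\<^sub>R v 1 - \<beta> y *\<^sub>R v 2)
      (z - \<alpha> z *\<^sub>R v 1 - \<beta> z *\<^sub>R v 2) (w - \<alpha> w *\<^sub>R v 1 - \<beta> w *\<^sub>R v 2) = 0" for x y z w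
    by (rule zero_on_family[of "{3..7}" v, OF _ P P P P]) (use van in \<open>simp add: F_def\<close>)
  note W = wedge_vanishing[OF lin(2) b0 this]
  define A B where "A = (\<lambda>i. \<alpha> (u i))" and "B = (\<lambda>i. \<beta> (u i))"
  have muu: "m (u i) (u j) = A i * B j - A j * B i" for i j by (simp add: m_def A_def B_def)
  have u': "f 1 (u 1) = 1" "f 1 (u 2) = 0" "f 1 (u 3) = 0" "f 1 (u 4) = 0" "f 1 (u 5) = 0" "f 1 (u 6) = 0" "f 1 (u 7) = 0"
    "f 2 (u 1) = 0" "f 2 (u 2) = 1" "f 2 (u 3) = 0" "f 2 (u 4) = 0" "f 2 (u 5) = 0" "f 2 (u 6) = 0" "f 2 (u 7) = 0"
    "f 3 (u 1) = 0" "f 3 (u 2) = 0" "f 3 (u 3) = 1" "f 3 (u 4) = 0" "f 3 (u 5) = 0" "f 3 (u 6) = 0" "f 3 (u 7) = 0"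
    "f 4 (u 1) = 0" "f 4 (u 2) = 0" "f 4 (u 3) = 0" "f 4 (u 4) = 1" "f 4 (u 5) = 0" "f 4 (u 6) = 0" "f 4 (u 7) = 0"
    "f 5 (u 1) = 0" "f 5 (u 2) = 0" "f 5 (u 3) = 0" "f 5 (u 4) = 0" "f 5 (u 5) = 1" "f 5 (u 6) = 0" "f 5 (u 7) = 0"
    "f 6 (u 1) = 0" "f 6 (u 2) = 0" "f 6 (u 3) = 0" "f 6 (u 4) = 0" "f 6 (u 5) = 0" "f 6 (u 6) = 1" "f 6 (u 7) = 0"
    "f 7 (u 1) = 0" "f 7 (u 2) = 0" "f 7 (u 3) = 0" "f 7 (u 4) = 0" "f 7 (u 5) = 0" "f 7 (u 6) = 0" "f 7 (u 7) = 1"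
    by (simp_all add: u)
  have vals: "F (u 1) (u 2) (u 3) (u 4) = 1"
    "F (u 1) (u 2) (u 3) (u 5) = 0"
    "F (u 1) (u 2) (u 3) (u 6) = 0"
    "F (u 1) (u 2) (u 3) (u 7) = 0"
    "F (u 1) (u 2) (u 4) (u 5) = 0"
    "F (u 1) (u 2) (u 4) (u 6) = 0"
    "F (u 1) (u 2) (u 4) (u 7) = 0"
    "F (u 1) (u 2) (u 5) (u 6) = 1"
    "F (u 1) (u 2) (u 5) (u 7) = 0"
    "F (u 1) (u 2) (u 6) (u 7) = 0"
    "F (u 1) (u 3) (u 4) (u 5) = 0"
    "F (u 1) (u 3) (u 4) (u 6) = 0"
    "F (u 1) (u 3) (u 4) (u 7) = 0"
    "F (u 1) (u 3) (u 5) (u 6) = 0"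
    "F (u 1) (u 3) (u 5) (u 7) = 0"
    "F (u 1) (u 3) (u 6) (u 7) = -1"
    "F (u 1) (u 4) (u 5) (u 6) = 0"
    "F (u 1) (u 4) (u 5) (u 7) = -1"
    "F (u 1) (u 4) (u 6) (u 7) = 0"
    "F (u 1) (u 5) (u 6) (u 7) = 0"
    "F (u 2) (u 3) (u 4) (u 5) = 0"
    "F (u 2) (u 3) (u 4) (u 6) = 0"
    "F (u 2) (u 3) (u 4) (u 7) = 0"
    "F (u 2) (u 3) (u 5) (u 6) = 0"
    "F (u 2) (u 3) (u 5) (u 7) = -1"
    "F (u 2) (u 3) (u 6) (u 7) = 0"
    "F (u 2) (u 4) (u 5) (u 6) = 0"
    "F (u 2) (u 4) (u 5) (u 7) = 0"
    "F (u 2) (u 4) (u 6) (u 7) = 1"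
    "F (u 2) (u 5) (u 6) (u 7) = 0"
    "F (u 3) (u 4) (u 5) (u 6) = 1"
    "F (u 3) (u 4) (u 5) (u 7) = 0"
    "F (u 3) (u 4) (u 6) (u 7) = 0"
    "F (u 3) (u 5) (u 6) (u 7) = 0"
    "F (u 4) (u 5) (u 6) (u 7) = 0"
    by (simp_all add: F_def phi wedge_list_4 wedge_list_3 u'[unfolded One_nat_def])
  \<comment> \<open>Up to sign the coefficients of \<alpha> \<and> \<beta> \<and> \<phi>, one for
    each choice of six vectors of the basis u.\<close>
  have c: "m (u 1) (u 2) + m (u 3) (u 4) + m (u 5) (u 6) = 0"
    "m (u 1) (u 4) + m (u 2) (u 3) - m (u 5) (u 7) = 0"
    "m (u 1) (u 3) - m (u 2) (u 4) - m (u 6) (u 7) = 0"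
    "m (u 1) (u 6) + m (u 2) (u 5) + m (u 3) (u 7) = 0"
    "m (u 1) (u 5) - m (u 2) (u 6) + m (u 4) (u 7) = 0"
    "m (u 1) (u 7) - m (u 3) (u 6) - m (u 4) (u 5) = 0"
    "m (u 2) (u 7) - m (u 3) (u 5) + m (u 4) (u 6) = 0"
    using W[of "u 1" "u 2" "u 3" "u 4" "u 5" "u 6"] W[of "u 1" "u 2" "u 3" "u 4" "u 5" "u 7"]
      W[of "u 1" "u 2" "u 3" "u 4" "u 6" "u 7"] W[of "u 1" "u 2" "u 3" "u 5" "u 6" "u 7"]
      W[of "u 1" "u 2" "u 4" "u 5" "u 6" "u 7"] W[of "u 1" "u 3" "u 4" "u 5" "u 6" "u 7"]
      W[of "u 2" "u 3" "u 4" "u 5" "u 6" "u 7"]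
    by (simp_all add: vals[unfolded One_nat_def] m_def algebra_simps)
  have "m (u i) (u j) = 0" if ij: "i \<in> {1..7}" "j \<in> {1..7}" for i j
  proof -
    have 7: "{1..7::nat} = {1, 2, 3, 4, 5, 6, 7}" by auto
    \<comment> \<open>The arguments follow the order in which the variables first occur in the
      identity. Its right side is now zero, so every square on the left is.\<close>
    from cross_product_norm[of "A 1" "B 2" "A 2" "B 1" "B 3" "A 3" "B 4" "A 4" "B 5" "A 5" "B 6" "A 6" "B 7" "A 7"]
      c[unfolded muu]
    have "A 1 * B 2 = A 2 * B 1 \<and> A 1 * B 3 = A 3 * B 1 \<and> A 1 * B 4 = A 4 * B 1 \<and> A 1 * B 5 = A 5 * B 1
      \<and> A 1 * B 6 = A 6 * B 1 \<and> A 1 * B 7 = A 7 * B 1 \<and> A 2 * B 3 = A 3 * B 2 \<and> A 2 * B 4 = A 4 * B 2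
      \<and> A 2 * B 5 = A 5 * B 2 \<and> A 2 * B 6 = A 6 * B 2 \<and> A 2 * B 7 = A 7 * B 2 \<and> A 3 * B 4 = A 4 * B 3
      \<and> A 3 * B 5 = A 5 * B 3 \<and> A 3 * B 6 = A 6 * B 3 \<and> A 3 * B 7 = A 7 * B 3 \<and> A 4 * B 5 = A 5 * B 4
      \<and> A 4 * B 6 = A 6 * B 4 \<and> A 4 * B 7 = A 7 * B 4 \<and> A 5 * B 6 = A 6 * B 5 \<and> A 5 * B 7 = A 7 * B 5
      \<and> A 6 * B 7 = A 7 * B 6"
      by (simp add: add_nonneg_eq_0_iff)
    then show ?thesis using ij unfolding 7 muu by auto
  qed
  note m0 = this
  have g0: "g x = 0" if g: "linear g" "\<And>i. i \<in> {1..7} \<Longrightarrow> g (u i) = 0" for g :: "'a \<Rightarrow> real" and x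
  proof -
    have "g x = g (\<Sum>i=1..7. f i x *\<^sub>R u i)" by (rule arg_cong[where f = g, OF ux[of x, symmetric]])
    then show ?thesis by (simp add: linear_sum[OF g(1)] linear_scale[OF g(1)] g(2))
  qed
  have lm: "linear (\<lambda>x. m x y)" "linear (m y)" for y
    unfolding m_def by (auto intro!: linearI simp: lin[THEN linear_add] lin[THEN linear_scale] algebra_simps)
  have "m x (u j) = 0" if "j \<in> {1..7}" for x j
    using g0[OF lm(1)] m0 that by blast
  then have "m x y = 0" for x y
    using g0[OF lm(2)] by blast
  moreover have "m (v 1) (v 2) = 1"
    unfolding m_def \<alpha>_def \<beta>_def using ev[of 1 1] ev[of 1 2] ev[of 2 1] ev[of 2 2] by simp
  ultimately show False by simp
qed

section \<open>Structure equations\<close>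

locale lie_alg =
  fixes br :: "'a::real_vector \<Rightarrow> 'a \<Rightarrow> 'a"
  assumes lie: "lie_algebra br"
begin

lemma bil: "bilinear br" using lie by (simp add: lie_algebra_def)

lemmas expand = bilinear_ladd[OF bil] bilinear_radd[OF bil] bilinear_lmul[OF bil] bilinear_rmul[OF bil]
  bilinear_lneg[OF bil] bilinear_rneg[OF bil] bilinear_lsub[OF bil] bilinear_rsub[OF bil]
  bilinear_lzero[OF bil] bilinear_rzero[OF bil]

lemma self [simp]: "br x x = 0" using lie by (simp add: lie_algebra_def)

lemma swap: "br y x = - br x y"
proof -
  have "br (x + y) (x + y) = 0" by simp
  then have "br x y + br y x = 0" by (simp add: expand del: self) (simp add: add.commute)
  then show ?thesis by (simp add: eq_neg_iff_add_eq_0 add.commute)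
qed

text \<open>The Leibniz form of the identity: bracketing with x is a derivation.\<close>

lemma jacobi: "br x (br y z) = br (br x y) z + br y (br x z)"
proof -
  have "br x (br y z) + br y (br z x) + br z (br x y) = 0" using lie by (simp add: lie_algebra_def)
  moreover have "br y (br z x) = - br y (br x z)" using swap[of z x] by (simp add: expand)
  moreover have "br z (br x y) = - br (br x y) z" by (rule swap)
  ultimately show ?thesis by (simp add: algebra_simps)
qed

end

text \<open>The value of the 2-form encoded by l on the i-th and j-th vectors of the dual basis,
  with indices counted from 1.\<close>

definition scoef :: "int list \<Rightarrow> nat \<Rightarrow> nat \<Rightarrow> real" where
  "scoef l i j = (\<Sum>t\<leftarrow>l. of_int (sgn t) *
     ((if nat \<bar>t\<bar> div 10 = i then 1 else 0) * (if nat \<bar>t\<bar> mod 10 = j then 1 else 0)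
      - (if nat \<bar>t\<bar> div 10 = j then 1 else 0) * (if nat \<bar>t\<bar> mod 10 = i then 1 else 0)))"

text \<open>The bracket of the i-th and j-th members of vs when the negatives of vs are dual to a
  coframe with structure equations L: the sign in df(x, y) = - f [x, y] is absorbed by the negative
  basis.\<close>

definition struct_comb :: "int list list \<Rightarrow> nat \<Rightarrow> nat \<Rightarrow> 'a list \<Rightarrow> 'a::real_vector" where
  "struct_comb L i j vs = (\<Sum>(l, v)\<leftarrow>zip L vs. scoef l i j *\<^sub>R v)"

text \<open>Guards against digits that are not indices of the coframe, about which a coframe says
  nothing.\<close>

definition valid_equations :: "int list list \<Rightarrow> bool" where
  "valid_equations L \<longleftrightarrow> (\<forall>l\<in>set L. \<forall>t\<in>set l.
     nat \<bar>t\<bar> div 10 \<in> {1..length L} \<and> nat \<bar>t\<bar> mod 10 \<in> {1..length L})"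

lemma scoef_swap: "scoef l j i = - scoef l i j"
  unfolding scoef_def by (induction l) (simp_all add: algebra_simps)

lemma struct_comb_eq:
  assumes "length vs = length L"
  shows "struct_comb L i j vs = (\<Sum>k=1..length L. scoef (L ! (k - 1)) i j *\<^sub>R vs ! (k - 1))"
proof -
  have "struct_comb L i j vs = (\<Sum>k<length L. scoef (L ! k) i j *\<^sub>R vs ! k)"
    using assms by (simp add: struct_comb_def sum_list_sum_nth atLeast0LessThan)
  also have "\<dots> = (\<Sum>k=1..length L. scoef (L ! (k - 1)) i j *\<^sub>R vs ! (k - 1))"
    by (rule sum.reindex_bij_witness[of _ "\<lambda>k. k - 1" Suc]) auto
  finally show ?thesis .
qed

lemma ce_d_one_form:
  "ce_d br (one_form f) xs = (if length xs = 2 then - f (br (xs ! 0) (xs ! 1)) else 0)"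
proof (cases "length xs = 2")
  case True
  then obtain a b where "xs = [a, b]" by (auto simp: length_Suc_conv numeral_eq_Suc)
  then show ?thesis by (simp add: ce_d_2 one_form_def)
next
  case False
  then have "ce_d br (one_form f) xs = 0"
    by (intro ce_d_length[of 1]) (auto simp: one_form_def)
  then show ?thesis using False by simp
qed

lemma signed_terms_length:
  "length xs \<noteq> 2 \<Longrightarrow> (\<Sum>t\<leftarrow>l. signed_term e t xs) = 0"
  by (induction l) (simp_all add: signed_term_def wedge_list_length)

lemma bilinear_signed_terms:
  assumes "\<And>t. t \<in> set l \<Longrightarrow> linear (e (nat \<bar>t\<bar> div 10)) \<and> linear (e (nat \<bar>t\<bar> mod 10))"
  shows "bilinear (\<lambda>a b. \<Sum>t\<leftarrow>l. signed_term e t [a, b])"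
  using assms
proof (induction l)
  case Nil
  then show ?case by (simp add: bilinear_def linear_iff)
next
  case (Cons t l)
  then have "bilinear (\<lambda>a b. \<Sum>t\<leftarrow>l. signed_term e t [a, b])" by simp
  moreover have "linear (e (nat \<bar>t\<bar> div 10))" "linear (e (nat \<bar>t\<bar> mod 10))"
    using Cons.prems by auto
  ultimately show ?case
    by (simp add: bilinear_def linear_iff signed_term_def wedge_list_2 algebra_simps)
qed

lemma signed_terms_dual:
  assumes "\<And>t. t \<in> set l \<Longrightarrow> e (nat \<bar>t\<bar> div 10) x = (if nat \<bar>t\<bar> div 10 = i then 1 else 0)"
    "\<And>t. t \<in> set l \<Longrightarrow> e (nat \<bar>t\<bar> mod 10) x = (if nat \<bar>t\<bar> mod 10 = i then 1 else 0)"
    "\<And>t. t \<in> set l \<Longrightarrow> e (nat \<bar>t\<bar> div 10) y = (if nat \<bar>t\<bar> div 10 = j then 1 else 0)"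
    "\<And>t. t \<in> set l \<Longrightarrow> e (nat \<bar>t\<bar> mod 10) y = (if nat \<bar>t\<bar> mod 10 = j then 1 else 0)"
  shows "(\<Sum>t\<leftarrow>l. signed_term e t [x, y]) = scoef l i j"
  unfolding scoef_def
  by (rule arg_cong[of _ _ sum_list], rule map_cong[OF refl])
    (simp only: signed_term_def wedge_list_2 assms)

lemma structure_equationsI:
  fixes br :: "'a::real_vector \<Rightarrow> 'a \<Rightarrow> 'a"
  assumes "lie_algebra br" "valid_equations L" and len: "length vs = length L"
    and dm: "dim (UNIV :: 'a set) = length L" and sp: "span (set vs) = UNIV"
    and tab: "\<And>i j. i < j \<Longrightarrow> j < length L \<Longrightarrow> br (vs ! i) (vs ! j) = struct_comb L (Suc i) (Suc j) vs"
  shows "has_structure_equations br L"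
proof -
  interpret lie_alg br by unfold_locales fact
  let ?n = "length L"
  \<comment> \<open>The coframe is dual to the negatives of vs, which removes the sign from the
    Chevalley-Eilenberg differential.\<close>
  define w where "w = (\<lambda>k. - (vs ! (k - 1)))"
  have "set vs \<subseteq> span (w ` {1..?n})"
  proof
    fix v assume "v \<in> set vs"
    then obtain i where i: "i < ?n" "v = vs ! i" using len by (metis in_set_conv_nth)
    then have "w (Suc i) \<in> w ` {1..?n}" by auto
    then have "- w (Suc i) \<in> span (w ` {1..?n})" by (intro span_neg span_base)
    then show "v \<in> span (w ` {1..?n})" using i by (simp add: w_def)
  qed
  then have spw: "span (w ` {1..?n}) = UNIV"
    using sp by (metis span_minimal subspace_span top.extremum_uniqueI)
  obtain e where e: "coframe ?n e" and ew: "\<And>i j. j \<in> {1..?n} \<Longrightarrow> e i (w j) = (if i = j then 1 else 0)"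
    and "\<And>x. (\<Sum>i=1..?n. e i x *\<^sub>R w i) = x"
    using dual_coframe_exists[OF spw dm] by blast
  have lin: "linear (e i)" if "i \<in> {1..?n}" for i using e that unfolding coframe_def by blast
  have "ce_d br (one_form (e (Suc k))) xs = (\<Sum>t\<leftarrow>L ! k. signed_term e t xs)" if k: "k < ?n" for k xs
  proof (cases "length xs = 2")
    case False
    then show ?thesis by (simp add: ce_d_one_form signed_terms_length)
  next
    case True
    then obtain a b where xs: "xs = [a, b]" by (auto simp: length_Suc_conv numeral_eq_Suc)
    have dig: "nat \<bar>t\<bar> div 10 \<in> {1..?n} \<and> nat \<bar>t\<bar> mod 10 \<in> {1..?n}" if "t \<in> set (L ! k)" for t
      using assms(2) k that unfolding valid_equations_def by (meson nth_mem)
    have lk: "linear (e (Suc k))" using k by (intro lin) auto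
    \<comment> \<open>Both sides of a structure equation are bilinear, so they only need to be
      compared on the spanning family w.\<close>
    have b1: "bilinear (\<lambda>a b. - e (Suc k) (br a b))"
      using bil by (auto simp: bilinear_def linear_iff linear_add[OF lk] linear_scale[OF lk])
    have b2: "bilinear (\<lambda>a b. \<Sum>t\<leftarrow>L ! k. signed_term e t [a, b])"
      using dig lin by (intro bilinear_signed_terms) blast
    have b3: "- e (Suc k) (br x y) = (\<Sum>t\<leftarrow>L ! k. signed_term e t [x, y])"
      if "x \<in> w ` {1..?n}" "y \<in> w ` {1..?n}" for x y
    proof -
      obtain i j where ij: "i \<in> {1..?n}" "j \<in> {1..?n}" "x = w i" "y = w j" using \<open>x \<in> _\<close> \<open>y \<in> _\<close> by blast
      have "br (vs ! (i - 1)) (vs ! (j - 1)) = struct_comb L i j vs"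
      proof (cases i j rule: linorder_cases)
        case less
        then show ?thesis using tab[of "i - 1" "j - 1"] ij by auto
      next
        case equal
        then show ?thesis using scoef_swap[of _ i i] len by (simp add: struct_comb_eq)
      next
        case greater
        have "br (vs ! (i - 1)) (vs ! (j - 1)) = - struct_comb L j i vs"
          using tab[of "j - 1" "i - 1"] ij greater swap[of "vs ! (i - 1)"] by auto
        also have "\<dots> = struct_comb L i j vs"
          unfolding struct_comb_eq[OF len] scoef_swap[of _ i j] by (simp add: sum_negf)
        finally show ?thesis .
      qed
      then have "br x y = (\<Sum>m=1..?n. - scoef (L ! (m - 1)) i j *\<^sub>R w m)"
        unfolding ij w_def struct_comb_eq[OF len] by (simp add: expand)
      then have "e (Suc k) (br x y) = (\<Sum>m=1..?n. - scoef (L ! (m - 1)) i j * e (Suc k) (w m))"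
        by (simp add: linear_sum[OF lk] linear_neg[OF lk] linear_scale[OF lk])
      also have "\<dots> = (\<Sum>m=1..?n. if m = Suc k then - scoef (L ! k) i j else 0)"
        using ew by (intro sum.cong) auto
      also have "\<dots> = - scoef (L ! k) i j" using k by simp
      also have "scoef (L ! k) i j = (\<Sum>t\<leftarrow>L ! k. signed_term e t [x, y])"
        by (rule signed_terms_dual[symmetric]) (use ij ew in auto)
      finally show ?thesis by simp
    qed
    have U: "UNIV \<subseteq> span (w ` {1..?n})" using spw by blast
    have "- e (Suc k) (br a b) = (\<Sum>t\<leftarrow>L ! k. signed_term e t [a, b])"
      by (rule bilinear_eq[OF b1 b2 U U UNIV_I UNIV_I b3])
    then show ?thesis by (simp add: ce_d_one_form xs)
  qed
  then show ?thesis unfolding has_structure_equations_def using e by blast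
qed

lemma structure_equationsE:
  assumes "has_structure_equations br L" "lie_algebra br" "valid_equations L"
  obtains vs where "length vs = length L" "span (set vs) = UNIV"
    "\<And>i j. i < length L \<Longrightarrow> j < length L \<Longrightarrow> br (vs ! i) (vs ! j) = struct_comb L (Suc i) (Suc j) vs"
proof -
  interpret lie_alg br by unfold_locales fact
  let ?n = "length L"
  obtain e where e: "coframe ?n e"
    and d: "\<And>k xs. k < ?n \<Longrightarrow> ce_d br (one_form (e (Suc k))) xs = (\<Sum>t\<leftarrow>L ! k. signed_term e t xs)"
    using assms(1) unfolding has_structure_equations_def by blast
  obtain u where u: "\<And>i j. i \<in> {1..?n} \<Longrightarrow> j \<in> {1..?n} \<Longrightarrow> e i (u j) = (if i = j then 1 else 0)"
    and ux: "\<And>x. (\<Sum>i=1..?n. e i x *\<^sub>R u i) = x"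
    using coframe_dual_basis[OF e] by blast
  define vs where "vs = map (\<lambda>k. - u (Suc k)) [0..<?n]"
  have len: "length vs = ?n" by (simp add: vs_def)
  have vs: "vs ! i = - u (Suc i)" if "i < ?n" for i using that by (simp add: vs_def)
  have uin: "u i \<in> span (set vs)" if i: "i \<in> {1..?n}" for i
  proof -
    have "- (vs ! (i - 1)) \<in> span (set vs)" using i len by (intro span_neg span_base nth_mem) auto
    moreover have "i - 1 < ?n" using i by auto
    ultimately show ?thesis using vs[of "i - 1"] i by simp
  qed
  have "x \<in> span (set vs)" for x
    by (subst ux[symmetric]) (intro span_sum span_scale uin)
  then have sp: "span (set vs) = UNIV" by blast
  have "br (vs ! i) (vs ! j) = struct_comb L (Suc i) (Suc j) vs" if ij: "i < ?n" "j < ?n" for i j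
  proof -
    have c: "e k (br (u (Suc i)) (u (Suc j))) = - scoef (L ! (k - 1)) (Suc i) (Suc j)" if k: "k \<in> {1..?n}" for k
    proof -
      have "L ! (k - 1) \<in> set L" using k by auto
      then have dig: "nat \<bar>t\<bar> div 10 \<in> {1..?n} \<and> nat \<bar>t\<bar> mod 10 \<in> {1..?n}" if "t \<in> set (L ! (k - 1))" for t
        using assms(3) that unfolding valid_equations_def by blast
      have "(\<Sum>t\<leftarrow>L ! (k - 1). signed_term e t [u (Suc i), u (Suc j)]) = scoef (L ! (k - 1)) (Suc i) (Suc j)"
        by (rule signed_terms_dual) (use dig u ij in auto)
      moreover have "k - 1 < ?n" "Suc (k - 1) = k" using k by auto
      ultimately show ?thesis using d[of "k - 1" "[u (Suc i), u (Suc j)]"] by (simp add: ce_d_one_form)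
    qed
    have "br (vs ! i) (vs ! j) = br (u (Suc i)) (u (Suc j))" using vs ij by (simp add: expand)
    also have "\<dots> = (\<Sum>k=1..?n. e k (br (u (Suc i)) (u (Suc j))) *\<^sub>R u k)" by (rule ux[symmetric])
    also have "\<dots> = (\<Sum>k=1..?n. scoef (L ! (k - 1)) (Suc i) (Suc j) *\<^sub>R vs ! (k - 1))"
    proof (rule sum.cong)
      fix k assume k: "k \<in> {1..?n}"
      then show "e k (br (u (Suc i)) (u (Suc j))) *\<^sub>R u k = scoef (L ! (k - 1)) (Suc i) (Suc j) *\<^sub>R vs ! (k - 1)"
        using c[OF k] vs[of "k - 1"] less_eq_Suc_le by auto
    qed simp
    finally show ?thesis by (simp add: struct_comb_eq[OF len])
  qed
  then show thesis using len sp that by blast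
qed

text \<open>The shape used for the exclusions: p, q, r, s, t span the subspace, a and b merely
  complete the basis, and a 4-form on five vectors has five components.\<close>

lemma positive_4form_nonvanishing':
  fixes a :: "'a::real_vector"
  assumes "positive_4form \<phi>" "span {a, b, p, q, r, s, t} = UNIV" "dim (UNIV :: 'a set) = 7"
    and "\<phi> [p, q, r, s] = 0" "\<phi> [p, q, r, t] = 0" "\<phi> [p, q, s, t] = 0" "\<phi> [p, r, s, t] = 0"
      "\<phi> [q, r, s, t] = 0"
  shows False
proof (rule positive_4form_nonvanishing[OF assms(1) _ assms(3)])
  let ?v = "\<lambda>i. [a, b, p, q, r, s, t] ! (i - 1)"
  have 7: "{1..7::nat} = {1, 2, 3, 4, 5, 6, 7}" by auto
  show "span (?v ` {1..7}) = UNIV" unfolding 7 using assms(2) by simp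
  fix i j k l :: nat assume *: "i < j" "j < k" "k < l" "{i, j, k, l} \<subseteq> {3..7}"
  then have "i = 3 \<or> i = 4" "j = 4 \<or> j = 5" "k = 5 \<or> k = 6" "l = 6 \<or> l = 7" by auto
  then show "\<phi> [?v i, ?v j, ?v k, ?v l] = 0"
    using assms(4-) * by (elim disjE) simp_all
qed

section \<open>Expansions in low degree\<close>

lemma sum_1_to_6: "(\<Sum>i=1..6. g i) = g 1 + g 2 + g 3 + g 4 + g 5 + g (6::nat)"
  for g :: "nat \<Rightarrow> 'b::comm_monoid_add"
proof -
  have "{1..6::nat} = {1, 2, 3, 4, 5, 6}" by auto
  then show ?thesis by (simp add: add.assoc)
qed

lemma sum_1_to_7: "(\<Sum>i=1..7. g i) = g 1 + g 2 + g 3 + g 4 + g 5 + g 6 + g (7::nat)"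
  for g :: "nat \<Rightarrow> 'b::comm_monoid_add"
proof -
  have "{1..7::nat} = {1, 2, 3, 4, 5, 6, 7}" by auto
  then show ?thesis by (simp add: add.assoc)
qed

text \<open>Only the six two-element sets S contribute; their inversion numbers 0, 1, 2, 2, 3, 4
  give the signs.\<close>

lemma wedge_2_2:
  assumes "\<And>xs. length xs \<noteq> 2 \<Longrightarrow> \<alpha> xs = 0"
  shows "wedge \<alpha> \<beta> [a, b, c, d] = \<alpha> [a, b] * \<beta> [c, d] - \<alpha> [a, c] * \<beta> [b, d] + \<alpha> [a, d] * \<beta> [b, c]
     + \<alpha> [b, c] * \<beta> [a, d] - \<alpha> [b, d] * \<beta> [a, c] + \<alpha> [c, d] * \<beta> [a, b]"
proof -
  let ?xs = "[a, b, c, d]"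
  let ?I = "\<lambda>S. {(i, j). i \<in> S \<and> j \<in> {..<4} - S \<and> j < (i::nat)}"
  let ?g = "\<lambda>S. (-1) ^ card (?I S) * \<alpha> (nths ?xs S) * \<beta> (nths ?xs (- S))"
  let ?P = "{{0, 1}, {0, 2}, {0, 3}, {1, 2}, {1, 3}, {2, 3}} :: nat set set"
  have "length ?xs = 4" by simp
  then have "wedge \<alpha> \<beta> ?xs = sum ?g (Pow {..<4})" unfolding wedge_def by (simp only:)
  also have "\<dots> = sum ?g ?P"
  proof (rule sum.mono_neutral_right)
    show "\<forall>S\<in>Pow {..<4} - ?P. ?g S = 0"
    proof
      fix S :: "nat set" assume S: "S \<in> Pow {..<4} - ?P"
      then have S4: "S \<subseteq> {..<4}" by blast
      then have "{i. i < length ?xs \<and> i \<in> S} = S" by auto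
      then have l: "length (nths ?xs S) = card S" by (simp add: length_nths)
      have "card S \<noteq> 2"
      proof
        assume "card S = 2"
        then obtain x y where xy: "S = {x, y}" "x \<noteq> y" by (auto simp: card_2_iff)
        then have "x < 4" "y < 4" using S4 by auto
        then have "x = 0 \<or> x = 1 \<or> x = 2 \<or> x = 3" "y = 0 \<or> y = 1 \<or> y = 2 \<or> y = 3" by auto
        then show False using S xy by (elim disjE) (simp_all add: insert_commute)
      qed
      then show "?g S = 0" using assms l by simp
    qed
  qed auto
  also have "\<dots> = ?g {0, 1} + ?g {0, 2} + ?g {0, 3} + ?g {1, 2} + ?g {1, 3} + ?g {2, 3}"
    by (simp add: doubleton_eq_iff add.assoc)
  also have "\<dots> = \<alpha> [a, b] * \<beta> [c, d] - \<alpha> [a, c] * \<beta> [b, d] + \<alpha> [a, d] * \<beta> [b, c]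
     + \<alpha> [b, c] * \<beta> [a, d] - \<alpha> [b, d] * \<beta> [a, c] + \<alpha> [c, d] * \<beta> [a, b]"
  proof -
    have "?I {0, 1} = {}" "?I {0, 2} = {(2, 1)}" "?I {0, 3} = {(3, 1), (3, 2)}"
      "?I {1, 2} = {(1, 0), (2, 0)}" "?I {1, 3} = {(1, 0), (3, 0), (3, 2)}"
      "?I {2, 3} = {(2, 0), (2, 1), (3, 0), (3, 1)}"
      by auto
    note I = this
    have "card (?I {0, 1}) = 0" "card (?I {0, 2}) = 1" "card (?I {0, 3}) = 2"
      "card (?I {1, 2}) = 2" "card (?I {1, 3}) = 3" "card (?I {2, 3}) = 4"
      unfolding I by simp_all
    then show ?thesis by (simp only:) (simp add: nths_Cons)
  qed
  finally show ?thesis .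
qed

section \<open>Alternating 3- and 5-forms and their behaviour under the differential\<close>

locale alternating3 =
  fixes F :: "'a::real_vector \<Rightarrow> 'a \<Rightarrow> 'a \<Rightarrow> real"
  assumes lin1: "linear (\<lambda>x. F x b c)"
    and swap12: "F b a c = - F a b c"
    and swap23: "F a c b = - F a b c"
begin

lemma lin2: "linear (\<lambda>x. F a x c)"
  using linear_compose_neg[OF lin1[of a c]] by (simp add: swap12[of _ a])

lemma lin3: "linear (\<lambda>x. F a b x)"
  using linear_compose_neg[OF lin2[of a b]] by (simp add: swap23[of _ _ b])

lemmas expand =
  linear_add[OF lin1] linear_add[OF lin2] linear_add[OF lin3]
  linear_scale[OF lin1, simplified] linear_scale[OF lin2, simplified] linear_scale[OF lin3, simplified]
  linear_neg[OF lin1] linear_neg[OF lin2] linear_neg[OF lin3]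

end

locale alternating5 =
  fixes F :: "'a::real_vector \<Rightarrow> 'a \<Rightarrow> 'a \<Rightarrow> 'a \<Rightarrow> 'a \<Rightarrow> real"
  assumes lin1: "linear (\<lambda>x. F x b c d e)"
    and swap12: "F b a c d e = - F a b c d e"
    and swap23: "F a c b d e = - F a b c d e"
    and swap34: "F a b d c e = - F a b c d e"
    and swap45: "F a b c e d = - F a b c d e"
begin

lemma lin2: "linear (\<lambda>x. F a x c d e)"
  using linear_compose_neg[OF lin1[of a c d e]] by (simp add: swap12[of _ a])

lemma lin3: "linear (\<lambda>x. F a b x d e)"
  using linear_compose_neg[OF lin2[of a b d e]] by (simp add: swap23[of _ _ b])

lemma lin4: "linear (\<lambda>x. F a b c x e)"
  using linear_compose_neg[OF lin3[of a b c e]] by (simp add: swap34[of _ _ _ c])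

lemma lin5: "linear (\<lambda>x. F a b c d x)"
  using linear_compose_neg[OF lin4[of a b c d]] by (simp add: swap45[of _ _ _ _ d])

lemma zero_on_family:
  fixes v :: "nat \<Rightarrow> 'a"
  assumes inc: "\<And>i j k l m. i < j \<Longrightarrow> j < k \<Longrightarrow> k < l \<Longrightarrow> l < m \<Longrightarrow> {i, j, k, l, m} \<subseteq> I \<Longrightarrow>
      F (v i) (v j) (v k) (v l) (v m) = 0"
    and x: "x \<in> span (v ` I)" "y \<in> span (v ` I)" "z \<in> span (v ` I)" "w \<in> span (v ` I)" "t \<in> span (v ` I)"
  shows "F x y z w t = 0"
proof -
  let ?Z = "\<lambda>i j k l m. {i, j, k, l, m} \<subseteq> I \<longrightarrow> F (v i) (v j) (v k) (v l) (v m) = 0"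
  have "?Z i j k l m" for i j k l m :: nat
  proof (rule sorting_induct_5[of ?Z])
    fix i j k l m :: nat
    show "?Z i j k l m \<Longrightarrow> ?Z j i k l m" using swap12[of "v j" "v i"] by auto
    show "?Z i j k l m \<Longrightarrow> ?Z i k j l m" using swap23[of "v i" "v k" "v j"] by auto
    show "?Z i j k l m \<Longrightarrow> ?Z i j l k m" using swap34[of "v i" "v j" "v l" "v k"] by auto
    show "?Z i j k l m \<Longrightarrow> ?Z i j k m l" using swap45[of "v i" "v j" "v k" "v m" "v l"] by auto
    show "?Z i i k l m" using swap12[of "v i" "v i" "v k" "v l" "v m"] by auto
    show "?Z i j j l m" using swap23[of "v i" "v j" "v j" "v l" "v m"] by auto
    show "?Z i j k k m" using swap34[of "v i" "v j" "v k" "v k" "v m"] by auto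
    show "?Z i j k l l" using swap45[of "v i" "v j" "v k" "v l" "v l"] by auto
  qed (use inc in auto)
  then have B: "F a b c d e = 0" if "a \<in> v ` I" "b \<in> v ` I" "c \<in> v ` I" "d \<in> v ` I" "e \<in> v ` I" for a b c d e
    using that by auto
  have 1: "F x b c d e = 0" if "b \<in> v ` I" "c \<in> v ` I" "d \<in> v ` I" "e \<in> v ` I" for b c d e
    by (rule linear_eq_0_on_span[OF lin1 _ x(1)]) (rule B[OF _ that])
  have 2: "F x y c d e = 0" if "c \<in> v ` I" "d \<in> v ` I" "e \<in> v ` I" for c d e
    by (rule linear_eq_0_on_span[OF lin2 _ x(2)]) (rule 1[OF _ that])
  have 3: "F x y z d e = 0" if "d \<in> v ` I" "e \<in> v ` I" for d e
    by (rule linear_eq_0_on_span[OF lin3 _ x(3)]) (rule 2[OF _ that])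
  have 4: "F x y z w e = 0" if "e \<in> v ` I" for e
    by (rule linear_eq_0_on_span[OF lin4 _ x(4)]) (rule 3[OF _ that])
  show ?thesis by (rule linear_eq_0_on_span[OF lin5 _ x(5)]) (rule 4)
qed

end

lemma alternating3_wedge_list:
  assumes "linear (f i)" "linear (f j)" "linear (f k)"
  shows "alternating3 (\<lambda>a b c. wedge_list f [i, j, k] [a, b, c])"
proof (rule alternating3.intro)
  fix b c
  show "linear (\<lambda>x. wedge_list f [i, j, k] [x, b, c])"
    by (rule linearI) (simp_all add: wedge_list_3 assms[THEN linear_add]
        assms[THEN linear_scale] algebra_simps)
qed (simp_all add: wedge_list_3 algebra_simps)

lemma alternating3_diff:
  assumes "alternating3 F" "alternating3 G"
  shows "alternating3 (\<lambda>a b c. F a b c - G a b c)"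
proof -
  interpret F: alternating3 F by fact
  interpret G: alternating3 G by fact
  show ?thesis
  proof (rule alternating3.intro)
    fix a b c
    show "F b a c - G b a c = - (F a b c - G a b c)" using F.swap12[of b a] G.swap12[of b a] by simp
    show "F a c b - G a c b = - (F a b c - G a b c)" using F.swap23[of a c b] G.swap23[of a c b] by simp
  qed (intro linear_compose_sub F.lin1 G.lin1)
qed

lemma alternating4_scale:
  assumes "alternating4 F"
  shows "alternating4 (\<lambda>a b c d. s * F a b c d)"
proof -
  interpret F: alternating4 F by fact
  show ?thesis
  proof (rule alternating4.intro)
    fix a b c d
    show "linear (\<lambda>x. s * F x b c d)" using linear_compose_scale_right[OF F.lin1] by simp
    show "s * F b a c d = - (s * F a b c d)" using F.swap12[of b a] by simp
    show "s * F a c b d = - (s * F a b c d)" using F.swap23[of a c b] by simp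
    show "s * F a b d c = - (s * F a b c d)" using F.swap34[of a b d c] by simp
  qed
qed

text \<open>Makes it possible to test closedness on increasing tuples of basis vectors only.\<close>

lemma alternating4_ce_d:
  assumes "lie_algebra br" "alternating3 (\<lambda>a b c. \<alpha> [a, b, c])"
  shows "alternating4 (\<lambda>a b c d. ce_d br \<alpha> [a, b, c, d])"
proof -
  interpret lie_alg br by unfold_locales fact
  define F where "F = (\<lambda>a b c. \<alpha> [a, b, c])"
  interpret F: alternating3 F unfolding F_def by fact
  have F: "\<alpha> [a, b, c] = F a b c" for a b c by (simp add: F_def)
  show ?thesis unfolding ce_d_4 F
  proof (rule alternating4.intro)
    fix b c d
    show "linear (\<lambda>a. - F (br a b) c d + F (br a c) b d - F (br a d) b c - F (br b c) a d
      + F (br b d) a c - F (br c d) a b)"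
      by (rule linearI) (simp_all add: expand F.expand algebra_simps)
  next
    fix a b c d
    show "- F (br b a) c d + F (br b c) a d - F (br b d) a c - F (br a c) b d + F (br a d) b c - F (br c d) b a =
      - (- F (br a b) c d + F (br a c) b d - F (br a d) b c - F (br b c) a d + F (br b d) a c - F (br c d) a b)"
      by (simp add: swap[of b a] F.swap23[of _ b a] F.expand)
    show "- F (br a c) b d + F (br a b) c d - F (br a d) c b - F (br c b) a d + F (br c d) a b - F (br b d) a c =
      - (- F (br a b) c d + F (br a c) b d - F (br a d) b c - F (br b c) a d + F (br b d) a c - F (br c d) a b)"
      by (simp add: swap[of c b] F.swap23[of _ c b] F.expand)
    show "- F (br a b) d c + F (br a d) b c - F (br a c) b d - F (br b d) a c + F (br b c) a d - F (br d c) a b =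
      - (- F (br a b) c d + F (br a c) b d - F (br a d) b c - F (br b c) a d + F (br b d) a c - F (br c d) a b)"
      by (simp add: swap[of d c] F.swap23[of _ d c] F.expand)
  qed
qed

lemma alternating5_ce_d:
  assumes "lie_algebra br" "alternating4 (\<lambda>a b c d. \<alpha> [a, b, c, d])"
  shows "alternating5 (\<lambda>a b c d e. ce_d br \<alpha> [a, b, c, d, e])"
proof -
  interpret lie_alg br by unfold_locales fact
  define F where "F = (\<lambda>a b c d. \<alpha> [a, b, c, d])"
  interpret F: alternating4 F unfolding F_def by fact
  have F: "\<alpha> [a, b, c, d] = F a b c d" for a b c d by (simp add: F_def)
  show ?thesis
  proof (rule alternating5.intro)
    fix b c d e
    show "linear (\<lambda>a. ce_d br \<alpha> [a, b, c, d, e])"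
      unfolding ce_d_5 F by (rule linearI) (simp_all add: expand F.expand algebra_simps)
  next
    fix a b c d e
    show "ce_d br \<alpha> [b, a, c, d, e] = - ce_d br \<alpha> [a, b, c, d, e]"
      unfolding ce_d_5 F by (simp add: swap[of b a] F.swap23[of _ b a] F.expand)
    show "ce_d br \<alpha> [a, c, b, d, e] = - ce_d br \<alpha> [a, b, c, d, e]"
      unfolding ce_d_5 F by (simp add: swap[of c b] F.swap23[of _ c b] F.swap34[of _ _ c b] F.expand)
    show "ce_d br \<alpha> [a, b, d, c, e] = - ce_d br \<alpha> [a, b, c, d, e]"
      unfolding ce_d_5 F by (simp add: swap[of d c] F.swap23[of _ d c] F.swap34[of _ _ d c] F.expand)
    show "ce_d br \<alpha> [a, b, c, e, d] = - ce_d br \<alpha> [a, b, c, d, e]"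
      unfolding ce_d_5 F by (simp add: swap[of e d] F.swap23[of _ e d] F.swap34[of _ _ e d] F.expand)
  qed
qed

section \<open>Half-flat structures from structure constants\<close>

lemma coframe_scale:
  assumes f: "coframe n f" and s: "\<And>i. s i \<noteq> 0"
  shows "coframe n (\<lambda>i x. s i * f i x)"
  unfolding coframe_def
proof (intro conjI ballI allI impI)
  fix i assume "i \<in> {1..n}"
  then have "linear (f i)" using f unfolding coframe_def by blast
  then show "linear (\<lambda>x. s i * f i x)" using linear_compose_scale_right[of "f i" "s i"] by simp
next
  fix c i assume c: "\<forall>v. (\<Sum>i=1..n. c i * (s i * f i v)) = 0" and i: "i \<in> {1..n}"
  have "c i * s i = 0"
  proof -
    have "\<forall>v. (\<Sum>i=1..n. (c i * s i) * f i v) = 0" using c by (simp add: mult.assoc)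
    moreover have "\<forall>c. (\<forall>v. (\<Sum>i=1..n. c i * f i v) = 0) \<longrightarrow> (\<forall>i\<in>{1..n}. c i = 0)"
      using f unfolding coframe_def by (rule conjunct1[OF conjunct2])
    ultimately have "\<forall>i\<in>{1..n}. c i * s i = 0" by (rule spec[of _ "\<lambda>i. c i * s i", THEN mp, rotated])
    then show ?thesis using i by blast
  qed
  then show "c i = 0" using s by simp
next
  fix g :: "'a \<Rightarrow> real" assume "linear g"
  then obtain c where c: "\<forall>v. g v = (\<Sum>i=1..n. c i * f i v)" using f unfolding coframe_def by blast
  then have "\<forall>v. g v = (\<Sum>i=1..n. (c i / s i) * (s i * f i v))" using s by simp
  then show "\<exists>c. \<forall>v. g v = (\<Sum>i=1..n. c i * (s i * f i v))" by (rule exI[of _ "\<lambda>i. c i / s i"])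
qed

lemma complex_volume_form:
  fixes f :: "nat \<Rightarrow> 'a \<Rightarrow> real"
  defines "z \<equiv> \<lambda>i j v. complex_of_real (f i v) + \<i> * complex_of_real (f j v)"
  defines "\<Psi> \<equiv> wedge (one_form (z 1 2)) (wedge (one_form (z 3 4)) (one_form (z 5 6)))"
  shows "length xs \<noteq> 3 \<Longrightarrow> \<Psi> xs = 0"
    and "Re (\<Psi> [a, b, c]) = wedge_list f [1,3,5] [a, b, c] - wedge_list f [1,4,6] [a, b, c]
      - wedge_list f [2,3,6] [a, b, c] - wedge_list f [2,4,5] [a, b, c]"
proof -
  have o: "length xs \<noteq> 1 \<Longrightarrow> one_form g xs = 0" for g :: "'a \<Rightarrow> complex" and xs
    by (simp add: one_form_def)
  show "length xs \<noteq> 3 \<Longrightarrow> \<Psi> xs = 0"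
    unfolding \<Psi>_def by (rule wedge_length[of 1 _ 2, OF o wedge_length[of 1 _ 1, OF o o]]) auto
  have 2: "wedge (one_form g) (one_form h) [a, b] = g a * h b - g b * h a" for g h :: "'a \<Rightarrow> complex" and a b
    by (simp add: wedge_one_form one_form_def expand_lists)
  have "\<Psi> [a, b, c] = z 1 2 a * (z 3 4 b * z 5 6 c - z 3 4 c * z 5 6 b)
     - z 1 2 b * (z 3 4 a * z 5 6 c - z 3 4 c * z 5 6 a) + z 1 2 c * (z 3 4 a * z 5 6 b - z 3 4 b * z 5 6 a)"
    unfolding \<Psi>_def wedge_one_form[of "z 1 2"] by (simp add: 2 expand_lists del: One_nat_def)
  note P = this
  show "Re (\<Psi> [a, b, c]) = wedge_list f [1,3,5] [a, b, c] - wedge_list f [1,4,6] [a, b, c]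
      - wedge_list f [2,3,6] [a, b, c] - wedge_list f [2,4,5] [a, b, c]"
    unfolding P z_def by (simp add: wedge_list_3 algebra_simps)
qed

text \<open>Each plane form squares to zero, which is the Pluecker relation \<open>P0\<close>, so
  only the cross terms remain, each of them twice.\<close>

lemma wedge_square:
  fixes f :: "nat \<Rightarrow> 'a \<Rightarrow> real"
  assumes \<omega>0: "\<And>xs. length xs \<noteq> 2 \<Longrightarrow> \<omega> xs = 0"
    and \<omega>2: "\<And>x y. \<omega> [x, y] = a * wedge_list f [1,2] [x, y] + b * wedge_list f [3,4] [x, y] + c * wedge_list f [5,6] [x, y]"
  shows "wedge \<omega> \<omega> [x, y, z, w] = 2 * (a * b * wedge_list f [1,2,3,4] [x, y, z, w]
    + a * c * wedge_list f [1,2,5,6] [x, y, z, w] + b * c * wedge_list f [3,4,5,6] [x, y, z, w])"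
proof -
  define P where "P = (\<lambda>i j x y. wedge_list f [i, j] [x, y])"
  have P4: "wedge_list f [i, j, k, l] [x, y, z, w] = P i j x y * P k l z w - P i j x z * P k l y w
    + P i j x w * P k l y z + P i j y z * P k l x w - P i j y w * P k l x z + P i j z w * P k l x y" for i j k l
    by (simp add: P_def wedge_list_4 wedge_list_3 wedge_list_2 algebra_simps)
  have P0: "P i j x y * P i j z w - P i j x z * P i j y w + P i j x w * P i j y z = 0" for i j
    by (simp add: P_def wedge_list_2 algebra_simps)
  have w: "wedge \<omega> \<omega> [x, y, z, w] = \<omega> [x, y] * \<omega> [z, w] - \<omega> [x, z] * \<omega> [y, w] + \<omega> [x, w] * \<omega> [y, z]
    + \<omega> [y, z] * \<omega> [x, w] - \<omega> [y, w] * \<omega> [x, z] + \<omega> [z, w] * \<omega> [x, y]"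
    by (rule wedge_2_2) (rule \<omega>0)
  have \<omega>P: "\<omega> [x, y] = a * P 1 2 x y + b * P 3 4 x y + c * P 5 6 x y" for x y
    unfolding \<omega>2 P_def ..
  have "wedge \<omega> \<omega> [x, y, z, w] = 2 * (a * b * wedge_list f [1,2,3,4] [x, y, z, w]
      + a * c * wedge_list f [1,2,5,6] [x, y, z, w] + b * c * wedge_list f [3,4,5,6] [x, y, z, w])
    + 2 * a * a * (P 1 2 x y * P 1 2 z w - P 1 2 x z * P 1 2 y w + P 1 2 x w * P 1 2 y z)
    + 2 * b * b * (P 3 4 x y * P 3 4 z w - P 3 4 x z * P 3 4 y w + P 3 4 x w * P 3 4 y z)
    + 2 * c * c * (P 5 6 x y * P 5 6 z w - P 5 6 x z * P 5 6 y w + P 5 6 x w * P 5 6 y z)"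
    unfolding w \<omega>P P4 by (simp add: algebra_simps)
  then show ?thesis unfolding P0 by simp
qed

text \<open>
  For a basis \<open>u\<^sub>1, \<dots>, u\<^sub>6\<close> with brackets \<open>[u\<^sub>i, u\<^sub>j] = \<Sum>\<^sub>k T i j k u\<^sub>k\<close> and dual coframe \<open>f\<close>, these
  equations say that \<open>Re ((f\<^sup>1 + i f\<^sup>2) \<and> (f\<^sup>3 + i f\<^sup>4) \<and> (f\<^sup>5 + i f\<^sup>6))\<close> and
  \<open>r f\<^sup>1\<^sup>2\<^sup>3\<^sup>4 + q f\<^sup>1\<^sup>2\<^sup>5\<^sup>6 + p f\<^sup>3\<^sup>4\<^sup>5\<^sup>6\<close> are closed. The latter is \<open>\<omega>\<^sup>2 / 2\<close> for
  \<open>\<omega> = a f\<^sup>1\<^sup>2 + b f\<^sup>3\<^sup>4 + c f\<^sup>5\<^sup>6\<close> with \<open>a b = r\<close>, \<open>a c = q\<close>, \<open>b c = p\<close>.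
\<close>

definition half_flat_equations :: "real \<Rightarrow> real \<Rightarrow> real \<Rightarrow> (nat \<Rightarrow> nat \<Rightarrow> nat \<Rightarrow> real) \<Rightarrow> bool" where
  "half_flat_equations p q r T \<longleftrightarrow>
     - T 1 3 5 + T 1 4 6 + T 2 3 6 + T 2 4 5 = 0 \<and>
     - T 1 2 1 + T 1 3 4 + T 1 5 6 + T 2 3 3 + T 2 5 5 = 0 \<and>
     T 1 2 2 + T 1 3 3 + T 1 6 6 - T 2 3 4 + T 2 6 5 = 0 \<and>
     T 1 2 2 + T 1 4 4 + T 1 5 5 + T 2 4 3 - T 2 5 6 = 0 \<and>
     T 1 2 1 + T 1 4 3 + T 1 6 5 - T 2 4 4 - T 2 6 6 = 0 \<and>
     T 1 5 3 - T 1 6 4 - T 2 5 4 - T 2 6 3 = 0 \<and>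
     T 1 3 2 + T 1 4 1 + T 3 4 3 - T 3 5 6 - T 4 5 5 = 0 \<and>
     T 1 3 1 - T 1 4 2 - T 3 4 4 - T 3 6 6 - T 4 6 5 = 0 \<and>
     - T 1 5 2 - T 1 6 1 - T 3 5 4 - T 3 6 3 - T 5 6 5 = 0 \<and>
     - T 1 5 1 + T 1 6 2 - T 4 5 4 - T 4 6 3 + T 5 6 6 = 0 \<and>
     T 2 3 2 + T 2 4 1 - T 3 4 4 - T 3 5 5 + T 4 5 6 = 0 \<and>
     T 2 3 1 - T 2 4 2 - T 3 4 3 - T 3 6 5 + T 4 6 6 = 0 \<and>
     - T 2 5 2 - T 2 6 1 - T 3 5 3 + T 3 6 4 + T 5 6 6 = 0 \<and>
     - T 2 5 1 + T 2 6 2 - T 4 5 3 + T 4 6 4 + T 5 6 5 = 0 \<and>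
     - T 3 5 1 + T 3 6 2 + T 4 5 2 + T 4 6 1 = 0 \<and>
     p * T 1 2 6 + r * T 1 5 1 + r * T 2 5 2 + q * T 3 4 6 + r * T 3 5 3 + r * T 4 5 4 = 0 \<and>
     - p * T 1 2 5 + r * T 1 6 1 + r * T 2 6 2 - q * T 3 4 5 + r * T 3 6 3 + r * T 4 6 4 = 0 \<and>
     p * T 1 2 4 + q * T 1 3 1 + q * T 2 3 2 - q * T 3 5 5 - q * T 3 6 6 + r * T 5 6 4 = 0 \<and>
     - p * T 1 2 3 + q * T 1 4 1 + q * T 2 4 2 - q * T 4 5 5 - q * T 4 6 6 - r * T 5 6 3 = 0 \<and>
     - p * T 1 3 3 - p * T 1 4 4 - p * T 1 5 5 - p * T 1 6 6 + q * T 3 4 2 + r * T 5 6 2 = 0 \<and>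
     - p * T 2 3 3 - p * T 2 4 4 - p * T 2 5 5 - p * T 2 6 6 - q * T 3 4 1 - r * T 5 6 1 = 0"

text \<open>The weights p, q, r are the coefficients of \<omega> \<and> \<omega> / 2 rather than of
  \<omega>, so the conditions stay rational in the structure constants; square roots enter only when
  \<omega> is reconstructed.\<close>

lemma half_flat_criterion:
  fixes br :: "'a::real_vector \<Rightarrow> 'a \<Rightarrow> 'a"
  assumes lie: "lie_algebra br" and len: "length us = 6" "length L = 6"
    and dm: "dim (UNIV :: 'a set) = 6" and sp: "span (set us) = UNIV"
    and tab: "\<And>i j. i < j \<Longrightarrow> j < 6 \<Longrightarrow> br (us ! i) (us ! j) = struct_comb L (Suc i) (Suc j) us"
    and pos: "p > 0" "q > 0" "r > 0"
    and eqs: "half_flat_equations p q r (\<lambda>i j k. scoef (L ! (k - 1)) i j)"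
  shows "admits_half_flat_SU3 br"
proof -
  interpret lie_alg br by unfold_locales fact
  define u where "u = (\<lambda>i. us ! (i - 1))"
  have 6: "{1..6::nat} = {1, 2, 3, 4, 5, 6}" by auto
  have "u ` {1..6} = set us"
  proof -
    obtain a b c d e f where "us = [a, b, c, d, e, f]"
      using len by (auto simp: length_Suc_conv numeral_eq_Suc)
    then show ?thesis unfolding 6 by (simp add: u_def)
  qed
  then have spu: "span (u ` {1..6}) = UNIV" using sp by simp
  obtain f where f: "coframe 6 f"
    and fu: "\<And>i j. j \<in> {1..6} \<Longrightarrow> f i (u j) = (if i = j then 1 else 0)"
    and fx: "\<And>x. (\<Sum>i=1..6. f i x *\<^sub>R u i) = x"
    using dual_coframe_exists[OF spu dm] by blast
  have lin: "linear (f i)" if "i \<in> {1..6}" for i using f that unfolding coframe_def by blast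
  define T where "T = (\<lambda>i j k. scoef (L ! (k - 1)) i j)"
  have fT: "f k (br (u i) (u j)) = T i j k" if "i \<in> {1..6}" "j \<in> {1..6}" "i < j" "k \<in> {1..6}" for i j k
  proof -
    have "br (u i) (u j) = (\<Sum>m=1..6. T i j m *\<^sub>R u m)"
      using tab[of "i - 1" "j - 1"] that len by (auto simp: u_def T_def struct_comb_eq)
    then have "f k (br (u i) (u j)) = (\<Sum>m=1..6. T i j m * f k (u m))"
      by (simp add: linear_sum[OF lin[OF that(4)]] linear_scale[OF lin[OF that(4)]])
    also have "\<dots> = (\<Sum>m=1..6. if m = k then T i j m else 0)"
      using fu by (intro sum.cong) auto
    finally show ?thesis using that by simp
  qed
  \<comment> \<open>The positive solution of a b = r, a c = q, b c = p.\<close>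
  define a b c where "a = sqrt (q * r / p)" and "b = sqrt (p * r / q)" and "c = sqrt (p * q / r)"
  have abc: "a > 0" "b > 0" "c > 0" using pos by (simp_all add: a_def b_def c_def)
  have prods: "a * b = r" "a * c = q" "b * c = p"
    using pos by (simp_all add: a_def b_def c_def flip: real_sqrt_mult)
  \<comment> \<open>Scaling both members of each pair of the coframe by the same factor gives
    \<omega> the coefficients a, b, c and multiplies the complex volume form by a constant, which
    does not affect closedness.\<close>
  define s where "s = (\<lambda>i::nat. sqrt (if i \<le> 2 then a else if i \<le> 4 then b else c))"
  have s0: "s i \<noteq> 0" for i using abc by (simp add: s_def)
  have ss: "s 1 * s 1 = a" "s 2 = s 1" "s 3 * s 3 = b" "s 4 = s 3" "s 5 * s 5 = c" "s 6 = s 5"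
    using abc by (simp_all add: s_def)
  define g where "g = (\<lambda>i x. s i * f i x)"
  have g: "coframe 6 g" unfolding g_def by (rule coframe_scale[OF f s0])
  define \<omega> where "\<omega> = (\<lambda>xs. wedge_list g [1,2] xs + wedge_list g [3,4] xs + wedge_list g [5,6] xs)"
  define \<Psi> where "\<Psi> = wedge (one_form (\<lambda>v. complex_of_real (g 1 v) + \<i> * complex_of_real (g 2 v)))
             (wedge (one_form (\<lambda>v. complex_of_real (g 3 v) + \<i> * complex_of_real (g 4 v)))
               (one_form (\<lambda>v. complex_of_real (g 5 v) + \<i> * complex_of_real (g 6 v))))"
  have SU3: "SU3_structure \<omega> \<Psi>"
    unfolding SU3_structure_def
    by (rule exI[of _ g], rule exI[of _ 1]) (simp add: g \<omega>_def \<Psi>_def)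
  have \<omega>0: "length xs \<noteq> 2 \<Longrightarrow> \<omega> xs = 0" for xs by (simp add: \<omega>_def wedge_list_length)
  have \<omega>2: "\<omega> [x, y] = a * wedge_list f [1,2] [x, y] + b * wedge_list f [3,4] [x, y] + c * wedge_list f [5,6] [x, y]" for x y
    by (simp add: \<omega>_def wedge_list_2 g_def ss(2,4,6) flip: ss(1,3,5)) (simp add: algebra_simps)
  define W where "W = (\<lambda>xs. r * wedge_list f [1,2,3,4] xs + q * wedge_list f [1,2,5,6] xs + p * wedge_list f [3,4,5,6] xs)"
  have WW: "wedge \<omega> \<omega> [x, y, z, w] = 2 * W [x, y, z, w]" for x y z w
    by (subst wedge_square[OF _ \<omega>2]) (simp_all add: \<omega>0 W_def prods)
  define R where "R = (\<lambda>xs. wedge_list f [1,3,5] xs - wedge_list f [1,4,6] xs - wedge_list f [2,3,6] xs - wedge_list f [2,4,5] xs)"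
  have RR: "Re (\<Psi> [x, y, z]) = s 1 * s 3 * s 5 * R [x, y, z]" for x y z
    unfolding \<Psi>_def complex_volume_form(2) R_def
    by (simp add: wedge_list_3 g_def ss(2,4,6)) (simp add: algebra_simps)
  have u0: "\<And>x. x \<in> span (u ` {1..6})" using spu by blast
  have fu': "f 1 (u 1) = 1" "f 1 (u 2) = 0" "f 1 (u 3) = 0" "f 1 (u 4) = 0" "f 1 (u 5) = 0" "f 1 (u 6) = 0"
    "f 2 (u 1) = 0" "f 2 (u 2) = 1" "f 2 (u 3) = 0" "f 2 (u 4) = 0" "f 2 (u 5) = 0" "f 2 (u 6) = 0"
    "f 3 (u 1) = 0" "f 3 (u 2) = 0" "f 3 (u 3) = 1" "f 3 (u 4) = 0" "f 3 (u 5) = 0" "f 3 (u 6) = 0"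
    "f 4 (u 1) = 0" "f 4 (u 2) = 0" "f 4 (u 3) = 0" "f 4 (u 4) = 1" "f 4 (u 5) = 0" "f 4 (u 6) = 0"
    "f 5 (u 1) = 0" "f 5 (u 2) = 0" "f 5 (u 3) = 0" "f 5 (u 4) = 0" "f 5 (u 5) = 1" "f 5 (u 6) = 0"
    "f 6 (u 1) = 0" "f 6 (u 2) = 0" "f 6 (u 3) = 0" "f 6 (u 4) = 0" "f 6 (u 5) = 0" "f 6 (u 6) = 1"
    by (simp_all add: fu)
  have fT': "f 1 (br (u 1) (u 2)) = T 1 2 1" "f 2 (br (u 1) (u 2)) = T 1 2 2" "f 3 (br (u 1) (u 2)) = T 1 2 3" "f 4 (br (u 1) (u 2)) = T 1 2 4" "f 5 (br (u 1) (u 2)) = T 1 2 5" "f 6 (br (u 1) (u 2)) = T 1 2 6"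
    "f 1 (br (u 1) (u 3)) = T 1 3 1" "f 2 (br (u 1) (u 3)) = T 1 3 2" "f 3 (br (u 1) (u 3)) = T 1 3 3" "f 4 (br (u 1) (u 3)) = T 1 3 4" "f 5 (br (u 1) (u 3)) = T 1 3 5" "f 6 (br (u 1) (u 3)) = T 1 3 6"
    "f 1 (br (u 1) (u 4)) = T 1 4 1" "f 2 (br (u 1) (u 4)) = T 1 4 2" "f 3 (br (u 1) (u 4)) = T 1 4 3" "f 4 (br (u 1) (u 4)) = T 1 4 4" "f 5 (br (u 1) (u 4)) = T 1 4 5" "f 6 (br (u 1) (u 4)) = T 1 4 6"
    "f 1 (br (u 1) (u 5)) = T 1 5 1" "f 2 (br (u 1) (u 5)) = T 1 5 2" "f 3 (br (u 1) (u 5)) = T 1 5 3" "f 4 (br (u 1) (u 5)) = T 1 5 4" "f 5 (br (u 1) (u 5)) = T 1 5 5" "f 6 (br (u 1) (u 5)) = T 1 5 6"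
    "f 1 (br (u 1) (u 6)) = T 1 6 1" "f 2 (br (u 1) (u 6)) = T 1 6 2" "f 3 (br (u 1) (u 6)) = T 1 6 3" "f 4 (br (u 1) (u 6)) = T 1 6 4" "f 5 (br (u 1) (u 6)) = T 1 6 5" "f 6 (br (u 1) (u 6)) = T 1 6 6"
    "f 1 (br (u 2) (u 3)) = T 2 3 1" "f 2 (br (u 2) (u 3)) = T 2 3 2" "f 3 (br (u 2) (u 3)) = T 2 3 3" "f 4 (br (u 2) (u 3)) = T 2 3 4" "f 5 (br (u 2) (u 3)) = T 2 3 5" "f 6 (br (u 2) (u 3)) = T 2 3 6"
    "f 1 (br (u 2) (u 4)) = T 2 4 1" "f 2 (br (u 2) (u 4)) = T 2 4 2" "f 3 (br (u 2) (u 4)) = T 2 4 3" "f 4 (br (u 2) (u 4)) = T 2 4 4" "f 5 (br (u 2) (u 4)) = T 2 4 5" "f 6 (br (u 2) (u 4)) = T 2 4 6"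
    "f 1 (br (u 2) (u 5)) = T 2 5 1" "f 2 (br (u 2) (u 5)) = T 2 5 2" "f 3 (br (u 2) (u 5)) = T 2 5 3" "f 4 (br (u 2) (u 5)) = T 2 5 4" "f 5 (br (u 2) (u 5)) = T 2 5 5" "f 6 (br (u 2) (u 5)) = T 2 5 6"
    "f 1 (br (u 2) (u 6)) = T 2 6 1" "f 2 (br (u 2) (u 6)) = T 2 6 2" "f 3 (br (u 2) (u 6)) = T 2 6 3" "f 4 (br (u 2) (u 6)) = T 2 6 4" "f 5 (br (u 2) (u 6)) = T 2 6 5" "f 6 (br (u 2) (u 6)) = T 2 6 6"
    "f 1 (br (u 3) (u 4)) = T 3 4 1" "f 2 (br (u 3) (u 4)) = T 3 4 2" "f 3 (br (u 3) (u 4)) = T 3 4 3" "f 4 (br (u 3) (u 4)) = T 3 4 4" "f 5 (br (u 3) (u 4)) = T 3 4 5" "f 6 (br (u 3) (u 4)) = T 3 4 6"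
    "f 1 (br (u 3) (u 5)) = T 3 5 1" "f 2 (br (u 3) (u 5)) = T 3 5 2" "f 3 (br (u 3) (u 5)) = T 3 5 3" "f 4 (br (u 3) (u 5)) = T 3 5 4" "f 5 (br (u 3) (u 5)) = T 3 5 5" "f 6 (br (u 3) (u 5)) = T 3 5 6"
    "f 1 (br (u 3) (u 6)) = T 3 6 1" "f 2 (br (u 3) (u 6)) = T 3 6 2" "f 3 (br (u 3) (u 6)) = T 3 6 3" "f 4 (br (u 3) (u 6)) = T 3 6 4" "f 5 (br (u 3) (u 6)) = T 3 6 5" "f 6 (br (u 3) (u 6)) = T 3 6 6"
    "f 1 (br (u 4) (u 5)) = T 4 5 1" "f 2 (br (u 4) (u 5)) = T 4 5 2" "f 3 (br (u 4) (u 5)) = T 4 5 3" "f 4 (br (u 4) (u 5)) = T 4 5 4" "f 5 (br (u 4) (u 5)) = T 4 5 5" "f 6 (br (u 4) (u 5)) = T 4 5 6"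
    "f 1 (br (u 4) (u 6)) = T 4 6 1" "f 2 (br (u 4) (u 6)) = T 4 6 2" "f 3 (br (u 4) (u 6)) = T 4 6 3" "f 4 (br (u 4) (u 6)) = T 4 6 4" "f 5 (br (u 4) (u 6)) = T 4 6 5" "f 6 (br (u 4) (u 6)) = T 4 6 6"
    "f 1 (br (u 5) (u 6)) = T 5 6 1" "f 2 (br (u 5) (u 6)) = T 5 6 2" "f 3 (br (u 5) (u 6)) = T 5 6 3" "f 4 (br (u 5) (u 6)) = T 5 6 4" "f 5 (br (u 5) (u 6)) = T 5 6 5" "f 6 (br (u 5) (u 6)) = T 5 6 6"
    by (simp_all add: fT)
  have RT: "ce_d br R [u 1, u 2, u 3, u 4] = - T 1 3 5 + T 1 4 6 + T 2 3 6 + T 2 4 5"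
    "ce_d br R [u 1, u 2, u 3, u 5] = - T 1 2 1 + T 1 3 4 + T 1 5 6 + T 2 3 3 + T 2 5 5"
    "ce_d br R [u 1, u 2, u 3, u 6] = T 1 2 2 + T 1 3 3 + T 1 6 6 - T 2 3 4 + T 2 6 5"
    "ce_d br R [u 1, u 2, u 4, u 5] = T 1 2 2 + T 1 4 4 + T 1 5 5 + T 2 4 3 - T 2 5 6"
    "ce_d br R [u 1, u 2, u 4, u 6] = T 1 2 1 + T 1 4 3 + T 1 6 5 - T 2 4 4 - T 2 6 6"
    "ce_d br R [u 1, u 2, u 5, u 6] = T 1 5 3 - T 1 6 4 - T 2 5 4 - T 2 6 3"
    "ce_d br R [u 1, u 3, u 4, u 5] = T 1 3 2 + T 1 4 1 + T 3 4 3 - T 3 5 6 - T 4 5 5"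
    "ce_d br R [u 1, u 3, u 4, u 6] = T 1 3 1 - T 1 4 2 - T 3 4 4 - T 3 6 6 - T 4 6 5"
    "ce_d br R [u 1, u 3, u 5, u 6] = - T 1 5 2 - T 1 6 1 - T 3 5 4 - T 3 6 3 - T 5 6 5"
    "ce_d br R [u 1, u 4, u 5, u 6] = - T 1 5 1 + T 1 6 2 - T 4 5 4 - T 4 6 3 + T 5 6 6"
    "ce_d br R [u 2, u 3, u 4, u 5] = T 2 3 2 + T 2 4 1 - T 3 4 4 - T 3 5 5 + T 4 5 6"
    "ce_d br R [u 2, u 3, u 4, u 6] = T 2 3 1 - T 2 4 2 - T 3 4 3 - T 3 6 5 + T 4 6 6"
    "ce_d br R [u 2, u 3, u 5, u 6] = - T 2 5 2 - T 2 6 1 - T 3 5 3 + T 3 6 4 + T 5 6 6"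
    "ce_d br R [u 2, u 4, u 5, u 6] = - T 2 5 1 + T 2 6 2 - T 4 5 3 + T 4 6 4 + T 5 6 5"
    "ce_d br R [u 3, u 4, u 5, u 6] = - T 3 5 1 + T 3 6 2 + T 4 5 2 + T 4 6 1"
    by (simp_all add: ce_d_4 R_def wedge_list_3 fu' fT' del: One_nat_def)
  have WT: "ce_d br W [u 1, u 2, u 3, u 4, u 5] = p * T 1 2 6 + r * T 1 5 1 + r * T 2 5 2 + q * T 3 4 6 + r * T 3 5 3 + r * T 4 5 4"
    "ce_d br W [u 1, u 2, u 3, u 4, u 6] = - p * T 1 2 5 + r * T 1 6 1 + r * T 2 6 2 - q * T 3 4 5 + r * T 3 6 3 + r * T 4 6 4"
    "ce_d br W [u 1, u 2, u 3, u 5, u 6] = p * T 1 2 4 + q * T 1 3 1 + q * T 2 3 2 - q * T 3 5 5 - q * T 3 6 6 + r * T 5 6 4"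
    "ce_d br W [u 1, u 2, u 4, u 5, u 6] = - p * T 1 2 3 + q * T 1 4 1 + q * T 2 4 2 - q * T 4 5 5 - q * T 4 6 6 - r * T 5 6 3"
    "ce_d br W [u 1, u 3, u 4, u 5, u 6] = - p * T 1 3 3 - p * T 1 4 4 - p * T 1 5 5 - p * T 1 6 6 + q * T 3 4 2 + r * T 5 6 2"
    "ce_d br W [u 2, u 3, u 4, u 5, u 6] = - p * T 2 3 3 - p * T 2 4 4 - p * T 2 5 5 - p * T 2 6 6 - q * T 3 4 1 - r * T 5 6 1"
    by (simp_all add: ce_d_5 W_def wedge_list_4 wedge_list_3 fu' fT' del: One_nat_def)
  note E = eqs[folded T_def, unfolded half_flat_equations_def]
  have Rz: "ce_d br R [u 1, u 2, u 3, u 4] = 0"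
    "ce_d br R [u 1, u 2, u 3, u 5] = 0"
    "ce_d br R [u 1, u 2, u 3, u 6] = 0"
    "ce_d br R [u 1, u 2, u 4, u 5] = 0"
    "ce_d br R [u 1, u 2, u 4, u 6] = 0"
    "ce_d br R [u 1, u 2, u 5, u 6] = 0"
    "ce_d br R [u 1, u 3, u 4, u 5] = 0"
    "ce_d br R [u 1, u 3, u 4, u 6] = 0"
    "ce_d br R [u 1, u 3, u 5, u 6] = 0"
    "ce_d br R [u 1, u 4, u 5, u 6] = 0"
    "ce_d br R [u 2, u 3, u 4, u 5] = 0"
    "ce_d br R [u 2, u 3, u 4, u 6] = 0"
    "ce_d br R [u 2, u 3, u 5, u 6] = 0"
    "ce_d br R [u 2, u 4, u 5, u 6] = 0"
    "ce_d br R [u 3, u 4, u 5, u 6] = 0"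
    by (simp_all only: RT E)
  have Wz: "ce_d br W [u 1, u 2, u 3, u 4, u 5] = 0"
    "ce_d br W [u 1, u 2, u 3, u 4, u 6] = 0"
    "ce_d br W [u 1, u 2, u 3, u 5, u 6] = 0"
    "ce_d br W [u 1, u 2, u 4, u 5, u 6] = 0"
    "ce_d br W [u 1, u 3, u 4, u 5, u 6] = 0"
    "ce_d br W [u 2, u 3, u 4, u 5, u 6] = 0"
    by (simp_all only: WT E)
  \<comment> \<open>The differential is alternating, so the fifteen values on increasing quadruples
    of the basis decide.\<close>
  have R0: "ce_d br R [x, y, z, w] = 0" for x y z w
  proof -
    interpret D: alternating4 "\<lambda>a b c d. ce_d br R [a, b, c, d]"
      unfolding R_def
      by (rule alternating4_ce_d[OF lie]) (intro alternating3_diff alternating3_wedge_list lin; simp)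
    show ?thesis
    proof (rule D.zero_on_family[OF _ u0 u0 u0 u0])
      fix i j k l :: nat assume *: "i < j" "j < k" "k < l" "{i, j, k, l} \<subseteq> {1..6}"
      then have "i = 1 \<or> i = 2 \<or> i = 3" "j = 2 \<or> j = 3 \<or> j = 4" "k = 3 \<or> k = 4 \<or> k = 5" "l = 4 \<or> l = 5 \<or> l = 6"
        by auto
      then show "ce_d br R [u i, u j, u k, u l] = 0"
        using *(1-3) by (elim disjE) (simp_all add: Rz del: One_nat_def)
    qed
  qed
  have W0: "ce_d br W [x, y, z, w, t] = 0" for x y z w t
  proof -
    interpret D: alternating5 "\<lambda>a b c d e. ce_d br W [a, b, c, d, e]"
      unfolding W_def
      by (rule alternating5_ce_d[OF lie]) (intro alternating4_add alternating4_scale alternating4_wedge_list lin; simp)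
    show ?thesis
    proof (rule D.zero_on_family[OF _ u0 u0 u0 u0 u0])
      fix i j k l m :: nat assume *: "i < j" "j < k" "k < l" "l < m" "{i, j, k, l, m} \<subseteq> {1..6}"
      then have "i = 1 \<or> i = 2" "j = 2 \<or> j = 3" "k = 3 \<or> k = 4" "l = 4 \<or> l = 5" "m = 5 \<or> m = 6"
        by auto
      then show "ce_d br W [u i, u j, u k, u l, u m] = 0"
        using *(1-4) by (elim disjE) (simp_all add: Wz del: One_nat_def)
    qed
  qed
  have "closed_form br (wedge \<omega> \<omega>)"
  proof (subst closed_form_4_iff)
    show "wedge \<omega> \<omega> xs = 0" if "length xs \<noteq> 4" for xs
      by (rule wedge_length[of 2 _ 2]) (use \<omega>0 that in auto)
    show "\<forall>a b c d e. ce_d br (wedge \<omega> \<omega>) [a, b, c, d, e] = 0"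
    proof (intro allI)
      fix a b c d e
      have "ce_d br (wedge \<omega> \<omega>) [a, b, c, d, e] = 2 * ce_d br W [a, b, c, d, e]"
        unfolding ce_d_5 WW by simp
      then show "ce_d br (wedge \<omega> \<omega>) [a, b, c, d, e] = 0" using W0 by simp
    qed
  qed
  moreover have "closed_form br (\<lambda>xs. Re (\<Psi> xs))"
  proof (subst closed_form_3_iff)
    show "Re (\<Psi> xs) = 0" if "length xs \<noteq> 3" for xs
      unfolding \<Psi>_def complex_volume_form(1)[OF that] by simp
    show "\<forall>a b c d. ce_d br (\<lambda>xs. Re (\<Psi> xs)) [a, b, c, d] = 0"
    proof (intro allI)
      fix a b c d
      have "ce_d br (\<lambda>xs. Re (\<Psi> xs)) [a, b, c, d] = s 1 * s 3 * s 5 * ce_d br R [a, b, c, d]"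
        unfolding ce_d_4 RR by (simp add: algebra_simps)
      then show "ce_d br (\<lambda>xs. Re (\<Psi> xs)) [a, b, c, d] = 0" using R0 by simp
    qed
  qed
  ultimately show ?thesis unfolding admits_half_flat_SU3_def using SU3 by blast
qed

section \<open>Lower central series\<close>

lemma lower_central_hom_image:
  assumes F: "linear F" "surj F" "\<And>x y. F (br x y) = br' (F x) (F y)"
  shows "lower_central br' n = F ` lower_central br n"
proof (induction n)
  case 0
  then show ?case using F(2) by simp
next
  case (Suc n)
  have "{br' x y | x y. y \<in> lower_central br' n} = F ` {br x y | x y. y \<in> lower_central br n}"
  proof (intro set_eqI iffI)
    fix z assume "z \<in> {br' x y | x y. y \<in> lower_central br' n}"
    then obtain x y' where z: "z = br' x y'" "y' \<in> lower_central br' n" by blast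
    then obtain y where "y' = F y" "y \<in> lower_central br n" using Suc.IH by blast
    then have "z = br' x (F y)" "y \<in> lower_central br n" using z by simp_all
    moreover obtain x' where "x = F x'" using F(2) by (metis surjD)
    ultimately show "z \<in> F ` {br x y | x y. y \<in> lower_central br n}"
      by (intro image_eqI[of _ F "br x' y"]) (auto simp: F(3))
  next
    fix z assume "z \<in> F ` {br x y | x y. y \<in> lower_central br n}"
    then obtain x y where "z = F (br x y)" "y \<in> lower_central br n" by blast
    then show "z \<in> {br' x y | x y. y \<in> lower_central br' n}"
      unfolding Suc.IH using F(3) by blast
  qed
  then show ?case by (simp add: linear_span_image[OF F(1)])
qed

lemma nilpotent_hom_image:
  assumes "linear F" "surj F" "\<And>x y. F (br x y) = br' (F x) (F y)" "nilpotent_lie br"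
  shows "nilpotent_lie br'"
proof -
  obtain n where "lower_central br n = {0}" using assms(4) unfolding nilpotent_lie_def by blast
  then have "lower_central br' n = {0}"
    using lower_central_hom_image[of F br br' n] assms(1-3) by (simp add: linear_0)
  then show ?thesis unfolding nilpotent_lie_def by blast
qed

section \<open>Complements and dimension counts\<close>

lemma complement_exists:
  fixes U W :: "'a::euclidean_space set"
  assumes "subspace U" "subspace W" "U \<subseteq> W"
  obtains S where "finite S" "card S = dim W - dim U" "S \<subseteq> W" "W \<subseteq> span (S \<union> U)"
proof -
  obtain B where B: "B \<subseteq> U" "independent B" "U \<subseteq> span B" "card B = dim U" using basis_exists by blast
  obtain B' where B': "B \<subseteq> B'" "B' \<subseteq> W" "independent B'" "W \<subseteq> span B'"
    using maximal_independent_subset_extend[OF order_trans[OF B(1) assms(3)] B(2)] by blast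
  have fin: "finite B'" using B'(3) by (rule independent_imp_finite)
  have "card B' = dim W" using B' by (simp add: basis_card_eq_dim)
  then have "card (B' - B) = dim W - dim U"
    using B(4) B'(1) fin by (simp add: card_Diff_subset finite_subset)
  moreover have "W \<subseteq> span (B' - B \<union> U)"
    using B'(4) B(1) span_mono[of B' "B' - B \<union> U"] by blast
  ultimately show thesis using that[of "B' - B"] fin B'(2) by auto
qed

lemma dim_span_Un:
  fixes U W :: "'a::euclidean_space set"
  assumes "finite T" "W \<subseteq> span (T \<union> U)" "subspace U"
  shows "dim W \<le> card T + dim U"
proof -
  obtain B where B: "B \<subseteq> U" "independent B" "U \<subseteq> span B" "card B = dim U" using basis_exists by blast
  have "T \<union> U \<subseteq> span (T \<union> B)" using B(3) span_mono[of B "T \<union> B"] span_superset[of "T \<union> B"] by blast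
  then have "W \<subseteq> span (T \<union> B)" using assms(2) span_minimal[OF _ subspace_span] by blast
  then have "dim W \<le> card (T \<union> B)"
    using assms(1) independent_imp_finite[OF B(2)] by (intro dim_le_card) auto
  also have "\<dots> \<le> card T + card B" by (rule card_Un_le)
  finally show ?thesis using B(4) by simp
qed

section \<open>The lower central series and its generators\<close>

context lie_alg
begin

text \<open>Numbered from 0: \<open>C 0\<close> is the whole algebra and \<open>C 1\<close> the
  derived algebra.\<close>

abbreviation C :: "nat \<Rightarrow> 'a set" where "C \<equiv> lower_central br"

lemma C_subspace: "subspace (C n)" by (cases n) auto

lemma C_Suc: "y \<in> C n \<Longrightarrow> br x y \<in> C (Suc n)"
  by (auto intro!: span_base)

lemma C_Suc': "y \<in> C n \<Longrightarrow> br y x \<in> C (Suc n)"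
  using C_Suc[of y n x] subspace_neg[OF C_subspace] swap[of y x] by metis

lemma C_1: "br x y \<in> C 1" using C_Suc[of y 0] by simp

lemma C_decreasing: "C (Suc n) \<subseteq> C n"
proof (induction n)
  case (Suc n)
  show ?case unfolding lower_central.simps(2)[of br "Suc n"]
  proof (rule span_minimal[OF _ C_subspace], clarify)
    fix x y assume "y \<in> C (Suc n)"
    then show "br x y \<in> C (Suc n)" using Suc C_Suc by blast
  qed
qed simp

lemma C_antimono: "m \<le> n \<Longrightarrow> C n \<subseteq> C m"
  by (rule lift_Suc_antimono_le[of C]) (use C_decreasing in auto)

text \<open>By the Jacobi identity a bracket [a, b] acts as a commutator of two operators, each of
  which lowers y by one step. Hence elements of \<open>C 1\<close> push two steps down.\<close>

lemma C_1_bracket: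
  assumes x: "x \<in> C 1" and y: "y \<in> C n"
  shows "br x y \<in> C (Suc (Suc n))"
proof -
  have "subspace {x. br x y \<in> C (Suc (Suc n))}"
    using C_subspace[of "Suc (Suc n)"] unfolding subspace_def by (simp add: expand)
  moreover have "{br a b | a b. b \<in> C 0} \<subseteq> {x. br x y \<in> C (Suc (Suc n))}"
  proof clarify
    fix a b
    have "br (br a b) y = br a (br b y) - br b (br a y)" using jacobi[of a b y] by simp
    moreover have "br a (br b y) \<in> C (Suc (Suc n))" "br b (br a y) \<in> C (Suc (Suc n))"
      using y C_Suc by blast+
    ultimately show "br (br a b) y \<in> C (Suc (Suc n))" using subspace_diff[OF C_subspace] by metis
  qed
  ultimately have "span {br a b | a b. b \<in> C 0} \<subseteq> {x. br x y \<in> C (Suc (Suc n))}"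
    by (intro span_minimal)
  then show ?thesis using x by auto
qed

text \<open>Generators are needed only modulo the next term: an error of S in \<open>C 1\<close> or
  of T in \<open>C (Suc n)\<close> changes the bracket by an element of
  \<open>C (Suc (Suc n))\<close>. Repeated use turns a few brackets into a spanning family of the
  whole algebra.\<close>

lemma C_generate:
  assumes S: "UNIV \<subseteq> span (S \<union> C 1)" and T: "C n \<subseteq> span (T \<union> C (Suc n))"
  shows "C (Suc n) \<subseteq> span ({br s t | s t. s \<in> S \<and> t \<in> T} \<union> C (Suc (Suc n)))" (is "_ \<subseteq> ?W")
proof -
  have sub: "subspace {x. br x y \<in> ?W}" "subspace {y. br x y \<in> ?W}" for x y
    unfolding subspace_def by (auto simp: expand span_0 intro: span_add span_scale)
  have C2: "C (Suc (Suc n)) \<subseteq> ?W" using span_superset by blast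
  have 1: "br s y \<in> ?W" if s: "s \<in> S" and y: "y \<in> C n" for s y
  proof -
    have "T \<union> C (Suc n) \<subseteq> {y. br s y \<in> ?W}"
      using s C2 C_Suc by (auto intro!: span_base simp del: lower_central.simps)
    then have "span (T \<union> C (Suc n)) \<subseteq> {y. br s y \<in> ?W}" by (intro span_minimal sub)
    then show ?thesis using y T by blast
  qed
  have 2: "br x y \<in> ?W" if y: "y \<in> C n" for x y
  proof -
    have "S \<union> C 1 \<subseteq> {x. br x y \<in> ?W}"
      using 1 y C_1_bracket C2 by blast
    then have "span (S \<union> C 1) \<subseteq> {x. br x y \<in> ?W}" by (intro span_minimal sub)
    then show ?thesis using S by blast
  qed
  show ?thesis unfolding lower_central.simps(2)[of br n]
    by (rule span_minimal) (use 2 in auto)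
qed

end

locale nilpotent_lie_alg = lie_alg br for br :: "'a::euclidean_space \<Rightarrow> 'a \<Rightarrow> 'a" +
  assumes nil: "nilpotent_lie br"
begin

text \<open>A term contained in its successor is contained in all later terms, one of which is
  zero.\<close>

lemma C_stable_imp_zero:
  assumes "C n \<subseteq> C (Suc n)"
  shows "C n = {0}"
proof -
  have "C n \<subseteq> C (n + k)" for k
  proof (induction k)
    case (Suc k)
    have "C (Suc n) \<subseteq> C (Suc (n + k))"
      unfolding lower_central.simps(2)[of br n]
      by (rule span_minimal[OF _ C_subspace]) (use Suc C_Suc in blast)
    then show ?case using assms by simp
  qed simp
  moreover obtain m where "C m = {0}" using nil unfolding nilpotent_lie_def by blast
  moreover have "C (n + m) \<subseteq> C m" by (rule C_antimono) simp
  ultimately have "C n \<subseteq> {0}" by blast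
  then show ?thesis using subspace_0[OF C_subspace] by blast
qed

lemma dim_C_less:
  assumes "C n \<noteq> {0}"
  shows "dim (C (Suc n)) < dim (C n)"
proof (rule ccontr)
  assume "\<not> dim (C (Suc n)) < dim (C n)"
  then have "C (Suc n) = C n"
    by (intro subspace_dim_equal C_subspace C_decreasing) simp
  then show False using C_stable_imp_zero[of n] assms by simp
qed

lemma dim_C_zero: "dim (C n) = 0 \<longleftrightarrow> C n = {0}"
  using subspace_0[OF C_subspace[of n]] by (auto simp: dim_eq_0)

end

section \<open>Normal forms of six-dimensional nilpotent Lie algebras\<close>

definition lc :: "real list \<Rightarrow> 'a list \<Rightarrow> 'a::real_vector" where
  "lc cs us = (\<Sum>(c, u)\<leftarrow>zip cs us. c *\<^sub>R u)"

lemma lc_in_span: "lc cs us \<in> span (set us)"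
  unfolding lc_def
proof (induction us arbitrary: cs)
  case (Cons u us)
  show ?case
  proof (cases cs)
    case (Cons c cs')
    have "(\<Sum>(c, u)\<leftarrow>zip cs' us. c *\<^sub>R u) \<in> span (set (u # us))"
      using Cons.IH[of cs'] span_mono[of "set us" "set (u # us)"] by auto
    then show ?thesis using Cons by (simp add: span_add span_scale span_base)
  qed (simp add: span_0)
qed (simp add: span_0)

text \<open>The rows of M express the old spanning vectors through the new ones. Exhibiting this
  inverse change of basis proves that the new family spans, without any argument about
  independence.\<close>

lemma span_change:
  assumes "span (set ws) = UNIV" "map (\<lambda>cs. lc cs us) M = ws"
  shows "span (set us) = UNIV"
proof -
  have "set ws \<subseteq> span (set us)" using assms(2) lc_in_span by auto
  then show ?thesis using assms(1) span_minimal[OF _ subspace_span] by blast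
qed

definition has_half_flat_equations :: "('a::real_vector \<Rightarrow> 'a \<Rightarrow> 'a) \<Rightarrow> bool" where
  "has_half_flat_equations br \<longleftrightarrow> (\<exists>L\<in>set half_flat_list. has_structure_equations br L)"

lemma half_flat_list_valid:
  assumes "L \<in> set half_flat_list"
  shows "valid_equations L \<and> length L = 6"
proof -
  have "\<forall>L\<in>set half_flat_list. valid_equations L \<and> length L = 6" by code_simp
  then show ?thesis using assms by blast
qed

text \<open>Interface for the normal forms: the old family ws, a new basis of six vectors, the
  matrix M of the old family in the new basis, and the fifteen brackets prescribed by L.\<close>

lemma structure_tableI:
  fixes br :: "'a::real_vector \<Rightarrow> 'a \<Rightarrow> 'a"
  assumes "span (set ws) = UNIV" "lie_algebra br" "dim (UNIV :: 'a set) = 6"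
    and "L \<in> set half_flat_list"
    and "map (\<lambda>cs. lc cs [v1, v2, v3, v4, v5, v6]) M = ws"
    and "br v1 v2 = struct_comb L 1 2 [v1, v2, v3, v4, v5, v6]"
    and "br v1 v3 = struct_comb L 1 3 [v1, v2, v3, v4, v5, v6]"
    and "br v1 v4 = struct_comb L 1 4 [v1, v2, v3, v4, v5, v6]"
    and "br v1 v5 = struct_comb L 1 5 [v1, v2, v3, v4, v5, v6]"
    and "br v1 v6 = struct_comb L 1 6 [v1, v2, v3, v4, v5, v6]"
    and "br v2 v3 = struct_comb L 2 3 [v1, v2, v3, v4, v5, v6]"
    and "br v2 v4 = struct_comb L 2 4 [v1, v2, v3, v4, v5, v6]"
    and "br v2 v5 = struct_comb L 2 5 [v1, v2, v3, v4, v5, v6]"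
    and "br v2 v6 = struct_comb L 2 6 [v1, v2, v3, v4, v5, v6]"
    and "br v3 v4 = struct_comb L 3 4 [v1, v2, v3, v4, v5, v6]"
    and "br v3 v5 = struct_comb L 3 5 [v1, v2, v3, v4, v5, v6]"
    and "br v3 v6 = struct_comb L 3 6 [v1, v2, v3, v4, v5, v6]"
    and "br v4 v5 = struct_comb L 4 5 [v1, v2, v3, v4, v5, v6]"
    and "br v4 v6 = struct_comb L 4 6 [v1, v2, v3, v4, v5, v6]"
    and "br v5 v6 = struct_comb L 5 6 [v1, v2, v3, v4, v5, v6]"
  shows "has_half_flat_equations br"
proof -
  let ?vs = "[v1, v2, v3, v4, v5, v6]"
  note L = half_flat_list_valid[OF assms(4)]
  have "has_structure_equations br L"
  proof (rule structure_equationsI[OF assms(2), of L ?vs])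
    show "span (set ?vs) = UNIV" by (rule span_change[OF assms(1,5)])
    fix i j assume ij: "i < j" "j < length L"
    then have "(i = 0 \<or> i = 1 \<or> i = 2 \<or> i = 3 \<or> i = 4)" "(j = 1 \<or> j = 2 \<or> j = 3 \<or> j = 4 \<or> j = 5)"
      using L by auto
    then show "br (?vs ! i) (?vs ! j) = struct_comb L (Suc i) (Suc j) ?vs"
      using ij(1) assms(6-) by (elim disjE) (simp_all add: numeral_eq_Suc)
  qed (use L assms(3) in auto)
  then show ?thesis unfolding has_half_flat_equations_def using assms(4) by blast
qed

lemmas table_simps = lc_def struct_comb_def scoef_def half_flat_list_def

section \<open>Normal forms for each shape of the lower central series\<close>

context lie_alg
begin

text \<open>The brackets among y, z, w form a nonzero skew form with values in the line of Q, hence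
  of rank two. If it is nonzero on z, w, then y can be corrected to lie in its radical; otherwise y
  pairs nontrivially with z or w and a combination of these two is in the radical.\<close>

lemma case_411:
  assumes dm: "dim (UNIV :: 'a set) = 6" and sp: "span (set [x, y, z, w, P, Q]) = UNIV"
    and t: "br x y = P" "br x z = 0" "br x w = 0" "br x P = Q" "br x Q = 0" "br y z = a *\<^sub>R Q" "br y w = b *\<^sub>R Q"
      "br y P = 0" "br y Q = 0" "br z w = c *\<^sub>R Q" "br z P = 0" "br z Q = 0" "br w P = 0" "br w Q = 0" "br P Q = 0"
    and nz: "a \<noteq> 0 \<or> b \<noteq> 0 \<or> c \<noteq> 0"
  shows "has_half_flat_equations br"
proof -
  note t' = t t[THEN arg_cong[of _ _ uminus], folded swap]
  consider "c \<noteq> 0" | "c = 0" "a \<noteq> 0" | "c = 0" "a = 0" "b \<noteq> 0" using nz by blast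
  then show ?thesis
  proof cases
    case 1
    show ?thesis
      by (rule structure_tableI[OF sp lie dm, of "[[], [], [], [], [12], [15, 34]]" x
          "y - (b / c) *\<^sub>R z + (a / c) *\<^sub>R w" "(1 / c) *\<^sub>R z" w P Q
          "[[1,0,0,0,0,0], [0,1,b,-a/c,0,0], [0,0,c,0,0,0], [0,0,0,1,0,0], [0,0,0,0,1,0], [0,0,0,0,0,1]]"])
        (simp_all add: table_simps expand t' 1)
  next
    case 2
    show ?thesis
      by (rule structure_tableI[OF sp lie dm, of "[[], [], [], [], [12], [14, 25]]" y x
          "w - (b / a) *\<^sub>R z" "- (1 / a) *\<^sub>R z" "- P" "- Q"
          "[[0,1,0,0,0,0], [1,0,0,0,0,0], [0,0,0,-a,0,0], [0,0,1,-b,0,0], [0,0,0,0,-1,0], [0,0,0,0,0,-1]]"])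
        (simp_all add: table_simps expand t' 2)
  next
    case 3
    show ?thesis
      by (rule structure_tableI[OF sp lie dm, of "[[], [], [], [], [12], [14, 25]]" y x
          "z" "- (1 / b) *\<^sub>R w" "- P" "- Q"
          "[[0,1,0,0,0,0], [1,0,0,0,0,0], [0,0,1,0,0,0], [0,0,0,-b,0,0], [0,0,0,0,-1,0], [0,0,0,0,0,-1]]"])
        (simp_all add: table_simps expand t' 3)
  qed
qed

text \<open>The operator [x, v] \<mapsto> [y, v] on the derived algebra sends P to Q and Q to d P,
  so its square is d. The sign of d decides between two real eigenvalues, a nilpotent operator and a
  complex structure.\<close>

lemma case_42:
  assumes dm: "dim (UNIV :: 'a set) = 6" and sp: "span (set [x, y, z, w, P, Q]) = UNIV"
    and t: "br x y = 0" "br x z = P" "br x w = Q" "br y z = Q" "br y w = d *\<^sub>R P" "br z w = 0"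
      and c: "\<And>u. br u P = 0" "\<And>u. br u Q = 0"
  shows "has_half_flat_equations br"
proof -
  note c' = c[THEN arg_cong[of _ _ uminus], folded swap]
  note t' = t t[THEN arg_cong[of _ _ uminus], folded swap] c c'
  consider "d = 0" | "d > 0" | "d < 0" by linarith
  then show ?thesis
  proof cases
    case 1
    show ?thesis
      by (rule structure_tableI[OF sp lie dm, of "[[], [], [], [], [12], [14, 23]]" x z "- y" w P Q
          "[[1,0,0,0,0,0], [0,0,-1,0,0,0], [0,1,0,0,0,0], [0,0,0,1,0,0], [0,0,0,0,1,0], [0,0,0,0,0,1]]"])
        (simp_all add: table_simps expand t' 1)
  next
    case 2
    define s where "s = sqrt d"
    have s: "s \<noteq> 0" "d = s * s" using 2 by (simp_all add: s_def)
    \<comment> \<open>The operator has the eigenvectors P + Q/s and P - Q/s. Brackets of x + y/s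
      with z and w lie in the first eigenline, those of x - y/s in the second; this splits the
      algebra into two Heisenberg algebras.\<close>
    show ?thesis
      by (rule structure_tableI[OF sp lie dm, of "[[], [], [], [], [12], [34]]"
          "x + (1/s) *\<^sub>R y" "z + (1/s) *\<^sub>R w" "x - (1/s) *\<^sub>R y" "z - (1/s) *\<^sub>R w"
          "2 *\<^sub>R P + (2/s) *\<^sub>R Q" "2 *\<^sub>R P - (2/s) *\<^sub>R Q"
          "[[1/2,0,1/2,0,0,0], [s/2,0,-s/2,0,0,0], [0,1/2,0,1/2,0,0], [0,s/2,0,-s/2,0,0], [0,0,0,0,1/4,1/4], [0,0,0,0,s/4,-s/4]]"])
        (simp_all add: table_simps expand t' s scaleR_add_left[symmetric] scaleR_add_right scaleR_diff_right, simp_all add: scaleR_2 algebra_simps flip: scaleR_add_left)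
  next
    case 3
    define s where "s = sqrt (- d)"
    have s: "s \<noteq> 0" "d = - (s * s)" using 3 by (simp_all add: s_def)
    show ?thesis
      by (rule structure_tableI[OF sp lie dm, of "[[], [], [], [], [13, -24], [14, 23]]"
          x "(1/s) *\<^sub>R y" z "(1/s) *\<^sub>R w" P "(1/s) *\<^sub>R Q"
          "[[1,0,0,0,0,0], [0,s,0,0,0,0], [0,0,1,0,0,0], [0,0,0,s,0,0], [0,0,0,0,1,0], [0,0,0,0,0,s]]"])
        (simp_all add: table_simps expand t' s)
  qed
qed

text \<open>The remaining possibility for that operator, a scalar: after subtracting a multiple of x
  from y, the vector y is central.\<close>

lemma case_42_degenerate:
  assumes dm: "dim (UNIV :: 'a set) = 6" and sp: "span (set [x, y, z, w, P, Q]) = UNIV"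
    and t: "br x y = 0" "br x z = P" "br x w = Q" "br y z = 0" "br y w = 0" "br z w = 0"
      and c: "\<And>u. br u P = 0" "\<And>u. br u Q = 0"
  shows "has_half_flat_equations br"
proof -
  note c' = c[THEN arg_cong[of _ _ uminus], folded swap]
  note t' = t t[THEN arg_cong[of _ _ uminus], folded swap] c c'
  show ?thesis
    by (rule structure_tableI[OF sp lie dm, of "[[], [], [], [], [12], [13]]" x z w y P Q
        "[[1,0,0,0,0,0], [0,0,0,1,0,0], [0,1,0,0,0,0], [0,0,1,0,0,0], [0,0,0,0,1,0], [0,0,0,0,0,1]]"])
      (simp_all add: table_simps expand t')
qed

text \<open>The bracket is a skew form with values in the line of P, and x, y is a hyperbolic pair
  for it. On the orthogonal vectors a, b, c its rank is 2 or 0, so one combination of them can be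
  made central.\<close>

lemma case_51:
  assumes dm: "dim (UNIV :: 'a set) = 6" and sp: "span (set [x, y, a, b, c, P]) = UNIV"
    and t: "br x y = P" "br x a = 0" "br x b = 0" "br x c = 0" "br y a = 0" "br y b = 0" "br y c = 0"
      "br a b = k *\<^sub>R P" "br a c = l *\<^sub>R P" "br b c = m *\<^sub>R P"
    and z: "\<And>u. br u P = 0"
  shows "has_half_flat_equations br"
proof -
  note z' = z[THEN arg_cong[of _ _ uminus], folded swap]
  note t' = t t[THEN arg_cong[of _ _ uminus], folded swap] z z'
  consider "k \<noteq> 0" | "k = 0" "l \<noteq> 0" | "k = 0" "l = 0" "m \<noteq> 0" | "k = 0" "l = 0" "m = 0" by blast
  then show ?thesis
  proof cases
    case 1
    show ?thesis
      by (rule structure_tableI[OF sp lie dm, of "[[], [], [], [], [], [12, 34]]" x y "(1/k) *\<^sub>R a" b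
          "c - (l/k) *\<^sub>R b + (m/k) *\<^sub>R a" P
          "[[1,0,0,0,0,0], [0,1,0,0,0,0], [0,0,k,0,0,0], [0,0,0,1,0,0], [0,0,-m,l/k,1,0], [0,0,0,0,0,1]]"])
        (simp_all add: table_simps expand t' 1)
  next
    case 2
    show ?thesis
      by (rule structure_tableI[OF sp lie dm, of "[[], [], [], [], [], [12, 34]]" x y "(1/l) *\<^sub>R a" c
          "b - (m/l) *\<^sub>R a" P
          "[[1,0,0,0,0,0], [0,1,0,0,0,0], [0,0,l,0,0,0], [0,0,m,0,1,0], [0,0,0,1,0,0], [0,0,0,0,0,1]]"])
        (simp_all add: table_simps expand t' 2)
  next
    case 3
    show ?thesis
      by (rule structure_tableI[OF sp lie dm, of "[[], [], [], [], [], [12, 34]]" x y "(1/m) *\<^sub>R b" c a P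
          "[[1,0,0,0,0,0], [0,1,0,0,0,0], [0,0,0,0,1,0], [0,0,m,0,0,0], [0,0,0,1,0,0], [0,0,0,0,0,1]]"])
        (simp_all add: table_simps expand t' 3)
  next
    case 4
    show ?thesis
      by (rule structure_tableI[OF sp lie dm, of "[[], [], [], [], [], [12]]" x y a b c P
          "[[1,0,0,0,0,0], [0,1,0,0,0,0], [0,0,1,0,0,0], [0,0,0,1,0,0], [0,0,0,0,1,0], [0,0,0,0,0,1]]"])
        (simp_all add: table_simps expand t' 4)
  qed
qed

text \<open>The coefficient of [u, [x, v]] for u, v in the plane of y, z is a symmetric form with
  entries p, q, r, and e is its determinant divided by p squared. The sign of e separates definite,
  indefinite and degenerate forms; if the form is degenerate, g tells whether x still acts on the
  radical.\<close>

lemma case_321_nonzero: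
  assumes dm: "dim (UNIV :: 'a set) = 6" and sp: "span (set [x, y, z, P, R, Q]) = UNIV"
    and t: "br x y = P" "br x z = R" "br y z = c *\<^sub>R Q" "br x P = a *\<^sub>R Q" "br x R = b *\<^sub>R Q"
      "br y P = p *\<^sub>R Q" "br y R = q *\<^sub>R Q" "br z P = q *\<^sub>R Q" "br z R = r *\<^sub>R Q" "br P R = 0"
    and z: "\<And>u. br u Q = 0"
    and nz: "p \<noteq> 0"
  shows "has_half_flat_equations br"
proof -
  note z' = z[THEN arg_cong[of _ _ uminus], folded swap]
  note t' = t t[THEN arg_cong[of _ _ uminus], folded swap] z z'
  define e where "e = r / p - q * q / (p * p)"
  define g where "g = b / p - a * q / (p * p)"
  define k where "k = c / p"
  \<comment> \<open>\<open>y, P\<close> stay; \<open>z\<close> is made orthogonal to \<open>y\<close> and corrected by \<open>P\<close> to commute with it, and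
    \<open>x\<close> is corrected by \<open>y\<close>.\<close>
  define z1 where "z1 = z - (q/p) *\<^sub>R y - k *\<^sub>R P"
  define x1 where "x1 = x - (a/p) *\<^sub>R y"
  define R1 where "R1 = R - (q/p) *\<^sub>R P - (a * c / p) *\<^sub>R Q"
  define Q1 where "Q1 = p *\<^sub>R Q"
  have t1: "br x1 y = P" "br x1 z1 = R1" "br y z1 = 0" "br x1 P = 0" "br x1 R1 = g *\<^sub>R Q1"
    "br y P = Q1" "br y R1 = 0" "br z1 P = 0" "br z1 R1 = e *\<^sub>R Q1" "br P R1 = 0" "br x1 Q1 = 0"
    "br y Q1 = 0" "br z1 Q1 = 0" "br P Q1 = 0" "br R1 Q1 = 0"
    using nz by (simp_all add: x1_def z1_def R1_def Q1_def e_def g_def k_def expand t' flip: scaleR_add_left scaleR_diff_left)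
      (simp_all add: field_simps)
  note t1' = t1 t1[THEN arg_cong[of _ _ uminus], folded swap]
  have sp1: "span (set [x1, y, z1, P, R1, Q1]) = UNIV"
    by (rule span_change[OF sp, of _ "[[1, a/p, 0, 0, 0, 0], [0,1,0,0,0,0], [0,q/p,1,k,0,0], [0,0,0,1,0,0],
          [0,0,0,q/p,1,a*c/(p*p)], [0,0,0,0,0,1/p]]"])
      (use nz in \<open>simp_all add: lc_def x1_def z1_def R1_def Q1_def\<close>)
  consider "e = 0" "g = 0" | "e = 0" "g \<noteq> 0" | "e > 0" | "e < 0" by linarith
  then show ?thesis
  proof cases
    case 1
    show ?thesis
      by (rule structure_tableI[OF sp1 lie dm, of "[[], [], [], [12], [13], [24]]" x1 y z1 P R1 Q1
          "[[1,0,0,0,0,0], [0,1,0,0,0,0], [0,0,1,0,0,0], [0,0,0,1,0,0], [0,0,0,0,1,0], [0,0,0,0,0,1]]"])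
        (simp_all add: table_simps expand t1' 1)
  next
    case 2
    show ?thesis
      by (rule structure_tableI[OF sp1 lie dm, of "[[], [], [], [12], [13], [14, 35]]" x1 "(1/g) *\<^sub>R z1" y "(1/g) *\<^sub>R R1" P Q1
          "[[1,0,0,0,0,0], [0,0,1,0,0,0], [0,g,0,0,0,0], [0,0,0,0,1,0], [0,0,0,g,0,0], [0,0,0,0,0,1]]"])
        (simp_all add: table_simps expand t1' 2)
  next
    case 3
    define s where "s = sqrt e"
    have s: "s \<noteq> 0" "e = s * s" using 3 by (simp_all add: s_def)
    show ?thesis
      by (rule structure_tableI[OF sp1 lie dm, of "[[], [], [], [12], [23], [14, -35]]" y "- (x1 - (g/e) *\<^sub>R z1)" "(1/s) *\<^sub>R z1"
          P "- (1/s) *\<^sub>R R1" Q1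
          "[[0,-1,g/s,0,0,0], [1,0,0,0,0,0], [0,0,s,0,0,0], [0,0,0,1,0,0], [0,0,0,0,-s,0], [0,0,0,0,0,1]]"])
        (simp_all add: table_simps expand t1' s)
  next
    case 4
    define s where "s = sqrt (- e)"
    have s: "s \<noteq> 0" "e = - (s * s)" using 4 by (simp_all add: s_def)
    show ?thesis
      by (rule structure_tableI[OF sp1 lie dm, of "[[], [], [], [12], [23], [14, 35]]" y "- (x1 - (g/e) *\<^sub>R z1)" "(1/s) *\<^sub>R z1"
          P "- (1/s) *\<^sub>R R1" Q1
          "[[0,-1,-g/s,0,0,0], [1,0,0,0,0,0], [0,0,s,0,0,0], [0,0,0,1,0,0], [0,0,0,0,-s,0], [0,0,0,0,0,1]]"])
        (simp_all add: table_simps expand t1' s)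
  qed
qed

text \<open>The symmetric form vanishes and x acts alone. Subtracting a multiple of y from z makes
  [x, [x, z]] zero; the scaling turns [y, z] into [x, P].\<close>

lemma case_321_zero:
  assumes dm: "dim (UNIV :: 'a set) = 6" and sp: "span (set [x, y, z, P, R, Q]) = UNIV"
    and t: "br x y = P" "br x z = R" "br y z = c *\<^sub>R Q" "br x P = a *\<^sub>R Q" "br x R = b *\<^sub>R Q"
      "br y P = 0" "br y R = 0" "br z P = 0" "br z R = 0" "br P R = 0"
    and z: "\<And>u. br u Q = 0"
    and nz: "a \<noteq> 0" "c \<noteq> 0"
  shows "has_half_flat_equations br"
proof -
  note z' = z[THEN arg_cong[of _ _ uminus], folded swap]
  note t' = t t[THEN arg_cong[of _ _ uminus], folded swap] z z'
  show ?thesis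
    by (rule structure_tableI[OF sp lie dm, of "[[], [], [], [12], [13], [14, 23]]" x y "(a/c) *\<^sub>R z - (b/c) *\<^sub>R y"
        P "(a/c) *\<^sub>R R - (b/c) *\<^sub>R P" "a *\<^sub>R Q"
        "[[1,0,0,0,0,0], [0,1,0,0,0,0], [0,b/a,c/a,0,0,0], [0,0,0,1,0,0], [0,0,0,b/a,c/a,0], [0,0,0,0,0,1/a]]"])
      (use nz in \<open>simp_all add: table_simps expand t' algebra_simps\<close>)
qed

text \<open>For c = 0 the parameters s and e are independent, and each is either zero or scaled to
  1. For c nonzero both can be removed by adding multiples of z to y and x.\<close>

lemma case_3111:
  assumes dm: "dim (UNIV :: 'a set) = 6" and sp: "span (set [x, y, z, P, A, B]) = UNIV"
    and t: "br x y = P" "br x z = 0" "br x P = A" "br x A = B" "br y z = c *\<^sub>R A + e *\<^sub>R B" "br y P = s *\<^sub>R B"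
      "br y A = 0" "br z P = - c *\<^sub>R B" "br z A = 0" "br P A = 0"
    and z: "\<And>u. br u B = 0"
  shows "has_half_flat_equations br"
proof -
  note z' = z[THEN arg_cong[of _ _ uminus], folded swap]
  note t' = t t[THEN arg_cong[of _ _ uminus], folded swap] z z'
  show ?thesis
  proof (cases "c = 0")
    case True
    consider "s = 0" "e = 0" | "s = 0" "e \<noteq> 0" | "s \<noteq> 0" "e = 0" | "s \<noteq> 0" "e \<noteq> 0" by blast
    then show ?thesis
    proof cases
      case 1
      show ?thesis
        by (rule structure_tableI[OF sp lie dm, of "[[], [], [], [12], [14], [15]]" x y z P A B
            "[[1,0,0,0,0,0], [0,1,0,0,0,0], [0,0,1,0,0,0], [0,0,0,1,0,0], [0,0,0,0,1,0], [0,0,0,0,0,1]]"])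
          (simp_all add: table_simps expand t' 1 True)
    next
      case 2
      show ?thesis
        by (rule structure_tableI[OF sp lie dm, of "[[], [], [], [12], [14], [15, 23]]" x y "(1/e) *\<^sub>R z" P A B
            "[[1,0,0,0,0,0], [0,1,0,0,0,0], [0,0,e,0,0,0], [0,0,0,1,0,0], [0,0,0,0,1,0], [0,0,0,0,0,1]]"])
          (simp_all add: table_simps expand t' 2 True)
    next
      case 3
      show ?thesis
        by (rule structure_tableI[OF sp lie dm, of "[[], [], [], [12], [14], [15, 24]]" x "(1/s) *\<^sub>R y" z
            "(1/s) *\<^sub>R P" "(1/s) *\<^sub>R A" "(1/s) *\<^sub>R B"
            "[[1,0,0,0,0,0], [0,s,0,0,0,0], [0,0,1,0,0,0], [0,0,0,s,0,0], [0,0,0,0,s,0], [0,0,0,0,0,s]]"])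
          (simp_all add: table_simps expand t' 3 True)
    next
      case 4
      show ?thesis
        by (rule structure_tableI[OF sp lie dm, of "[[], [], [], [12], [14], [15, 23, 24]]" x "(1/s) *\<^sub>R y" "(1/e) *\<^sub>R z"
            "(1/s) *\<^sub>R P" "(1/s) *\<^sub>R A" "(1/s) *\<^sub>R B"
            "[[1,0,0,0,0,0], [0,s,0,0,0,0], [0,0,e,0,0,0], [0,0,0,s,0,0], [0,0,0,0,s,0], [0,0,0,0,0,s]]"])
          (simp_all add: table_simps expand t' 4 True)
    qed
  next
    case False
    \<comment> \<open>Replacing x by x + \<mu> z changes A to A - 2 \<mu> c B, and [y, z] becomes c
      times the new A exactly when - 2 \<mu> c c = e.\<close>
    define \<mu> where "\<mu> = - e / (2 * c * c)"
    \<comment> \<open>The multiple of z cancels [y, P] = s B against [z, P] = - c B.\<close>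
    define y1 where "y1 = y + (s/c) *\<^sub>R z"
    define x1 where "x1 = x + \<mu> *\<^sub>R z"
    define P1 where "P1 = P - (\<mu> * c) *\<^sub>R A - (\<mu> * e) *\<^sub>R B"
    define A1 where "A1 = A - (2 * \<mu> * c) *\<^sub>R B"
    have t1: "br x1 y1 = P1" "br x1 z = 0" "br x1 P1 = A1" "br x1 A1 = B" "br y1 z = c *\<^sub>R A1" "br y1 P1 = 0"
      "br y1 A1 = 0" "br z P1 = - c *\<^sub>R B" "br z A1 = 0" "br P1 A1 = 0"
      using False by (simp_all add: x1_def y1_def P1_def A1_def \<mu>_def expand t' flip: scaleR_add_left scaleR_diff_left)
        (simp_all add: algebra_simps flip: scaleR_add_left scaleR_diff_left)
    note t1' = t1 t1[THEN arg_cong[of _ _ uminus], folded swap] z z'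
    have sp1: "span (set [x1, y1, z, P1, A1, B]) = UNIV"
      by (rule span_change[OF sp, of _ "[[1,0,-\<mu>,0,0,0], [0,1,-s/c,0,0,0], [0,0,1,0,0,0],
            [0,0,0,1,\<mu>*c,\<mu>*e+2*\<mu>*c*\<mu>*c], [0,0,0,0,1,2*\<mu>*c], [0,0,0,0,0,1]]"])
        (simp_all add: lc_def x1_def y1_def P1_def A1_def algebra_simps)
    show ?thesis
      by (rule structure_tableI[OF sp1 lie dm, of "[[], [], [], [12], [14, -23], [15, 34]]" x1 y1 "- (1/c) *\<^sub>R z" P1 A1 B
          "[[1,0,0,0,0,0], [0,1,0,0,0,0], [0,0,-c,0,0,0], [0,0,0,1,0,0], [0,0,0,0,1,0], [0,0,0,0,0,1]]"])
        (use False in \<open>simp_all add: table_simps expand t1'\<close>)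
  qed
qed

text \<open>The coefficient of [u, [v, P]] is a symmetric form on the plane of x, y with entries a,
  b, d. It is diagonalised using a nonzero; e is its determinant divided by a squared, and its sign
  gives the three algebras.\<close>

lemma case_2121:
  assumes dm: "dim (UNIV :: 'a set) = 6" and sp: "span (set [x, y, P, A, B, Q]) = UNIV"
    and t: "br x y = P" "br x P = A" "br y P = B" "br x A = a *\<^sub>R Q" "br x B = b *\<^sub>R Q" "br y A = b *\<^sub>R Q"
      "br y B = d *\<^sub>R Q" "br P A = 0" "br P B = 0" "br A B = 0"
    and z: "\<And>u. br u Q = 0"
    and nz: "a \<noteq> 0"
  shows "has_half_flat_equations br"
proof -
  note z' = z[THEN arg_cong[of _ _ uminus], folded swap]
  note t' = t t[THEN arg_cong[of _ _ uminus], folded swap] z z'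
  define e where "e = d / a - b * b / (a * a)"
  define y1 where "y1 = y - (b/a) *\<^sub>R x"
  define B1 where "B1 = B - (b/a) *\<^sub>R A"
  define Q1 where "Q1 = a *\<^sub>R Q"
  have z1: "br u Q1 = 0" for u by (simp add: Q1_def expand z)
  have t1: "br x y1 = P" "br x P = A" "br y1 P = B1" "br x A = Q1" "br x B1 = 0" "br y1 A = 0"
      "br y1 B1 = e *\<^sub>R Q1" "br P A = 0" "br P B1 = 0" "br A B1 = 0"
    using nz by (simp_all add: y1_def B1_def Q1_def e_def expand t' flip: scaleR_add_left scaleR_diff_left)
      (simp_all add: field_simps)
  note t1' = t1 t1[THEN arg_cong[of _ _ uminus], folded swap] z1 z1[THEN arg_cong[of _ _ uminus], folded swap]
  have sp1: "span (set [x, y1, P, A, B1, Q1]) = UNIV"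
    by (rule span_change[OF sp, of _ "[[1,0,0,0,0,0], [b/a,1,0,0,0,0], [0,0,1,0,0,0], [0,0,0,1,0,0],
          [0,0,0,b/a,1,0], [0,0,0,0,0,1/a]]"])
      (use nz in \<open>simp_all add: lc_def y1_def B1_def Q1_def\<close>)
  consider "e = 0" | "e > 0" | "e < 0" by linarith
  then show ?thesis
  proof cases
    case 1
    show ?thesis
      by (rule structure_tableI[OF sp1 lie dm, of "[[], [], [12], [13], [23], [14]]" x y1 P A B1 Q1
          "[[1,0,0,0,0,0], [0,1,0,0,0,0], [0,0,1,0,0,0], [0,0,0,1,0,0], [0,0,0,0,1,0], [0,0,0,0,0,1]]"])
        (simp_all add: table_simps expand t1' 1)
  next
    case 2
    define s where "s = sqrt e"
    have s: "s \<noteq> 0" "e = s * s" using 2 by (simp_all add: s_def)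
    show ?thesis
      by (rule structure_tableI[OF sp1 lie dm, of "[[], [], [12], [13], [23], [14, 25]]" x "(1/s) *\<^sub>R y1" "(1/s) *\<^sub>R P"
          "(1/s) *\<^sub>R A" "(1/(s * s)) *\<^sub>R B1" "(1/s) *\<^sub>R Q1"
          "[[1,0,0,0,0,0], [0,s,0,0,0,0], [0,0,s,0,0,0], [0,0,0,s,0,0], [0,0,0,0,s * s,0], [0,0,0,0,0,s]]"])
        (simp_all add: table_simps expand t1' s)
  next
    case 3
    define s where "s = sqrt (- e)"
    have s: "s \<noteq> 0" "e = - (s * s)" using 3 by (simp_all add: s_def)
    show ?thesis
      by (rule structure_tableI[OF sp1 lie dm, of "[[], [], [12], [13], [23], [14, -25]]" x "(1/s) *\<^sub>R y1" "(1/s) *\<^sub>R P"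
          "(1/s) *\<^sub>R A" "(1/(s * s)) *\<^sub>R B1" "(1/s) *\<^sub>R Q1"
          "[[1,0,0,0,0,0], [0,s,0,0,0,0], [0,0,s,0,0,0], [0,0,0,s,0,0], [0,0,0,0,s * s,0], [0,0,0,0,0,s]]"])
        (simp_all add: table_simps expand t1' s)
  qed
qed

text \<open>Here [y, B] = 0 and [y, P] has a B-component. The remaining parameter e is absorbed by a
  shift of x along y, and b by scaling.\<close>

lemma case_21111:
  assumes dm: "dim (UNIV :: 'a set) = 6" and sp: "span (set [x, y, P, A, B, Q]) = UNIV"
    and t: "br x y = P" "br x P = A" "br x A = B" "br x B = c *\<^sub>R Q" "br y P = b *\<^sub>R B + e *\<^sub>R Q"
      "br y A = (b * c) *\<^sub>R Q" "br y B = 0" "br P A = 0" "br P B = 0" "br A B = 0"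
    and z: "\<And>u. br u Q = 0"
    and nz: "b \<noteq> 0" "c \<noteq> 0"
  shows "has_half_flat_equations br"
proof -
  note z' = z[THEN arg_cong[of _ _ uminus], folded swap]
  note t' = t t[THEN arg_cong[of _ _ uminus], folded swap] z z'
  \<comment> \<open>With x + l y in place of x, the vector B becomes B + 2 l b c Q; then [y, P] = b
    B + e Q is b times the new B for this l.\<close>
  define l where "l = e / (2 * b * b * c)"
  define x1 where "x1 = x + l *\<^sub>R y"
  define A1 where "A1 = A + (l * b) *\<^sub>R B + (l * e) *\<^sub>R Q"
  define B1 where "B1 = B + (2 * l * b * c) *\<^sub>R Q"
  define Q1 where "Q1 = c *\<^sub>R Q"
  have z1: "br u Q1 = 0" for u by (simp add: Q1_def expand z)
  have t1: "br x1 y = P" "br x1 P = A1" "br x1 A1 = B1" "br x1 B1 = Q1" "br y P = b *\<^sub>R B1"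
      "br y A1 = b *\<^sub>R Q1" "br y B1 = 0" "br P A1 = 0" "br P B1 = 0" "br A1 B1 = 0"
    using nz by (simp_all add: x1_def A1_def B1_def Q1_def l_def expand t' flip: scaleR_add_left scaleR_diff_left)
      (simp_all add: algebra_simps flip: scaleR_add_left scaleR_diff_left)
  note t1' = t1 t1[THEN arg_cong[of _ _ uminus], folded swap] z1 z1[THEN arg_cong[of _ _ uminus], folded swap]
  have sp1: "span (set [x1, y, P, A1, B1, Q1]) = UNIV"
    by (rule span_change[OF sp, of _ "[[1,-l,0,0,0,0], [0,1,0,0,0,0], [0,0,1,0,0,0],
          [0,0,0,1,-l*b,(2*l*b*l*b*c - l*e)/c], [0,0,0,0,1,-2*l*b], [0,0,0,0,0,1/c]]"])
      (use nz in \<open>simp_all add: lc_def x1_def A1_def B1_def Q1_def algebra_simps flip: scaleR_add_left scaleR_diff_left\<close>,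
        use nz in \<open>simp add: field_simps\<close>)
  show ?thesis
    by (rule structure_tableI[OF sp1 lie dm, of "[[], [], [12], [13], [14, 23], [24, 15]]" x1 "(1/b) *\<^sub>R y" "(1/b) *\<^sub>R P"
        "(1/b) *\<^sub>R A1" "(1/b) *\<^sub>R B1" "(1/b) *\<^sub>R Q1"
        "[[1,0,0,0,0,0], [0,b,0,0,0,0], [0,0,b,0,0,0], [0,0,0,b,0,0], [0,0,0,0,b,0], [0,0,0,0,0,b]]"])
      (use nz in \<open>simp_all add: table_simps expand t1'\<close>)
qed

text \<open>The free two-step nilpotent algebra on three generators.\<close>

lemma case_33:
  assumes dm: "dim (UNIV :: 'a set) = 6" and sp: "span (set [x, y, z, br x y, br x z, br y z]) = UNIV"
    and c: "\<And>u v w. br u (br v w) = 0"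
  shows "has_half_flat_equations br"
  by (rule structure_tableI[OF sp lie dm, of "[[], [], [], [12], [13], [23]]" x y z "br x y" "br x z" "br y z"
      "[[1,0,0,0,0,0], [0,1,0,0,0,0], [0,0,1,0,0,0], [0,0,0,1,0,0], [0,0,0,0,1,0], [0,0,0,0,0,1]]"])
    (simp_all add: table_simps c)

lemma case_6:
  fixes x1 x2 x3 x4 x5 x6 :: 'a
  assumes dm: "dim (UNIV :: 'a set) = 6" and sp: "span (set [x1, x2, x3, x4, x5, x6]) = UNIV"
    and c: "\<And>u v. br u v = 0"
  shows "has_half_flat_equations br"
  by (rule structure_tableI[OF sp lie dm, of "[[], [], [], [], [], []]" x1 x2 x3 x4 x5 x6
      "[[1,0,0,0,0,0], [0,1,0,0,0,0], [0,0,1,0,0,0], [0,0,0,1,0,0], [0,0,0,0,1,0], [0,0,0,0,0,1]]"])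
    (simp_all add: table_simps c)

end

text \<open>
  The nilpotent Lie algebras of dimension six that are not on the list, as tables of brackets with
  respect to a spanning family. The parameters cover several isomorphism types at once.
\<close>

definition excluded_411 :: "('a::real_vector \<Rightarrow> 'a \<Rightarrow> 'a) \<Rightarrow> 'a \<Rightarrow> 'a \<Rightarrow> 'a \<Rightarrow> 'a \<Rightarrow> 'a \<Rightarrow> 'a \<Rightarrow> bool" where
  "excluded_411 br x y z w P Q \<longleftrightarrow> br x y = P \<and> br x z = 0 \<and> br x w = 0 \<and> br x P = Q \<and> br x Q = 0 \<and>
     br y z = 0 \<and> br y w = 0 \<and> br y P = 0 \<and> br y Q = 0 \<and> br z w = 0 \<and> br z P = 0 \<and> br z Q = 0 \<and>
     br w P = 0 \<and> br w Q = 0 \<and> br P Q = 0"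

definition excluded_321 :: "('a::real_vector \<Rightarrow> 'a \<Rightarrow> 'a) \<Rightarrow> 'a \<Rightarrow> 'a \<Rightarrow> 'a \<Rightarrow> 'a \<Rightarrow> 'a \<Rightarrow> 'a \<Rightarrow> bool" where
  "excluded_321 br x y z P R Q \<longleftrightarrow> br x y = P \<and> br x z = R \<and> br y z = 0 \<and> br x P = Q \<and> br x R = 0 \<and>
     br x Q = 0 \<and> br y P = 0 \<and> br y R = 0 \<and> br y Q = 0 \<and> br z P = 0 \<and> br z R = 0 \<and> br z Q = 0 \<and>
     br P R = 0 \<and> br P Q = 0 \<and> br R Q = 0"

definition excluded_312 :: "('a::real_vector \<Rightarrow> 'a \<Rightarrow> 'a) \<Rightarrow> 'a \<Rightarrow> 'a \<Rightarrow> 'a \<Rightarrow> 'a \<Rightarrow> 'a \<Rightarrow> 'a \<Rightarrow> bool" where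
  "excluded_312 br x y z P A B \<longleftrightarrow> br x y = P \<and> br x P = A \<and> br y P = B \<and> br z P = 0 \<and>
     (\<exists>a b. br x z = a *\<^sub>R A + b *\<^sub>R B) \<and> (\<exists>a b. br y z = a *\<^sub>R A + b *\<^sub>R B) \<and>
     br x A = 0 \<and> br x B = 0 \<and> br y A = 0 \<and> br y B = 0 \<and> br z A = 0 \<and> br z B = 0 \<and>
     br P A = 0 \<and> br P B = 0 \<and> br A B = 0"

text \<open>The last condition is complementary to f = 0, b \<noteq> 0, which
  \<open>case_21111\<close> puts on the list; at least one of c and f is nonzero, as the series does
  not stop earlier.\<close>

definition excluded_21111 :: "('a::real_vector \<Rightarrow> 'a \<Rightarrow> 'a) \<Rightarrow> 'a \<Rightarrow> 'a \<Rightarrow> 'a \<Rightarrow> 'a \<Rightarrow> 'a \<Rightarrow> 'a \<Rightarrow> bool" where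
  "excluded_21111 br x y P A B Q \<longleftrightarrow> br x y = P \<and> br x P = A \<and> br x A = B \<and>
     (\<exists>b c e f. br x B = c *\<^sub>R Q \<and> br y B = f *\<^sub>R Q \<and> br y P = b *\<^sub>R B + e *\<^sub>R Q \<and>
        br y A = (b * c) *\<^sub>R Q \<and> br P A = - f *\<^sub>R Q \<and> (f \<noteq> 0 \<or> b = 0 \<and> c \<noteq> 0)) \<and>
     br P B = 0 \<and> br A B = 0 \<and> br x Q = 0 \<and> br y Q = 0 \<and> br P Q = 0 \<and> br A Q = 0 \<and> br B Q = 0"

definition excluded_equations :: "('a::real_vector \<Rightarrow> 'a \<Rightarrow> 'a) \<Rightarrow> bool" where
  "excluded_equations br \<longleftrightarrow> (\<exists>a b c d e f. span (set [a, b, c, d, e, f]) = UNIV \<and>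
     (excluded_411 br a b c d e f \<or> excluded_321 br a b c d e f \<or> excluded_312 br a b c d e f \<or>
      excluded_21111 br a b c d e f))"

lemma excluded_equationsI:
  assumes "span (set [a, b, c, d, e, f]) = UNIV"
    "excluded_411 br a b c d e f \<or> excluded_321 br a b c d e f \<or> excluded_312 br a b c d e f \<or>
      excluded_21111 br a b c d e f"
  shows "excluded_equations br"
  using assms unfolding excluded_equations_def by blast

section \<open>Coordinates in a span modulo a subspace\<close>

lemma span_insert_cases:
  assumes "x \<in> span (insert a U)" "subspace U"
  obtains k where "x - k *\<^sub>R a \<in> U"
  using assms by (metis span_breakdown_eq span_eq_iff)

lemma span_singletonE:
  assumes "x \<in> span {a}"
  obtains k where "x = k *\<^sub>R a"
  using assms by (auto simp: span_singleton)

lemma span_doubletonE: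
  assumes "x \<in> span {a, b}"
  obtains k l where "x = k *\<^sub>R a + l *\<^sub>R b"
proof -
  obtain k where "x - k *\<^sub>R a \<in> span {b}" using assms by (auto simp: span_breakdown_eq[of x a])
  then obtain l where "x - k *\<^sub>R a = l *\<^sub>R b" by (rule span_singletonE)
  then have "x = k *\<^sub>R a + l *\<^sub>R b" by (simp add: algebra_simps)
  then show thesis by (rule that)
qed

text \<open>Lets the remainder in one step of the lower central series be replaced by generators of
  the next step.\<close>

lemma span_Un_chain:
  assumes "W \<subseteq> span (S \<union> U)" "U \<subseteq> span (T \<union> V)"
  shows "W \<subseteq> span (S \<union> T \<union> V)"
proof -
  have "S \<union> U \<subseteq> span (S \<union> T \<union> V)"
    using assms(2) span_mono[of "T \<union> V" "S \<union> T \<union> V"] span_superset[of "S \<union> T \<union> V"] by blast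
  then show ?thesis using assms(1) span_minimal[OF _ subspace_span] by blast
qed

lemma dim_insert_subspace:
  fixes U :: "'a::euclidean_space set"
  assumes "subspace U" "a \<notin> U"
  shows "dim (insert a U) = dim U + 1"
  using assms by (simp add: dim_insert span_eq_iff[THEN iffD2])

lemma subspace_subset_dim:
  fixes U W :: "'a::euclidean_space set"
  assumes "subspace W" "S \<subseteq> W" "dim W \<le> dim S"
  shows "W \<subseteq> span S"
proof -
  have "span S \<subseteq> W" using assms(1,2) by (simp add: span_minimal)
  moreover have "dim W \<le> dim (span S)" using assms(3) by (simp add: dim_span)
  ultimately have "span S = W" using assms(1) subspace_dim_equal[OF subspace_span, of W S] by blast
  then show ?thesis by blast
qed

declare lower_central.simps(2) [simp del]

lemma span_listI:
  assumes "UNIV \<subseteq> span (S \<union> T)" "T \<subseteq> span (set us)" "S \<subseteq> span (set us)"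
  shows "span (set us) = UNIV"
proof -
  have "span (S \<union> T) \<subseteq> span (set us)" using assms(2,3) by (intro span_minimal) auto
  then show ?thesis using assms(1) by blast
qed

context nilpotent_lie_alg
begin

lemma C_zero_bracket: "C (Suc n) = {0} \<Longrightarrow> y \<in> C n \<Longrightarrow> br x y = 0 \<and> br y x = 0"
  using C_Suc[of y n x] C_Suc'[of y n x] by auto

lemma C_1_zeroI:
  assumes "\<And>x y. br x y \<in> U" "subspace U"
  shows "C 1 \<subseteq> U"
  unfolding One_nat_def lower_central.simps(2) by (rule span_minimal) (use assms in auto)

lemma C_dim_1:
  assumes "dim (C n) = 1" "P \<in> C n" "P \<noteq> 0"
  shows "C n \<subseteq> span {P}"
  by (rule subspace_subset_dim[OF C_subspace]) (use assms in \<open>auto simp: dim_insert\<close>)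

lemma C_dim_Suc_0:
  assumes "dim (C n) = 1"
  shows "C (Suc n) = {0}"
proof -
  have "C n \<noteq> {0}" using assms dim_C_zero[of n] by linarith
  then have "dim (C (Suc n)) < dim (C n)" by (rule dim_C_less)
  then have "dim (C (Suc n)) = 0" using assms by linarith
  then show ?thesis by (rule dim_C_zero[THEN iffD1])
qed

lemma generators_exist:
  assumes "DIM('a) = 6"
  obtains S where "finite S" "card S = 6 - dim (C 1)" "UNIV \<subseteq> span (S \<union> C 1)"
proof -
  obtain S where "finite S" "card S = dim (UNIV :: 'a set) - dim (C 1)" "UNIV \<subseteq> span (S \<union> C 1)"
    using complement_exists[OF C_subspace[of 1] subspace_UNIV] by (metis subset_UNIV)
  then show thesis using that assms by (metis dim_UNIV)
qed

end

section \<open>Classification in dimension six by the shape of the lower central series\<close>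

context nilpotent_lie_alg
begin

text \<open>A nonzero bracket P gives a hyperbolic pair x, y for the skew form with values in the
  line of P; a complement is then made orthogonal to this pair.\<close>

lemma classify_51:
  assumes d6: "DIM('a) = 6" and d1: "dim (C 1) = 1"
  shows "has_half_flat_equations br"
proof -
  have dm: "dim (UNIV :: 'a set) = 6" using d6 by (simp add: dim_UNIV)
  have C2: "C (Suc 1) = {0}" by (rule C_dim_Suc_0[OF d1])
  have "\<exists>x y. br x y \<noteq> 0"
  proof (rule ccontr)
    assume "\<nexists>x y. br x y \<noteq> 0"
    then have "C 1 \<subseteq> {0}" by (intro C_1_zeroI) auto
    then show False using d1 dim_eq_0[of "C 1"] by simp
  qed
  then obtain x y where xy: "br x y \<noteq> 0" by blast
  define P where "P = br x y"
  have C1: "C 1 \<subseteq> span {P}" unfolding P_def by (rule C_dim_1[OF d1 C_1 xy])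
  have z: "br u P = 0" "br P u = 0" for u using C_zero_bracket[OF C2, of P u] C_1[of x y] by (simp_all add: P_def)
  have w: "\<exists>k. br u v = k *\<^sub>R P" for u v
    using C1 C_1[of u v] span_singletonE by blast
  have P0: "P \<noteq> 0" using xy P_def by simp
  have ny: "y \<notin> span {P}"
  proof
    assume "y \<in> span {P}"
    then obtain k where k: "y = k *\<^sub>R P" by (rule span_singletonE)
    have "P = br x y" by (simp add: P_def)
    also have "\<dots> = 0" by (subst k) (simp add: expand z)
    finally show False using P0 by simp
  qed
  have nx: "x \<notin> span {y, P}"
  proof
    assume "x \<in> span {y, P}"
    then obtain k l where k: "x = k *\<^sub>R y + l *\<^sub>R P" by (rule span_doubletonE)
    have "P = br x y" by (simp add: P_def)
    also have "\<dots> = 0" by (subst k) (simp add: expand z)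
    finally show False using P0 by simp
  qed
  have "dim {x, y, P} = 3" using nx ny P0 by (simp add: dim_insert)
  then have "dim (span {x, y, P}) = 3" by (simp add: dim_span)
  then obtain S where S: "card S = 3" "UNIV \<subseteq> span (S \<union> span {x, y, P})"
    using complement_exists[OF subspace_span subspace_UNIV, of "{x, y, P}"] dm by auto
  then obtain a b c where abc: "S = {a, b, c}" by (auto simp: card_3_iff)
  \<comment> \<open>Projection of v to the orthogonal complement of the hyperbolic pair.\<close>
  have adj: "\<exists>\<alpha> \<beta>. br x (v + \<alpha> *\<^sub>R x + \<beta> *\<^sub>R y) = 0 \<and> br y (v + \<alpha> *\<^sub>R x + \<beta> *\<^sub>R y) = 0" for v
  proof -
    obtain k l where "br x v = k *\<^sub>R P" "br y v = l *\<^sub>R P" using w by blast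
    then have "br x (v + l *\<^sub>R x + (- k) *\<^sub>R y) = 0 \<and> br y (v + l *\<^sub>R x + (- k) *\<^sub>R y) = 0"
      using swap[of y x] by (simp add: expand P_def)
    then show ?thesis by blast
  qed
  obtain a1 a2 b1 b2 c1 c2 where ab:
      "br x (a + a1 *\<^sub>R x + a2 *\<^sub>R y) = 0" "br y (a + a1 *\<^sub>R x + a2 *\<^sub>R y) = 0"
      "br x (b + b1 *\<^sub>R x + b2 *\<^sub>R y) = 0" "br y (b + b1 *\<^sub>R x + b2 *\<^sub>R y) = 0"
      "br x (c + c1 *\<^sub>R x + c2 *\<^sub>R y) = 0" "br y (c + c1 *\<^sub>R x + c2 *\<^sub>R y) = 0"
    using adj[of a] adj[of b] adj[of c] by blast
  define a' b' c' where "a' = a + a1 *\<^sub>R x + a2 *\<^sub>R y" and "b' = b + b1 *\<^sub>R x + b2 *\<^sub>R y" and "c' = c + c1 *\<^sub>R x + c2 *\<^sub>R y"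
  have "span (set [x, y, a, b, c, P]) = UNIV"
    by (rule span_listI[OF S(2)]) (auto simp: abc span_base intro!: span_mono)
  then have sp: "span (set [x, y, a', b', c', P]) = UNIV"
    by (rule span_change[of _ _ "[[1,0,0,0,0,0], [0,1,0,0,0,0], [-a1,-a2,1,0,0,0], [-b1,-b2,0,1,0,0], [-c1,-c2,0,0,1,0], [0,0,0,0,0,1]]"])
      (simp add: lc_def a'_def b'_def c'_def)
  obtain k l m where klm: "br a' b' = k *\<^sub>R P" "br a' c' = l *\<^sub>R P" "br b' c' = m *\<^sub>R P" using w by blast
  show ?thesis
    by (rule case_51[OF dm sp _ _ _ _ _ _ _ klm z(1)]) (use ab in \<open>simp_all add: a'_def b'_def c'_def P_def\<close>)
qed

text \<open>Once x is found for which bracketing with x has rank two, some y outside the plane of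
  the preimages z0, w0 commutes with x. The algebra is then governed by the operator [x, v]
  \<mapsto> [y, v] on the two-dimensional derived algebra.\<close>

lemma classify_42:
  assumes d6: "DIM('a) = 6" and d1: "dim (C 1) = 2" and C2: "C (Suc 1) = {0}"
  shows "has_half_flat_equations br"
proof -
  have dm: "dim (UNIV :: 'a set) = 6" using d6 by (simp add: dim_UNIV)
  have zc2: "br u (br v w) = 0" "br (br v w) u = 0" for u v w
    using C_zero_bracket[OF C2 C_1] by blast+
  have nspan: "\<exists>c d. br c d \<notin> span {P}" for P
  proof (rule ccontr)
    assume "\<nexists>c d. br c d \<notin> span {P}"
    then have "C 1 \<subseteq> span {P}" by (intro C_1_zeroI) auto
    then have "dim (C 1) \<le> card {P}" by (intro dim_le_card) auto
    then show False using d1 by simp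
  qed
  \<comment> \<open>If every single element had bracketing rank at most one, then for independent
    [a, b] and [c, d] the mixed brackets [a, d] and [c, b] would vanish, and a + c would have rank
    two.\<close>
  have "\<exists>x z w. br x z \<noteq> 0 \<and> br x w \<notin> span {br x z}"
  proof (rule ccontr)
    assume "\<not> ?thesis"
    then have n: "br x z \<noteq> 0 \<Longrightarrow> br x w \<in> span {br x z}" for x z w by blast
    obtain a b where ab: "br a b \<noteq> 0" using nspan[of 0] by (metis span_zero)
    obtain c d where cd: "br c d \<notin> span {br a b}" using nspan by blast
    then have cd0: "br c d \<noteq> 0" by (metis span_zero)
    have sab: "br v u \<in> span {br b a} \<Longrightarrow> br u v \<in> span {br a b}" for a b u v
      using swap[of v u] swap[of b a] by (auto simp: span_singleton)
    have dis: "v = 0" if "v \<in> span {br a b}" "v \<in> span {br c d}" for v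
    proof (rule ccontr)
      assume "v \<noteq> 0"
      obtain k where k: "v = k *\<^sub>R br a b" using \<open>v \<in> span {br a b}\<close> by (rule span_singletonE)
      obtain l where l: "v = l *\<^sub>R br c d" using \<open>v \<in> span {br c d}\<close> by (rule span_singletonE)
      then have "l \<noteq> 0" using \<open>v \<noteq> 0\<close> by auto
      then have "br c d = (1 / l) *\<^sub>R v" using l by simp
      then have "br c d = (k / l) *\<^sub>R br a b" using k by simp
      then have "br c d \<in> span {br a b}" by (simp only:) (intro span_scale span_base, simp)
      then show False using cd by simp
    qed
    have "br a d \<in> span {br a b}" using n[OF ab] .
    moreover have "br d a \<in> span {br d c}" using n[of d c a] cd0 swap[of d c] by simp
    then have "br a d \<in> span {br c d}" by (rule sab)
    ultimately have ad: "br a d = 0" using dis by blast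
    have "br b c \<in> span {br b a}" using n[of b a c] ab swap[of b a] by simp
    then have "br c b \<in> span {br a b}" by (rule sab)
    moreover have "br c b \<in> span {br c d}" using n[OF cd0] .
    ultimately have bc: "br c b = 0" using dis by blast
    have "br (a + c) b = br a b" "br (a + c) d = br c d" using ad bc by (simp_all add: expand)
    then show False using n[of "a + c" b d] ab cd by simp
  qed
  then obtain x z0 w0 where xzw: "br x z0 \<noteq> 0" "br x w0 \<notin> span {br x z0}" by blast
  have two: "C 1 \<subseteq> span {br x z, br x w}" if "br x z \<noteq> 0" "br x w \<notin> span {br x z}" for z w
  proof -
    have "dim {br x w, br x z} = 2" using that by (simp add: dim_insert)
    then show ?thesis
      by (subst insert_commute) (rule subspace_subset_dim[OF C_subspace], use d1 C_1 in auto)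
  qed
  define P0 Q0 where "P0 = br x z0" and "Q0 = br x w0"
  have nQ: "Q0 \<notin> span {P0}" "P0 \<noteq> 0" using xzw by (simp_all add: P0_def Q0_def)
  have indep: "k = 0 \<and> l = 0" if "k *\<^sub>R P0 + l *\<^sub>R Q0 = 0" for k l
  proof -
    have "l = 0"
    proof (rule ccontr)
      assume "l \<noteq> 0"
      moreover have "l *\<^sub>R Q0 = (- k) *\<^sub>R P0" using that by (simp add: add_eq_0_iff)
      then have "(1 / l) *\<^sub>R (l *\<^sub>R Q0) = (1 / l) *\<^sub>R ((- k) *\<^sub>R P0)" by simp
      ultimately have "Q0 = (- k / l) *\<^sub>R P0" by simp
      then have "Q0 \<in> span {P0}" by (simp only:) (intro span_scale span_base, simp)
      then show False using nQ by simp
    qed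
    then show ?thesis using that nQ by simp
  qed
  have zz: "br u P0 = 0" "br P0 u = 0" "br u Q0 = 0" "br Q0 u = 0" for u using zc2 by (simp_all add: P0_def Q0_def)
  have C1: "\<exists>k l. br u v = k *\<^sub>R P0 + l *\<^sub>R Q0" for u v
    using two[OF xzw] C_1[of u v] span_doubletonE unfolding P0_def Q0_def by blast
  have "w0 \<notin> span {P0, Q0}"
  proof
    assume "w0 \<in> span {P0, Q0}"
    then obtain k l where k: "w0 = k *\<^sub>R P0 + l *\<^sub>R Q0" by (rule span_doubletonE)
    have "Q0 = br x w0" by (simp add: Q0_def)
    also have "\<dots> = 0" by (subst k) (simp add: expand zz)
    finally show False using nQ(1) by (simp add: span_zero)
  qed
  moreover have "z0 \<notin> span {w0, P0, Q0}"
  proof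
    assume "z0 \<in> span {w0, P0, Q0}"
    then obtain m where "z0 - m *\<^sub>R w0 \<in> span {P0, Q0}" by (auto simp: span_breakdown_eq[of _ w0])
    then obtain k l where "z0 - m *\<^sub>R w0 = k *\<^sub>R P0 + l *\<^sub>R Q0" by (rule span_doubletonE)
    then have "br x (z0 - m *\<^sub>R w0) = 0" by (simp add: expand zz)
    then have "1 *\<^sub>R P0 + (- m) *\<^sub>R Q0 = 0" by (simp add: expand P0_def Q0_def)
    from indep[OF this] show False by simp
  qed
  moreover have "x \<notin> span {z0, w0, P0, Q0}"
  proof
    assume "x \<in> span {z0, w0, P0, Q0}"
    then obtain n m where "x - n *\<^sub>R z0 - m *\<^sub>R w0 \<in> span {P0, Q0}"
      by (auto simp: span_breakdown_eq[of _ w0] span_breakdown_eq[of _ z0])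
    then obtain k l where e: "x - n *\<^sub>R z0 - m *\<^sub>R w0 = k *\<^sub>R P0 + l *\<^sub>R Q0" by (rule span_doubletonE)
    then have "br x (x - n *\<^sub>R z0 - m *\<^sub>R w0) = 0" by (simp add: expand zz)
    then have "(- n) *\<^sub>R P0 + (- m) *\<^sub>R Q0 = 0" by (simp add: expand P0_def Q0_def)
    from indep[OF this] have "n = 0" "m = 0" by simp_all
    then have "x = k *\<^sub>R P0 + l *\<^sub>R Q0" using e by simp
    note k = this
    have "P0 = br x z0" by (simp add: P0_def)
    also have "\<dots> = 0" by (subst k) (simp add: expand zz)
    finally show False using nQ by simp
  qed
  moreover have "P0 \<notin> span {Q0}"
  proof
    assume "P0 \<in> span {Q0}"
    then obtain k where k: "P0 = k *\<^sub>R Q0" by (rule span_singletonE)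
    have "1 *\<^sub>R P0 + (- k) *\<^sub>R Q0 = P0 - k *\<^sub>R Q0" by simp
    also have "\<dots> = 0" using k by (rule right_minus_eq[THEN iffD2])
    finally have "1 *\<^sub>R P0 + (- k) *\<^sub>R Q0 = 0" .
    from indep[OF this] show False by simp
  qed
  moreover have "Q0 \<noteq> 0" using nQ(1) by (metis span_zero)
  ultimately have "dim {x, z0, w0, P0, Q0} = 5" by (simp add: dim_insert)
  then have "dim (span {x, z0, w0, P0, Q0}) = 5" by (simp add: dim_span)
  then obtain S where S: "card S = 1" "UNIV \<subseteq> span (S \<union> span {x, z0, w0, P0, Q0})"
    using complement_exists[OF subspace_span subspace_UNIV, of "{x, z0, w0, P0, Q0}"] dm by auto
  then obtain y0 where y0: "S = {y0}" by (auto simp: card_1_singleton_iff)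
  have spy0: "span (set [x, y0, z0, w0, P0, Q0]) = UNIV"
    by (rule span_listI[OF S(2)]) (auto simp: y0 span_base intro!: span_mono)
  obtain \<alpha> \<beta> where ab: "br x y0 = \<alpha> *\<^sub>R P0 + \<beta> *\<^sub>R Q0" using C1 by blast
  \<comment> \<open>Corrects y0 by preimages so that it commutes with x.\<close>
  define y1 where "y1 = y0 - \<alpha> *\<^sub>R z0 - \<beta> *\<^sub>R w0"
  have xy1: "br x y1 = 0" using ab by (simp add: y1_def expand P0_def Q0_def)
  have sp1: "span (set [x, y1, z0, w0, P0, Q0]) = UNIV"
    by (rule span_change[OF spy0, of _ "[[1,0,0,0,0,0], [0,1,\<alpha>,\<beta>,0,0], [0,0,1,0,0,0], [0,0,0,1,0,0], [0,0,0,0,1,0], [0,0,0,0,0,1]]"])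
      (simp add: lc_def y1_def)
  \<comment> \<open>Multiples of x added to z and w cancel [z, w], because [x, z] and [x, w] span
    the derived algebra; brackets with elements commuting with x are unaffected.\<close>
  have fix_zw: "\<exists>z' w'. br x z' = br x z \<and> br x w' = br x w \<and> (\<forall>u. br u x = 0 \<longrightarrow> br u z' = br u z \<and> br u w' = br u w)
      \<and> br z' w' = 0 \<and> (\<exists>\<alpha> \<beta>. z' = z + \<alpha> *\<^sub>R x \<and> w' = w + \<beta> *\<^sub>R x)"
    if zw: "br x z \<noteq> 0" "br x w \<notin> span {br x z}" for z w
  proof -
    obtain k l where kl: "br z w = k *\<^sub>R br x z + l *\<^sub>R br x w"
      using two[OF zw] C_1[of z w] span_doubletonE by blast
    have "br (z + (- l) *\<^sub>R x) (w + k *\<^sub>R x) = 0"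
      using swap[of z x] by (simp add: expand kl)
    moreover have "\<forall>u. br u x = 0 \<longrightarrow> br u (z + (- l) *\<^sub>R x) = br u z \<and> br u (w + k *\<^sub>R x) = br u w"
      "br x (z + (- l) *\<^sub>R x) = br x z" "br x (w + k *\<^sub>R x) = br x w" by (simp_all add: expand)
    ultimately show ?thesis by blast
  qed
  \<comment> \<open>Three test vectors suffice: an operator on a plane with two basis vectors and
    their sum as eigenvectors is scalar.\<close>
  show ?thesis
  proof (cases "\<exists>z\<in>{z0, w0, z0 + w0}. br y1 z \<notin> span {br x z}")
    case True
    \<comment> \<open>A cyclic vector \<open>z\<close> for the operator \<open>[x, v] \<mapsto> [y, v]\<close> on the derived algebra.\<close>
    then obtain z where z: "z \<in> {z0, w0, z0 + w0}" "br y1 z \<notin> span {br x z}" by blast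
    obtain c1 c2 where zc: "z = c1 *\<^sub>R z0 + c2 *\<^sub>R w0" "c1 \<noteq> 0 \<or> c2 \<noteq> 0"
    proof -
      have "z0 = 1 *\<^sub>R z0 + 0 *\<^sub>R w0" "w0 = 0 *\<^sub>R z0 + 1 *\<^sub>R w0" "z0 + w0 = 1 *\<^sub>R z0 + 1 *\<^sub>R w0" by simp_all
      then show thesis using z(1) that[of 1 0] that[of 0 1] that[of 1 1] by auto
    qed
    define P where "P = br x z"
    define Q where "Q = br y1 z"
    have Pc: "P = c1 *\<^sub>R P0 + c2 *\<^sub>R Q0" by (simp add: P_def zc(1) expand P0_def Q0_def)
    then have P: "P \<noteq> 0" using indep[of c1 c2] zc(2) by auto
    have Q: "Q \<notin> span {P}" using z(2) by (simp add: P_def Q_def)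
    obtain d1 d2 where Qd: "Q = d1 *\<^sub>R P0 + d2 *\<^sub>R Q0" unfolding Q_def using C1 by blast
    \<comment> \<open>A preimage of Q under bracketing with x, so that the operator sends [x, z] to
      [x, w].\<close>
    define w where "w = d1 *\<^sub>R z0 + d2 *\<^sub>R w0"
    have xw: "br x w = Q" by (simp add: w_def Qd expand P0_def Q0_def)
    have C1P: "C 1 \<subseteq> span {P, Q}" using two[of z w] P Q unfolding xw P_def[symmetric] by blast
    have C1': "\<exists>k l. br u v = k *\<^sub>R P + l *\<^sub>R Q" for u v
      using C1P C_1[of u v] span_doubletonE by blast
    have zw0: "\<exists>k l. v = k *\<^sub>R z + l *\<^sub>R w" if v: "v = e1 *\<^sub>R z0 + e2 *\<^sub>R w0" for v e1 e2
    proof -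
      obtain k l where kl: "br x v = k *\<^sub>R P + l *\<^sub>R Q" using C1' by blast
      have "(e1 - k * c1 - l * d1) *\<^sub>R P0 + (e2 - k * c2 - l * d2) *\<^sub>R Q0 = 0"
        using kl unfolding v Pc Qd by (simp add: expand P0_def Q0_def algebra_simps)
      from indep[OF this] have e: "e1 = k * c1 + l * d1" "e2 = k * c2 + l * d2" by (simp_all add: algebra_simps)
      have "v = k *\<^sub>R z + l *\<^sub>R w" unfolding v e zc(1) w_def
        by (simp only: scaleR_add_left scaleR_add_right scaleR_scaleR add_ac)
      then show ?thesis by blast
    qed
    have "z0 = 1 *\<^sub>R z0 + 0 *\<^sub>R w0" "w0 = 0 *\<^sub>R z0 + 1 *\<^sub>R w0" by simp_all
    note zw0s = this
    obtain k1 l1 where z0e: "z0 = k1 *\<^sub>R z + l1 *\<^sub>R w" using zw0[OF zw0s(1)] by blast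
    obtain k2 l2 where w0e: "w0 = k2 *\<^sub>R z + l2 *\<^sub>R w" using zw0[OF zw0s(2)] by blast
    have PQe: "P0 = k1 *\<^sub>R P + l1 *\<^sub>R Q" "Q0 = k2 *\<^sub>R P + l2 *\<^sub>R Q"
      unfolding P0_def Q0_def z0e w0e by (simp_all add: expand P_def xw)
    obtain \<delta> \<tau> where yw: "br y1 w = \<delta> *\<^sub>R P + \<tau> *\<^sub>R Q" using C1' by blast
    \<comment> \<open>Subtracting half the trace \<tau> makes the operator traceless, so that its
      square is the scalar \<delta> + \<tau> \<tau> / 4; w and Q are shifted accordingly.\<close>
    define y where "y = y1 - (\<tau> / 2) *\<^sub>R x"
    define w1 where "w1 = w - (\<tau> / 2) *\<^sub>R z"
    define Q1 where "Q1 = Q - (\<tau> / 2) *\<^sub>R P"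
    have xw1: "br x w1 = Q1" by (simp add: w1_def Q1_def expand xw P_def)
    have "Q1 \<notin> span {P}"
    proof
      assume "Q1 \<in> span {P}"
      then obtain k where "Q1 = k *\<^sub>R P" by (rule span_singletonE)
      then have "Q = (k + \<tau> / 2) *\<^sub>R P" by (simp add: Q1_def algebra_simps)
      then have "Q \<in> span {P}" by (simp only:) (intro span_scale span_base, simp)
      then show False using Q by simp
    qed
    then obtain z' w' where zw: "br x z' = P" "br x w' = Q1" "\<And>u. br u x = 0 \<Longrightarrow> br u z' = br u z \<and> br u w' = br u w1"
      "br z' w' = 0" "\<exists>\<alpha> \<beta>. z' = z + \<alpha> *\<^sub>R x \<and> w' = w1 + \<beta> *\<^sub>R x"
      using fix_zw[of z w1] P unfolding P_def xw1 by blast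
    have yx: "br y x = 0" "br x y = 0" using xy1 swap[of y1 x] by (simp_all add: y_def expand)
    have yz: "br y z' = Q1" using zw(3)[OF yx(1)] by (simp add: y_def expand Q1_def Q_def P_def)
    have yw': "br y w' = (\<delta> + \<tau> * \<tau> / 4) *\<^sub>R P"
    proof -
      have "br y w' = br y w1" using zw(3)[OF yx(1)] by simp
      also have "\<dots> = br y1 w - (\<tau> / 2) *\<^sub>R br y1 z - (\<tau> / 2) *\<^sub>R br x w + (\<tau> * \<tau> / 4) *\<^sub>R br x z"
        by (simp add: y_def w1_def expand algebra_simps)
      also have "\<dots> = (\<delta> + \<tau> * \<tau> / 4) *\<^sub>R P + (\<tau> *\<^sub>R Q - (\<tau> / 2) *\<^sub>R Q - (\<tau> / 2) *\<^sub>R Q)"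
        unfolding yw xw Q_def[symmetric] P_def[symmetric] by (simp add: scaleR_add_left)
      also have "\<tau> *\<^sub>R Q - (\<tau> / 2) *\<^sub>R Q - (\<tau> / 2) *\<^sub>R Q = 0" by (simp flip: scaleR_diff_left)
      finally show ?thesis by simp
    qed
    obtain \<alpha> \<beta> where e: "z' = z + \<alpha> *\<^sub>R x" "w' = w1 + \<beta> *\<^sub>R x" using zw(5) by blast
    have sp: "span (set [x, y, z', w', P, Q1]) = UNIV"
      unfolding e by (rule span_change[OF sp1, of _ "[[1,0,0,0,0,0], [\<tau>/2,1,0,0,0,0],
            [- k1 * \<alpha> - l1 * \<beta> - l1 * \<tau> / 2 * \<alpha>, 0, k1 + l1 * \<tau> / 2, l1, 0, 0],
            [- k2 * \<alpha> - l2 * \<beta> - l2 * \<tau> / 2 * \<alpha>, 0, k2 + l2 * \<tau> / 2, l2, 0, 0],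
            [0,0,0,0,k1 + l1 * \<tau> / 2,l1], [0,0,0,0,k2 + l2 * \<tau> / 2,l2]]"])
        (simp add: lc_def y_def w1_def Q1_def PQe z0e w0e algebra_simps)
    have zP: "br u P = 0" "br u Q1 = 0" for u by (simp_all add: Q1_def P_def Q_def expand zc2)
    show ?thesis by (rule case_42[OF dm sp yx(2) zw(1,2) yz yw' zw(4) zP])
  next
    case False
    then obtain k l m where klm: "br y1 z0 = k *\<^sub>R P0" "br y1 w0 = l *\<^sub>R Q0" "br y1 (z0 + w0) = m *\<^sub>R br x (z0 + w0)"
      unfolding P0_def Q0_def by (metis insertI1 insertI2 span_singletonE)
    then have "(k - m) *\<^sub>R P0 + (l - m) *\<^sub>R Q0 = 0"
      by (simp add: expand P0_def Q0_def algebra_simps)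
    from indep[OF this] have kl: "k = m" "l = m" by simp_all
    define y where "y = y1 - m *\<^sub>R x"
    obtain z w where zw: "br x z = P0" "br x w = Q0" "\<And>u. br u x = 0 \<Longrightarrow> br u z = br u z0 \<and> br u w = br u w0"
      "br z w = 0" "\<exists>\<alpha> \<beta>. z = z0 + \<alpha> *\<^sub>R x \<and> w = w0 + \<beta> *\<^sub>R x"
      using fix_zw[OF xzw] unfolding P0_def Q0_def by blast
    have yx: "br y x = 0" "br x y = 0" using xy1 swap[of y1 x] by (simp_all add: y_def expand)
    have yz: "br y z = 0" "br y w = 0"
      using zw(3)[OF yx(1)] klm kl by (simp_all add: y_def expand P0_def Q0_def)
    obtain \<alpha> \<beta> where "z = z0 + \<alpha> *\<^sub>R x" "w = w0 + \<beta> *\<^sub>R x" using zw(5) by blast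
    then have sp: "span (set [x, y, z, w, P0, Q0]) = UNIV"
      by (intro span_change[OF sp1, of _ "[[1,0,0,0,0,0], [m,1,0,0,0,0], [-\<alpha>,0,1,0,0,0], [-\<beta>,0,0,1,0,0], [0,0,0,0,1,0], [0,0,0,0,0,1]]"])
        (simp add: lc_def y_def)
    show ?thesis by (rule case_42_degenerate[OF dm sp yx(2) zw(1,2) yz zw(4) zz(1,3)])
  qed
qed

text \<open>Bracketing with a generator P0 of \<open>C 1\<close> modulo \<open>C 2\<close> is a
  functional with values in the line \<open>C 2\<close>. Elements of its kernel commute up to that
  line, so only x and one further y matter for P.\<close>

lemma classify_411:
  assumes d6: "DIM('a) = 6" and d1: "dim (C 1) = 2" and d2: "dim (C (Suc 1)) = 1"
  shows "has_half_flat_equations br \<or> excluded_equations br"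
proof -
  have dm: "dim (UNIV :: 'a set) = 6" using d6 by (simp add: dim_UNIV)
  have C3: "C (Suc (Suc 1)) = {0}" by (rule C_dim_Suc_0[OF d2])
  obtain S where "finite S" and cS: "card S = dim (C 1) - dim (C (Suc 1))" and S2: "S \<subseteq> C 1"
    and S3: "C 1 \<subseteq> span (S \<union> C (Suc 1))"
    using complement_exists[OF C_subspace C_subspace C_decreasing[of 1]] by blast
  have S: "card S = 1" "S \<subseteq> C 1" "C 1 \<subseteq> span (S \<union> C (Suc 1))" using cS d1 d2 S2 S3 by simp_all
  then obtain P0 where P0: "S = {P0}" by (auto simp: card_1_singleton_iff)
  have P01: "P0 \<in> C 1" using S(2) P0 by simp
  have "\<exists>x. br x P0 \<noteq> 0"
  proof (rule ccontr)
    assume "\<nexists>x. br x P0 \<noteq> 0"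
    then have "{br s t | s t. s \<in> UNIV \<and> t \<in> S} \<union> C (Suc (Suc 1)) \<subseteq> {0}" using P0 C3 by auto
    moreover have "UNIV \<subseteq> span (UNIV \<union> C 1)" by (simp add: span_superset)
    ultimately have "C (Suc 1) \<subseteq> span {0}"
      using C_generate[of UNIV 1 S] S(3) span_mono by blast
    then have "C (Suc 1) \<subseteq> {0}" by simp
    then show False using d2 dim_eq_0[of "C (Suc 1)"] by simp
  qed
  then obtain x where x: "br x P0 \<noteq> 0" by blast
  define Q0 where "Q0 = br x P0"
  have Q02: "Q0 \<in> C (Suc 1)" unfolding Q0_def by (rule C_Suc[OF P01])
  have Q0n: "Q0 \<noteq> 0" using x by (simp add: Q0_def)
  have C2: "C (Suc 1) \<subseteq> span {Q0}" by (rule C_dim_1[OF d2 Q02 Q0n])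
  have zQ: "br u Q0 = 0" "br Q0 u = 0" for u using C_zero_bracket[OF C3 Q02] by blast+
  have "C 1 \<subseteq> span (S \<union> {Q0} \<union> {})" by (rule span_Un_chain[OF S(3)]) (use C2 in simp)
  then have "C 1 \<subseteq> span {P0, Q0}" by (simp add: P0 insert_commute)
  then have C1: "\<exists>k l. br u v = k *\<^sub>R P0 + l *\<^sub>R Q0" for u v
    using C_1[of u v] span_doubletonE by blast
  have gam: "\<exists>g. br v P0 = g *\<^sub>R Q0" for v
    using C2 C_Suc[OF P01] span_singletonE by blast
  \<comment> \<open>By the Jacobi identity [x, [k, k']] = 0, so [k, k'] has no P0-component.\<close>
  have K: "\<exists>t. br k k' = t *\<^sub>R Q0" if k: "br k P0 = 0" "br k' P0 = 0" for k k'
  proof -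
    obtain p q where pq: "br k k' = p *\<^sub>R P0 + q *\<^sub>R Q0" using C1 by blast
    obtain a b where ab: "br x k = a *\<^sub>R P0 + b *\<^sub>R Q0" using C1 by blast
    obtain c d where cd: "br x k' = c *\<^sub>R P0 + d *\<^sub>R Q0" using C1 by blast
    have "br P0 k' = 0" using k swap[of P0 k'] by simp
    then have "br (br x k) k' = 0" by (simp add: ab expand zQ)
    moreover have "br k (br x k') = 0" using k by (simp add: cd expand zQ)
    ultimately have "br x (br k k') = 0" using jacobi[of x k k'] by simp
    then have "p *\<^sub>R Q0 = 0" by (simp add: pq expand zQ Q0_def[symmetric])
    then show ?thesis using pq x Q0_def by auto
  qed
  \<comment> \<open>Otherwise, after splitting multiples of x off u and v, every bracket [u, v]
    would lie in the line of Q0, and \<open>C 1\<close> would be one-dimensional.\<close>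
  have "\<exists>y. br y P0 = 0 \<and> br x y \<notin> span {Q0}"
  proof (rule ccontr)
    assume "\<nexists>y. br y P0 = 0 \<and> br x y \<notin> span {Q0}"
    then have n: "\<And>y. br y P0 = 0 \<Longrightarrow> \<exists>t. br x y = t *\<^sub>R Q0" using span_singletonE by metis
    have "br u v \<in> span {Q0}" for u v
    proof -
      obtain g where g: "br u P0 = g *\<^sub>R Q0" using gam by blast
      obtain h where h: "br v P0 = h *\<^sub>R Q0" using gam by blast
      have u0: "br (u - g *\<^sub>R x) P0 = 0" and v0: "br (v - h *\<^sub>R x) P0 = 0"
        using g h by (simp_all add: expand Q0_def)
      obtain s where s: "br x (u - g *\<^sub>R x) = s *\<^sub>R Q0" using n[OF u0] by blast
      obtain t where t: "br x (v - h *\<^sub>R x) = t *\<^sub>R Q0" using n[OF v0] by blast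
      obtain r where r: "br (u - g *\<^sub>R x) (v - h *\<^sub>R x) = r *\<^sub>R Q0" using K[OF u0 v0] by blast
      have "br u v = (r - h * s + g * t) *\<^sub>R Q0"
        using r s t swap[of u x] by (simp add: expand algebra_simps)
      then show ?thesis by (simp only:) (intro span_scale span_base, simp)
    qed
    then have "C 1 \<subseteq> span {Q0}" by (intro C_1_zeroI) auto
    then have "dim (C 1) \<le> card {Q0}" by (intro dim_le_card) auto
    then show False using d1 by simp
  qed
  then obtain y where y: "br y P0 = 0" "br x y \<notin> span {Q0}" by blast
  \<comment> \<open>A new generator: it differs from a nonzero multiple of P0 by a multiple of Q0,
    and makes [x, y] = P and [x, P] = Q hold exactly.\<close>
  define P where "P = br x y"
  obtain \<delta> \<tau> where dt: "P = \<delta> *\<^sub>R P0 + \<tau> *\<^sub>R Q0" unfolding P_def using C1 by blast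
  have d0: "\<delta> \<noteq> 0" using y(2) dt span_scale[OF span_base[of Q0 "{Q0}"], of \<tau>] by (auto simp: P_def)
  define Q where "Q = br x P"
  have Qd: "Q = \<delta> *\<^sub>R Q0" by (simp add: Q_def dt expand zQ Q0_def[symmetric])
  have Q0: "Q \<noteq> 0" unfolding Qd using d0 Q0n by simp
  have zQ': "br u Q = 0" "br Q u = 0" for u
    unfolding Qd bilinear_rmul[OF bil] bilinear_lmul[OF bil] zQ by (rule scaleR_zero_right)+
  have kP: "br k P = \<delta> *\<^sub>R br k P0" for k
    unfolding dt bilinear_radd[OF bil] bilinear_rmul[OF bil] zQ by simp
  have KP: "br k P = 0 \<longleftrightarrow> br k P0 = 0" for k unfolding kP using d0 by simp
  have C1': "\<exists>k l. br u v = k *\<^sub>R P + l *\<^sub>R Q" for u v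
  proof -
    obtain k l where "br u v = k *\<^sub>R P0 + l *\<^sub>R Q0" using C1 by blast
    moreover have "(k / \<delta>) *\<^sub>R P = k *\<^sub>R P0 + (k * \<tau> / \<delta>) *\<^sub>R Q0" using d0 by (simp add: dt scaleR_add_right)
    moreover have "((l - k * \<tau> / \<delta>) / \<delta>) *\<^sub>R Q = l *\<^sub>R Q0 - (k * \<tau> / \<delta>) *\<^sub>R Q0"
    proof -
      have "(l - k * \<tau> / \<delta>) / \<delta> * \<delta> = l - k * \<tau> / \<delta>" using d0 by simp
      then show ?thesis unfolding Qd scaleR_scaleR by (simp only: scaleR_diff_left)
    qed
    ultimately have "br u v = (k / \<delta>) *\<^sub>R P + ((l - k * \<tau> / \<delta>) / \<delta>) *\<^sub>R Q" by simp
    then show ?thesis by blast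
  qed
  have K': "\<exists>t. br k k' = t *\<^sub>R Q" if kk: "br k P = 0" "br k' P = 0" for k k'
  proof -
    obtain t where "br k k' = t *\<^sub>R Q0" using K[OF kk[unfolded KP]] by blast
    then have "br k k' = (t / \<delta>) *\<^sub>R Q" unfolding Qd using d0 by simp
    then show ?thesis by blast
  qed
  have gam': "\<exists>g. br v P = g *\<^sub>R Q" for v
  proof -
    obtain g where "br v P0 = g *\<^sub>R Q0" using gam by blast
    then have "br v P = g *\<^sub>R Q" unfolding kP Qd by simp
    then show ?thesis by blast
  qed
  have yP: "br y P = 0" using y KP by blast
  have "P \<notin> span {Q}"
  proof
    assume "P \<in> span {Q}"
    then obtain k where k: "P = k *\<^sub>R Q" by (rule span_singletonE)
    have "Q = br x P" by (simp add: Q_def)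
    also have "\<dots> = 0" by (subst k) (simp add: expand zQ')
    finally show False using Q0 by simp
  qed
  moreover have "y \<notin> span {P, Q}"
  proof
    assume "y \<in> span {P, Q}"
    then obtain k l where k: "y = k *\<^sub>R P + l *\<^sub>R Q" by (rule span_doubletonE)
    have "P = br x y" by (simp add: P_def)
    also have "\<dots> = k *\<^sub>R Q" by (subst k) (simp add: expand zQ' Q_def[symmetric])
    finally have "P \<in> span {Q}" by (simp only:) (intro span_scale span_base, simp)
    then show False using \<open>P \<notin> span {Q}\<close> by simp
  qed
  moreover have "x \<notin> span {y, P, Q}"
  proof
    assume "x \<in> span {y, P, Q}"
    then obtain m where "x - m *\<^sub>R y \<in> span {P, Q}" by (auto simp: span_breakdown_eq[of _ y])
    then obtain k l where "x - m *\<^sub>R y = k *\<^sub>R P + l *\<^sub>R Q" by (rule span_doubletonE)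
    then have k: "x = m *\<^sub>R y + k *\<^sub>R P + l *\<^sub>R Q" by (simp add: algebra_simps)
    have "Q = br x P" by (simp add: Q_def)
    also have "\<dots> = 0" by (subst k) (simp add: expand zQ' yP)
    finally show False using Q0 by simp
  qed
  ultimately have "dim {x, y, P, Q} = 4" using Q0 by (simp add: dim_insert)
  then have "dim (span {x, y, P, Q}) = 4" by (simp add: dim_span)
  then obtain S where S: "card S = 2" "UNIV \<subseteq> span (S \<union> span {x, y, P, Q})"
    using complement_exists[OF subspace_span subspace_UNIV, of "{x, y, P, Q}"] dm by auto
  then obtain z0 w0 where zw0: "S = {z0, w0}" by (auto simp: card_2_iff)
  \<comment> \<open>The multiple of x restores commutation with P; the multiples of y and P cancel
    the two components of [x, v].\<close>
  have adj: "\<exists>g d s. br x (v - g *\<^sub>R x - d *\<^sub>R y - s *\<^sub>R P) = 0 \<and> br (v - g *\<^sub>R x - d *\<^sub>R y - s *\<^sub>R P) P = 0" for v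
  proof -
    obtain g where g: "br v P = g *\<^sub>R Q" using gam' by blast
    obtain d s where ds: "br x v = d *\<^sub>R P + s *\<^sub>R Q" using C1' by blast
    have "br x (v - g *\<^sub>R x - d *\<^sub>R y - s *\<^sub>R P) = 0 \<and> br (v - g *\<^sub>R x - d *\<^sub>R y - s *\<^sub>R P) P = 0"
      using g ds yP by (simp add: expand P_def[symmetric] Q_def[symmetric])
    then show ?thesis by blast
  qed
  obtain g1 d1 s1 where a1: "br x (z0 - g1 *\<^sub>R x - d1 *\<^sub>R y - s1 *\<^sub>R P) = 0" "br (z0 - g1 *\<^sub>R x - d1 *\<^sub>R y - s1 *\<^sub>R P) P = 0"
    using adj by blast
  obtain g2 d2 s2 where a2: "br x (w0 - g2 *\<^sub>R x - d2 *\<^sub>R y - s2 *\<^sub>R P) = 0" "br (w0 - g2 *\<^sub>R x - d2 *\<^sub>R y - s2 *\<^sub>R P) P = 0"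
    using adj by blast
  define z where "z = z0 - g1 *\<^sub>R x - d1 *\<^sub>R y - s1 *\<^sub>R P"
  define w where "w = w0 - g2 *\<^sub>R x - d2 *\<^sub>R y - s2 *\<^sub>R P"
  have zw: "br x z = 0" "br z P = 0" "br x w = 0" "br w P = 0" using a1 a2 by (simp_all add: z_def w_def)
  have sp0: "span (set [x, y, z0, w0, P, Q]) = UNIV"
    by (rule span_listI[OF S(2)]) (auto simp: zw0 span_base intro!: span_mono)
  have sp: "span (set [x, y, z, w, P, Q]) = UNIV"
    by (rule span_change[OF sp0, of _ "[[1,0,0,0,0,0], [0,1,0,0,0,0], [g1,d1,1,0,s1,0], [g2,d2,0,1,s2,0], [0,0,0,0,1,0], [0,0,0,0,0,1]]"])
      (simp add: lc_def z_def w_def)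
  obtain a where a: "br y z = a *\<^sub>R Q" using K' yP zw by blast
  obtain b where b: "br y w = b *\<^sub>R Q" using K' yP zw by blast
  obtain c where c: "br z w = c *\<^sub>R Q" using K' zw by blast
  show ?thesis
  proof (cases "a = 0 \<and> b = 0 \<and> c = 0")
    case True
    have "excluded_411 br x y z w P Q"
      unfolding excluded_411_def using zw a b c True yP zQ' P_def Q_def by simp
    then show ?thesis using excluded_equationsI[OF sp] by blast
  next
    case False
    have "has_half_flat_equations br"
      by (rule case_411[OF dm sp _ zw(1,3) _ zQ'(1) a b yP zQ'(1) c zw(2) zQ'(1) zw(4) zQ'(1) zQ'(1)])
        (use False in \<open>simp_all add: P_def Q_def\<close>)
    then show ?thesis ..
  qed
qed

lemma classify_33:
  assumes d6: "DIM('a) = 6" and d1: "dim (C 1) = 3" and C2: "C (Suc 1) = {0}"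
  shows "has_half_flat_equations br"
proof -
  have dm: "dim (UNIV :: 'a set) = 6" using d6 by (simp add: dim_UNIV)
  obtain S where S: "card S = 3" "UNIV \<subseteq> span (S \<union> C 1)" using generators_exist[OF d6] d1 by auto
  then obtain x y z where xyz: "S = {x, y, z}" by (auto simp: card_3_iff)
  have "C 0 \<subseteq> span (S \<union> C (Suc 0))" using S(2) by simp
  then have "C (Suc 0) \<subseteq> span ({br s t | s t. s \<in> S \<and> t \<in> S} \<union> C (Suc (Suc 0)))" by (rule C_generate[OF S(2)])
  then have C1: "C 1 \<subseteq> span ({br s t | s t. s \<in> S \<and> t \<in> S} \<union> {0})" using C2 by simp
  have sp: "span (set [x, y, z, br x y, br x z, br y z]) = UNIV" (is "span ?T = _")
  proof (rule span_listI[OF S(2)])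
    show "S \<subseteq> span ?T" using xyz by (auto intro: span_base)
    have b: "br x y \<in> span ?T" "br x z \<in> span ?T" "br y z \<in> span ?T" by (rule span_base, simp)+
    have "br y x \<in> span ?T" "br z x \<in> span ?T" "br z y \<in> span ?T"
      unfolding swap[of y x] swap[of z x] swap[of z y] by (intro span_neg b)+
    then have "{br s t | s t. s \<in> S \<and> t \<in> S} \<union> {0} \<subseteq> span ?T"
      using b span_zero unfolding xyz by auto
    then show "C 1 \<subseteq> span ?T" using C1 span_minimal[OF _ subspace_span] by blast
  qed
  show ?thesis
    by (rule case_33[OF dm sp]) (use C_zero_bracket[OF C2 C_1] in blast)
qed

end

section \<open>Quotients of dimensions three, two and one\<close>

context lie_alg
begin

text \<open>With the symmetric form zero, the bracket [y, z] decides between a listed and an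
  excluded algebra; in the latter z is corrected so that x annihilates R.\<close>

lemma table_321_zero:
  assumes dm: "dim (UNIV :: 'a set) = 6" and sp: "span (set [x, y, z, P, R, Q]) = UNIV"
    and t: "br x y = P" "br x z = R" "br y z = c *\<^sub>R Q" "br x P = a *\<^sub>R Q" "br x R = b *\<^sub>R Q"
      "br y P = 0" "br y R = 0" "br z P = 0" "br z R = 0" "br P R = 0"
    and z: "\<And>u. br u Q = 0"
    and nz: "a \<noteq> 0"
  shows "has_half_flat_equations br \<or> excluded_equations br"
proof (cases "c = 0")
  case False
  then show ?thesis using case_321_zero[OF dm sp t z nz] by blast
next
  case True
  define z1 where "z1 = z - (b/a) *\<^sub>R y"
  define R1 where "R1 = R - (b/a) *\<^sub>R P"
  define Q1 where "Q1 = a *\<^sub>R Q"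
  have sp1: "span (set [x, y, z1, P, R1, Q1]) = UNIV"
    by (rule span_change[OF sp, of _ "[[1,0,0,0,0,0], [0,1,0,0,0,0], [0,b/a,1,0,0,0], [0,0,0,1,0,0], [0,0,0,b/a,1,0], [0,0,0,0,0,1/a]]"])
      (use nz in \<open>simp add: lc_def z1_def R1_def Q1_def\<close>)
  have "excluded_321 br x y z1 P R1 Q1"
    unfolding excluded_321_def using True nz by (simp add: z1_def R1_def Q1_def expand t z)
  then show ?thesis using excluded_equationsI[OF sp1] by blast
qed

text \<open>A nonzero symmetric form with entries p, q, r takes a nonzero value on y, on z or on y +
  z, and that vector is moved to the place of y. If the form is zero, x acts nontrivially on P or on
  R.\<close>

lemma table_321:
  assumes dm: "dim (UNIV :: 'a set) = 6" and sp: "span (set [x, y, z, P, R, Q]) = UNIV"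
    and t: "br x y = P" "br x z = R" "br y z = c *\<^sub>R Q" "br x P = a *\<^sub>R Q" "br x R = b *\<^sub>R Q"
      "br y P = p *\<^sub>R Q" "br y R = q *\<^sub>R Q" "br z P = q *\<^sub>R Q" "br z R = r *\<^sub>R Q" "br P R = 0"
    and z: "\<And>u. br u Q = 0"
    and nz: "p \<noteq> 0 \<or> q \<noteq> 0 \<or> r \<noteq> 0 \<or> a \<noteq> 0 \<or> b \<noteq> 0"
  shows "has_half_flat_equations br \<or> excluded_equations br"
proof -
  have zy: "br z y = (- c) *\<^sub>R Q" "br R P = 0" using swap[of z y] swap[of R P] t by simp_all
  have sp': "span (set [x, z, y, R, P, Q]) = UNIV"
    by (rule span_change[OF sp, of _ "[[1,0,0,0,0,0], [0,0,1,0,0,0], [0,1,0,0,0,0], [0,0,0,0,1,0], [0,0,0,1,0,0], [0,0,0,0,0,1]]"])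
      (simp add: lc_def)
  consider "p \<noteq> 0" | "r \<noteq> 0" | "p = 0" "r = 0" "q \<noteq> 0" | "p = 0" "q = 0" "r = 0" "a \<noteq> 0"
    | "p = 0" "q = 0" "r = 0" "b \<noteq> 0" using nz by blast
  then show ?thesis
  proof cases
    case 1
    then show ?thesis using case_321_nonzero[OF dm sp t z] by blast
  next
    case 2
    then show ?thesis using case_321_nonzero[OF dm sp' t(2,1) zy(1) t(5,4,9,8,7,6) zy(2) z] by blast
  next
    case 3
    \<comment> \<open>Polarisation: with p = r = 0 the value of the form on y + z is 2 q.\<close>
    have sp1: "span (set [x, y + z, z, P + R, R, Q]) = UNIV"
      by (rule span_change[OF sp, of _ "[[1,0,0,0,0,0], [0,1,-1,0,0,0], [0,0,1,0,0,0], [0,0,0,1,-1,0], [0,0,0,0,1,0], [0,0,0,0,0,1]]"])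
        (simp add: lc_def)
    have "has_half_flat_equations br"
      by (rule case_321_nonzero[OF dm sp1, of c "a + b" b "p + 2 * q + r" "q + r" r])
        (use 3 in \<open>simp_all add: expand t z scaleR_add_left\<close>, simp add: scaleR_2 flip: scaleR_scaleR)
    then show ?thesis ..
  next
    case 4
    show ?thesis
      by (rule table_321_zero[OF dm sp t(1-5) _ _ _ _ t(10) z 4(4)]) (use 4 t in simp_all)
  next
    case 5
    show ?thesis
      by (rule table_321_zero[OF dm sp' t(2,1) zy(1) t(5,4) _ _ _ _ zy(2) z 5(4)]) (use 5 t in simp_all)
  qed
qed

end

context nilpotent_lie_alg
begin

lemma span_three_generators:
  assumes "UNIV \<subseteq> span ({x, y, z} \<union> C 1)" "x \<in> span ({u, v, w} \<union> C 1)" "y \<in> span ({u, v, w} \<union> C 1)"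
    "z \<in> span ({u, v, w} \<union> C 1)"
  shows "UNIV \<subseteq> span ({u, v, w} \<union> C 1)"
proof -
  have "C 1 \<subseteq> span ({u, v, w} \<union> C 1)" using span_superset[of "{u, v, w} \<union> C 1"] by blast
  then have "{x, y, z} \<union> C 1 \<subseteq> span ({u, v, w} \<union> C 1)" using assms(2-4) by blast
  then show ?thesis using assms(1) span_minimal[OF _ subspace_span] by blast
qed

lemma C_1_generate:
  assumes "UNIV \<subseteq> span ({x, y, z} \<union> C 1)"
  shows "C 1 \<subseteq> span ({br x y, br x z, br y z} \<union> C (Suc 1))"
proof -
  let ?S = "{x, y, z}"
  have "C 0 \<subseteq> span (?S \<union> C (Suc 0))" using assms by simp
  then have 1: "C (Suc 0) \<subseteq> span ({br s t | s t. s \<in> ?S \<and> t \<in> ?S} \<union> C (Suc (Suc 0)))"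
    by (rule C_generate[OF assms])
  let ?W = "span ({br x y, br x z, br y z} \<union> C (Suc (Suc 0)))"
  have b: "br x y \<in> ?W" "br x z \<in> ?W" "br y z \<in> ?W" by (rule span_base, simp)+
  have "br y x \<in> ?W" "br z x \<in> ?W" "br z y \<in> ?W"
    unfolding swap[of y x] swap[of z x] swap[of z y] by (intro span_neg b)+
  then have "{br s t | s t. s \<in> ?S \<and> t \<in> ?S} \<subseteq> ?W" using b span_zero by auto
  moreover have "C (Suc (Suc 0)) \<subseteq> ?W" using span_superset by blast
  ultimately have "{br s t | s t. s \<in> ?S \<and> t \<in> ?S} \<union> C (Suc (Suc 0)) \<subseteq> ?W" by blast
  then have "span ({br s t | s t. s \<in> ?S \<and> t \<in> ?S} \<union> C (Suc (Suc 0))) \<subseteq> span ({br x y, br x z, br y z} \<union> C (Suc (Suc 0)))"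
    by (rule span_minimal[OF _ subspace_span])
  then show ?thesis using 1 by simp
qed

lemma C_nonzero_element:
  assumes "dim (C n) = 1"
  obtains Q where "Q \<in> C n" "Q \<noteq> 0" "C n \<subseteq> span {Q}" "\<And>u. br u Q = 0" "\<And>u. br Q u = 0"
proof -
  have "C n \<noteq> {0}" using assms dim_C_zero[of n] by linarith
  then obtain Q where Q: "Q \<in> C n" "Q \<noteq> 0" using subspace_0[OF C_subspace[of n]] by blast
  show thesis
    by (rule that[OF Q C_dim_1[OF assms Q]]) (use C_zero_bracket[OF C_dim_Suc_0[OF assms] Q(1)] in blast)+
qed

text \<open>The bracket from bivectors of three generators to the plane \<open>C 1\<close> modulo
  \<open>C 2\<close> has a kernel. Bivectors in dimension three are decomposable, so the kernel
  contains one of the form y \<and> z.\<close>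

lemma classify_321:
  assumes d6: "DIM('a) = 6" and d1: "dim (C 1) = 3" and d2: "dim (C (Suc 1)) = 1"
  shows "has_half_flat_equations br \<or> excluded_equations br"
proof -
  have dm: "dim (UNIV :: 'a set) = 6" using d6 by (simp add: dim_UNIV)
  have C3: "C (Suc (Suc 1)) = {0}" by (rule C_dim_Suc_0[OF d2])
  obtain S where S: "card S = 3" "UNIV \<subseteq> span (S \<union> C 1)" using generators_exist[OF d6] d1 by auto
  then obtain x0 y0 z0 where "S = {x0, y0, z0}" by (auto simp: card_3_iff)
  then have sp0: "UNIV \<subseteq> span ({x0, y0, z0} \<union> C 1)" using S(2) by simp
  \<comment> \<open>The case analysis writes a kernel bivector explicitly as y \<and> z, following
    the first linear dependence among the three brackets.\<close>
  obtain x y z where yz: "br y z \<in> C (Suc 1)" and spx: "UNIV \<subseteq> span ({x, y, z} \<union> C 1)"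
  proof (cases "br y0 z0 \<in> C (Suc 1)")
    case True
    then show thesis using that sp0 by blast
  next
    case n1: False
    show thesis
    proof (cases "br x0 z0 \<in> span (insert (br y0 z0) (C (Suc 1)))")
      case True
      then obtain k where k: "br x0 z0 - k *\<^sub>R br y0 z0 \<in> C (Suc 1)"
        by (rule span_insert_cases[OF _ C_subspace])
      let ?T = "{y0, x0 - k *\<^sub>R y0, z0} \<union> C 1"
      have y: "y0 \<in> span ?T" and z: "z0 \<in> span ?T" and x: "x0 - k *\<^sub>R y0 \<in> span ?T" by (rule span_base, simp)+
      have "(x0 - k *\<^sub>R y0) + k *\<^sub>R y0 \<in> span ?T" by (intro span_add[OF x] span_scale y)
      then have "x0 \<in> span ?T" by simp
      then have "UNIV \<subseteq> span ?T" using span_three_generators[OF sp0] y z by blast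
      moreover have "br (x0 - k *\<^sub>R y0) z0 \<in> C (Suc 1)" using k by (simp add: expand)
      ultimately show thesis using that by blast
    next
      case n2: False
      show thesis
      proof (cases "br x0 y0 \<in> span (insert (br x0 z0) (insert (br y0 z0) (C (Suc 1))))")
        case True
        then obtain k where "br x0 y0 - k *\<^sub>R br x0 z0 \<in> span (insert (br y0 z0) (C (Suc 1)))"
          by (auto simp: span_breakdown_eq[of _ "br x0 z0"])
        then obtain l where kl: "br x0 y0 - k *\<^sub>R br x0 z0 - l *\<^sub>R br y0 z0 \<in> C (Suc 1)"
          by (rule span_insert_cases[OF _ C_subspace])
        let ?T = "{z0, x0 + l *\<^sub>R z0, y0 - k *\<^sub>R z0} \<union> C 1"
        have z: "z0 \<in> span ?T" "x0 + l *\<^sub>R z0 \<in> span ?T" "y0 - k *\<^sub>R z0 \<in> span ?T" by (rule span_base, simp)+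
        have "(x0 + l *\<^sub>R z0) - l *\<^sub>R z0 \<in> span ?T" by (intro span_diff[OF z(2)] span_scale z(1))
        moreover have "(y0 - k *\<^sub>R z0) + k *\<^sub>R z0 \<in> span ?T" by (intro span_add[OF z(3)] span_scale z(1))
        ultimately have "x0 \<in> span ?T" "y0 \<in> span ?T" by simp_all
        then have "UNIV \<subseteq> span ?T" using span_three_generators[OF sp0] z(1) by blast
        moreover have "br (x0 + l *\<^sub>R z0) (y0 - k *\<^sub>R z0) \<in> C (Suc 1)"
          using kl swap[of z0 y0] by (simp add: expand algebra_simps)
        ultimately show thesis using that by blast
      next
        case False
        have "dim (insert (br y0 z0) (C (Suc 1))) = 2"
          using n1 d2 by (simp add: dim_insert_subspace[OF C_subspace])
        then have "dim (insert (br x0 y0) (insert (br x0 z0) (insert (br y0 z0) (C (Suc 1))))) = 4"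
          using n2 False by (simp add: dim_insert)
        moreover have "insert (br x0 y0) (insert (br x0 z0) (insert (br y0 z0) (C (Suc 1)))) \<subseteq> C 1"
          using C_1 C_decreasing[of 1] by blast
        ultimately have "4 \<le> dim (C 1)" by (metis dim_subset)
        then show thesis using d1 by simp
      qed
    qed
  qed
  define P where "P = br x y"
  define R where "R = br x z"
  obtain Q where Q: "Q \<in> C (Suc 1)" "Q \<noteq> 0" "C (Suc 1) \<subseteq> span {Q}" "\<And>u. br u Q = 0" "\<And>u. br Q u = 0"
    using C_nonzero_element[OF d2] by blast
  have m: "\<exists>k. v = k *\<^sub>R Q" if "v \<in> C (Suc 1)" for v using Q(3) that span_singletonE by blast
  have PR1: "P \<in> C 1" "R \<in> C 1" using C_1 by (simp_all add: P_def R_def)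
  have C1: "C 1 \<subseteq> span ({P, R, br y z} \<union> C (Suc 1))" using C_1_generate[OF spx] by (simp add: P_def R_def)
  have sp: "span (set [x, y, z, P, R, Q]) = UNIV" (is "span ?T = _")
  proof (rule span_listI[OF spx])
    show "{x, y, z} \<subseteq> span ?T" by (auto intro: span_base)
    have Q': "C (Suc 1) \<subseteq> span ?T" using Q(3) span_mono[of "{Q}" ?T] by auto
    then have "{P, R, br y z} \<union> C (Suc 1) \<subseteq> span ?T" using yz by (auto intro: span_base)
    then show "C 1 \<subseteq> span ?T" using C1 span_minimal[OF _ subspace_span] by blast
  qed
  obtain a where a: "br x P = a *\<^sub>R Q" using m C_Suc[OF PR1(1)] by blast
  obtain b where b: "br x R = b *\<^sub>R Q" using m C_Suc[OF PR1(2)] by blast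
  obtain p where p: "br y P = p *\<^sub>R Q" using m C_Suc[OF PR1(1)] by blast
  obtain q where q: "br y R = q *\<^sub>R Q" using m C_Suc[OF PR1(2)] by blast
  obtain r where r: "br z R = r *\<^sub>R Q" using m C_Suc[OF PR1(2)] by blast
  obtain c where c: "br y z = c *\<^sub>R Q" using m yz by blast
  have PR: "br P R = 0" using C_1_bracket[OF PR1] C3 by simp
  \<comment> \<open>Symmetry of the form (u, v) \<mapsto> [u, [x, v]]: the Jacobi term [x, [y, z]]
    vanishes because [y, z] is central.\<close>
  have "br y R = br (br y x) z + br x (br y z)" unfolding R_def by (rule jacobi)
  also have "\<dots> = br z P" using swap[of y x] swap[of P z] c Q by (simp add: P_def expand)
  finally have zP: "br z P = q *\<^sub>R Q" using q by simp
  have "p \<noteq> 0 \<or> q \<noteq> 0 \<or> r \<noteq> 0 \<or> a \<noteq> 0 \<or> b \<noteq> 0"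
  proof (rule ccontr)
    assume "\<not> ?thesis"
    then have 0: "br s t = 0" if "s \<in> {x, y, z}" "t \<in> {P, R, br y z}" for s t
      using that a b p q r zP c Q(4) by (auto simp: expand)
    have "C (Suc 1) \<subseteq> span ({br s t | s t. s \<in> {x, y, z} \<and> t \<in> {P, R, br y z}} \<union> C (Suc (Suc 1)))"
      by (rule C_generate[OF spx C1])
    also have "\<dots> \<subseteq> span {0}" by (rule span_mono) (use 0 C3 in auto)
    finally show False using Q(1,2) by auto
  qed
  then show ?thesis
    by (intro table_321[OF dm sp _ _ c a b p q zP r PR Q(4)]) (simp_all add: P_def R_def)
qed

text \<open>Modulo \<open>C 2\<close> the bracket is a skew form in three variables with values in a
  line, so it has a radical vector z. The dimension of \<open>C 3\<close> is 0 or 1; the first case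
  is excluded, the second is listed.\<close>

lemma classify_31:
  assumes d6: "DIM('a) = 6" and d1: "dim (C 1) = 3" and d2: "dim (C (Suc 1)) = 2"
  shows "has_half_flat_equations br \<or> excluded_equations br"
proof -
  have dm: "dim (UNIV :: 'a set) = 6" using d6 by (simp add: dim_UNIV)
  obtain S where S: "card S = 3" "UNIV \<subseteq> span (S \<union> C 1)" using generators_exist[OF d6] d1 by auto
  then obtain x0 y0 z0 where "S = {x0, y0, z0}" by (auto simp: card_3_iff)
  then have sp0: "UNIV \<subseteq> span ({x0, y0, z0} \<union> C 1)" using S(2) by simp
  have "\<exists>x y z. br x y \<notin> C (Suc 1) \<and> UNIV \<subseteq> span ({x, y, z} \<union> C 1)"
  proof (rule ccontr)
    assume n: "\<not> ?thesis"
    have "{x0, z0, y0} = {x0, y0, z0}" "{y0, z0, x0} = {x0, y0, z0}" by auto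
    then have "br x0 y0 \<in> C (Suc 1)" "br x0 z0 \<in> C (Suc 1)" "br y0 z0 \<in> C (Suc 1)"
      using n sp0 by metis+
    then have "{br x0 y0, br x0 z0, br y0 z0} \<union> C (Suc 1) \<subseteq> C (Suc 1)" by blast
    then have "C 1 \<subseteq> C (Suc 1)"
      using C_1_generate[OF sp0] span_minimal[OF _ C_subspace] by blast
    then have "dim (C 1) \<le> dim (C (Suc 1))" by (rule dim_subset)
    then show False using d1 d2 by simp
  qed
  then obtain x1 y1 z1 where xyz1: "br x1 y1 \<notin> C (Suc 1)" "UNIV \<subseteq> span ({x1, y1, z1} \<union> C 1)" by blast
  have C1': "C 1 \<subseteq> span (insert (br x y) (C (Suc 1)))" if "br x y \<notin> C (Suc 1)" for x y
  proof (rule subspace_subset_dim[OF C_subspace])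
    show "insert (br x y) (C (Suc 1)) \<subseteq> C 1" using C_1 C_decreasing[of 1] by blast
    show "dim (C 1) \<le> dim (insert (br x y) (C (Suc 1)))"
      using dim_insert_subspace[OF C_subspace that] d1 d2 by simp
  qed
  have cf: "\<exists>k. br u v - k *\<^sub>R br x1 y1 \<in> C (Suc 1)" for u v
    using C1'[OF xyz1(1)] C_1[of u v] span_insert_cases[OF _ C_subspace] by blast
  obtain q where q: "br x1 z1 - q *\<^sub>R br x1 y1 \<in> C (Suc 1)" using cf by blast
  obtain r where r: "br y1 z1 - r *\<^sub>R br x1 y1 \<in> C (Suc 1)" using cf by blast
  \<comment> \<open>Moves z1 into the radical of the skew form modulo \<open>C 2\<close>, where x1,
    y1 is a hyperbolic pair.\<close>
  define z2 where "z2 = z1 - q *\<^sub>R y1 + r *\<^sub>R x1"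
  have z2: "br x1 z2 \<in> C (Suc 1)" "br y1 z2 \<in> C (Suc 1)"
    using q r swap[of y1 x1] by (simp_all add: z2_def expand)
  have sp2: "UNIV \<subseteq> span ({x1, y1, z2} \<union> C 1)"
  proof -
    let ?T = "{x1, y1, z2} \<union> C 1"
    have b: "x1 \<in> span ?T" "y1 \<in> span ?T" "z2 \<in> span ?T" by (auto intro: span_base)
    have "z2 + q *\<^sub>R y1 - r *\<^sub>R x1 \<in> span ?T" by (intro span_add span_diff span_scale b)
    then have "z1 \<in> span ?T" by (simp add: z2_def)
    then show ?thesis using span_three_generators[OF xyz1(2)] b by blast
  qed
  \<comment> \<open>For z in the radical the Jacobi identity puts [z, [x, y]] into
    \<open>C 3\<close>, so only x and y contribute to \<open>C 2\<close> modulo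
    \<open>C 3\<close>.\<close>
  have C2: "C (Suc 1) \<subseteq> span ({br x (br x y), br y (br x y)} \<union> C (Suc (Suc 1)))"
    and zP: "br z (br x y) \<in> C (Suc (Suc 1))"
    if "br x y \<notin> C (Suc 1)" "br x z \<in> C (Suc 1)" "br y z \<in> C (Suc 1)" "UNIV \<subseteq> span ({x, y, z} \<union> C 1)" for x y z
  proof -
    have "br z (br x y) = br (br z x) y + br x (br z y)" by (rule jacobi)
    also have "\<dots> = br y (br x z) - br x (br y z)" using swap[of z x] swap[of z y] swap[of "br x z" y] by (simp add: expand)
    also have "\<dots> \<in> C (Suc (Suc 1))" using that C_Suc by (intro subspace_diff C_subspace) blast+
    finally show zP: "br z (br x y) \<in> C (Suc (Suc 1))" .
    have "C 1 \<subseteq> span ({br x y} \<union> C (Suc 1))" using C1'[OF that(1)] by simp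
    then have "C (Suc 1) \<subseteq> span ({br s t | s t. s \<in> {x, y, z} \<and> t \<in> {br x y}} \<union> C (Suc (Suc 1)))"
      by (rule C_generate[OF that(4)])
    moreover have "{br s t | s t. s \<in> {x, y, z} \<and> t \<in> {br x y}} \<union> C (Suc (Suc 1))
        \<subseteq> span ({br x (br x y), br y (br x y)} \<union> C (Suc (Suc 1)))"
      using zP by (auto intro: span_base)
    ultimately show "C (Suc 1) \<subseteq> span ({br x (br x y), br y (br x y)} \<union> C (Suc (Suc 1)))"
      using span_minimal[OF _ subspace_span] by blast
  qed
  have "C (Suc 1) \<noteq> {0}" using d2 dim_C_zero[of "Suc 1"] by linarith
  then have "dim (C (Suc (Suc 1))) < 2" using dim_C_less[of "Suc 1"] d2 by simp
  then consider "dim (C (Suc (Suc 1))) = 0" | "dim (C (Suc (Suc 1))) = 1" by linarith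
  then show ?thesis
  proof cases
    case 1
    then have C3: "C (Suc (Suc 1)) = {0}" using dim_C_zero by blast
    define P where "P = br x1 y1"
    define A where "A = br x1 P"
    define B where "B = br y1 P"
    have "C (Suc 1) \<subseteq> span ({A, B} \<union> {0})" using C2[OF xyz1(1) z2 sp2] unfolding C3 A_def B_def P_def .
    also have "{A, B} \<union> {0} = insert 0 {A, B}" by auto
    also have "span (insert 0 {A, B}) = span {A, B}" by (rule span_insert_0)
    finally have C2': "C (Suc 1) \<subseteq> span {A, B}" .
    have P1: "P \<in> C 1" using C_1 by (simp add: P_def)
    have AB: "A \<in> C (Suc 1)" "B \<in> C (Suc 1)" using C_Suc[OF P1] by (simp_all add: A_def B_def)
    have c: "br u A = 0" "br u B = 0" for u using C_zero_bracket[OF C3] AB by blast+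
    have sp: "span (set [x1, y1, z2, P, A, B]) = UNIV" (is "span ?T = _")
    proof (rule span_listI[OF sp2])
      show "{x1, y1, z2} \<subseteq> span ?T" by (auto intro: span_base)
      have "C (Suc 1) \<subseteq> span ?T" using C2' span_mono[of "{A, B}" ?T] by auto
      then have "insert (br x1 y1) (C (Suc 1)) \<subseteq> span ?T" by (auto intro: span_base simp: P_def)
      then show "C 1 \<subseteq> span ?T" using C1'[OF xyz1(1)] span_minimal[OF _ subspace_span] by blast
    qed
    have "br z2 P = 0" using zP[OF xyz1(1) z2 sp2] C3 by (simp add: P_def)
    moreover have "\<exists>a b. br x1 z2 = a *\<^sub>R A + b *\<^sub>R B" "\<exists>a b. br y1 z2 = a *\<^sub>R A + b *\<^sub>R B"
      using C2' z2 span_doubletonE by blast+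
    ultimately have "excluded_312 br x1 y1 z2 P A B"
      unfolding excluded_312_def using c by (simp add: P_def A_def B_def)
    then show ?thesis using excluded_equationsI[OF sp] by blast
  next
    case d3: 2
    have C4: "C (Suc (Suc (Suc 1))) = {0}" by (rule C_dim_Suc_0[OF d3])
    \<comment> \<open>Bracketing with P maps the plane of x, y to \<open>C 2\<close> modulo
      \<open>C 3\<close>, which is a line; y is taken from the kernel.\<close>
    have "\<exists>x y. br x y \<notin> C (Suc 1) \<and> br x z2 \<in> C (Suc 1) \<and> br y z2 \<in> C (Suc 1) \<and> UNIV \<subseteq> span ({x, y, z2} \<union> C 1)
        \<and> br y (br x y) \<in> C (Suc (Suc 1))"
    proof (cases "br y1 (br x1 y1) \<in> C (Suc (Suc 1))")
      case True
      then show ?thesis using xyz1(1) z2 sp2 by blast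
    next
      case False
      let ?P = "br x1 y1"
      have "C (Suc 1) \<subseteq> span (insert (br y1 ?P) (C (Suc (Suc 1))))"
      proof (rule subspace_subset_dim[OF C_subspace])
        show "insert (br y1 ?P) (C (Suc (Suc 1))) \<subseteq> C (Suc 1)" using C_Suc[OF C_1] C_decreasing[of "Suc 1"] by blast
        show "dim (C (Suc 1)) \<le> dim (insert (br y1 ?P) (C (Suc (Suc 1))))"
          using dim_insert_subspace[OF C_subspace False] d2 d3 by simp
      qed
      then have "br x1 ?P \<in> span (insert (br y1 ?P) (C (Suc (Suc 1))))" using C_Suc[OF C_1] by blast
      then obtain k where k: "br x1 ?P - k *\<^sub>R br y1 ?P \<in> C (Suc (Suc 1))"
        by (rule span_insert_cases[OF _ C_subspace])
      \<comment> \<open>The sign is chosen so that [y1, y] is the same P.\<close>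
      define y where "y = k *\<^sub>R y1 - x1"
      have e: "br y1 y = ?P" using swap[of y1 x1] by (simp add: y_def expand)
      have "- (br x1 ?P - k *\<^sub>R br y1 ?P) \<in> C (Suc (Suc 1))" using k by (intro subspace_neg C_subspace)
      then have "br y (br y1 y) \<in> C (Suc (Suc 1))" unfolding e by (simp add: y_def expand)
      moreover have "br y z2 \<in> C (Suc 1)"
        using z2 by (simp add: y_def expand subspace_diff[OF C_subspace] subspace_scale[OF C_subspace])
      moreover have "UNIV \<subseteq> span ({y1, y, z2} \<union> C 1)"
      proof -
        let ?T = "{y1, y, z2} \<union> C 1"
        have b: "y1 \<in> span ?T" "y \<in> span ?T" "z2 \<in> span ?T" by (auto intro: span_base)
        have "k *\<^sub>R y1 - y \<in> span ?T" by (intro span_diff span_scale b)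
        then have "x1 \<in> span ?T" by (simp add: y_def)
        then show ?thesis using span_three_generators[OF sp2] b by blast
      qed
      moreover have "br y1 y \<notin> C (Suc 1)" using xyz1(1) e by simp
      ultimately show ?thesis using z2(2) by blast
    qed
    then obtain x y where xy: "br x y \<notin> C (Suc 1)" "br x z2 \<in> C (Suc 1)" "br y z2 \<in> C (Suc 1)"
      "UNIV \<subseteq> span ({x, y, z2} \<union> C 1)" "br y (br x y) \<in> C (Suc (Suc 1))" by blast
    define P where "P = br x y"
    define A where "A = br x P"
    define B where "B = br x A"
    have P1: "P \<in> C 1" using C_1 by (simp add: P_def)
    have A2: "A \<in> C (Suc 1)" using C_Suc[OF P1] by (simp add: A_def)
    have B3: "B \<in> C (Suc (Suc 1))" using C_Suc[OF A2] by (simp add: B_def)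
    have c3: "br u v = 0" "br v u = 0" if "v \<in> C (Suc (Suc 1))" for u v using C_zero_bracket[OF C4 that] by blast+
    have c12: "br u v = 0" "br v u = 0" if "u \<in> C 1" "v \<in> C (Suc 1)" for u v
      using C_1_bracket[OF that] C4 swap[of v u] by simp_all
    have yP3: "br y P \<in> C (Suc (Suc 1))" using xy(5) by (simp add: P_def)
    have zP3: "br z2 P \<in> C (Suc (Suc 1))" using zP[OF xy(1-4)] by (simp add: P_def)
    have yA: "br y A = 0"
    proof -
      have "br y A = br (br y x) P + br x (br y P)" unfolding A_def by (rule jacobi)
      then show ?thesis using swap[of y x] c3(1)[OF yP3] by (simp add: P_def[symmetric] expand)
    qed
    have zA: "br z2 A = 0"
    proof -
      have "br z2 A = br (br z2 x) P + br x (br z2 P)" unfolding A_def by (rule jacobi)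
      moreover have "br (br x z2) P = 0" using c12[OF P1 xy(2)] by simp
      ultimately show ?thesis using swap[of z2 x] c3(1)[OF zP3] by (simp add: expand)
    qed
    have C2': "C (Suc 1) \<subseteq> span ({A} \<union> C (Suc (Suc 1)))"
    proof -
      have "{br x (br x y), br y (br x y)} \<union> C (Suc (Suc 1)) \<subseteq> span ({A} \<union> C (Suc (Suc 1)))"
        using xy(5) by (auto intro: span_base simp: A_def P_def)
      then show ?thesis using C2[OF xy(1-4)] span_minimal[OF _ subspace_span] by blast
    qed
    have "C (Suc (Suc 1)) \<subseteq> span ({br s t | s t. s \<in> {x, y, z2} \<and> t \<in> {A}} \<union> C (Suc (Suc (Suc 1))))"
      by (rule C_generate[OF xy(4) C2'])
    also have "\<dots> \<subseteq> span {B, 0}" by (rule span_mono) (use yA zA C4 in \<open>auto simp: B_def\<close>)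
    also have "{B, 0} = insert 0 {B}" by auto
    also have "span (insert 0 {B}) = span {B}" by (rule span_insert_0)
    finally have C3': "C (Suc (Suc 1)) \<subseteq> span {B}" .
    have m3: "\<exists>k. v = k *\<^sub>R B" if "v \<in> C (Suc (Suc 1))" for v using C3' that span_singletonE by blast
    have m2: "\<exists>k l. v = k *\<^sub>R A + l *\<^sub>R B" if v: "v \<in> C (Suc 1)" for v
    proof -
      have "v \<in> span (insert A (C (Suc (Suc 1))))" using C2' v by auto
      then obtain k where "v - k *\<^sub>R A \<in> C (Suc (Suc 1))" by (rule span_insert_cases[OF _ C_subspace])
      then obtain l where "v - k *\<^sub>R A = l *\<^sub>R B" using m3 by blast
      then have "v = k *\<^sub>R A + l *\<^sub>R B" by (simp add: algebra_simps)
      then show ?thesis by blast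
    qed
    obtain a b where ab: "br x z2 = a *\<^sub>R A + b *\<^sub>R B" using m2[OF xy(2)] by blast
    \<comment> \<open>Subtracting preimages P and A of A and B under x makes z commute with
      x.\<close>
    define z where "z = z2 - a *\<^sub>R P - b *\<^sub>R A"
    have xz: "br x z = 0" by (simp add: z_def expand ab A_def[symmetric] B_def[symmetric])
    obtain s where s: "br y P = s *\<^sub>R B" using m3[OF yP3] by blast
    have "br y z \<in> C (Suc 1)"
      using xy(3) C_Suc[OF P1, of y] yA by (simp add: z_def expand subspace_diff[OF C_subspace] subspace_scale[OF C_subspace])
    then obtain c e where ce: "br y z = c *\<^sub>R A + e *\<^sub>R B" using m2 by blast
    have "br z P = br (br z x) y + br x (br z y)" unfolding P_def by (rule jacobi)
    then have zP': "br z P = - c *\<^sub>R B"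
      using swap[of z x] xz swap[of z y] ce c3(1)[OF B3] by (simp add: expand B_def[symmetric])
    have PA: "br P A = 0" using c12[OF P1 A2] by simp
    have zA': "br z A = 0" using zA PA by (simp add: z_def expand)
    have sp: "span (set [x, y, z, P, A, B]) = UNIV" (is "span ?T = _")
    proof (rule span_listI[OF xy(4)])
      have b: "x \<in> span ?T" "y \<in> span ?T" "z \<in> span ?T" "P \<in> span ?T" "A \<in> span ?T" "B \<in> span ?T" by (auto intro: span_base)
      have "z + a *\<^sub>R P + b *\<^sub>R A \<in> span ?T" by (intro span_add span_scale b)
      then have "z2 \<in> span ?T" by (simp add: z_def)
      then show "{x, y, z2} \<subseteq> span ?T" using b by blast
      have 3: "C (Suc (Suc 1)) \<subseteq> span ?T" using C3' span_mono[of "{B}" ?T] by auto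
      then have "{A} \<union> C (Suc (Suc 1)) \<subseteq> span ?T" using b by blast
      then have "C (Suc 1) \<subseteq> span ?T" using C2' span_minimal[OF _ subspace_span] by blast
      then have "insert (br x y) (C (Suc 1)) \<subseteq> span ?T" using b(4) by (simp add: P_def)
      then show "C 1 \<subseteq> span ?T" using C1'[OF xy(1)] span_minimal[OF _ subspace_span] by blast
    qed
    have "has_half_flat_equations br"
      by (rule case_3111[OF dm sp _ xz _ _ ce s yA zP' zA' PA]) (simp_all add: P_def A_def B_def c3(1)[OF B3[unfolded B_def A_def P_def]])
    then show ?thesis ..
  qed
qed

section \<open>Two generators\<close>

lemma C_generate_two:
  assumes "UNIV \<subseteq> span ({x, y} \<union> C 1)"
  shows "C 1 \<subseteq> span ({br x y} \<union> C (Suc 1))"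
    and "C (Suc 1) \<subseteq> span ({br x (br x y), br y (br x y)} \<union> C (Suc (Suc 1)))"
proof -
  let ?W = "span ({br x y} \<union> C (Suc (Suc 0)))"
  have b: "br x y \<in> ?W" by (rule span_base, simp)
  then have "br y x \<in> ?W" unfolding swap[of y x] by (rule span_neg)
  then have st: "br s t \<in> ?W" if "s \<in> {x, y}" "t \<in> {x, y}" for s t
    using that b span_zero[of "{br x y} \<union> C (Suc (Suc 0))"] by (elim insertE emptyE) simp_all
  have "C 0 \<subseteq> span ({x, y} \<union> C (Suc 0))" using assms by simp
  then have "C (Suc 0) \<subseteq> span ({br s t | s t. s \<in> {x, y} \<and> t \<in> {x, y}} \<union> C (Suc (Suc 0)))"
    by (rule C_generate[OF assms])
  also have "\<dots> \<subseteq> ?W"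
  proof (rule span_minimal[OF _ subspace_span])
    show "{br s t | s t. s \<in> {x, y} \<and> t \<in> {x, y}} \<union> C (Suc (Suc 0)) \<subseteq> ?W"
      using st span_superset[of "{br x y} \<union> C (Suc (Suc 0))"] by blast
  qed
  finally show 1: "C 1 \<subseteq> span ({br x y} \<union> C (Suc 1))" by simp
  have "{br s t | s t. s \<in> {x, y} \<and> t \<in> {br x y}} = {br x (br x y), br y (br x y)}" by blast
  then show "C (Suc 1) \<subseteq> span ({br x (br x y), br y (br x y)} \<union> C (Suc (Suc 1)))"
    using C_generate[OF assms 1] by simp
qed

text \<open>With two generators \<open>C 1\<close> modulo \<open>C 2\<close> is spanned by one
  bracket and \<open>C 2\<close> modulo \<open>C 3\<close> by two, which forces dimension 3 for
  \<open>C 2\<close> and leaves 1 or 2 for \<open>C 3\<close>.\<close>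

lemma classify_2:
  assumes d6: "DIM('a) = 6" and d1: "dim (C 1) = 4"
  shows "has_half_flat_equations br \<or> excluded_equations br"
proof -
  have dm: "dim (UNIV :: 'a set) = 6" using d6 by (simp add: dim_UNIV)
  obtain S where S: "card S = 2" "UNIV \<subseteq> span (S \<union> C 1)" using generators_exist[OF d6] d1 by auto
  then obtain x0 y0 where "S = {x0, y0}" by (auto simp: card_2_iff)
  then have sp0: "UNIV \<subseteq> span ({x0, y0} \<union> C 1)" using S(2) by simp
  have nz: "C n \<noteq> {0}" if "dim (C n) \<noteq> 0" for n using that dim_C_zero[of n] by linarith
  have "dim (C 1) \<le> card {br x0 y0} + dim (C (Suc 1))"
    by (rule dim_span_Un[OF _ C_generate_two(1)[OF sp0] C_subspace]) simp
  moreover have "dim (C (Suc 1)) < dim (C 1)" by (rule dim_C_less[OF nz]) (use d1 in linarith)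
  ultimately have d2: "dim (C (Suc 1)) = 3" using d1 by simp
  have "dim (C (Suc 1)) \<le> card {br x0 (br x0 y0), br y0 (br x0 y0)} + dim (C (Suc (Suc 1)))"
    by (rule dim_span_Un[OF _ C_generate_two(2)[OF sp0] C_subspace]) simp
  moreover have "card {br x0 (br x0 y0), br y0 (br x0 y0)} \<le> 2" by (simp add: card_insert_if)
  moreover have "dim (C (Suc (Suc 1))) < dim (C (Suc 1))" by (rule dim_C_less[OF nz]) (use d2 in linarith)
  ultimately have "dim (C (Suc (Suc 1))) = 1 \<or> dim (C (Suc (Suc 1))) = 2"
    using d2 by linarith
  then consider "dim (C (Suc (Suc 1))) = 1" | "dim (C (Suc (Suc 1))) = 2" by blast
  then show ?thesis
  proof cases
    case d3: 1
    have C4: "C (Suc (Suc (Suc 1))) = {0}" by (rule C_dim_Suc_0[OF d3])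
    \<comment> \<open>[x, y] commutes with itself, so the two operators commute on it; this is the
      symmetry of the form (u, v) \<mapsto> [u, [v, P]].\<close>
    have sym: "br x (br y (br x y)) = br y (br x (br x y))" for x y
      using jacobi[of x y "br x y"] by simp
    \<comment> \<open>Polarisation: the pairs (x0, y0), (y0, - x0) and (x0 + y0, y0) have the same
      bracket P, so otherwise the symmetric form would vanish on x0, y0 and x0 + y0, hence
      everywhere, and \<open>C 3\<close> would be zero.\<close>
    have "\<exists>x y. UNIV \<subseteq> span ({x, y} \<union> C 1) \<and> br x (br x (br x y)) \<noteq> 0"
    proof (rule ccontr)
      assume n: "\<not> ?thesis"
      define P where "P = br x0 y0"
      have 1: "br x0 (br x0 P) = 0" using n sp0 by (simp add: P_def)
      have "UNIV \<subseteq> span ({y0, - x0} \<union> C 1)"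
      proof -
        let ?T = "{y0, - x0} \<union> C 1"
        have "y0 \<in> span ?T" "- x0 \<in> span ?T" "C 1 \<subseteq> span ?T" using span_superset[of ?T] by auto
        then have "{x0, y0} \<union> C 1 \<subseteq> span ?T" using span_neg[of "- x0" ?T] by auto
        then show ?thesis using sp0 span_minimal[OF _ subspace_span] by blast
      qed
      then have "br y0 (br y0 (br y0 (- x0))) = 0" using n by blast
      then have 2: "br y0 (br y0 P) = 0" using swap[of y0 x0] by (simp add: P_def expand)
      have "UNIV \<subseteq> span ({x0 + y0, y0} \<union> C 1)"
      proof -
        let ?T = "{x0 + y0, y0} \<union> C 1"
        have b: "y0 \<in> span ?T" "x0 + y0 \<in> span ?T" "C 1 \<subseteq> span ?T" using span_superset[of ?T] by auto
        have "(x0 + y0) - y0 \<in> span ?T" by (intro span_diff b)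
        then have "{x0, y0} \<union> C 1 \<subseteq> span ?T" using b by auto
        then show ?thesis using sp0 span_minimal[OF _ subspace_span] by blast
      qed
      then have "br (x0 + y0) (br (x0 + y0) (br (x0 + y0) y0)) = 0" using n by blast
      then have "br x0 (br y0 P) + br y0 (br x0 P) = 0" using 1 2 by (simp add: P_def expand add.commute)
      then have "2 *\<^sub>R br x0 (br y0 P) = 0" using sym[of x0 y0] by (simp add: P_def scaleR_2)
      then have 3: "br x0 (br y0 P) = 0" "br y0 (br x0 P) = 0" using sym[of x0 y0] by (simp_all add: P_def)
      have st: "br s t = 0" if "s \<in> {x0, y0}" "t \<in> {br x0 (br x0 y0), br y0 (br x0 y0)}" for s t
        using that 1 2 3 by (elim insertE emptyE) (simp_all add: P_def)
      have "C (Suc (Suc 1)) \<subseteq> span ({br s t | s t. s \<in> {x0, y0} \<and> t \<in> {br x0 (br x0 y0), br y0 (br x0 y0)}} \<union> C (Suc (Suc (Suc 1))))"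
        by (rule C_generate[OF sp0 C_generate_two(2)[OF sp0]])
      also have "\<dots> \<subseteq> span {0}" by (rule span_mono) (use st C4 in blast)
      finally have "C (Suc (Suc 1)) \<subseteq> {0}" by simp
      then show False using d3 dim_eq_0[of "C (Suc (Suc 1))"] by simp
    qed
    then obtain x y where spx: "UNIV \<subseteq> span ({x, y} \<union> C 1)" and ne: "br x (br x (br x y)) \<noteq> 0" by blast
    define P where "P = br x y"
    define A where "A = br x P"
    define B where "B = br y P"
    obtain Q where Q: "Q \<in> C (Suc (Suc 1))" "Q \<noteq> 0" "C (Suc (Suc 1)) \<subseteq> span {Q}" "\<And>u. br u Q = 0" "\<And>u. br Q u = 0"
      using C_nonzero_element[OF d3] by blast
    have P1: "P \<in> C 1" using C_1 by (simp add: P_def)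
    have A2: "A \<in> C (Suc 1)" and B2: "B \<in> C (Suc 1)" using C_Suc[OF P1] by (simp_all add: A_def B_def)
    have A1: "A \<in> C 1" using A2 C_decreasing[of 1] by blast
    have m: "\<exists>k. v = k *\<^sub>R Q" if "v \<in> C (Suc (Suc 1))" for v using Q(3) that span_singletonE by blast
    obtain a where a: "br x A = a *\<^sub>R Q" using m C_Suc[OF A2] by blast
    obtain b where b: "br x B = b *\<^sub>R Q" using m C_Suc[OF B2] by blast
    obtain d where d: "br y B = d *\<^sub>R Q" using m C_Suc[OF B2] by blast
    have yA: "br y A = b *\<^sub>R Q" using b sym[of x y] by (simp add: A_def B_def P_def)
    have z: "br P A = 0" "br P B = 0" "br A B = 0"
      using C_1_bracket[OF P1 A2] C_1_bracket[OF P1 B2] C_1_bracket[OF A1 B2] C4 by auto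
    have sp: "span (set [x, y, P, A, B, Q]) = UNIV" (is "span ?T = _")
    proof (rule span_listI[OF spx])
      have bs: "x \<in> span ?T" "y \<in> span ?T" "P \<in> span ?T" "A \<in> span ?T" "B \<in> span ?T" by (rule span_base, simp)+
      then show "{x, y} \<subseteq> span ?T" by blast
      have "C (Suc (Suc 1)) \<subseteq> span ?T" using Q(3) span_mono[of "{Q}" ?T] by auto
      then have "{br x (br x y), br y (br x y)} \<union> C (Suc (Suc 1)) \<subseteq> span ?T"
        using bs by (simp add: A_def B_def P_def)
      then have "C (Suc 1) \<subseteq> span ?T" using C_generate_two(2)[OF spx] span_minimal[OF _ subspace_span] by blast
      then have "{br x y} \<union> C (Suc 1) \<subseteq> span ?T" using bs(3) by (simp add: P_def)
      then show "C 1 \<subseteq> span ?T" using C_generate_two(1)[OF spx] span_minimal[OF _ subspace_span] by blast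
    qed
    have a0: "a \<noteq> 0" using ne a by (auto simp: A_def P_def)
    have "has_half_flat_equations br"
      by (rule case_2121[OF dm sp _ _ _ a b yA d z Q(4) a0]) (simp_all add: P_def A_def B_def)
    then show ?thesis ..
  next
    case d3: 2
    \<comment> \<open>Since \<open>C 2\<close> modulo \<open>C 3\<close> is a line, some generator y
      maps P into \<open>C 3\<close>; as k y0 - x0 its bracket with y0 is again the old P.\<close>
    have "\<exists>x y. UNIV \<subseteq> span ({x, y} \<union> C 1) \<and> br y (br x y) \<in> C (Suc (Suc 1))"
    proof (cases "br y0 (br x0 y0) \<in> C (Suc (Suc 1))")
      case True
      then show ?thesis using sp0 by blast
    next
      case False
      let ?P = "br x0 y0"
      have "C (Suc 1) \<subseteq> span (insert (br y0 ?P) (C (Suc (Suc 1))))"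
      proof (rule subspace_subset_dim[OF C_subspace])
        show "insert (br y0 ?P) (C (Suc (Suc 1))) \<subseteq> C (Suc 1)" using C_Suc[OF C_1] C_decreasing[of "Suc 1"] by blast
        show "dim (C (Suc 1)) \<le> dim (insert (br y0 ?P) (C (Suc (Suc 1))))"
          using dim_insert_subspace[OF C_subspace False] d2 d3 by simp
      qed
      then have "br x0 ?P \<in> span (insert (br y0 ?P) (C (Suc (Suc 1))))" using C_Suc[OF C_1] by blast
      then obtain k where k: "br x0 ?P - k *\<^sub>R br y0 ?P \<in> C (Suc (Suc 1))"
        by (rule span_insert_cases[OF _ C_subspace])
      define y where "y = k *\<^sub>R y0 - x0"
      have e: "br y0 y = ?P" using swap[of y0 x0] by (simp add: y_def expand)
      have "- (br x0 ?P - k *\<^sub>R br y0 ?P) \<in> C (Suc (Suc 1))" using k by (intro subspace_neg C_subspace)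
      then have "br y (br y0 y) \<in> C (Suc (Suc 1))" unfolding e by (simp add: y_def expand)
      moreover have "UNIV \<subseteq> span ({y0, y} \<union> C 1)"
      proof -
        let ?T = "{y0, y} \<union> C 1"
        have b: "y0 \<in> span ?T" "y \<in> span ?T" "C 1 \<subseteq> span ?T" using span_superset[of ?T] by auto
        have "k *\<^sub>R y0 - y \<in> span ?T" by (intro span_diff span_scale b)
        then have "{x0, y0} \<union> C 1 \<subseteq> span ?T" using b by (simp add: y_def)
        then show ?thesis using sp0 span_minimal[OF _ subspace_span] by blast
      qed
      ultimately show ?thesis by blast
    qed
    then obtain x y where spx: "UNIV \<subseteq> span ({x, y} \<union> C 1)" and yP3: "br y (br x y) \<in> C (Suc (Suc 1))" by blast
    define P where "P = br x y"
    define A where "A = br x P"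
    define B where "B = br x A"
    have P1: "P \<in> C 1" using C_1 by (simp add: P_def)
    have A2: "A \<in> C (Suc 1)" using C_Suc[OF P1] by (simp add: A_def)
    have A1: "A \<in> C 1" using A2 C_decreasing[of 1] by blast
    have B3: "B \<in> C (Suc (Suc 1))" using C_Suc[OF A2] by (simp add: B_def)
    have yA': "br y A = br x (br y P)"
    proof -
      have "br y A = br (br y x) P + br x (br y P)" unfolding A_def by (rule jacobi)
      then show ?thesis using swap[of y x] by (simp add: P_def[symmetric] expand)
    qed
    have yA4: "br y A \<in> C (Suc (Suc (Suc 1)))" unfolding yA' using C_Suc[OF yP3] by (simp add: P_def)
    have C2': "C (Suc 1) \<subseteq> span ({A} \<union> C (Suc (Suc 1)))"
    proof -
      let ?W = "span ({A} \<union> C (Suc (Suc 1)))"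
      have "A \<in> ?W" "C (Suc (Suc 1)) \<subseteq> ?W" using span_superset[of "{A} \<union> C (Suc (Suc 1))"] by auto
      then have "{br x (br x y), br y (br x y)} \<union> C (Suc (Suc 1)) \<subseteq> ?W" using yP3 by (auto simp: A_def P_def)
      then show ?thesis using C_generate_two(2)[OF spx] span_minimal[OF _ subspace_span] by blast
    qed
    have C3': "C (Suc (Suc 1)) \<subseteq> span ({B} \<union> C (Suc (Suc (Suc 1))))"
    proof -
      let ?W = "span ({B} \<union> C (Suc (Suc (Suc 1))))"
      have W: "B \<in> ?W" "C (Suc (Suc (Suc 1))) \<subseteq> ?W" using span_superset[of "{B} \<union> C (Suc (Suc (Suc 1)))"] by auto
      have "{br s t | s t. s \<in> {x, y} \<and> t \<in> {A}} = {B, br y A}" by (auto simp: B_def)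
      then have "C (Suc (Suc 1)) \<subseteq> span ({B, br y A} \<union> C (Suc (Suc (Suc 1))))" using C_generate[OF spx C2'] by simp
      moreover have "{B, br y A} \<union> C (Suc (Suc (Suc 1))) \<subseteq> ?W" using W yA4 by blast
      ultimately show ?thesis using span_minimal[OF _ subspace_span] by blast
    qed
    have "dim (C (Suc (Suc 1))) \<le> card {B} + dim (C (Suc (Suc (Suc 1))))"
      by (rule dim_span_Un[OF _ C3' C_subspace]) simp
    moreover have "dim (C (Suc (Suc (Suc 1)))) < dim (C (Suc (Suc 1)))" by (rule dim_C_less[OF nz]) (use d3 in linarith)
    ultimately have d4: "dim (C (Suc (Suc (Suc 1)))) = 1" using d3 by simp
    obtain Q where Q: "Q \<in> C (Suc (Suc (Suc 1)))" "Q \<noteq> 0" "C (Suc (Suc (Suc 1))) \<subseteq> span {Q}" "\<And>u. br u Q = 0" "\<And>u. br Q u = 0"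
      using C_nonzero_element[OF d4] by blast
    have C5: "C (Suc (Suc (Suc (Suc 1)))) = {0}" by (rule C_dim_Suc_0[OF d4])
    have m4: "\<exists>k. v = k *\<^sub>R Q" if "v \<in> C (Suc (Suc (Suc 1)))" for v using Q(3) that span_singletonE by blast
    obtain c where c: "br x B = c *\<^sub>R Q" using m4 C_Suc[OF B3] by blast
    obtain f where f: "br y B = f *\<^sub>R Q" using m4 C_Suc[OF B3] by blast
    obtain b e where be: "br y P = b *\<^sub>R B + e *\<^sub>R Q"
    proof -
      have "br y P \<in> span (insert B (C (Suc (Suc (Suc 1)))))" using C3' yP3 by (auto simp: P_def)
      then obtain k where "br y P - k *\<^sub>R B \<in> C (Suc (Suc (Suc 1)))" by (rule span_insert_cases[OF _ C_subspace])
      then obtain l where "br y P - k *\<^sub>R B = l *\<^sub>R Q" using m4 by blast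
      then have "br y P = k *\<^sub>R B + l *\<^sub>R Q" by (simp add: algebra_simps)
      then show thesis by (rule that)
    qed
    have yA: "br y A = (b * c) *\<^sub>R Q" unfolding yA' be by (simp add: expand c Q)
    \<comment> \<open>[y, A] is central, so the Jacobi identity for x, y, A gives [P, A] + [y, B] =
      0.\<close>
    have PA: "br P A = - f *\<^sub>R Q"
    proof -
      have "br x (br y A) = br (br x y) A + br y (br x A)" by (rule jacobi)
      then show ?thesis by (simp add: yA expand Q P_def[symmetric] B_def[symmetric] f eq_neg_iff_add_eq_0)
    qed
    have z: "br P B = 0" "br A B = 0" using C_1_bracket[OF P1 B3] C_1_bracket[OF A1 B3] C5 by auto
    have cf: "c \<noteq> 0 \<or> f \<noteq> 0"
    proof (rule ccontr)
      assume "\<not> (c \<noteq> 0 \<or> f \<noteq> 0)"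
      then have "br x B = 0" "br y B = 0" using c f by simp_all
      then have "{br s t | s t. s \<in> {x, y} \<and> t \<in> {B}} \<union> C (Suc (Suc (Suc (Suc 1)))) \<subseteq> {0}" using C5 by blast
      then have "C (Suc (Suc (Suc 1))) \<subseteq> span {0}" using C_generate[OF spx C3'] span_mono by blast
      then show False using Q(1,2) by auto
    qed
    have sp: "span (set [x, y, P, A, B, Q]) = UNIV" (is "span ?T = _")
    proof (rule span_listI[OF spx])
      have bs: "x \<in> span ?T" "y \<in> span ?T" "P \<in> span ?T" "A \<in> span ?T" "B \<in> span ?T" by (rule span_base, simp)+
      then show "{x, y} \<subseteq> span ?T" by blast
      have "C (Suc (Suc (Suc 1))) \<subseteq> span ?T" using Q(3) span_mono[of "{Q}" ?T] by auto
      then have "{B} \<union> C (Suc (Suc (Suc 1))) \<subseteq> span ?T" using bs by blast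
      then have "C (Suc (Suc 1)) \<subseteq> span ?T" using C3' span_minimal[OF _ subspace_span] by blast
      then have "{A} \<union> C (Suc (Suc 1)) \<subseteq> span ?T" using bs by blast
      then have "C (Suc 1) \<subseteq> span ?T" using C2' span_minimal[OF _ subspace_span] by blast
      then have "{br x y} \<union> C (Suc 1) \<subseteq> span ?T" using bs(3) by (simp add: P_def)
      then show "C 1 \<subseteq> span ?T" using C_generate_two(1)[OF spx] span_minimal[OF _ subspace_span] by blast
    qed
    show ?thesis
    \<comment> \<open>Exactly f = 0 with b nonzero is on the list; there c is nonzero by
      \<open>cf\<close>.\<close>
    proof (cases "f = 0 \<and> b \<noteq> 0")
      case True
      have "has_half_flat_equations br"
        by (rule case_21111[OF dm sp _ _ _ c be yA _ _ z Q(4)]) (use True cf f PA in \<open>simp_all add: P_def A_def B_def\<close>)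
      then show ?thesis ..
    next
      case False
      then have n: "f \<noteq> 0 \<or> b = 0 \<and> c \<noteq> 0" using cf by blast
      have "\<exists>b c e f. br x B = c *\<^sub>R Q \<and> br y B = f *\<^sub>R Q \<and> br y P = b *\<^sub>R B + e *\<^sub>R Q \<and>
        br y A = (b * c) *\<^sub>R Q \<and> br P A = - f *\<^sub>R Q \<and> (f \<noteq> 0 \<or> b = 0 \<and> c \<noteq> 0)"
        using c f be yA PA n by blast
      then have "excluded_21111 br x y P A B Q"
        unfolding excluded_21111_def using z Q(4) by (simp add: P_def A_def B_def)
      then show ?thesis using excluded_equationsI[OF sp] by blast
    qed
  qed
qed

end

section \<open>Obstructions to closed positive 4-forms\<close>

text \<open>Used for rewriting only at a fixed pair b, a: it puts these two arguments in a chosen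
  order without looping.\<close>

lemma (in alternating4) order:
  "F b a c d = - F a b c d \<and> F c b a d = - F c a b d \<and> F c d b a = - F c d a b"
  by (intro conjI; rule swap12 swap23 swap34)

locale cocalibrated = lie_alg br for br :: "'a::real_vector \<Rightarrow> 'a \<Rightarrow> 'a" +
  fixes \<phi> :: "('a, real) form"
  assumes dim7: "dim (UNIV :: 'a set) = 7"
    and positive: "positive_4form \<phi>"
    and closed: "closed_form br \<phi>"
begin

definition F :: "'a \<Rightarrow> 'a \<Rightarrow> 'a \<Rightarrow> 'a \<Rightarrow> real" where "F a b c d = \<phi> [a, b, c, d]"

sublocale F: alternating4 F
  using positive_4form_alternating4[OF positive] by (simp add: F_def[abs_def])

lemma dF:
  "- F (br a b) c d e + F (br a c) b d e - F (br a d) b c e + F (br a e) b c d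
   - F (br b c) a d e + F (br b d) a c e - F (br b e) a c d
   - F (br c d) a b e + F (br c e) a b d - F (br d e) a b c = 0"
  using closed ce_d_5[of br \<phi> a b c d e] unfolding closed_form_def F_def by simp

lemma nonvanishing:
  assumes "span (set [a, b, p, q, r, s, t]) = UNIV"
    and "F p q r s = 0" "F p q r t = 0" "F p q s t = 0" "F p r s t = 0" "F q r s t = 0"
  shows False
  using positive_4form_nonvanishing'[OF positive _ dim7, of a b p q r s t] assms by (simp add: F_def)

text \<open>The subspace is spanned by z, w, P, Q, v. Since v is central and few brackets are
  nonzero, each component is the single surviving term of the differential on a suitable quintuple
  containing x.\<close>

lemma not_excluded_411:
  assumes sp: "span (set [x, y, z, w, P, Q, v]) = UNIV" and t: "excluded_411 br x y z w P Q"
    and v: "\<And>u. br u v = 0"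
  shows False
proof (rule nonvanishing[of x y z w P Q v])
  note t' = t[unfolded excluded_411_def] swap[of P z] swap[of P w]
  show "F z w P Q = 0" using dF[of x y z w Q] by (simp add: t' v F.expand F.order[of P z] F.order[of P w] F.order[of P Q])
  show "F z w P v = 0" using dF[of x y z w v] by (simp add: t' v F.expand F.order[of P z] F.order[of P w])
  show "F z w Q v = 0" using dF[of x P z w v] by (simp add: t' v F.expand F.order[of Q z] F.order[of Q w])
  show "F z P Q v = 0" using dF[of x y z Q v] by (simp add: t' v F.expand F.order[of P z])
  show "F w P Q v = 0" using dF[of x y w Q v] by (simp add: t' v F.expand F.order[of P w])
  show "span (set [x, y, z, w, P, Q, v]) = UNIV" by (rule sp)
qed

text \<open>The subspace is spanned by z, P, R, Q, v. Only the component on z, P, Q, v is entangled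
  with another value, that on y, R, Q, v, which has to be shown to vanish first.\<close>

lemma not_excluded_321:
  assumes sp: "span (set [x, y, z, P, R, Q, v]) = UNIV" and t: "excluded_321 br x y z P R Q"
    and v: "\<And>u. br u v = 0"
  shows False
proof (rule nonvanishing[of x y z P R Q v])
  note t' = t[unfolded excluded_321_def] v F.expand swap[of P z]
  have 1: "F P R Q v = 0" using dF[of x y R Q v] by (simp add: t')
  have "F y R Q v = 0" using dF[of x y P R v] 1 by (simp add: t' F.order[of Q y] F.order[of Q R])
  then show "F z P Q v = 0" using dF[of x y z Q v] by (simp add: t' F.order[of P z] F.order[of R y])
  show "F P R Q v = 0" by (rule 1)
  show "F z R Q v = 0" using dF[of x P z R v] by (simp add: t' F.order[of Q z] F.order[of Q R])
  show "F z P R v = 0" using dF[of x y z R v] by (simp add: t' F.order[of P z])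
  show "F z P R Q = 0" using dF[of x y z R Q] by (simp add: t' F.order[of P z])
  show "span (set [x, y, z, P, R, Q, v]) = UNIV" by (rule sp)
qed

text \<open>The subspace is spanned by z, P, A, B, v. The values on x, A, B, v and y, A, B, v vanish
  as well, which kills the contributions of the arbitrary brackets [x, z] and [y, z].\<close>

lemma not_excluded_312:
  assumes sp: "span (set [x, y, z, P, A, B, v]) = UNIV" and t: "excluded_312 br x y z P A B"
    and v: "\<And>u. br u v = 0"
  shows False
proof (rule nonvanishing[of x y z P A B v])
  obtain a b c d where ab: "br x z = a *\<^sub>R A + b *\<^sub>R B" "br y z = c *\<^sub>R A + d *\<^sub>R B"
    using t unfolding excluded_312_def by blast
  have t': "br x y = P" "br x P = A" "br y P = B" "br z P = 0" "br x A = 0" "br x B = 0" "br y A = 0" "br y B = 0"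
    "br z A = 0" "br z B = 0" "br P A = 0" "br P B = 0" "br A B = 0"
    using t unfolding excluded_312_def by blast+
  note t' = t' ab v F.expand swap[of P z]
  have 1: "F P A B v = 0" using dF[of x y A B v] by (simp add: t')
  show "F P A B v = 0" by (rule 1)
  have 2: "F x A B v = 0" using dF[of x y P A v] by (simp add: t' F.order[of B x] F.order[of B A])
  have 3: "F y A B v = 0" using dF[of x y P B v] by (simp add: t' F.order[of A y])
  show "F z A B v = 0" using dF[of x z P B v] 1 by (simp add: t' F.order[of A z] F.order[of A P])
  show "F z P A v = 0" using dF[of x y z A v] 2 3 by (simp add: t' F.order[of P z] F.order[of B y] F.order[of B A] F.order[of B x])
  show "F z P B v = 0" using dF[of x y z B v] 2 3 by (simp add: t' F.order[of P z] F.order[of A y] F.order[of A x])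
  show "F z P A B = 0" using dF[of x y z A B] by (simp add: t' F.order[of P z])
  show "span (set [x, y, z, P, A, B, v]) = UNIV" by (rule sp)
qed

text \<open>Closedness gives all components on P, A, B, Q, v except the one on P, A, B, v. If that
  one is nonzero, P is traded for a combination of y and P on which the corresponding value
  vanishes.\<close>

lemma not_excluded_21111:
  assumes sp: "span (set [x, y, P, A, B, Q, v]) = UNIV" and t: "excluded_21111 br x y P A B Q"
    and v: "\<And>u. br u v = 0"
  shows False
proof -
  obtain b c e f where ex: "br x B = c *\<^sub>R Q" "br y B = f *\<^sub>R Q" "br y P = b *\<^sub>R B + e *\<^sub>R Q"
      "br y A = (b * c) *\<^sub>R Q" "br P A = - f *\<^sub>R Q" and nz: "f \<noteq> 0 \<or> b = 0 \<and> c \<noteq> 0"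
    using t unfolding excluded_21111_def by blast
  have t': "br x y = P" "br x P = A" "br x A = B" "br P B = 0" "br A B = 0" "br x Q = 0" "br y Q = 0" "br P Q = 0"
    "br A Q = 0" "br B Q = 0"
    using t unfolding excluded_21111_def by blast+
  note t' = t' ex v F.expand
  have 1: "F A B Q v = 0" using dF[of x P B Q v] by (simp add: t')
  have 2: "F P B Q v = 0" using dF[of x y B Q v] by (simp add: t')
  have 3: "F P A B Q = 0" using dF[of x y A B Q] by (simp add: t')
  have 4: "F y A B Q = 0" using dF[of x y P B Q] by (simp add: t' F.order[of A y])
  have 5: "F P A Q v = - F y B Q v" using dF[of x y A Q v] by (simp add: t' F.order[of B y])
  have 6: "f * F P A Q v = f * F y B Q v"
    using dF[of y P A B v] 1 2
    by (auto simp: t' F.order[of Q A] F.order[of Q B] F.order[of Q P] F.order[of Q y] F.order[of B y] F.order[of A P])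
  have 7: "c * F P A Q v = f * F x B Q v"
    using dF[of x P A B v]
    by (auto simp: t' F.order[of Q A] F.order[of Q B] F.order[of Q P] F.order[of Q x] F.order[of B x])
  \<comment> \<open>For f nonzero, relations 5 and 6 are opposite to each other; for f = 0 the
    parameter c is nonzero and relation 7 gives the claim.\<close>
  have 8: "F P A Q v = 0" using 5 6 7 nz by (cases "f = 0") auto
  then have 9: "F y B Q v = 0" using 5 by simp
  have "b * F x B Q v = 0" using 7 8 nz by auto
  then have 10: "F y A Q v = 0" using dF[of x y P Q v] by (auto simp: t' F.order[of A y] F.order[of B x])
  show False
  proof (cases "F P A B v = 0")
    case True
    show False
      by (rule nonvanishing[of x y P A B Q v]) (use sp 1 2 3 8 True in simp_all)
  next
    case False
    \<comment> \<open>Solves F y A B v + l F P A B v = 0.\<close>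
    define l where "l = - F y A B v / F P A B v"
    define u where "u = y + l *\<^sub>R P"
    show False
    proof (rule nonvanishing[of x P u A B Q v])
      show "span (set [x, P, u, A, B, Q, v]) = UNIV"
        by (rule span_change[OF sp, of _ "[[1,0,0,0,0,0,0], [0,-l,1,0,0,0,0], [0,1,0,0,0,0,0], [0,0,0,1,0,0,0],
              [0,0,0,0,1,0,0], [0,0,0,0,0,1,0], [0,0,0,0,0,0,1]]"])
          (simp add: lc_def u_def)
      show "F u A B v = 0" using False by (simp add: u_def F.expand l_def)
    qed (use 1 2 3 4 8 9 10 in \<open>simp_all add: u_def F.expand\<close>)
  qed
qed

text \<open>The bracket tables are transported along the embedding E of the six-dimensional summand;
  the central v is the seventh basis vector.\<close>

lemma not_excluded_equations:
  assumes ex: "excluded_equations h" and lin: "linear E" and E: "\<And>a b. br (E a) (E b) = E (h a b)"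
    and v: "\<And>u. br u v = 0" and sp: "span (insert v (range E)) = UNIV"
  shows False
proof -
  obtain a b c d e f where ab: "span (set [a, b, c, d, e, f]) = UNIV"
    and t: "excluded_411 h a b c d e f \<or> excluded_321 h a b c d e f \<or> excluded_312 h a b c d e f \<or>
      excluded_21111 h a b c d e f"
    using ex unfolding excluded_equations_def by blast
  have "span (E ` set [a, b, c, d, e, f]) = range E"
    using linear_span_image[OF lin, of "set [a, b, c, d, e, f]"] ab by simp
  then have "range E \<subseteq> span (set [E a, E b, E c, E d, E e, E f, v])" (is "_ \<subseteq> span ?T")
    using span_mono[of "E ` set [a, b, c, d, e, f]" ?T] by auto
  then have "insert v (range E) \<subseteq> span ?T" using span_base[of v ?T] by simp
  then have sp': "span ?T = UNIV" using sp span_minimal[OF _ subspace_span] by blast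
  note l = linear_add[OF lin] linear_scale[OF lin] linear_0[OF lin] linear_neg[OF lin]
  from t show False
  proof (elim disjE)
    assume "excluded_411 h a b c d e f"
    then have "excluded_411 br (E a) (E b) (E c) (E d) (E e) (E f)"
      unfolding excluded_411_def E by (simp add: l)
    then show False using not_excluded_411[OF sp' _ v] by blast
  next
    assume "excluded_321 h a b c d e f"
    then have "excluded_321 br (E a) (E b) (E c) (E d) (E e) (E f)"
      unfolding excluded_321_def E by (simp add: l)
    then show False using not_excluded_321[OF sp' _ v] by blast
  next
    assume *: "excluded_312 h a b c d e f"
    then obtain p q r s where pq: "h a c = p *\<^sub>R e + q *\<^sub>R f" "h b c = r *\<^sub>R e + s *\<^sub>R f"
      unfolding excluded_312_def by blast
    have "\<exists>p q. br (E a) (E c) = p *\<^sub>R E e + q *\<^sub>R E f"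
      by (rule exI[of _ p], rule exI[of _ q]) (simp add: E pq l)
    moreover have "\<exists>p q. br (E b) (E c) = p *\<^sub>R E e + q *\<^sub>R E f"
      by (rule exI[of _ r], rule exI[of _ s]) (simp add: E pq l)
    moreover have "h a b = d" "h a d = e" "h b d = f" "h c d = 0" "h a e = 0" "h a f = 0" "h b e = 0" "h b f = 0"
      "h c e = 0" "h c f = 0" "h d e = 0" "h d f = 0" "h e f = 0"
      using * unfolding excluded_312_def by blast+
    ultimately have "excluded_312 br (E a) (E b) (E c) (E d) (E e) (E f)"
      unfolding excluded_312_def by (simp add: E l)
    then show False using not_excluded_312[OF sp' _ v] by blast
  next
    assume *: "excluded_21111 h a b c d e f"
    then obtain b' c' e' f' where ex: "h a e = c' *\<^sub>R f" "h b e = f' *\<^sub>R f" "h b c = b' *\<^sub>R e + e' *\<^sub>R f"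
      "h b d = (b' * c') *\<^sub>R f" "h c d = - f' *\<^sub>R f" "f' \<noteq> 0 \<or> b' = 0 \<and> c' \<noteq> 0"
      unfolding excluded_21111_def by blast
    have "\<exists>b' c' e' f'. br (E a) (E e) = c' *\<^sub>R E f \<and> br (E b) (E e) = f' *\<^sub>R E f \<and>
       br (E b) (E c) = b' *\<^sub>R E e + e' *\<^sub>R E f \<and> br (E b) (E d) = (b' * c') *\<^sub>R E f \<and>
       br (E c) (E d) = - f' *\<^sub>R E f \<and> (f' \<noteq> 0 \<or> b' = 0 \<and> c' \<noteq> 0)"
      by (rule exI[of _ b'], rule exI[of _ c'], rule exI[of _ e'], rule exI[of _ f'])
        (use ex in \<open>simp add: E l\<close>)
    moreover have "h a b = c" "h a c = d" "h a d = e" "h c e = 0" "h d e = 0" "h a f = 0" "h b f = 0" "h c f = 0"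
        "h d f = 0" "h e f = 0" using * unfolding excluded_21111_def by blast+
    ultimately have "excluded_21111 br (E a) (E b) (E c) (E d) (E e) (E f)"
      unfolding excluded_21111_def by (simp add: E l)
    then show False using not_excluded_21111[OF sp' _ v] by blast
  qed
qed

text \<open>The subspace is spanned by a, b, c, P, Q or, when F a b P Q is nonzero, by b, u, c, P, Q
  with u in the plane of a and y.\<close>

lemma not_heisenberg_plus_filiform:
  assumes sp: "span (set [a, b, c, x, y, P, Q]) = UNIV"
    and t: "br a b = c" "br a c = 0" "br b c = 0" "br x y = P" "br x P = Q" "br y P = 0" "br x Q = 0" "br y Q = 0"
      "br P Q = 0"
    and m: "\<And>u w. u \<in> {a, b, c} \<Longrightarrow> w \<in> {x, y, P, Q} \<Longrightarrow> br u w = 0"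
  shows False
proof -
  \<comment> \<open>\<open>b\<close> may be chosen in the plane spanned by \<open>a\<close> and \<open>b\<close> such that \<open>F b c y P = 0\<close>.\<close>
  have main: False
    if sp: "span (set [a, b, c, x, y, P, Q]) = UNIV" and t': "br a b = c" "br a c = 0" "br b c = 0"
      and m: "\<And>u w. u \<in> {a, b, c} \<Longrightarrow> w \<in> {x, y, P, Q} \<Longrightarrow> br u w = 0" and z: "F b c y P = 0" for a b c
  proof -
    have m': "br a x = 0" "br a y = 0" "br a P = 0" "br a Q = 0" "br b x = 0" "br b y = 0" "br b P = 0" "br b Q = 0"
      "br c x = 0" "br c y = 0" "br c P = 0" "br c Q = 0" by (simp_all add: m)
    note t' = t' t(4-) m' F.expand
    have 1: "F a b c P = 0" using dF[of a b c x y] by (simp add: t' F.order[of P a] F.order[of P b] F.order[of P c])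
    have 2: "F a b c Q = 0" using dF[of a b c x P] by (simp add: t' F.order[of Q a] F.order[of Q b] F.order[of Q c])
    have 3: "F a c P Q = 0" using dF[of a c x y Q] by (simp add: t' F.order[of P a] F.order[of P c])
    have 4: "F b c P Q = 0" using dF[of b c x y Q] by (simp add: t' F.order[of P b] F.order[of P c])
    have 5: "F b c y Q = 0" using dF[of b c x y P]
      by (simp add: t' F.order[of Q b] F.order[of Q c] F.order[of Q y] F.order[of P b] F.order[of P c])
    have 6: "F c y P Q = 0" using dF[of a b y P Q] by (simp add: t')
    show False
    proof (cases "F a b P Q = 0")
      case True
      show False
      proof (rule nonvanishing[of x y a b c P Q])
        show "span (set [x, y, a, b, c, P, Q]) = UNIV"
          by (rule span_change[OF sp, of _ "[[0,0,1,0,0,0,0], [0,0,0,1,0,0,0], [0,0,0,0,1,0,0], [1,0,0,0,0,0,0],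
                [0,1,0,0,0,0,0], [0,0,0,0,0,1,0], [0,0,0,0,0,0,1]]"])
            (simp add: lc_def)
      qed (use True 1 2 3 4 in simp_all)
    next
      case False
      \<comment> \<open>Chosen so that F b u P Q = F b y P Q + l F a b P Q = 0.\<close>
      define l where "l = - F b y P Q / F a b P Q"
      define u where "u = y - l *\<^sub>R a"
      show False
      proof (rule nonvanishing[of x a b u c P Q])
        show "span (set [x, a, b, u, c, P, Q]) = UNIV"
          by (rule span_change[OF sp, of _ "[[0,1,0,0,0,0,0], [0,0,1,0,0,0,0], [0,0,0,0,1,0,0], [1,0,0,0,0,0,0],
                [0,l,0,1,0,0,0], [0,0,0,0,0,1,0], [0,0,0,0,0,0,1]]"])
            (simp add: lc_def u_def)
        show "F b u P Q = 0" using False by (simp add: u_def F.expand F.order[of b a] l_def)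
      qed (use 1 2 3 4 5 6 z in \<open>simp_all add: u_def F.expand F.order[of b a] F.order[of y c]\<close>)
    qed
  qed
  show False
  proof (cases "F b c y P = 0")
    case True
    then show False using main[OF sp t(1-3) m] by blast
  next
    case False
    define l where "l = F a c y P / F b c y P"
    have z: "F (a - l *\<^sub>R b) c y P = 0" using False by (simp add: F.expand l_def)
    \<comment> \<open>The pair (- b, a - l b) has the same bracket c as (a, b), so the Heisenberg
      relations persist while the second member gets the required vanishing value.\<close>
    have "span (set [- b, a - l *\<^sub>R b, c, x, y, P, Q]) = UNIV"
      by (rule span_change[OF sp, of _ "[[-l,1,0,0,0,0,0], [-1,0,0,0,0,0,0], [0,0,1,0,0,0,0], [0,0,0,1,0,0,0],
            [0,0,0,0,1,0,0], [0,0,0,0,0,1,0], [0,0,0,0,0,0,1]]"])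
        (simp add: lc_def)
    moreover have "br (- b) (a - l *\<^sub>R b) = c" "br (- b) c = 0" "br (a - l *\<^sub>R b) c = 0"
      using t swap[of b a] by (simp_all add: expand)
    moreover have "br u w = 0" if "u \<in> {- b, a - l *\<^sub>R b, c}" "w \<in> {x, y, P, Q}" for u w
    proof -
      have "br a w = 0" "br b w = 0" "br c w = 0" by (intro m that(2), simp)+
      then show ?thesis using that(1) by (elim insertE emptyE) (simp_all add: expand)
    qed
    ultimately show False using z by (rule main)
  qed
qed

end

section \<open>Models of ideals\<close>

lemma lie_algebra_hom_image:
  assumes "lie_algebra br" and F: "linear F" "surj F" "\<And>x y. F (br x y) = br' (F x) (F y)"
  shows "lie_algebra br'"
proof -
  interpret lie_alg br by unfold_locales fact
  obtain G where G: "\<And>a. F (G a) = a" using F(2) by (metis surj_f_inv_f)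
  note l = linear_add[OF F(1)] linear_scale[OF F(1)]
  have br': "br' a b = F (br (G a) (G b))" for a b by (simp add: F(3) G)
  have "br' (a + b) c = br' a c + br' b c" for a b c
  proof -
    have "br' (a + b) c = F (br (G a + G b) (G c))" by (simp add: F(3) G l)
    then show ?thesis by (simp add: expand l F(3) G)
  qed
  moreover have "br' c (a + b) = br' c a + br' c b" for a b c
  proof -
    have "br' c (a + b) = F (br (G c) (G a + G b))" by (simp add: F(3) G l)
    then show ?thesis by (simp add: expand l F(3) G)
  qed
  moreover have "br' (r *\<^sub>R a) c = r *\<^sub>R br' a c" for r a c
  proof -
    have "br' (r *\<^sub>R a) c = F (br (r *\<^sub>R G a) (G c))" by (simp add: F(3) G l)
    then show ?thesis by (simp add: expand l F(3) G)
  qed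
  moreover have "br' c (r *\<^sub>R a) = r *\<^sub>R br' c a" for r a c
  proof -
    have "br' c (r *\<^sub>R a) = F (br (G c) (r *\<^sub>R G a))" by (simp add: F(3) G l)
    then show ?thesis by (simp add: expand l F(3) G)
  qed
  ultimately have "bilinear br'" unfolding bilinear_def by (auto intro: linearI)
  moreover have "br' a a = 0" for a by (simp add: br' linear_0[OF F(1)])
  moreover have "br' a (br' b c) + br' b (br' c a) + br' c (br' a b) = 0" for a b c
  proof -
    have "br' a (br' b c) + br' b (br' c a) + br' c (br' a b) =
      F (br (G a) (br (G b) (G c)) + br (G b) (br (G c) (G a)) + br (G c) (br (G a) (G b)))"
      by (simp add: l F(3) G)
    also have "\<dots> = F 0" using lie by (simp add: lie_algebra_def)
    finally show ?thesis by (simp add: linear_0[OF F(1)])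
  qed
  ultimately show ?thesis unfolding lie_algebra_def by blast
qed

lemma independent_complementary:
  assumes B: "finite B" "finite B'" "independent B" "independent B'" "span B \<inter> span B' = {0}"
  shows "independent (B \<union> B')" "B \<inter> B' = {}"
proof -
  have "0 \<notin> B" using B(3) dependent_zero[of B] by blast
  show dis: "B \<inter> B' = {}"
  proof (rule equals0I)
    fix v assume v: "v \<in> B \<inter> B'"
    then have "v \<in> span B \<inter> span B'" by (intro IntI span_base) simp_all
    then show False using B(5) \<open>0 \<notin> B\<close> v by simp
  qed
  show "independent (B \<union> B')"
  proof
    assume "dependent (B \<union> B')"
    then obtain u where u: "\<exists>v\<in>B \<union> B'. u v \<noteq> 0" "(\<Sum>v\<in>B \<union> B'. u v *\<^sub>R v) = 0"
      using iffD1[OF dependent_finite[OF finite_UnI[OF B(1,2)]]] by blast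
    have s: "(\<Sum>v\<in>B. u v *\<^sub>R v) + (\<Sum>v\<in>B'. u v *\<^sub>R v) = 0"
      using u(2) unfolding sum.union_disjoint[OF B(1,2) dis] .
    have 0: "(\<Sum>v\<in>A. u v *\<^sub>R v) \<in> span A" for A by (intro span_sum span_scale span_base)
    note 1 = 0[of B] 0[of B']
    have "(\<Sum>v\<in>B. u v *\<^sub>R v) = - (\<Sum>v\<in>B'. u v *\<^sub>R v)" using s by (rule eq_neg_iff_add_eq_0[THEN iffD2])
    then have "(\<Sum>v\<in>B. u v *\<^sub>R v) \<in> span B'" using span_neg[OF 1(2)] by simp
    then have z: "(\<Sum>v\<in>B. u v *\<^sub>R v) = 0" using 1(1) B(5) by blast
    then have z': "(\<Sum>v\<in>B'. u v *\<^sub>R v) = 0" using s by simp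
    have n: "\<forall>v\<in>A. u v = 0" if "finite A" "independent A" "(\<Sum>v\<in>A. u v *\<^sub>R v) = 0" for A
    proof (rule ccontr)
      assume "\<not> (\<forall>v\<in>A. u v = 0)"
      then have "(\<exists>v\<in>A. u v \<noteq> 0) \<and> (\<Sum>v\<in>A. u v *\<^sub>R v) = 0" using that(3) by blast
      then have "dependent A" by (intro iffD2[OF dependent_finite[OF that(1)]] exI[of _ u])
      then show False using that(2) by blast
    qed
    have "\<forall>v\<in>B. u v = 0" by (rule n[OF B(1,3) z])
    moreover have "\<forall>v\<in>B'. u v = 0" by (rule n[OF B(2,4) z'])
    ultimately show False using u(1) by blast
  qed
qed

text \<open>A copy h of the ideal K as an algebra on a whole space: E embeds it and \<pi> is a
  homomorphic retraction of the full algebra. Statements about whole algebras thereby apply to an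
  ideal.\<close>

definition lie_model :: "('a::real_vector \<Rightarrow> 'a \<Rightarrow> 'a) \<Rightarrow> 'a set \<Rightarrow>
    ('b::real_vector \<Rightarrow> 'a) \<Rightarrow> ('a \<Rightarrow> 'b) \<Rightarrow> ('b \<Rightarrow> 'b \<Rightarrow> 'b) \<Rightarrow> bool" where
  "lie_model br K E \<pi> h \<longleftrightarrow> linear E \<and> range E = K \<and> linear \<pi> \<and> (\<forall>a. \<pi> (E a) = a) \<and>
     (\<forall>a b. br (E a) (E b) = E (h a b)) \<and> (\<forall>x y. \<pi> (br x y) = h (\<pi> x) (\<pi> y))"

text \<open>The projection along the complementary ideal is a homomorphism because brackets between
  the two ideals lie in both and so vanish.\<close>

lemma lie_model_exists:
  fixes B :: "'a::real_vector set"
  assumes lie: "lie_algebra br" and K: "lie_ideal br K" "lie_ideal br K'" "K \<inter> K' = {0}"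
    "{x + y | x y. x \<in> K \<and> y \<in> K'} = UNIV"
    and B: "finite B" "independent B" "span B = K" "card B = CARD('n::finite)"
    and B': "finite B'" "independent B'" "span B' = K'"
  obtains E :: "real^'n \<Rightarrow> 'a" and \<pi> h where "lie_model br K E \<pi> h"
proof -
  interpret lie_alg br by unfold_locales fact
  obtain b :: "'n \<Rightarrow> 'a" where b: "bij_betw b UNIV B"
    using finite_same_card_bij[of "UNIV :: 'n set" B] B(1,4) by auto
  have bB: "b i \<in> B" for i using bij_betwE[OF b] by blast
  have injb: "inj b" using b by (simp add: bij_betw_def)
  note ind = independent_complementary[OF B(1) B'(1) B(2) B'(2)]
  have KK: "span B \<inter> span B' = {0}" using K(3) B(3) B'(3) by simp
  obtain \<pi> :: "'a \<Rightarrow> real^'n" where \<pi>: "linear \<pi>"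
    "\<forall>x\<in>B \<union> B'. \<pi> x = (if x \<in> B then axis (inv_into UNIV b x) 1 else 0)"
    using linear_independent_extend[OF ind(1)[OF KK], of "\<lambda>x. if x \<in> B then axis (inv_into UNIV b x) 1 else 0"] by blast
  have \<pi>b: "\<pi> (b i) = axis i 1" for i
    using \<pi>(2) bB[of i] injb by simp
  have \<pi>K': "\<pi> x = 0" if "x \<in> K'" for x
  proof (rule linear_eq_0_on_span[OF \<pi>(1)])
    show "x \<in> span B'" using that B'(3) by simp
    show "\<pi> y = 0" if "y \<in> B'" for y using \<pi>(2) that ind(2)[OF KK] by auto
  qed
  define E where "E = (\<lambda>a :: real^'n. \<Sum>i\<in>UNIV. a $ i *\<^sub>R b i)"
  have linE: "linear E" unfolding E_def
    by (rule linearI) (simp_all add: scaleR_add_left sum.distrib scaleR_sum_right)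
  have EK: "E a \<in> K" for a unfolding E_def B(3)[symmetric] by (intro span_sum span_scale span_base bB)
  have \<pi>E: "\<pi> (E a) = a" for a
  proof -
    have "\<pi> (E a) = (\<Sum>i\<in>UNIV. a $ i *\<^sub>R axis i 1)"
      by (simp add: E_def linear_sum[OF \<pi>(1)] linear_scale[OF \<pi>(1)] \<pi>b)
    also have "\<dots> = a" using basis_expansion[of a] by (simp add: scalar_mult_eq_scaleR)
    finally show ?thesis .
  qed
  have E\<pi>: "E (\<pi> x) = x" if "x \<in> K" for x
  proof -
    have "id x = (E \<circ> \<pi>) x"
    proof (rule linear_eq_on_span[OF linear_id linear_compose[OF \<pi>(1) linE]])
      show "x \<in> span B" using that B(3) by simp
      fix y assume "y \<in> B"
      then obtain i where y: "y = b i" using b by (auto simp: bij_betw_def)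
      have "E (axis i 1) = (\<Sum>j\<in>UNIV. if j = i then b j else 0)"
        unfolding E_def by (rule sum.cong) (auto simp: axis_def)
      then show "id y = (E \<circ> \<pi>) y" by (simp add: y \<pi>b)
    qed
    then show ?thesis by simp
  qed
  define h where "h = (\<lambda>a b. \<pi> (br (E a) (E b)))"
  have hom: "\<pi> (br x y) = h (\<pi> x) (\<pi> y)" for x y
  proof -
    obtain k k' where x: "x = k + k'" "k \<in> K" "k' \<in> K'" using K(4) by blast
    obtain l l' where y: "y = l + l'" "l \<in> K" "l' \<in> K'" using K(4) by blast
    have i: "br u v \<in> K" if "v \<in> K" for u v using K(1) that unfolding lie_ideal_def by blast
    have i': "br u v \<in> K'" if "v \<in> K'" for u v using K(2) that unfolding lie_ideal_def by blast
    \<comment> \<open>Mixed brackets lie in the intersection of the ideals.\<close>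
    have "br k' l \<in> K'" using i'[OF x(3), of l] swap[of k' l] K(2) unfolding lie_ideal_def by (metis subspace_neg)
    then have "br k' l = 0" using i[OF y(2), of k'] K(3) by blast
    moreover have "br k l' \<in> K" using i[OF x(2), of l'] swap[of k l'] K(1) unfolding lie_ideal_def by (metis subspace_neg)
    then have "br k l' = 0" using i'[OF y(3), of k] K(3) by blast
    ultimately have "br x y = br k l + br k' l'" by (simp add: x y expand)
    then have "\<pi> (br x y) = \<pi> (br k l)" using \<pi>K'[OF i'[OF y(3), of k']] by (simp add: linear_add[OF \<pi>(1)])
    moreover have "\<pi> x = \<pi> k" "\<pi> y = \<pi> l" using \<pi>K' x y by (simp_all add: linear_add[OF \<pi>(1)])
    ultimately show ?thesis using E\<pi> x(2) y(2) by (simp add: h_def)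
  qed
  have Eh: "br (E a) (E b) = E (h a b)" for a b
  proof -
    have "br (E a) (E b) \<in> K" using EK[of b] K(1) unfolding lie_ideal_def by blast
    then show ?thesis by (simp add: h_def E\<pi>)
  qed
  have "range E = K"
  proof
    show "range E \<subseteq> K" using EK by blast
    show "K \<subseteq> range E"
    proof
      fix x assume "x \<in> K"
      from E\<pi>[OF this, symmetric] show "x \<in> range E" by (rule range_eqI)
    qed
  qed
  then have "lie_model br K E \<pi> h" unfolding lie_model_def using linE \<pi>(1) \<pi>E Eh hom by blast
  then show thesis by (rule that)
qed

lemma lie_model_nilpotent:
  assumes "lie_model br K E \<pi> h" "lie_algebra br" "nilpotent_lie br"
  shows "lie_algebra h" "nilpotent_lie h"
proof -
  have \<pi>E: "\<forall>a. \<pi> (E a) = a" using assms(1)[unfolded lie_model_def] by (elim conjE)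
  have \<pi>: "linear \<pi>" using assms(1)[unfolded lie_model_def] by (elim conjE)
  have hom: "\<forall>x y. \<pi> (br x y) = h (\<pi> x) (\<pi> y)" using assms(1)[unfolded lie_model_def] by (elim conjE)
  have sj: "surj \<pi>" by (rule surjI[of \<pi> E]) (rule spec[OF \<pi>E])
  note \<pi> = \<pi> sj hom[rule_format]
  show "lie_algebra h" by (rule lie_algebra_hom_image[where F = \<pi> and br' = h, OF assms(2) \<pi>])
  show "nilpotent_lie h" by (rule nilpotent_hom_image[where F = \<pi> and br = br and br' = h, OF \<pi> assms(3)])
qed

section \<open>Small nilpotent algebras: Heisenberg and filiform\<close>

context nilpotent_lie_alg
begin

lemma generating_set_exists:
  obtains S where "finite S" "card S = DIM('a) - dim (C 1)" "UNIV \<subseteq> span (S \<union> C 1)"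
proof -
  obtain S where S: "finite S" "card S = dim (UNIV :: 'a set) - dim (C 1)" "S \<subseteq> UNIV" "UNIV \<subseteq> span (S \<union> C 1)"
    using complement_exists[OF C_subspace[of 1] subspace_UNIV subset_UNIV] by blast
  have "card S = DIM('a) - dim (C 1)" using S(2) unfolding dim_UNIV .
  from S(1) this S(4) show thesis by (rule that)
qed

text \<open>With at most one generator modulo \<open>C 1\<close> all brackets of generators vanish,
  so \<open>C 1\<close> lies in \<open>C 2\<close> and is zero by nilpotency.\<close>

lemma few_generators:
  assumes "C 1 \<noteq> {0}"
  shows "dim (C 1) + 2 \<le> DIM('a)"
proof (rule ccontr)
  assume n: "\<not> dim (C 1) + 2 \<le> DIM('a)"
  obtain S where S: "finite S" "card S = DIM('a) - dim (C 1)" "UNIV \<subseteq> span (S \<union> C 1)"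
    by (rule generating_set_exists)
  have "card S \<le> 1" using S(2) n by linarith
  then have eq: "\<forall>a\<in>S. \<forall>b\<in>S. a = b" using card_le_Suc0_iff_eq[OF S(1)] by simp
  have s: "br s t = 0" if "s \<in> S" "t \<in> S" for s t
  proof -
    have "s = t" using eq that by blast
    then show ?thesis by simp
  qed
  have "C 0 \<subseteq> span (S \<union> C (Suc 0))" using S(3) by simp
  then have "C (Suc 0) \<subseteq> span ({br s t | s t. s \<in> S \<and> t \<in> S} \<union> C (Suc (Suc 0)))" by (rule C_generate[OF S(3)])
  also have "\<dots> \<subseteq> C (Suc (Suc 0))"
  proof (rule span_minimal[OF _ C_subspace])
    have "{br s t | s t. s \<in> S \<and> t \<in> S} \<subseteq> {0}" using s by blast
    also have "\<dots> \<subseteq> C (Suc (Suc 0))" using subspace_0[OF C_subspace] by simp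
    finally show "{br s t | s t. s \<in> S \<and> t \<in> S} \<union> C (Suc (Suc 0)) \<subseteq> C (Suc (Suc 0))"
      by (rule Un_least[OF _ order_refl])
  qed
  finally have "C (Suc 0) = {0}" by (rule C_stable_imp_zero)
  then show False using assms by simp
qed

text \<open>At least two generators are needed, so \<open>C 1\<close> is a line spanned by their
  bracket.\<close>

lemma heisenberg_basis:
  assumes d: "DIM('a) = 3" and nz: "C 1 \<noteq> {0}"
  obtains a b where "span {a, b, br a b} = UNIV" "\<And>u. br u (br a b) = 0"
proof -
  have "dim (C 1) \<noteq> 0" using nz dim_C_zero[of 1] by linarith
  then have d1: "dim (C 1) = 1" using few_generators[OF nz] d by linarith
  have C2: "C (Suc 1) = {0}" by (rule C_dim_Suc_0[OF d1])
  obtain S where S: "finite S" "card S = DIM('a) - dim (C 1)" "UNIV \<subseteq> span (S \<union> C 1)"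
    by (rule generating_set_exists)
  have "card S = 2" using S(2) d d1 by linarith
  then obtain a b where "S = {a, b}" by (auto simp: card_2_iff)
  then have sp: "UNIV \<subseteq> span ({a, b} \<union> C 1)" using S(3) by simp
  have "UNIV \<subseteq> span ({a, b} \<union> {br a b} \<union> C (Suc 1))" by (rule span_Un_chain[OF sp C_generate_two(1)[OF sp]])
  also have "{a, b} \<union> {br a b} \<union> C (Suc 1) = insert 0 {a, b, br a b}" unfolding C2 by auto
  also have "span (insert 0 {a, b, br a b}) = span {a, b, br a b}" by (rule span_insert_0)
  finally have "span {a, b, br a b} = UNIV" by blast
  moreover have "br u (br a b) = 0" for u using C_zero_bracket[OF C2 C_1] by blast
  ultimately show thesis by (rule that)
qed

text \<open>The hypothesis on the centre excludes the Heisenberg algebra plus a line; what remains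
  has a two-dimensional derived algebra.\<close>

lemma filiform_basis:
  assumes d: "DIM('a) = 4" and nz: "C 1 \<noteq> {0}"
    and Z: "\<And>w. (\<And>u. br u w = 0) \<Longrightarrow> w \<in> C 1"
  obtains x y where "span {x, y, br x y, br x (br x y)} = UNIV" "br y (br x y) = 0"
    "\<And>u. br u (br x (br x y)) = 0"
proof -
  have dm: "dim (UNIV :: 'a set) = 4" using d by (simp add: dim_UNIV)
  have "dim (C 1) \<noteq> 0" using nz dim_C_zero[of 1] by linarith
  then consider "dim (C 1) = 1" | "dim (C 1) = 2" using few_generators[OF nz] d by linarith
  then show thesis
  proof cases
    case d1: 1
    \<comment> \<open>This case is contradictory: it produces a central element outside
      \<open>C 1\<close>.\<close>
    have C2: "C (Suc 1) = {0}" by (rule C_dim_Suc_0[OF d1])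
    have "\<exists>x y. br x y \<noteq> 0"
    proof (rule ccontr)
      assume "\<nexists>x y. br x y \<noteq> 0"
      then have "C 1 \<subseteq> {0}" by (intro C_1_zeroI) auto
      then show False using nz subspace_0[OF C_subspace[of 1]] by blast
    qed
    then obtain x y where xy: "br x y \<noteq> 0" by blast
    define P where "P = br x y"
    have C1: "C 1 \<subseteq> span {P}" unfolding P_def by (rule C_dim_1[OF d1 C_1 xy])
    have z: "br u P = 0" "br P u = 0" for u using C_zero_bracket[OF C2, of P u] C_1[of x y] by (simp_all add: P_def)
    have w: "\<exists>k. br u v = k *\<^sub>R P" for u v using C1 C_1[of u v] span_singletonE by blast
    have "\<not> UNIV \<subseteq> span {x, y, P}"
    proof
      assume "UNIV \<subseteq> span {x, y, P}"
      then have "dim (UNIV :: 'a set) \<le> card {x, y, P}" by (intro dim_le_card) auto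
      also have "\<dots> \<le> 3" by (simp add: card_insert_if)
      finally show False using dm by simp
    qed
    then obtain v where v: "v \<notin> span {x, y, P}" by blast
    obtain k where k: "br x v = k *\<^sub>R P" using w by blast
    obtain l where l: "br y v = l *\<^sub>R P" using w by blast
    \<comment> \<open>Orthogonal projection of v with respect to the hyperbolic pair x, y; the
      result commutes with everything.\<close>
    define u where "u = v + l *\<^sub>R x - k *\<^sub>R y"
    have u: "br x u = 0" "br y u = 0" using k l swap[of y x] by (simp_all add: u_def expand P_def)
    have nu: "u \<notin> span {x, y, P}"
    proof
      assume us: "u \<in> span {x, y, P}"
      have bs: "x \<in> span {x, y, P}" "y \<in> span {x, y, P}" by (rule span_base, simp)+
      have "u - l *\<^sub>R x + k *\<^sub>R y \<in> span {x, y, P}" by (intro span_add span_diff span_scale us bs)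
      then show False using v by (simp add: u_def)
    qed
    have "P \<noteq> 0" using xy P_def by simp
    have ny: "y \<notin> span {P}"
    proof
      assume "y \<in> span {P}"
      then obtain k where k: "y = k *\<^sub>R P" by (rule span_singletonE)
      have "P = br x y" by (simp add: P_def)
      also have "\<dots> = 0" by (subst k) (simp add: expand z)
      finally show False using \<open>P \<noteq> 0\<close> by simp
    qed
    have nx: "x \<notin> span {y, P}"
    proof
      assume "x \<in> span {y, P}"
      then obtain k l where k: "x = k *\<^sub>R y + l *\<^sub>R P" by (rule span_doubletonE)
      have "P = br x y" by (simp add: P_def)
      also have "\<dots> = 0" by (subst k) (simp add: expand z)
      finally show False using \<open>P \<noteq> 0\<close> by simp
    qed
    have "dim {u, x, y, P} = 4" using nu nx ny \<open>P \<noteq> 0\<close> by (simp add: dim_insert)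
    then have "UNIV \<subseteq> span {u, x, y, P}" using dm by (intro subspace_subset_dim subspace_UNIV) auto
    moreover have "subspace {t. br t u = 0}" unfolding subspace_def by (simp add: expand)
    moreover have "{u, x, y, P} \<subseteq> {t. br t u = 0}" using u z by auto
    ultimately have "\<And>t. br t u = 0" using span_minimal[of "{u, x, y, P}" "{t. br t u = 0}"] by blast
    then have "u \<in> C 1" by (rule Z)
    then have "u \<in> span {P}" using C1 by blast
    then have "u \<in> span {x, y, P}" using span_mono[of "{P}" "{x, y, P}"] by blast
    then show thesis using nu by blast
  next
    case d1: 2
    obtain S where S: "finite S" "card S = DIM('a) - dim (C 1)" "UNIV \<subseteq> span (S \<union> C 1)"
    by (rule generating_set_exists)
    have "card S = 2" using S(2) d d1 by linarith
    then obtain x0 y0 where "S = {x0, y0}" by (auto simp: card_2_iff)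
    then have sp0: "UNIV \<subseteq> span ({x0, y0} \<union> C 1)" using S(3) by simp
    have "dim (C 1) \<le> card {br x0 y0} + dim (C (Suc 1))"
      by (rule dim_span_Un[OF _ C_generate_two(1)[OF sp0] C_subspace]) simp
    moreover have "dim (C (Suc 1)) < dim (C 1)" by (rule dim_C_less[OF nz])
    ultimately have d2: "dim (C (Suc 1)) = 1" using d1 by simp
    have C3: "C (Suc (Suc 1)) = {0}" by (rule C_dim_Suc_0[OF d2])
    have zero: "br u (br v (br w t)) = 0" for u v w t using C_zero_bracket[OF C3 C_Suc[OF C_1]] by blast
    \<comment> \<open>Bracketing with P maps two generators to the line \<open>C 2\<close>, so some
      generator y annihilates P.\<close>
    have "\<exists>x y. UNIV \<subseteq> span ({x, y} \<union> C 1) \<and> br y (br x y) = 0"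
    proof (cases "br y0 (br x0 y0) = 0")
      case True
      then show ?thesis using sp0 by blast
    next
      case False
      have "C (Suc 1) \<subseteq> span {br y0 (br x0 y0)}" by (rule C_dim_1[OF d2 C_Suc[OF C_1] False])
      then have "br x0 (br x0 y0) \<in> span {br y0 (br x0 y0)}" using C_Suc[OF C_1] by blast
      then obtain k where k: "br x0 (br x0 y0) = k *\<^sub>R br y0 (br x0 y0)" by (rule span_singletonE)
      define y where "y = k *\<^sub>R y0 - x0"
      have e: "br y0 y = br x0 y0" using swap[of y0 x0] by (simp add: y_def expand)
      have "br y (br y0 y) = 0" unfolding e by (simp add: y_def expand k)
      moreover have "UNIV \<subseteq> span ({y0, y} \<union> C 1)"
      proof -
        let ?T = "{y0, y} \<union> C 1"
        have b: "y0 \<in> span ?T" "y \<in> span ?T" "C 1 \<subseteq> span ?T" using span_superset[of ?T] by auto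
        have "k *\<^sub>R y0 - y \<in> span ?T" by (intro span_diff span_scale b)
        then have "{x0, y0} \<union> C 1 \<subseteq> span ?T" using b by (simp add: y_def)
        then show ?thesis using sp0 span_minimal[OF _ subspace_span] by blast
      qed
      ultimately show ?thesis by blast
    qed
    then obtain x y where spx: "UNIV \<subseteq> span ({x, y} \<union> C 1)" and yP: "br y (br x y) = 0" by blast
    have "UNIV \<subseteq> span ({x, y} \<union> {br x y} \<union> C (Suc 1))" by (rule span_Un_chain[OF spx C_generate_two(1)[OF spx]])
    then have "UNIV \<subseteq> span ({x, y} \<union> {br x y} \<union> {br x (br x y), br y (br x y)} \<union> C (Suc (Suc 1)))"
      by (rule span_Un_chain[OF _ C_generate_two(2)[OF spx]])
    also have "{x, y} \<union> {br x y} \<union> {br x (br x y), br y (br x y)} \<union> C (Suc (Suc 1)) =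
        insert 0 {x, y, br x y, br x (br x y)}" unfolding C3 yP by auto
    also have "span (insert 0 {x, y, br x y, br x (br x y)}) = span {x, y, br x y, br x (br x y)}" by (rule span_insert_0)
    finally have "span {x, y, br x y, br x (br x y)} = UNIV" by blast
    then show thesis using yP zero by (rule that)
  qed
qed

end

section \<open>Half-flat structures on the listed algebras\<close>

definition bracket_table :: "('a::real_vector \<Rightarrow> 'a \<Rightarrow> 'a) \<Rightarrow> int list list \<Rightarrow> 'a list \<Rightarrow> bool" where
  "bracket_table br L vs \<longleftrightarrow> (\<forall>i<6. \<forall>j<6. br (vs ! i) (vs ! j) = struct_comb L (Suc i) (Suc j) vs)"

lemma bracket_tableD:
  assumes "bracket_table br L [v1, v2, v3, v4, v5, v6]"
  shows "br v1 v2 = struct_comb L 1 2 [v1, v2, v3, v4, v5, v6]"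
    "br v1 v3 = struct_comb L 1 3 [v1, v2, v3, v4, v5, v6]"
    "br v1 v4 = struct_comb L 1 4 [v1, v2, v3, v4, v5, v6]"
    "br v1 v5 = struct_comb L 1 5 [v1, v2, v3, v4, v5, v6]"
    "br v1 v6 = struct_comb L 1 6 [v1, v2, v3, v4, v5, v6]"
    "br v2 v3 = struct_comb L 2 3 [v1, v2, v3, v4, v5, v6]"
    "br v2 v4 = struct_comb L 2 4 [v1, v2, v3, v4, v5, v6]"
    "br v2 v5 = struct_comb L 2 5 [v1, v2, v3, v4, v5, v6]"
    "br v2 v6 = struct_comb L 2 6 [v1, v2, v3, v4, v5, v6]"
    "br v3 v4 = struct_comb L 3 4 [v1, v2, v3, v4, v5, v6]"
    "br v3 v5 = struct_comb L 3 5 [v1, v2, v3, v4, v5, v6]"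
    "br v3 v6 = struct_comb L 3 6 [v1, v2, v3, v4, v5, v6]"
    "br v4 v5 = struct_comb L 4 5 [v1, v2, v3, v4, v5, v6]"
    "br v4 v6 = struct_comb L 4 6 [v1, v2, v3, v4, v5, v6]"
    "br v5 v6 = struct_comb L 5 6 [v1, v2, v3, v4, v5, v6]"
proof -
  note t = assms[unfolded bracket_table_def, rule_format]
  show "br v1 v2 = struct_comb L 1 2 [v1, v2, v3, v4, v5, v6]"
    "br v1 v3 = struct_comb L 1 3 [v1, v2, v3, v4, v5, v6]"
    "br v1 v4 = struct_comb L 1 4 [v1, v2, v3, v4, v5, v6]"
    "br v1 v5 = struct_comb L 1 5 [v1, v2, v3, v4, v5, v6]"
    "br v1 v6 = struct_comb L 1 6 [v1, v2, v3, v4, v5, v6]"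
    "br v2 v3 = struct_comb L 2 3 [v1, v2, v3, v4, v5, v6]"
    "br v2 v4 = struct_comb L 2 4 [v1, v2, v3, v4, v5, v6]"
    "br v2 v5 = struct_comb L 2 5 [v1, v2, v3, v4, v5, v6]"
    "br v2 v6 = struct_comb L 2 6 [v1, v2, v3, v4, v5, v6]"
    "br v3 v4 = struct_comb L 3 4 [v1, v2, v3, v4, v5, v6]"
    "br v3 v5 = struct_comb L 3 5 [v1, v2, v3, v4, v5, v6]"
    "br v3 v6 = struct_comb L 3 6 [v1, v2, v3, v4, v5, v6]"
    "br v4 v5 = struct_comb L 4 5 [v1, v2, v3, v4, v5, v6]"
    "br v4 v6 = struct_comb L 4 6 [v1, v2, v3, v4, v5, v6]"
    "br v5 v6 = struct_comb L 5 6 [v1, v2, v3, v4, v5, v6]"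
    by (use t[of 0 1] t[of 0 2] t[of 0 3] t[of 0 4] t[of 0 5] t[of 1 2] t[of 1 3] t[of 1 4] t[of 1 5] t[of 2 3] t[of 2 4] t[of 2 5] t[of 3 4] t[of 3 5] t[of 4 5] in \<open>simp_all add: numeral_eq_Suc\<close>)
qed

lemma structure_tableE:
  fixes br :: "'a::real_vector \<Rightarrow> 'a \<Rightarrow> 'a"
  assumes eq: "has_structure_equations br L" and lie: "lie_algebra br" and L: "L \<in> set half_flat_list"
  obtains v1 v2 v3 v4 v5 v6 where "span (set [v1, v2, v3, v4, v5, v6]) = UNIV" "bracket_table br L [v1, v2, v3, v4, v5, v6]"
proof -
  note L' = half_flat_list_valid[OF L]
  obtain vs where vs: "length vs = length L" "span (set vs) = UNIV"
    "\<And>i j. i < length L \<Longrightarrow> j < length L \<Longrightarrow> br (vs ! i) (vs ! j) = struct_comb L (Suc i) (Suc j) vs"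
    using structure_equationsE[OF eq lie] L' by blast
  then obtain v1 v2 v3 v4 v5 v6 where v: "vs = [v1, v2, v3, v4, v5, v6]"
    using L' by (auto simp: length_Suc_conv numeral_eq_Suc)
  have sp: "span (set [v1, v2, v3, v4, v5, v6]) = UNIV" using vs(2) unfolding v .
  have "bracket_table br L [v1, v2, v3, v4, v5, v6]" using vs(3) L' unfolding bracket_table_def v by simp
  with sp show thesis by (rule that)
qed

text \<open>Here L is the bracket table of an adapted basis u1, ..., u6, which need not be one of
  the listed tuples; repeated entries encode integer coefficients, so 25 written twice stands for
  the coefficient 2. M expresses the listed basis through the adapted one, and the numbers at the
  end of each use are the weights p, q, r.\<close>

lemma half_flat_tableI:
  fixes br :: "'a::real_vector \<Rightarrow> 'a \<Rightarrow> 'a"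
  assumes "span (set ws) = UNIV" "lie_algebra br" "dim (UNIV :: 'a set) = 6"
    and "map (\<lambda>cs. lc cs [u1, u2, u3, u4, u5, u6]) M = ws"
    and L: "length L = 6" and pos: "p > 0" "q > 0" "r > 0"
    and hf: "half_flat_equations p q r (\<lambda>i j k. scoef (L ! (k - 1)) i j)"
    and "br u1 u2 = struct_comb L 1 2 [u1, u2, u3, u4, u5, u6]"
    and "br u1 u3 = struct_comb L 1 3 [u1, u2, u3, u4, u5, u6]"
    and "br u1 u4 = struct_comb L 1 4 [u1, u2, u3, u4, u5, u6]"
    and "br u1 u5 = struct_comb L 1 5 [u1, u2, u3, u4, u5, u6]"
    and "br u1 u6 = struct_comb L 1 6 [u1, u2, u3, u4, u5, u6]"
    and "br u2 u3 = struct_comb L 2 3 [u1, u2, u3, u4, u5, u6]"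
    and "br u2 u4 = struct_comb L 2 4 [u1, u2, u3, u4, u5, u6]"
    and "br u2 u5 = struct_comb L 2 5 [u1, u2, u3, u4, u5, u6]"
    and "br u2 u6 = struct_comb L 2 6 [u1, u2, u3, u4, u5, u6]"
    and "br u3 u4 = struct_comb L 3 4 [u1, u2, u3, u4, u5, u6]"
    and "br u3 u5 = struct_comb L 3 5 [u1, u2, u3, u4, u5, u6]"
    and "br u3 u6 = struct_comb L 3 6 [u1, u2, u3, u4, u5, u6]"
    and "br u4 u5 = struct_comb L 4 5 [u1, u2, u3, u4, u5, u6]"
    and "br u4 u6 = struct_comb L 4 6 [u1, u2, u3, u4, u5, u6]"
    and "br u5 u6 = struct_comb L 5 6 [u1, u2, u3, u4, u5, u6]"
  shows "admits_half_flat_SU3 br"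
proof (rule half_flat_criterion[OF assms(2) _ L assms(3) _ _ pos hf])
  let ?us = "[u1, u2, u3, u4, u5, u6]"
  show "length ?us = 6" by simp
  show "span (set ?us) = UNIV" by (rule span_change[OF assms(1,4)])
  fix i j :: nat assume ij: "i < j" "j < 6"
  then have "(i = 0 \<or> i = 1 \<or> i = 2 \<or> i = 3 \<or> i = 4)" "(j = 1 \<or> j = 2 \<or> j = 3 \<or> j = 4 \<or> j = 5)"
    by auto
  then show "br (?us ! i) (?us ! j) = struct_comb L (Suc i) (Suc j) ?us"
    using ij(1) assms(10-) by (elim disjE) (simp_all add: numeral_eq_Suc)
qed

section \<open>Adapted bases for the 24 algebras\<close>

context lie_alg
begin

lemma half_flat_1:
  assumes dm: "dim (UNIV :: 'a set) = 6" and eq: "has_structure_equations br [[], [], [], [], [], []]" (is "has_structure_equations _ ?L")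
  shows "admits_half_flat_SU3 br"
proof -
  have L: "?L \<in> set half_flat_list" by (simp add: half_flat_list_def)
  obtain v1 v2 v3 v4 v5 v6 where sp: "span (set [v1, v2, v3, v4, v5, v6]) = UNIV"
    and T: "bracket_table br ?L [v1, v2, v3, v4, v5, v6]"
    by (rule structure_tableE[OF eq lie L])
  note t = bracket_tableD[OF T, simplified struct_comb_def scoef_def, simplified]
  note t' = t t[THEN arg_cong[of _ _ uminus], folded swap]
  show ?thesis
    by (rule half_flat_tableI[OF sp lie dm, of "- v4" "- v6" v3 "- v2" v1 v5
        "[[0,0,0,0,1,0], [0,0,0,-1,0,0], [0,0,1,0,0,0], [-1,0,0,0,0,0], [0,0,0,0,0,1], [0,-1,0,0,0,0]]"
        "[[], [], [], [], [], []]" 1 1 1])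
      (simp_all add: struct_comb_def scoef_def lc_def half_flat_equations_def expand t' scaleR_2)
qed

lemma half_flat_2:
  assumes dm: "dim (UNIV :: 'a set) = 6" and eq: "has_structure_equations br [[], [], [], [12], [13], [23]]" (is "has_structure_equations _ ?L")
  shows "admits_half_flat_SU3 br"
proof -
  have L: "?L \<in> set half_flat_list" by (simp add: half_flat_list_def)
  obtain v1 v2 v3 v4 v5 v6 where sp: "span (set [v1, v2, v3, v4, v5, v6]) = UNIV"
    and T: "bracket_table br ?L [v1, v2, v3, v4, v5, v6]"
    by (rule structure_tableE[OF eq lie L])
  note t = bracket_tableD[OF T, simplified struct_comb_def scoef_def, simplified]
  note t' = t t[THEN arg_cong[of _ _ uminus], folded swap]
  show ?thesis
    by (rule half_flat_tableI[OF sp lie dm, of "- v2" "- v5" v3 v4 "- v1" v6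
        "[[0,0,0,0,-1,0], [-1,0,0,0,0,0], [0,0,1,0,0,0], [0,0,0,1,0,0], [0,-1,0,0,0,0], [0,0,0,0,0,1]]"
        "[[], [-35], [], [-15], [], [-13]]" 1 1 1])
      (simp_all add: struct_comb_def scoef_def lc_def half_flat_equations_def expand t' scaleR_2)
qed

lemma half_flat_3:
  assumes dm: "dim (UNIV :: 'a set) = 6" and eq: "has_structure_equations br [[], [], [], [], [13, -24], [14, 23]]" (is "has_structure_equations _ ?L")
  shows "admits_half_flat_SU3 br"
proof -
  have L: "?L \<in> set half_flat_list" by (simp add: half_flat_list_def)
  obtain v1 v2 v3 v4 v5 v6 where sp: "span (set [v1, v2, v3, v4, v5, v6]) = UNIV"
    and T: "bracket_table br ?L [v1, v2, v3, v4, v5, v6]"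
    by (rule structure_tableE[OF eq lie L])
  note t = bracket_tableD[OF T, simplified struct_comb_def scoef_def, simplified]
  note t' = t t[THEN arg_cong[of _ _ uminus], folded swap]
  show ?thesis
    by (rule half_flat_tableI[OF sp lie dm, of "- v4" v3 v5 v6 v2 v1
        "[[0,0,0,0,0,1], [0,0,0,0,1,0], [0,1,0,0,0,0], [-1,0,0,0,0,0], [0,0,1,0,0,0], [0,0,0,1,0,0]]"
        "[[], [], [-15, -26], [16, -25], [], []]" 1 1 1])
      (simp_all add: struct_comb_def scoef_def lc_def half_flat_equations_def expand t' scaleR_2)
qed

lemma half_flat_4:
  assumes dm: "dim (UNIV :: 'a set) = 6" and eq: "has_structure_equations br [[], [], [], [], [12], [14, 23]]" (is "has_structure_equations _ ?L")
  shows "admits_half_flat_SU3 br"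
proof -
  have L: "?L \<in> set half_flat_list" by (simp add: half_flat_list_def)
  obtain v1 v2 v3 v4 v5 v6 where sp: "span (set [v1, v2, v3, v4, v5, v6]) = UNIV"
    and T: "bracket_table br ?L [v1, v2, v3, v4, v5, v6]"
    by (rule structure_tableE[OF eq lie L])
  note t = bracket_tableD[OF T, simplified struct_comb_def scoef_def, simplified]
  note t' = t t[THEN arg_cong[of _ _ uminus], folded swap]
  show ?thesis
    by (rule half_flat_tableI[OF sp lie dm, of "- v6" "- v5" "- v4" v2 v3 v1
        "[[0,0,0,0,0,1], [0,0,0,1,0,0], [0,0,0,0,1,0], [0,0,-1,0,0,0], [0,-1,0,0,0,0], [-1,0,0,0,0,0]]"
        "[[-36, -45], [46], [], [], [], []]" 1 1 1])
      (simp_all add: struct_comb_def scoef_def lc_def half_flat_equations_def expand t' scaleR_2)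
qed

lemma half_flat_5:
  assumes dm: "dim (UNIV :: 'a set) = 6" and eq: "has_structure_equations br [[], [], [], [], [12], [13]]" (is "has_structure_equations _ ?L")
  shows "admits_half_flat_SU3 br"
proof -
  have L: "?L \<in> set half_flat_list" by (simp add: half_flat_list_def)
  obtain v1 v2 v3 v4 v5 v6 where sp: "span (set [v1, v2, v3, v4, v5, v6]) = UNIV"
    and T: "bracket_table br ?L [v1, v2, v3, v4, v5, v6]"
    by (rule structure_tableE[OF eq lie L])
  note t = bracket_tableD[OF T, simplified struct_comb_def scoef_def, simplified]
  note t' = t t[THEN arg_cong[of _ _ uminus], folded swap]
  show ?thesis
    by (rule half_flat_tableI[OF sp lie dm, of "- v2" v3 "- v4" v1 v5 "- v6"
        "[[0,0,0,1,0,0], [-1,0,0,0,0,0], [0,1,0,0,0,0], [0,0,-1,0,0,0], [0,0,0,0,1,0], [0,0,0,0,0,-1]]"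
        "[[], [], [], [], [14], [24]]" 1 1 1])
      (simp_all add: struct_comb_def scoef_def lc_def half_flat_equations_def expand t' scaleR_2)
qed

lemma half_flat_6:
  assumes dm: "dim (UNIV :: 'a set) = 6" and eq: "has_structure_equations br [[], [], [], [], [12], [34]]" (is "has_structure_equations _ ?L")
  shows "admits_half_flat_SU3 br"
proof -
  have L: "?L \<in> set half_flat_list" by (simp add: half_flat_list_def)
  obtain v1 v2 v3 v4 v5 v6 where sp: "span (set [v1, v2, v3, v4, v5, v6]) = UNIV"
    and T: "bracket_table br ?L [v1, v2, v3, v4, v5, v6]"
    by (rule structure_tableE[OF eq lie L])
  note t = bracket_tableD[OF T, simplified struct_comb_def scoef_def, simplified]
  note t' = t t[THEN arg_cong[of _ _ uminus], folded swap]
  show ?thesis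
    by (rule half_flat_tableI[OF sp lie dm, of v6 v5 v4 "v1 - v4" v2 "- v3"
        "[[0,0,1,1,0,0], [0,0,0,0,1,0], [0,0,0,0,0,-1], [0,0,1,0,0,0], [0,1,0,0,0,0], [1,0,0,0,0,0]]"
        "[[36, -46], [45], [], [], [], []]" 1 1 1])
      (simp_all add: struct_comb_def scoef_def lc_def half_flat_equations_def expand t' scaleR_2)
qed

lemma half_flat_7:
  assumes dm: "dim (UNIV :: 'a set) = 6" and eq: "has_structure_equations br [[], [], [], [], [], [12, 34]]" (is "has_structure_equations _ ?L")
  shows "admits_half_flat_SU3 br"
proof -
  have L: "?L \<in> set half_flat_list" by (simp add: half_flat_list_def)
  obtain v1 v2 v3 v4 v5 v6 where sp: "span (set [v1, v2, v3, v4, v5, v6]) = UNIV"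
    and T: "bracket_table br ?L [v1, v2, v3, v4, v5, v6]"
    by (rule structure_tableE[OF eq lie L])
  note t = bracket_tableD[OF T, simplified struct_comb_def scoef_def, simplified]
  note t' = t t[THEN arg_cong[of _ _ uminus], folded swap]
  show ?thesis
    by (rule half_flat_tableI[OF sp lie dm, of v4 v2 v3 v1 "- v6" "- v5"
        "[[0,0,0,1,0,0], [0,1,0,0,0,0], [0,0,1,0,0,0], [1,0,0,0,0,0], [0,0,0,0,0,-1], [0,0,0,0,-1,0]]"
        "[[], [], [], [], [13, 24], []]" 1 1 1])
      (simp_all add: struct_comb_def scoef_def lc_def half_flat_equations_def expand t' scaleR_2)
qed

lemma half_flat_8:
  assumes dm: "dim (UNIV :: 'a set) = 6" and eq: "has_structure_equations br [[], [], [], [], [], [12]]" (is "has_structure_equations _ ?L")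
  shows "admits_half_flat_SU3 br"
proof -
  have L: "?L \<in> set half_flat_list" by (simp add: half_flat_list_def)
  obtain v1 v2 v3 v4 v5 v6 where sp: "span (set [v1, v2, v3, v4, v5, v6]) = UNIV"
    and T: "bracket_table br ?L [v1, v2, v3, v4, v5, v6]"
    by (rule structure_tableE[OF eq lie L])
  note t = bracket_tableD[OF T, simplified struct_comb_def scoef_def, simplified]
  note t' = t t[THEN arg_cong[of _ _ uminus], folded swap]
  show ?thesis
    by (rule half_flat_tableI[OF sp lie dm, of v4 "- v2" v3 "- v6" "- v5" "- v1"
        "[[0,0,0,0,0,-1], [0,-1,0,0,0,0], [0,0,1,0,0,0], [1,0,0,0,0,0], [0,0,0,0,-1,0], [0,0,0,-1,0,0]]"
        "[[], [], [], [26], [], []]" 1 1 1])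
      (simp_all add: struct_comb_def scoef_def lc_def half_flat_equations_def expand t' scaleR_2)
qed

lemma half_flat_9:
  assumes dm: "dim (UNIV :: 'a set) = 6" and eq: "has_structure_equations br [[], [], [], [], [12], [15, 34]]" (is "has_structure_equations _ ?L")
  shows "admits_half_flat_SU3 br"
proof -
  have L: "?L \<in> set half_flat_list" by (simp add: half_flat_list_def)
  obtain v1 v2 v3 v4 v5 v6 where sp: "span (set [v1, v2, v3, v4, v5, v6]) = UNIV"
    and T: "bracket_table br ?L [v1, v2, v3, v4, v5, v6]"
    by (rule structure_tableE[OF eq lie L])
  note t = bracket_tableD[OF T, simplified struct_comb_def scoef_def, simplified]
  note t' = t t[THEN arg_cong[of _ _ uminus], folded swap]
  show ?thesis
    by (rule half_flat_tableI[OF sp lie dm, of v3 "v1 - v5" "- v5" v4 "- v2" v6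
        "[[0,1,-1,0,0,0], [0,0,0,0,-1,0], [1,0,0,0,0,0], [0,0,0,1,0,0], [0,0,-1,0,0,0], [0,0,0,0,0,1]]"
        "[[], [], [25], [], [], [14, -23]]" 1 1 1])
      (simp_all add: struct_comb_def scoef_def lc_def half_flat_equations_def expand t' scaleR_2)
qed

lemma half_flat_10:
  assumes dm: "dim (UNIV :: 'a set) = 6" and eq: "has_structure_equations br [[], [], [], [], [12], [14, 25]]" (is "has_structure_equations _ ?L")
  shows "admits_half_flat_SU3 br"
proof -
  have L: "?L \<in> set half_flat_list" by (simp add: half_flat_list_def)
  obtain v1 v2 v3 v4 v5 v6 where sp: "span (set [v1, v2, v3, v4, v5, v6]) = UNIV"
    and T: "bracket_table br ?L [v1, v2, v3, v4, v5, v6]"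
    by (rule structure_tableE[OF eq lie L])
  note t = bracket_tableD[OF T, simplified struct_comb_def scoef_def, simplified]
  note t' = t t[THEN arg_cong[of _ _ uminus], folded swap]
  show ?thesis
    by (rule half_flat_tableI[OF sp lie dm, of "v3 + v4" v1 "- v2" "- v5" v6 v4
        "[[0,1,0,0,0,0], [0,0,-1,0,0,0], [1,0,0,0,0,-1], [0,0,0,0,0,1], [0,0,0,-1,0,0], [0,0,0,0,1,0]]"
        "[[], [], [], [23], [-12, 26, 34], []]" 1 1 1])
      (simp_all add: struct_comb_def scoef_def lc_def half_flat_equations_def expand t' scaleR_2)
qed

lemma half_flat_11:
  assumes dm: "dim (UNIV :: 'a set) = 6" and eq: "has_structure_equations br [[], [], [], [12], [23], [14, 35]]" (is "has_structure_equations _ ?L")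
  shows "admits_half_flat_SU3 br"
proof -
  have L: "?L \<in> set half_flat_list" by (simp add: half_flat_list_def)
  obtain v1 v2 v3 v4 v5 v6 where sp: "span (set [v1, v2, v3, v4, v5, v6]) = UNIV"
    and T: "bracket_table br ?L [v1, v2, v3, v4, v5, v6]"
    by (rule structure_tableE[OF eq lie L])
  note t = bracket_tableD[OF T, simplified struct_comb_def scoef_def, simplified]
  note t' = t t[THEN arg_cong[of _ _ uminus], folded swap]
  show ?thesis
    by (rule half_flat_tableI[OF sp lie dm, of "- v3" v4 v1 "- v5" v2 v6
        "[[0,0,1,0,0,0], [0,0,0,0,1,0], [-1,0,0,0,0,0], [0,1,0,0,0,0], [0,0,0,-1,0,0], [0,0,0,0,0,1]]"
        "[[], [35], [], [-15], [], [14, -23]]" 1 1 1])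
      (simp_all add: struct_comb_def scoef_def lc_def half_flat_equations_def expand t' scaleR_2)
qed

lemma half_flat_12:
  assumes dm: "dim (UNIV :: 'a set) = 6" and eq: "has_structure_equations br [[], [], [], [12], [23], [14, -35]]" (is "has_structure_equations _ ?L")
  shows "admits_half_flat_SU3 br"
proof -
  have L: "?L \<in> set half_flat_list" by (simp add: half_flat_list_def)
  obtain v1 v2 v3 v4 v5 v6 where sp: "span (set [v1, v2, v3, v4, v5, v6]) = UNIV"
    and T: "bracket_table br ?L [v1, v2, v3, v4, v5, v6]"
    by (rule structure_tableE[OF eq lie L])
  note t = bracket_tableD[OF T, simplified struct_comb_def scoef_def, simplified]
  note t' = t t[THEN arg_cong[of _ _ uminus], folded swap]
  show ?thesis
    by (rule half_flat_tableI[OF sp lie dm, of "- v2" "- v6" v3 v1 v5 "- v4"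
        "[[0,0,0,1,0,0], [-1,0,0,0,0,0], [0,0,1,0,0,0], [0,0,0,0,0,-1], [0,0,0,0,1,0], [0,-1,0,0,0,0]]"
        "[[], [35, 46], [], [], [-13], [-14]]" 1 1 1])
      (simp_all add: struct_comb_def scoef_def lc_def half_flat_equations_def expand t' scaleR_2)
qed

lemma half_flat_13:
  assumes dm: "dim (UNIV :: 'a set) = 6" and eq: "has_structure_equations br [[], [], [], [12], [13], [14, 35]]" (is "has_structure_equations _ ?L")
  shows "admits_half_flat_SU3 br"
proof -
  have L: "?L \<in> set half_flat_list" by (simp add: half_flat_list_def)
  obtain v1 v2 v3 v4 v5 v6 where sp: "span (set [v1, v2, v3, v4, v5, v6]) = UNIV"
    and T: "bracket_table br ?L [v1, v2, v3, v4, v5, v6]"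
    by (rule structure_tableE[OF eq lie L])
  note t = bracket_tableD[OF T, simplified struct_comb_def scoef_def, simplified]
  note t' = t t[THEN arg_cong[of _ _ uminus], folded swap]
  show ?thesis
    by (rule half_flat_tableI[OF sp lie dm, of v3 v4 v5 "- v1" v6 "v2 - v5"
        "[[0,0,0,-1,0,0], [0,0,1,0,0,1], [1,0,0,0,0,0], [0,1,0,0,0,0], [0,0,1,0,0,0], [0,0,0,0,1,0]]"
        "[[], [-46], [14], [], [13, -16, 24], []]" 2 1 1])
      (simp_all add: struct_comb_def scoef_def lc_def half_flat_equations_def expand t' scaleR_2)
qed

lemma half_flat_14:
  assumes dm: "dim (UNIV :: 'a set) = 6" and eq: "has_structure_equations br [[], [], [], [12], [13], [14, 23]]" (is "has_structure_equations _ ?L")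
  shows "admits_half_flat_SU3 br"
proof -
  have L: "?L \<in> set half_flat_list" by (simp add: half_flat_list_def)
  obtain v1 v2 v3 v4 v5 v6 where sp: "span (set [v1, v2, v3, v4, v5, v6]) = UNIV"
    and T: "bracket_table br ?L [v1, v2, v3, v4, v5, v6]"
    by (rule structure_tableE[OF eq lie L])
  note t = bracket_tableD[OF T, simplified struct_comb_def scoef_def, simplified]
  note t' = t t[THEN arg_cong[of _ _ uminus], folded swap]
  show ?thesis
    by (rule half_flat_tableI[OF sp lie dm, of "- v5" "v2 - v6" "- v4" "- v1" "- v3" v2
        "[[0,0,0,-1,0,0], [0,0,0,0,0,1], [0,0,0,0,-1,0], [0,0,-1,0,0,0], [-1,0,0,0,0,0], [0,-1,0,0,0,1]]"
        "[[-45], [25, 34, -56], [-24, 46], [], [], [-25, -34, 56]]" 1 1 1])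
      (simp_all add: struct_comb_def scoef_def lc_def half_flat_equations_def expand t' scaleR_2)
qed

lemma half_flat_15:
  assumes dm: "dim (UNIV :: 'a set) = 6" and eq: "has_structure_equations br [[], [], [], [12], [13], [24]]" (is "has_structure_equations _ ?L")
  shows "admits_half_flat_SU3 br"
proof -
  have L: "?L \<in> set half_flat_list" by (simp add: half_flat_list_def)
  obtain v1 v2 v3 v4 v5 v6 where sp: "span (set [v1, v2, v3, v4, v5, v6]) = UNIV"
    and T: "bracket_table br ?L [v1, v2, v3, v4, v5, v6]"
    by (rule structure_tableE[OF eq lie L])
  note t = bracket_tableD[OF T, simplified struct_comb_def scoef_def, simplified]
  note t' = t t[THEN arg_cong[of _ _ uminus], folded swap]
  show ?thesis
    by (rule half_flat_tableI[OF sp lie dm, of "- v4" "- v5" v2 v3 v1 v6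
        "[[0,0,0,0,1,0], [0,0,1,0,0,0], [0,0,0,1,0,0], [-1,0,0,0,0,0], [0,-1,0,0,0,0], [0,0,0,0,0,1]]"
        "[[35], [45], [], [], [], [13]]" 1 1 1])
      (simp_all add: struct_comb_def scoef_def lc_def half_flat_equations_def expand t' scaleR_2)
qed

lemma half_flat_16:
  assumes dm: "dim (UNIV :: 'a set) = 6" and eq: "has_structure_equations br [[], [], [12], [13], [23], [14]]" (is "has_structure_equations _ ?L")
  shows "admits_half_flat_SU3 br"
proof -
  have L: "?L \<in> set half_flat_list" by (simp add: half_flat_list_def)
  obtain v1 v2 v3 v4 v5 v6 where sp: "span (set [v1, v2, v3, v4, v5, v6]) = UNIV"
    and T: "bracket_table br ?L [v1, v2, v3, v4, v5, v6]"
    by (rule structure_tableE[OF eq lie L])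
  note t = bracket_tableD[OF T, simplified struct_comb_def scoef_def, simplified]
  note t' = t t[THEN arg_cong[of _ _ uminus], folded swap]
  show ?thesis
    by (rule half_flat_tableI[OF sp lie dm, of "- v3" "- v6" v2 v4 "- v1" v5
        "[[0,0,0,0,-1,0], [0,0,1,0,0,0], [-1,0,0,0,0,0], [0,0,0,1,0,0], [0,0,0,0,0,1], [0,-1,0,0,0,0]]"
        "[[-35], [-45], [], [-15], [], [13]]" 1 1 1])
      (simp_all add: struct_comb_def scoef_def lc_def half_flat_equations_def expand t' scaleR_2)
qed

lemma half_flat_17:
  assumes dm: "dim (UNIV :: 'a set) = 6" and eq: "has_structure_equations br [[], [], [12], [13], [23], [14, 25]]" (is "has_structure_equations _ ?L")
  shows "admits_half_flat_SU3 br"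
proof -
  have L: "?L \<in> set half_flat_list" by (simp add: half_flat_list_def)
  obtain v1 v2 v3 v4 v5 v6 where sp: "span (set [v1, v2, v3, v4, v5, v6]) = UNIV"
    and T: "bracket_table br ?L [v1, v2, v3, v4, v5, v6]"
    by (rule structure_tableE[OF eq lie L])
  note t = bracket_tableD[OF T, simplified struct_comb_def scoef_def, simplified]
  note t' = t t[THEN arg_cong[of _ _ uminus], folded swap]
  show ?thesis
    by (rule half_flat_tableI[OF sp lie dm, of "- v2" v5 v6 "- v3" v4 "- v1 + v2"
        "[[-1,0,0,0,0,-1], [-1,0,0,0,0,0], [0,0,0,-1,0,0], [0,0,0,0,1,0], [0,1,0,0,0,0], [0,0,1,0,0,0]]"
        "[[], [14, 46], [-12, -26, 56], [16], [-46], []]" 1 1 1])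
      (simp_all add: struct_comb_def scoef_def lc_def half_flat_equations_def expand t' scaleR_2)
qed

lemma half_flat_18:
  assumes dm: "dim (UNIV :: 'a set) = 6" and eq: "has_structure_equations br [[], [], [12], [13], [23], [14, -25]]" (is "has_structure_equations _ ?L")
  shows "admits_half_flat_SU3 br"
proof -
  have L: "?L \<in> set half_flat_list" by (simp add: half_flat_list_def)
  obtain v1 v2 v3 v4 v5 v6 where sp: "span (set [v1, v2, v3, v4, v5, v6]) = UNIV"
    and T: "bracket_table br ?L [v1, v2, v3, v4, v5, v6]"
    by (rule structure_tableE[OF eq lie L])
  note t = bracket_tableD[OF T, simplified struct_comb_def scoef_def, simplified]
  note t' = t t[THEN arg_cong[of _ _ uminus], folded swap]
  \<comment> \<open>The factors 2 and 4 balance the first equation for the real part of the volume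
    form, where the three structure constants contribute - 4 + 2 + 2.\<close>
  show ?thesis
    by (rule half_flat_tableI[OF sp lie dm, of "- 4 *\<^sub>R v4" "- 2 *\<^sub>R v2" "2 *\<^sub>R v5" "- 2 *\<^sub>R v1" "- 2 *\<^sub>R v3" "2 *\<^sub>R v6"
        "[[0,0,0,-1/2,0,0], [0,-1/2,0,0,0,0], [0,0,0,0,-1/2,0], [-1/4,0,0,0,0,0], [0,0,1/2,0,0,0], [0,0,0,0,0,1/2]]"
        "[[-45], [], [25, 25], [], [24, 24], [-14, -14, -14, -14, 23, 23]]" 1 1 1])
      (simp_all add: struct_comb_def scoef_def lc_def half_flat_equations_def expand t' algebra_simps)
qed

lemma half_flat_19:
  assumes dm: "dim (UNIV :: 'a set) = 6" and eq: "has_structure_equations br [[], [], [], [12], [14], [15, 23]]" (is "has_structure_equations _ ?L")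
  shows "admits_half_flat_SU3 br"
proof -
  have L: "?L \<in> set half_flat_list" by (simp add: half_flat_list_def)
  obtain v1 v2 v3 v4 v5 v6 where sp: "span (set [v1, v2, v3, v4, v5, v6]) = UNIV"
    and T: "bracket_table br ?L [v1, v2, v3, v4, v5, v6]"
    by (rule structure_tableE[OF eq lie L])
  note t = bracket_tableD[OF T, simplified struct_comb_def scoef_def, simplified]
  note t' = t t[THEN arg_cong[of _ _ uminus], folded swap]
  show ?thesis
    by (rule half_flat_tableI[OF sp lie dm, of "v2 + v6" "- v4" "v3 + v6" "- v1" "- v6" "v5 + v6"
        "[[0,0,0,-1,0,0], [1,0,0,0,1,0], [0,0,1,0,1,0], [0,-1,0,0,0,0], [0,0,0,0,1,1], [0,0,0,0,-1,0]]"
        "[[], [-14], [], [], [-13, -24, 46], [-24]]" 1 2 1])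
      (simp_all add: struct_comb_def scoef_def lc_def half_flat_equations_def expand t' scaleR_2)
qed

lemma half_flat_20:
  assumes dm: "dim (UNIV :: 'a set) = 6" and eq: "has_structure_equations br [[], [], [], [12], [14, -23], [15, 34]]" (is "has_structure_equations _ ?L")
  shows "admits_half_flat_SU3 br"
proof -
  have L: "?L \<in> set half_flat_list" by (simp add: half_flat_list_def)
  obtain v1 v2 v3 v4 v5 v6 where sp: "span (set [v1, v2, v3, v4, v5, v6]) = UNIV"
    and T: "bracket_table br ?L [v1, v2, v3, v4, v5, v6]"
    by (rule structure_tableE[OF eq lie L])
  note t = bracket_tableD[OF T, simplified struct_comb_def scoef_def, simplified]
  note t' = t t[THEN arg_cong[of _ _ uminus], folded swap]
  show ?thesis
    by (rule half_flat_tableI[OF sp lie dm, of "- v5" v6 "- v2" "- v4" "- v1" v3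
        "[[0,0,0,0,-1,0], [0,0,-1,0,0,0], [0,0,0,0,0,1], [0,0,0,-1,0,0], [-1,0,0,0,0,0], [0,1,0,0,0,0]]"
        "[[-36, 45], [-15, 46], [], [35], [], []]" 1 2 1])
      (simp_all add: struct_comb_def scoef_def lc_def half_flat_equations_def expand t' scaleR_2)
qed

lemma half_flat_21:
  assumes dm: "dim (UNIV :: 'a set) = 6" and eq: "has_structure_equations br [[], [], [], [12], [14], [15]]" (is "has_structure_equations _ ?L")
  shows "admits_half_flat_SU3 br"
proof -
  have L: "?L \<in> set half_flat_list" by (simp add: half_flat_list_def)
  obtain v1 v2 v3 v4 v5 v6 where sp: "span (set [v1, v2, v3, v4, v5, v6]) = UNIV"
    and T: "bracket_table br ?L [v1, v2, v3, v4, v5, v6]"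
    by (rule structure_tableE[OF eq lie L])
  note t = bracket_tableD[OF T, simplified struct_comb_def scoef_def, simplified]
  note t' = t t[THEN arg_cong[of _ _ uminus], folded swap]
  show ?thesis
    by (rule half_flat_tableI[OF sp lie dm, of "- v4" v6 v2 "- v5" "- v1" v3
        "[[0,0,0,0,-1,0], [0,0,1,0,0,0], [0,0,0,0,0,1], [-1,0,0,0,0,0], [0,0,0,-1,0,0], [0,1,0,0,0,0]]"
        "[[-35], [-45], [], [15], [], []]" 1 1 1])
      (simp_all add: struct_comb_def scoef_def lc_def half_flat_equations_def expand t' scaleR_2)
qed

lemma half_flat_22:
  assumes dm: "dim (UNIV :: 'a set) = 6" and eq: "has_structure_equations br [[], [], [], [12], [14], [15, 24]]" (is "has_structure_equations _ ?L")
  shows "admits_half_flat_SU3 br"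
proof -
  have L: "?L \<in> set half_flat_list" by (simp add: half_flat_list_def)
  obtain v1 v2 v3 v4 v5 v6 where sp: "span (set [v1, v2, v3, v4, v5, v6]) = UNIV"
    and T: "bracket_table br ?L [v1, v2, v3, v4, v5, v6]"
    by (rule structure_tableE[OF eq lie L])
  note t = bracket_tableD[OF T, simplified struct_comb_def scoef_def, simplified]
  note t' = t t[THEN arg_cong[of _ _ uminus], folded swap]
  show ?thesis
    by (rule half_flat_tableI[OF sp lie dm, of "- 2 *\<^sub>R v4" "2 *\<^sub>R v1" "2 *\<^sub>R v5" "- 2 *\<^sub>R v2" "2 *\<^sub>R v3 + 2 *\<^sub>R v4 - 2 *\<^sub>R v6" "2 *\<^sub>R v1 + 4 *\<^sub>R v6"
        "[[0,1/2,0,0,0,0], [0,0,0,-1/2,0,0], [1/2,-1/4,0,0,1/2,1/4], [-1/2,0,0,0,0,0], [0,0,1/2,0,0,0], [0,-1/4,0,0,0,1/4]]"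
        "[[24, 24, -46, -46], [14, -23, 36, 45], [12, 12, 16, 16, 25, 25, -56, -56], [], [], [-14, 23, -36, -45]]" 1 1 1])
      (simp_all add: struct_comb_def scoef_def lc_def half_flat_equations_def expand t' algebra_simps)
qed

lemma half_flat_23:
  assumes dm: "dim (UNIV :: 'a set) = 6" and eq: "has_structure_equations br [[], [], [], [12], [14], [15, 23, 24]]" (is "has_structure_equations _ ?L")
  shows "admits_half_flat_SU3 br"
proof -
  have L: "?L \<in> set half_flat_list" by (simp add: half_flat_list_def)
  obtain v1 v2 v3 v4 v5 v6 where sp: "span (set [v1, v2, v3, v4, v5, v6]) = UNIV"
    and T: "bracket_table br ?L [v1, v2, v3, v4, v5, v6]"
    by (rule structure_tableE[OF eq lie L])
  note t = bracket_tableD[OF T, simplified struct_comb_def scoef_def, simplified]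
  note t' = t t[THEN arg_cong[of _ _ uminus], folded swap]
  show ?thesis
    by (rule half_flat_tableI[OF sp lie dm, of "- v3" "v1 + v2 + v3" "- v6" v5 "- v2 + 2 *\<^sub>R v4" "v4 - v6"
        "[[1,1,2,0,1,-2], [0,0,-2,0,-1,2], [-1,0,0,0,0,0], [0,0,-1,0,0,1], [0,0,0,1,0,0], [0,0,-1,0,0,0]]"
        "[[], [], [-12, 15, -24, -25, -25, -26, 56], [25, 25, 26], [], [-25]]" 1 1 1])
      (simp_all add: struct_comb_def scoef_def lc_def half_flat_equations_def expand t' algebra_simps)
qed

lemma half_flat_24:
  assumes dm: "dim (UNIV :: 'a set) = 6" and eq: "has_structure_equations br [[], [], [12], [13], [14, 23], [24, 15]]" (is "has_structure_equations _ ?L")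
  shows "admits_half_flat_SU3 br"
proof -
  have L: "?L \<in> set half_flat_list" by (simp add: half_flat_list_def)
  obtain v1 v2 v3 v4 v5 v6 where sp: "span (set [v1, v2, v3, v4, v5, v6]) = UNIV"
    and T: "bracket_table br ?L [v1, v2, v3, v4, v5, v6]"
    by (rule structure_tableE[OF eq lie L])
  note t = bracket_tableD[OF T, simplified struct_comb_def scoef_def, simplified]
  note t' = t t[THEN arg_cong[of _ _ uminus], folded swap]
  \<comment> \<open>For this table two of the equations for \<omega> \<and> \<omega> reduce to q =
    r.\<close>
  show ?thesis
    by (rule half_flat_tableI[OF sp lie dm, of "2 *\<^sub>R v3 - 2 *\<^sub>R v5" "- 4 *\<^sub>R v6" "- 2 *\<^sub>R v3" "- 2 *\<^sub>R v2 + 2 *\<^sub>R v4 - 2 *\<^sub>R v6" "2 *\<^sub>R v4 + 2 *\<^sub>R v6" "- 2 *\<^sub>R v1 + 2 *\<^sub>R v3 - 2 *\<^sub>R v5 + 2 *\<^sub>R v6"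
        "[[1/2,-1/4,0,0,0,-1/2], [0,1/2,0,-1/2,1/2,0], [0,0,-1/2,0,0,0], [0,1/4,0,0,1/2,0], [-1/2,0,-1/2,0,0,0], [0,-1/4,0,0,0,0]]"
        "[[-14, -14, 34, 34, -56, -56], [16, 16, -36, 45], [-14, -14, 34, 34, 46, 46, -56, -56], [], [16, 16, -36, -36], []]" 2 1 1])
      (simp_all add: struct_comb_def scoef_def lc_def half_flat_equations_def expand t' algebra_simps, simp_all flip: scaleR_add_left scaleR_2)
qed

end

lemma half_flat_list_admits_half_flat:
  fixes br :: "'a::real_vector \<Rightarrow> 'a \<Rightarrow> 'a"
  assumes "lie_algebra br" "dim (UNIV :: 'a set) = 6" "L \<in> set half_flat_list" "has_structure_equations br L"
  shows "admits_half_flat_SU3 br"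
proof -
  interpret lie_alg br by unfold_locales fact
  show ?thesis
    using assms(3,4) unfolding half_flat_list_def
    by (simp only: list.set insert_iff empty_iff, elim disjE FalseE)
      (simp_all only: half_flat_1[OF assms(2)] half_flat_2[OF assms(2)] half_flat_3[OF assms(2)] half_flat_4[OF assms(2)] half_flat_5[OF assms(2)] half_flat_6[OF assms(2)] half_flat_7[OF assms(2)] half_flat_8[OF assms(2)] half_flat_9[OF assms(2)] half_flat_10[OF assms(2)] half_flat_11[OF assms(2)] half_flat_12[OF assms(2)] half_flat_13[OF assms(2)] half_flat_14[OF assms(2)] half_flat_15[OF assms(2)] half_flat_16[OF assms(2)] half_flat_17[OF assms(2)] half_flat_18[OF assms(2)] half_flat_19[OF assms(2)] half_flat_20[OF assms(2)] half_flat_21[OF assms(2)] half_flat_22[OF assms(2)] half_flat_23[OF assms(2)] half_flat_24[OF assms(2)])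
qed

section \<open>The equivalence\<close>

lemma wedge_list_4_last:
  fixes f :: "nat \<Rightarrow> 'a \<Rightarrow> real"
  shows "wedge_list f [i, j, k, l] [a, b, c, d] =
     wedge_list f [i, j, k] [a, b, c] * f l d - wedge_list f [i, j, k] [a, b, d] * f l c
     + wedge_list f [i, j, k] [a, c, d] * f l b - wedge_list f [i, j, k] [b, c, d] * f l a"
  by (simp add: wedge_list_4 wedge_list_3 algebra_simps)

text \<open>The change of the first two forms multiplies f 1 + i f 2 by - i. It turns Re \<Psi> into
  the negative imaginary part of the new complex volume form, which has precisely the last four
  terms of the positive normal form; the constant c is absorbed in the seventh form.\<close>

lemma coframe_7_of_sum:
  fixes F :: "'a::real_vector \<Rightarrow> 'b::real_vector \<times> real"
  assumes F: "linear F" "bij F" and f: "coframe 6 f" and c: "c \<noteq> 0"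
  shows "coframe 7 (\<lambda>i x. if i = 1 then f 2 (fst (F x)) else if i = 2 then - f 1 (fst (F x))
    else if i = 7 then c * snd (F x) else f i (fst (F x)))" (is "coframe 7 ?g")
proof -
  define G where "G = inv F"
  have FG: "F (G p) = p" for p unfolding G_def using F(2) by (simp add: bij_is_surj surj_f_inv_f)
  have GF: "G (F x) = x" for x unfolding G_def using F(2) by (simp add: bij_is_inj)
  have Gadd: "G (p + q) = G p + G q" for p q
  proof -
    have "G (p + q) = G (F (G p + G q))" by (simp add: linear_add[OF F(1)] FG)
    then show ?thesis by (simp add: GF)
  qed
  have Gscale: "G (k *\<^sub>R p) = k *\<^sub>R G p" for k p
  proof -
    have "G (k *\<^sub>R p) = G (F (k *\<^sub>R G p))" by (simp add: linear_scale[OF F(1)] FG)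
    then show ?thesis by (simp add: GF)
  qed
  have lf: "linear (f i)" if "i \<in> {1..6}" for i using f that unfolding coframe_def by blast
  have lin: "linear (?g i)" if "i \<in> {1..7}" for i
  proof -
    have "i = 1 \<or> i = 2 \<or> i = 7 \<or> (i \<noteq> 1 \<and> i \<noteq> 2 \<and> i \<noteq> 7 \<and> i \<in> {1..6})" using that by auto
    then show ?thesis
      by (elim disjE)
        (simp_all add: linear_iff linear_add[OF F(1)] linear_scale[OF F(1)] linear_add[OF lf] linear_scale[OF lf]
          algebra_simps)
  qed
  have indep: "\<forall>i\<in>{1..7}. d i = 0" if d: "\<forall>v. (\<Sum>i=1..7. d i * ?g i v) = 0" for d
  proof -
    have e: "d 1 * f 2 (fst p) - d 2 * f 1 (fst p) + d 3 * f 3 (fst p) + d 4 * f 4 (fst p) + d 5 * f 5 (fst p)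
        + d 6 * f 6 (fst p) + d 7 * (c * snd p) = 0" for p
      using d[rule_format, of "G p"] unfolding sum_1_to_7 by (simp add: FG)
    define d' where "d' = d(1 := - d 2, 2 := d 1)"
    have "\<forall>v. (\<Sum>i=1..6. d' i * f i v) = 0"
    proof
      fix v show "(\<Sum>i=1..6. d' i * f i v) = 0" using e[of "(v, 0)"] unfolding sum_1_to_6 by (simp add: d'_def)
    qed
    then have d': "\<forall>i\<in>{1..6}. d' i = 0" using f unfolding coframe_def by blast
    have d6: "d 1 = 0" "d 2 = 0" "d 3 = 0" "d 4 = 0" "d 5 = 0" "d 6 = 0"
      using d'[rule_format, of 1] d'[rule_format, of 2] d'[rule_format, of 3] d'[rule_format, of 4]
        d'[rule_format, of 5] d'[rule_format, of 6] by (simp_all add: d'_def)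
    then have d7: "d 7 = 0" using e[of "(0, 1)"] c by simp
    show ?thesis
    proof
      fix i :: nat assume "i \<in> {1..7}"
      then have "i = 1 \<or> i = 2 \<or> i = 3 \<or> i = 4 \<or> i = 5 \<or> i = 6 \<or> i = 7" by auto
      then show "d i = 0" using d6 d7 by blast
    qed
  qed
  have gen: "\<exists>d. \<forall>v. l v = (\<Sum>i=1..7. d i * ?g i v)" if l: "linear l" for l
  proof -
    have "linear (\<lambda>x. l (G (x, 0)))"
    proof (rule linearI)
      show "l (G (x + y, 0)) = l (G (x, 0)) + l (G (y, 0))" for x y
        using Gadd[of "(x, 0)" "(y, 0)"] by (simp add: linear_add[OF l])
      show "l (G (k *\<^sub>R x, 0)) = k *\<^sub>R l (G (x, 0))" for k x
        using Gscale[of k "(x, 0)"] by (simp add: linear_scale[OF l])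
    qed
    then obtain d where d: "\<And>x. l (G (x, 0)) = (\<Sum>i=1..6. d i * f i x)"
      using f unfolding coframe_def by blast
    \<comment> \<open>Coefficients in the old coframe, with the rotation of the first two forms
      undone and the seventh rescaled.\<close>
    define d' where "d' = (\<lambda>i::nat. if i = 1 then d 2 else if i = 2 then - d 1 else if i = 7 then l (G (0, 1)) / c else d i)"
    have "l v = (\<Sum>i=1..7. d' i * ?g i v)" for v
    proof -
      have "F v = (fst (F v), 0) + snd (F v) *\<^sub>R (0, 1)" by (simp add: prod_eq_iff)
      then have "v = G ((fst (F v), 0) + snd (F v) *\<^sub>R (0, 1))" using GF[of v] by argo
      then have "l v = l (G ((fst (F v), 0) + snd (F v) *\<^sub>R (0, 1)))" by (rule arg_cong)
      also have "\<dots> = l (G (fst (F v), 0)) + snd (F v) * l (G (0, 1))"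
        unfolding Gadd Gscale linear_add[OF l] linear_scale[OF l] by simp
      also have "\<dots> = (\<Sum>i=1..7. d' i * ?g i v)"
        unfolding d sum_1_to_6 sum_1_to_7 using c by (simp add: d'_def)
      finally show ?thesis .
    qed
    then show ?thesis by blast
  qed
  show ?thesis unfolding coframe_def using lin indep gen by blast
qed

text \<open>Brackets have no component in the summand \<real>, so its coordinate is closed, and both
  parts of the 4-form are closed by half-flatness.\<close>

lemma half_flat_sum_cocalibrated:
  fixes br :: "'a::real_vector \<Rightarrow> 'a \<Rightarrow> 'a" and h :: "'b::real_vector \<Rightarrow> 'b \<Rightarrow> 'b"
  assumes iso: "lie_isomorphic br (lie_sum h (abelian_bracket :: real \<Rightarrow> real \<Rightarrow> real))" and hf: "admits_half_flat_SU3 h"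
  shows "admits_cocalibrated_G2 br"
proof -
  obtain F :: "'a \<Rightarrow> 'b \<times> real" where F: "linear F" "bij F"
    and hom: "\<And>x y. F (br x y) = lie_sum h abelian_bracket (F x) (F y)"
    using iso unfolding lie_isomorphic_def by blast
  have Fbr: "fst (F (br x y)) = h (fst (F x)) (fst (F y))" "snd (F (br x y)) = 0" for x y
    unfolding hom lie_sum_def abelian_bracket_def by simp_all
  obtain \<omega> \<Psi> where S: "SU3_structure \<omega> \<Psi>" and c\<omega>: "closed_form h (wedge \<omega> \<omega>)" and c\<Psi>: "closed_form h (\<lambda>xs. Re (\<Psi> xs))"
    using hf unfolding admits_half_flat_SU3_def by blast
  obtain f c where f: "coframe 6 f" "c > 0"
    and \<omega>: "\<And>xs. \<omega> xs = wedge_list f [1,2] xs + wedge_list f [3,4] xs + wedge_list f [5,6] xs"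
    and \<Psi>: "\<And>xs. \<Psi> xs = complex_of_real c *
           wedge (one_form (\<lambda>v. complex_of_real (f 1 v) + \<i> * complex_of_real (f 2 v)))
             (wedge (one_form (\<lambda>v. complex_of_real (f 3 v) + \<i> * complex_of_real (f 4 v)))
               (one_form (\<lambda>v. complex_of_real (f 5 v) + \<i> * complex_of_real (f 6 v)))) xs"
    using S unfolding SU3_structure_def by blast
  define R where "R = (\<lambda>xs. Re (\<Psi> xs))"
  have R: "R [x, y, z] = c * (wedge_list f [1,3,5] [x, y, z] - wedge_list f [1,4,6] [x, y, z]
      - wedge_list f [2,3,6] [x, y, z] - wedge_list f [2,4,5] [x, y, z])" for x y z
    unfolding R_def \<Psi> complex_volume_form(2)[symmetric] by simp
  have \<omega>0: "length xs \<noteq> 2 \<Longrightarrow> \<omega> xs = 0" for xs by (simp add: \<omega> wedge_list_length)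
  have \<omega>2: "\<omega> [x, y] = 1 * wedge_list f [1,2] [x, y] + 1 * wedge_list f [3,4] [x, y] + 1 * wedge_list f [5,6] [x, y]" for x y
    by (simp add: \<omega>)
  have W: "wedge \<omega> \<omega> [x, y, z, w] = 2 * (wedge_list f [1,2,3,4] [x, y, z, w]
    + wedge_list f [1,2,5,6] [x, y, z, w] + wedge_list f [3,4,5,6] [x, y, z, w])" for x y z w
    by (subst wedge_square[OF _ \<omega>2]) (simp_all add: \<omega>0)
  define g where "g = (\<lambda>i x. if i = 1 then f 2 (fst (F x)) else if i = 2 then - f 1 (fst (F x))
    else if i = 7 then c * snd (F x) else f i (fst (F x)))"
  have g: "coframe 7 g" unfolding g_def by (rule coframe_7_of_sum[OF F f(1)]) (use f(2) in simp)
  define \<phi> where "\<phi> = (\<lambda>xs. wedge_list g [1,2,3,4] xs + wedge_list g [1,2,5,6] xs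
           + wedge_list g [3,4,5,6] xs + wedge_list g [2,4,6,7] xs
           - wedge_list g [1,3,6,7] xs - wedge_list g [1,4,5,7] xs
           - wedge_list g [2,3,5,7] xs)"
  have pos: "positive_4form \<phi>" unfolding positive_4form_def \<phi>_def using g by blast
  have r: "wedge_list g [2,4,6] [x, y, z] = - wedge_list f [1,4,6] [fst (F x), fst (F y), fst (F z)]"
    "wedge_list g [1,3,6] [x, y, z] = wedge_list f [2,3,6] [fst (F x), fst (F y), fst (F z)]"
    "wedge_list g [1,4,5] [x, y, z] = wedge_list f [2,4,5] [fst (F x), fst (F y), fst (F z)]"
    "wedge_list g [2,3,5] [x, y, z] = - wedge_list f [1,3,5] [fst (F x), fst (F y), fst (F z)]" for x y z
    by (simp_all add: wedge_list_3 g_def algebra_simps)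
  have w: "wedge_list g [1,2,3,4] [x, y, z, w] = wedge_list f [1,2,3,4] [fst (F x), fst (F y), fst (F z), fst (F w)]"
    "wedge_list g [1,2,5,6] [x, y, z, w] = wedge_list f [1,2,5,6] [fst (F x), fst (F y), fst (F z), fst (F w)]"
    "wedge_list g [3,4,5,6] [x, y, z, w] = wedge_list f [3,4,5,6] [fst (F x), fst (F y), fst (F z), fst (F w)]" for x y z w
    by (simp_all add: wedge_list_4 wedge_list_3 g_def algebra_simps)
  have g7: "g 7 x = c * snd (F x)" for x by (simp add: g_def)
  have \<phi>: "\<phi> [x, y, z, w] = (1 / 2) * wedge \<omega> \<omega> [fst (F x), fst (F y), fst (F z), fst (F w)]
      + R [fst (F x), fst (F y), fst (F z)] * snd (F w) - R [fst (F x), fst (F y), fst (F w)] * snd (F z)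
      + R [fst (F x), fst (F z), fst (F w)] * snd (F y) - R [fst (F y), fst (F z), fst (F w)] * snd (F x)" for x y z w
    unfolding \<phi>_def w wedge_list_4_last[of g _ _ _ 7] r g7 W R by (simp add: algebra_simps)
  have "ce_d br \<phi> [a, b, d, e, k] = 0" for a b d e k
  proof -
    \<comment> \<open>The five terms with \<open>snd\<close> are the expansion of d Re \<Psi> wedged
      with the closed coordinate of \<real>.\<close>
    have "ce_d br \<phi> [a, b, d, e, k] = (1 / 2) * ce_d h (wedge \<omega> \<omega>) [fst (F a), fst (F b), fst (F d), fst (F e), fst (F k)]
      + snd (F k) * ce_d h R [fst (F a), fst (F b), fst (F d), fst (F e)]
      - snd (F e) * ce_d h R [fst (F a), fst (F b), fst (F d), fst (F k)]
      + snd (F d) * ce_d h R [fst (F a), fst (F b), fst (F e), fst (F k)]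
      - snd (F b) * ce_d h R [fst (F a), fst (F d), fst (F e), fst (F k)]
      + snd (F a) * ce_d h R [fst (F b), fst (F d), fst (F e), fst (F k)]"
      unfolding ce_d_5 ce_d_4 \<phi> Fbr by (simp add: algebra_simps)
    also have "\<dots> = 0" using c\<omega> c\<Psi> unfolding closed_form_def R_def by simp
    finally show ?thesis .
  qed
  then have "closed_form br \<phi>"
    by (subst closed_form_4_iff) (simp_all add: \<phi>_def wedge_list_length)
  moreover have "orientation 7 {\<lambda>xs. c * wedge_list g [1..<Suc 7] xs | c. c > 0}"
    unfolding orientation_def using g by blast
  ultimately show ?thesis unfolding admits_cocalibrated_G2_def G2_structure_def using pos by blast
qed

text \<open>A nonabelian nilpotent algebra needs two generators, so \<open>C 1\<close> has dimension
  at most 4; strict decrease of the series leaves the cases treated above.\<close>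

lemma (in nilpotent_lie_alg) classification_6:
  assumes d6: "DIM('a) = 6"
  shows "has_half_flat_equations br \<or> excluded_equations br"
proof (cases "C 1 = {0}")
  case True
  have z: "br u v = 0" for u v using C_1[of u v] unfolding True by simp
  obtain S where S: "card S = 6" "UNIV \<subseteq> span (S \<union> C 1)" "finite S"
    using generators_exist[OF d6] unfolding True by auto
  obtain xs where xs: "set xs = S" "distinct xs" using finite_distinct_list[OF S(3)] by blast
  then have "length xs = 6" using S(1) distinct_card by fastforce
  then obtain x1 x2 x3 x4 x5 x6 where e: "xs = [x1, x2, x3, x4, x5, x6]"
    by (auto simp: length_Suc_conv numeral_eq_Suc)
  have "span (set [x1, x2, x3, x4, x5, x6]) = UNIV"
    by (rule span_listI[OF S(2)[unfolded True]]) (use xs(1) in \<open>auto simp: e span_zero intro: span_base\<close>)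
  then have "has_half_flat_equations br" by (rule case_6[rotated]) (use d6 z in \<open>simp_all add: dim_UNIV\<close>)
  then show ?thesis ..
next
  case False
  have C2: "dim (C (Suc 1)) < dim (C 1)"
  proof (rule ccontr)
    assume "\<not> ?thesis"
    then have "C 1 \<subseteq> span (C (Suc 1))"
      using subspace_subset_dim[OF C_subspace C_decreasing[of 1]] by simp
    then have "C 1 \<subseteq> C (Suc 1)" unfolding span_eq_iff[THEN iffD2, OF C_subspace] .
    then have "C 1 = {0}" by (rule C_stable_imp_zero)
    then show False using False by simp
  qed
  have zero: "C n = {0}" if "dim (C n) = 0" for n
    using that subspace_0[OF C_subspace[of n]] dim_eq_0[of "C n"] by blast
  have "dim (C 1) \<noteq> 0" using zero[of 1] False by blast
  moreover have "dim (C 1) \<le> 4" using few_generators[OF False] d6 by simp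
  ultimately consider "dim (C 1) = 1" | "dim (C 1) = 2" | "dim (C 1) = 3" | "dim (C 1) = 4" by linarith
  then show ?thesis
  proof cases
    case 1
    then show ?thesis using classify_51[OF d6] by blast
  next
    case 2
    then have "dim (C (Suc 1)) = 0 \<or> dim (C (Suc 1)) = 1" using C2 by linarith
    then show ?thesis using classify_42[OF d6 2 zero] classify_411[OF d6 2] by blast
  next
    case 3
    then have "dim (C (Suc 1)) = 0 \<or> dim (C (Suc 1)) = 1 \<or> dim (C (Suc 1)) = 2" using C2 by linarith
    then show ?thesis using classify_33[OF d6 3 zero] classify_321[OF d6 3] classify_31[OF d6 3] by blast
  next
    case 4
    then show ?thesis by (rule classify_2[OF d6])
  qed
qed

section \<open>Splitting off a central line\<close>

lemma lie_isomorphicI: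
  assumes "linear G" "bij G" "\<And>p q. G (br' p q) = br (G p) (G q)"
  shows "lie_isomorphic br br'"
proof -
  define F where "F = inv G"
  have FG: "F (G p) = p" for p unfolding F_def using assms(2) by (simp add: bij_is_inj)
  have GF: "G (F x) = x" for x unfolding F_def using assms(2) by (simp add: bij_is_surj surj_f_inv_f)
  have "linear F"
  proof (rule linearI)
    show "F (x + y) = F x + F y" for x y
      using FG[of "F x + F y"] by (simp add: linear_add[OF assms(1)] GF)
    show "F (k *\<^sub>R x) = k *\<^sub>R F x" for k x
      using FG[of "k *\<^sub>R F x"] by (simp add: linear_scale[OF assms(1)] GF)
  qed
  moreover have "bij F" unfolding F_def by (rule bij_imp_bij_inv[OF assms(2)])
  moreover have "F (br x y) = br' (F x) (F y)" for x y
    using FG[of "br' (F x) (F y)"] by (simp add: assms(3) GF)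
  ultimately show ?thesis unfolding lie_isomorphic_def by blast
qed

text \<open>All brackets lie in \<open>C 1\<close>, so any hyperplane containing \<open>C 1\<close>
  is an ideal. Since w is not in \<open>C 1\<close>, such a hyperplane can be chosen complementary
  to w.\<close>

lemma central_summand:
  fixes br :: "'a::real_vector \<Rightarrow> 'a \<Rightarrow> 'a"
  assumes lie: "lie_algebra br" and nil: "nilpotent_lie br" and dm: "dim (UNIV :: 'a set) = 7"
    and cen: "\<And>u. br u w = 0" and nw: "w \<notin> lower_central br 1"
  obtains h :: "real^6 \<Rightarrow> real^6 \<Rightarrow> real^6" and E where "lie_algebra h" "nilpotent_lie h"
    "lie_isomorphic br (lie_sum h (abelian_bracket :: real \<Rightarrow> real \<Rightarrow> real))"
    "linear E" "\<And>a b. br (E a) (E b) = E (h a b)" "span (insert w (range E)) = UNIV"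
proof -
  interpret lie_alg br by unfold_locales (rule lie)
  obtain B1 where B1: "B1 \<subseteq> C 1" "independent B1" "C 1 \<subseteq> span B1"
    using maximal_independent_subset[of "C 1"] by blast
  have sB1: "span B1 = C 1" using B1 span_minimal[OF B1(1) C_subspace] by blast
  have wB1: "w \<notin> span B1" using nw sB1 by simp
  have ind: "independent (insert w B1)" by (rule independent_insertI[OF wB1 B1(2)])
  \<comment> \<open>Extending a basis of \<open>C 1\<close> together with w guarantees that
    \<open>C 1\<close> stays in the span after w is removed.\<close>
  obtain B where B: "insert w B1 \<subseteq> B" "B \<subseteq> UNIV" "independent B" "UNIV \<subseteq> span B"
    by (rule maximal_independent_subset_extend[OF subset_UNIV ind])
  note B = B(1,3,4)
  have "card B = dim B" using dim_eq_card_independent[OF B(2)] by simp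
  also have "\<dots> = dim (span B)" by (simp add: dim_span)
  also have "span B = UNIV" using B(3) by blast
  finally have cB: "card B = 7" using dm by simp
  then have fB: "finite B" by (intro card_ge_0_finite) simp
  define B' where "B' = B - {w}"
  have BB': "B = insert w B'" using B(1) by (auto simp: B'_def)
  have iB': "independent B'" using B(2) by (rule independent_mono) (simp add: B'_def)
  have wB': "w \<notin> span B'" using B(1,2) unfolding B'_def dependent_def by blast
  have cB': "card B' = 6" using cB B(1) fB by (simp add: B'_def)
  have w0: "w \<noteq> 0" using wB' span_zero by metis
  have sub: "C 1 \<subseteq> span B'"
  proof -
    have "B1 \<subseteq> B'" using B(1) wB1 span_base[of w B1] by (auto simp: B'_def)
    then show ?thesis using sB1 span_mono by blast
  qed
  have K: "lie_ideal br (span B')" unfolding lie_ideal_def using C_1 sub by blast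
  have K': "lie_ideal br (span {w})"
    unfolding lie_ideal_def
  proof (intro conjI allI ballI)
    fix x y assume "y \<in> span {w}"
    then obtain k where k: "y = k *\<^sub>R w" by (rule span_singletonE)
    show "br x y \<in> span {w}" unfolding k by (simp add: expand cen span_zero)
  qed simp
  have int: "span B' \<inter> span {w} = {0}"
  proof -
    have "x = 0" if x: "x \<in> span B'" "x \<in> span {w}" for x
    proof -
      obtain k where k: "x = k *\<^sub>R w" using x(2) by (rule span_singletonE)
      have "k = 0"
      proof (rule ccontr)
        assume "k \<noteq> 0"
        then have "w = (1 / k) *\<^sub>R x" using k by simp
        then have "w \<in> span B'" using span_scale[OF x(1), of "1 / k"] by simp
        then show False using wB' by simp
      qed
      then show ?thesis using k by simp
    qed
    then show ?thesis using span_zero by blast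
  qed
  have sum: "\<exists>u k. v = u + k *\<^sub>R w \<and> u \<in> span B'" for v
  proof -
    have "v \<in> span (insert w B')" using B(3) BB' by blast
    then obtain k where k: "v - k *\<^sub>R w \<in> span B'" by (auto simp: span_breakdown_eq)
    have "v = (v - k *\<^sub>R w) + k *\<^sub>R w" by simp
    then show ?thesis using k by blast
  qed
  have sum': "{x + y | x y. x \<in> span B' \<and> y \<in> span {w}} = UNIV"
  proof -
    have "v \<in> {x + y | x y. x \<in> span B' \<and> y \<in> span {w}}" for v
    proof -
      obtain u k where "v = u + k *\<^sub>R w" "u \<in> span B'" using sum by blast
      moreover have "k *\<^sub>R w \<in> span {w}" by (intro span_scale span_base) simp
      ultimately show ?thesis by blast
    qed
    then show ?thesis by blast
  qed
  have fB': "finite B'" using fB by (simp add: B'_def)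
  have cn: "card B' = CARD(6)" using cB' by simp
  have iw: "independent {w}" using w0 by simp
  obtain E :: "real^6 \<Rightarrow> 'a" and \<pi> h where m: "lie_model br (span B') E \<pi> h"
    using lie_model_exists[where 'n = 6, OF lie K K' int sum' fB' iB' refl cn _ iw refl] by blast
  have E: "linear E" "range E = span B'" "linear \<pi>" "\<And>a. \<pi> (E a) = a" "\<And>a b. br (E a) (E b) = E (h a b)"
    using m unfolding lie_model_def by blast+
  have cen': "br w u = 0" for u using swap[of w u] cen[of u] by simp
  \<comment> \<open>The inverse direction of the isomorphism; it is a homomorphism because w is
    central.\<close>
  define G where "G = (\<lambda>p :: (real^6) \<times> real. E (fst p) + snd p *\<^sub>R w)"
  have lG: "linear G"
    unfolding G_def by (rule linearI) (simp_all add: linear_add[OF E(1)] linear_scale[OF E(1)] algebra_simps)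
  have "inj G"
    unfolding linear_injective_0[OF lG]
  proof (intro allI impI)
    fix p assume "G p = 0"
    then have e: "E (fst p) = (- snd p) *\<^sub>R w" by (simp add: G_def add_eq_0_iff2)
    have "E (fst p) \<in> span {w}" unfolding e by (intro span_scale span_base) simp
    moreover have "E (fst p) \<in> span B'" using E(2) by blast
    ultimately have z: "E (fst p) = 0" using int by blast
    then have "snd p = 0" using e w0 by simp
    moreover have "fst p = 0" using E(4)[of "fst p"] linear_0[OF E(3)] z by simp
    ultimately show "p = 0" by (simp add: prod_eq_iff)
  qed
  moreover have "\<exists>p. v = G p" for v
  proof -
    obtain u k where uk: "v = u + k *\<^sub>R w" "u \<in> span B'" using sum by blast
    then obtain a where "u = E a" using E(2) by blast
    then have "v = G (a, k)" using uk by (simp add: G_def)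
    then show ?thesis by blast
  qed
  ultimately have bG: "bij G" by (simp add: bij_def surj_def)
  have "lie_isomorphic br (lie_sum h (abelian_bracket :: real \<Rightarrow> real \<Rightarrow> real))"
    by (rule lie_isomorphicI[OF lG bG])
      (simp add: G_def lie_sum_def abelian_bracket_def expand cen cen' E(5))
  moreover have "span (insert w (range E)) = UNIV"
    using B(3) BB' E(2) span_superset[of B'] span_mono[of "insert w B'" "insert w (range E)"] by blast
  ultimately show thesis using that lie_model_nilpotent[OF m lie nil] E(1,5) by blast
qed

text \<open>The situation to be ruled out: two complementary ideals while every central element lies
  in the derived algebra. It is symmetric in the two ideals, with bases carried along to fix their
  dimensions.\<close>

locale ideal_pair = lie_alg br for br :: "'a::real_vector \<Rightarrow> 'a \<Rightarrow> 'a" +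
  fixes K K' B B' :: "'a set"
  assumes nil: "nilpotent_lie br"
    and ideal: "lie_ideal br K" "lie_ideal br K'"
    and inter: "K \<inter> K' = {0}" and sum: "{x + y | x y. x \<in> K \<and> y \<in> K'} = UNIV"
    and basis: "finite B" "independent B" "span B = K"
    and basis': "finite B'" "independent B'" "span B' = K'"
    and centre: "\<And>w. (\<And>u. br u w = 0) \<Longrightarrow> w \<in> lower_central br 1"
begin

lemma ideal_pair_commute: "ideal_pair br K' K B' B"
proof unfold_locales
  have "v \<in> {x + y | x y. x \<in> K' \<and> y \<in> K}" for v
  proof -
    have "v \<in> {x + y | x y. x \<in> K \<and> y \<in> K'}" using sum by simp
    then obtain x y where "v = x + y" "x \<in> K" "y \<in> K'" by blast
    then have "v = y + x" "x \<in> K" "y \<in> K'" by simp_all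
    then show ?thesis by blast
  qed
  then show "{x + y | x y. x \<in> K' \<and> y \<in> K} = UNIV" by blast
  show "K' \<inter> K = {0}" using inter by blast
qed (fact nil ideal basis basis' centre)+

lemma mixed_bracket:
  assumes "x \<in> K" "y \<in> K'"
  shows "br x y = 0"
proof -
  have s: "subspace K" using ideal(1) unfolding lie_ideal_def by blast
  have "br y x \<in> K" using ideal(1) assms(1) unfolding lie_ideal_def by blast
  then have "br x y \<in> K" unfolding swap[of x y] by (rule subspace_neg[OF s])
  moreover have "br x y \<in> K'" using ideal(2) assms(2) unfolding lie_ideal_def by blast
  ultimately show ?thesis using inter by blast
qed

text \<open>A central element of one ideal commutes with the other ideal too, so it is central in
  the whole algebra. The centre condition therefore passes to each ideal, and a nonzero ideal cannot
  be abelian.\<close>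

lemma model_with_central_derived:
  assumes n: "card B = CARD('n::finite)"
  obtains E :: "real^'n \<Rightarrow> 'a" and h where "linear E" "range E = K" "\<forall>a b. br (E a) (E b) = E (h a b)"
    "nilpotent_lie_alg h" "\<forall>c. (\<forall>u. h u c = 0) \<longrightarrow> c \<in> lower_central h 1" "lower_central h 1 \<noteq> {0}"
proof -
  obtain E :: "real^'n \<Rightarrow> 'a" and \<pi> h where m: "lie_model br K E \<pi> h"
    using lie_model_exists[where 'n = 'n, OF lie ideal inter sum basis n basis'] by blast
  have E: "linear E" "range E = K" "linear \<pi>" "\<And>a. \<pi> (E a) = a" "\<And>a b. br (E a) (E b) = E (h a b)"
    "\<And>x y. \<pi> (br x y) = h (\<pi> x) (\<pi> y)"
    using m unfolding lie_model_def by blast+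
  have nh: "nilpotent_lie_alg h"
    by unfold_locales (rule lie_model_nilpotent[OF m lie nil])+
  interpret h: nilpotent_lie_alg h by (rule nh)
  have Z: "c \<in> lower_central h 1" if c: "\<And>u. h u c = 0" for c
  proof -
    have Ec: "E c \<in> K" using E(2) by blast
    \<comment> \<open>Central in K and commuting with K', hence central.\<close>
    have "br u (E c) = 0" for u
    proof -
      have "u \<in> {x + y | x y. x \<in> K \<and> y \<in> K'}" using sum by simp
      then obtain x y where u: "u = x + y" "x \<in> K" "y \<in> K'" by blast
      obtain a where a: "x = E a" using u(2) E(2) by blast
      have "br x (E c) = 0" unfolding a E(5) c by (rule linear_0[OF E(1)])
      moreover have "br y (E c) = 0" using mixed_bracket[OF Ec u(3)] swap[of y "E c"] by simp
      ultimately show ?thesis unfolding u(1) by (simp add: expand)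
    qed
    then have "E c \<in> lower_central br 1" by (rule centre)
    moreover have "surj \<pi>" using E(4) by (rule surjI)
    then have "lower_central h 1 = \<pi> ` lower_central br 1"
      using lower_central_hom_image[where F = \<pi> and br = br and br' = h and n = 1] E(3,6) by blast
    ultimately have "\<pi> (E c) \<in> lower_central h 1" by blast
    then show ?thesis by (simp only: E(4))
  qed
  \<comment> \<open>An abelian model would be its own centre and so contained in its zero derived
    algebra.\<close>
  moreover have "lower_central h 1 \<noteq> {0}"
  proof
    assume z: "lower_central h 1 = {0}"
    have "h u c = 0" for u c using h.C_1[of u c] unfolding z by simp
    then have "c = 0" for c :: "real^'n" using Z[of c] unfolding z by simp
    then show False using zero_neq_one[where 'a = "real^'n"] by metis
  qed
  ultimately show thesis using that[OF E(1,2) _ nh] E(5) by blast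
qed

text \<open>A nonzero derived algebra has dimension at least 1, and two generators are needed beside
  it.\<close>

lemma card_not_small:
  assumes "card B = CARD('n::finite)"
  shows "card B \<ge> 3"
proof -
  obtain E :: "real^'n \<Rightarrow> 'a" and h where "linear E" "range E = K" "\<forall>a b. br (E a) (E b) = E (h a b)"
    and h: "nilpotent_lie_alg h" and "\<forall>c. (\<forall>u. h u c = 0) \<longrightarrow> c \<in> lower_central h 1"
    and nz: "lower_central h 1 \<noteq> {0}"
    by (rule model_with_central_derived[OF assms])
  interpret h: nilpotent_lie_alg h by (rule h)
  have d0: "dim (h.C 1) \<noteq> 0"
    using nz subspace_0[OF h.C_subspace[of 1]] dim_eq_0[of "h.C 1"] by blast
  have "dim (h.C 1) + 2 \<le> CARD('n)" using h.few_generators[OF nz] by simp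
  then show ?thesis using d0 assms by linarith
qed

lemma card_ge_3:
  assumes "K \<noteq> {0}"
  shows "card B \<ge> 3"
proof -
  have "card B \<noteq> 0" using basis assms by (auto simp: card_eq_0_iff)
  \<comment> \<open>A model requires a type with as many elements as the basis, so the dimensions 1
    and 2 are refuted separately.\<close>
  then have "card B = 1 \<or> card B = 2 \<or> card B \<ge> 3" by linarith
  then show ?thesis using card_not_small[where 'n = 1] card_not_small[where 'n = 2] by auto
qed

lemma heisenberg_ideal:
  assumes "card B = 3"
  obtains a b where "span {a, b, br a b} = K" "br a (br a b) = 0" "br b (br a b) = 0"
proof -
  have n: "card B = CARD(3)" using assms by simp
  obtain E :: "real^3 \<Rightarrow> 'a" and h where E: "linear E" "range E = K" "\<forall>a b. br (E a) (E b) = E (h a b)"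
    and h: "nilpotent_lie_alg h" "\<forall>c. (\<forall>u. h u c = 0) \<longrightarrow> c \<in> lower_central h 1" "lower_central h 1 \<noteq> {0}"
    by (rule model_with_central_derived[OF n])
  interpret h: nilpotent_lie_alg h by (rule h(1))
  have d: "DIM(real^3) = 3" by simp
  obtain a b where ab: "span {a, b, h a b} = UNIV" "\<And>u. h u (h a b) = 0"
    using h.heisenberg_basis[OF d h(3)] by blast
  have "span (E ` {a, b, h a b}) = K" unfolding linear_span_image[OF E(1)] ab(1) E(2) ..
  then show thesis using that[of "E a" "E b"] by (simp add: E(3) ab(2) linear_0[OF E(1)])
qed

lemma filiform_ideal:
  assumes "card B = 4"
  obtains x y where "span {x, y, br x y, br x (br x y)} = K" "br y (br x y) = 0" "br x (br x (br x y)) = 0"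
    "br y (br x (br x y)) = 0" "br (br x y) (br x (br x y)) = 0"
proof -
  have n: "card B = CARD(4)" using assms by simp
  obtain E :: "real^4 \<Rightarrow> 'a" and h where E: "linear E" "range E = K" "\<forall>a b. br (E a) (E b) = E (h a b)"
    and h: "nilpotent_lie_alg h" "\<forall>c. (\<forall>u. h u c = 0) \<longrightarrow> c \<in> lower_central h 1" "lower_central h 1 \<noteq> {0}"
    by (rule model_with_central_derived[OF n])
  interpret h: nilpotent_lie_alg h by (rule h(1))
  have d: "DIM(real^4) = 4" by simp
  have Z: "c \<in> lower_central h 1" if "\<And>u. h u c = 0" for c using h(2) that by blast
  obtain x y where xy: "span {x, y, h x y, h x (h x y)} = UNIV" "h y (h x y) = 0" "\<And>u. h u (h x (h x y)) = 0"
    using h.filiform_basis[OF d h(3) Z] by blast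
  have "span (E ` {x, y, h x y, h x (h x y)}) = K" unfolding linear_span_image[OF E(1)] xy(1) E(2) ..
  then show thesis using that[of "E x" "E y"] by (simp add: E(3) xy(2,3) linear_0[OF E(1)])
qed

lemma not_cocalibrated_3_4:
  assumes "card B = 3" "card B' = 4" "cocalibrated br \<phi>"
  shows False
proof -
  interpret c: cocalibrated br \<phi> by fact
  interpret s: ideal_pair br K' K B' B by (rule ideal_pair_commute)
  obtain a b where a: "span {a, b, br a b} = K" "br a (br a b) = 0" "br b (br a b) = 0"
    using heisenberg_ideal[OF assms(1)] by blast
  obtain x y where x: "span {x, y, br x y, br x (br x y)} = K'" "br y (br x y) = 0" "br x (br x (br x y)) = 0"
    "br y (br x (br x y)) = 0" "br (br x y) (br x (br x y)) = 0"
    using s.filiform_ideal[OF assms(2)] by blast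
  let ?S = "set [a, b, br a b, x, y, br x y, br x (br x y)]"
  have "{a, b, br a b} \<subseteq> ?S" "{x, y, br x y, br x (br x y)} \<subseteq> ?S" by auto
  then have KS: "K \<subseteq> span ?S" "K' \<subseteq> span ?S" using a(1) x(1) span_mono by blast+
  have "v \<in> span ?S" for v
  proof -
    have "v \<in> {x + y | x y. x \<in> K \<and> y \<in> K'}" using sum by simp
    then obtain p q where v: "v = p + q" "p \<in> K" "q \<in> K'" by blast
    show ?thesis unfolding v(1) by (rule span_add) (use v KS in blast)+
  qed
  then have sp: "span ?S = UNIV" by blast
  have m: "br u w = 0" if "u \<in> {a, b, br a b}" "w \<in> {x, y, br x y, br x (br x y)}" for u w
    using mixed_bracket[of u w] span_base[OF that(1)] span_base[OF that(2)] a(1) x(1) by simp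
  show False
    by (rule c.not_heisenberg_plus_filiform[OF sp refl a(2,3) refl refl x(2-5) m])
qed

end

text \<open>If all central elements were in the derived algebra, both ideals would have dimension at
  least 3. Since the dimensions add up to 7, they would be 3 and 4, the pair that admits no closed
  positive 4-form.\<close>

lemma cocalibrated_imp_central_summand:
  fixes br :: "'a::real_vector \<Rightarrow> 'a \<Rightarrow> 'a"
  assumes c: "cocalibrated br \<phi>" and nil: "nilpotent_lie br" and dec: "decomposable_lie br"
  obtains w where "\<And>u. br u w = 0" "w \<notin> lower_central br 1"
proof -
  interpret c: cocalibrated br \<phi> by (rule c)
  have False if Z: "\<And>w. (\<And>u. br u w = 0) \<Longrightarrow> w \<in> lower_central br 1"
  proof -
    obtain I J where I: "lie_ideal br I" and J: "lie_ideal br J" and nz: "I \<noteq> {0}" "J \<noteq> {0}"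
      and int: "I \<inter> J = {0}" and sum: "{x + y | x y. x \<in> I \<and> y \<in> J} = UNIV"
      using dec unfolding decomposable_lie_def by blast
    obtain T :: "'a set" where T: "T \<subseteq> UNIV" "independent T" "UNIV \<subseteq> span T" "card T = dim (UNIV :: 'a set)"
      by (rule basis_exists)
    \<comment> \<open>A positive dimension forces the chosen basis to be finite, and this bounds all
      independent sets.\<close>
    have fT: "finite T" using T(4) c.dim7 card_ge_0_finite[of T] by simp
    have fin: "finite S" if S: "independent S" for S :: "'a set"
      using independent_span_bound[OF fT S] T(3) by blast
    have sub: "subspace I" "subspace J" using I J unfolding lie_ideal_def by blast+
    obtain B where B0: "B \<subseteq> I" "independent B" "I \<subseteq> span B" using maximal_independent_subset[of I] by blast
    obtain B' where B0': "B' \<subseteq> J" "independent B'" "J \<subseteq> span B'" using maximal_independent_subset[of J] by blast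
    have B: "finite B" "independent B" "span B = I"
      using B0 fin span_minimal[OF B0(1) sub(1)] by blast+
    have B': "finite B'" "independent B'" "span B' = J"
      using B0' fin span_minimal[OF B0'(1) sub(2)] by blast+
    interpret p: ideal_pair br I J B B'
      by unfold_locales (fact nil I J int sum B B' Z)+
    interpret q: ideal_pair br J I B' B by (rule p.ideal_pair_commute)
    have int': "span B \<inter> span B' = {0}" using int B(3) B'(3) by simp
    note U = independent_complementary[OF B(1) B'(1) B(2) B'(2) int']
    have "v \<in> span (B \<union> B')" for v
    proof -
      have "v \<in> {x + y | x y. x \<in> I \<and> y \<in> J}" using sum by simp
      then obtain x y where v: "v = x + y" "x \<in> span B" "y \<in> span B'" using B(3) B'(3) by blast
      show ?thesis unfolding v(1)
        by (rule span_add) (use v span_mono[of B "B \<union> B'"] span_mono[of B' "B \<union> B'"] in blast)+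
    qed
    then have "span (B \<union> B') = UNIV" by blast
    then have "card (B \<union> B') = 7"
      using dim_eq_card_independent[OF U(1)] c.dim7 by (metis dim_span)
    then have "card B + card B' = 7" using card_Un_disjoint[OF B(1) B'(1) U(2)] by simp
    then have "card B = 3 \<and> card B' = 4 \<or> card B' = 3 \<and> card B = 4"
      using p.card_ge_3[OF nz(1)] q.card_ge_3[OF nz(2)] by linarith
    then show False using p.not_cocalibrated_3_4[OF _ _ c] q.not_cocalibrated_3_4[OF _ _ c] by blast
  qed
  then show thesis using that by blast
qed

theorem proposition4p2:
  fixes br :: "'a::real_vector \<Rightarrow> 'a \<Rightarrow> 'a"
  assumes "lie_algebra br"
    and "dim (UNIV :: 'a set) = 7"
    and "nilpotent_lie br"
    and "decomposable_lie br"
  shows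
    "(admits_cocalibrated_G2 br \<longleftrightarrow>
       (\<exists>h :: real^6 \<Rightarrow> real^6 \<Rightarrow> real^6.
          lie_algebra h \<and> nilpotent_lie h \<and> admits_half_flat_SU3 h \<and>
          lie_isomorphic br (lie_sum h (abelian_bracket :: real \<Rightarrow> real \<Rightarrow> real)))) \<and>
     (admits_cocalibrated_G2 br \<longleftrightarrow>
       (\<exists>h :: real^6 \<Rightarrow> real^6 \<Rightarrow> real^6.
          lie_algebra h \<and> (\<exists>L\<in>set half_flat_list. has_structure_equations h L) \<and>
          lie_isomorphic br (lie_sum h (abelian_bracket :: real \<Rightarrow> real \<Rightarrow> real))))"
proof -
  let ?i = "admits_cocalibrated_G2 br"
  let ?iso = "\<lambda>h. lie_isomorphic br (lie_sum h (abelian_bracket :: real \<Rightarrow> real \<Rightarrow> real))"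
  let ?ii = "\<exists>h :: real^6 \<Rightarrow> real^6 \<Rightarrow> real^6. lie_algebra h \<and> nilpotent_lie h \<and> admits_half_flat_SU3 h \<and> ?iso h"
  let ?iii = "\<exists>h :: real^6 \<Rightarrow> real^6 \<Rightarrow> real^6. lie_algebra h \<and> (\<exists>L\<in>set half_flat_list. has_structure_equations h L) \<and> ?iso h"
  \<comment> \<open>The implications form the cycle (i) to (iii) to (ii) to (i).\<close>
  have 21: "?ii \<Longrightarrow> ?i" using half_flat_sum_cocalibrated by blast
  have 13: ?iii if i: ?i
  proof -
    obtain \<phi> where "positive_4form \<phi>" "closed_form br \<phi>"
      using i unfolding admits_cocalibrated_G2_def G2_structure_def by blast
    then have c: "cocalibrated br \<phi>" by unfold_locales (use assms in simp_all)
    obtain w where w: "\<And>u. br u w = 0" "w \<notin> lower_central br 1"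
      using cocalibrated_imp_central_summand[OF c assms(3,4)] by blast
    obtain h :: "real^6 \<Rightarrow> real^6 \<Rightarrow> real^6" and E where h: "lie_algebra h" "nilpotent_lie h" "?iso h"
      and E: "linear E" "\<And>a b. br (E a) (E b) = E (h a b)" "span (insert w (range E)) = UNIV"
      using central_summand[OF assms(1,3,2) w] by blast
    interpret h: nilpotent_lie_alg h by unfold_locales (fact h)+
    have "has_half_flat_equations h \<or> excluded_equations h" by (rule h.classification_6) simp
    moreover have "\<not> excluded_equations h"
      using cocalibrated.not_excluded_equations[OF c _ E(1,2) w(1) E(3)] by blast
    ultimately show ?thesis using h(1,3) unfolding has_half_flat_equations_def by blast
  qed
  have 32: ?ii if iii: ?iii
  proof -
    obtain h :: "real^6 \<Rightarrow> real^6 \<Rightarrow> real^6" and L where h: "lie_algebra h" "L \<in> set half_flat_list"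
      "has_structure_equations h L" "?iso h"
      using iii by blast
    obtain F where F: "linear F" "bij F" "\<And>x y. F (br x y) = lie_sum h (abelian_bracket :: real \<Rightarrow> real \<Rightarrow> real) (F x) (F y)"
      using h(4) unfolding lie_isomorphic_def by blast
    \<comment> \<open>The projection to the first summand is a surjective homomorphism, so
      nilpotency passes to h.\<close>
    have "linear (\<lambda>x. fst (F x))"
      by (rule linearI) (simp_all add: linear_add[OF F(1)] linear_scale[OF F(1)])
    moreover have "surj (\<lambda>x. fst (F x))"
    proof -
      have "\<exists>x. a = fst (F x)" for a
        using F(2) by (metis bij_pointE fst_conv)
      then show ?thesis by (simp add: surj_def)
    qed
    moreover have "fst (F (br x y)) = h (fst (F x)) (fst (F y))" for x y by (simp add: F(3) lie_sum_def)
    ultimately have "nilpotent_lie h"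
      using nilpotent_hom_image[where F = "\<lambda>x. fst (F x)" and br = br and br' = h] assms(3) by blast
    moreover have "admits_half_flat_SU3 h"
      by (rule half_flat_list_admits_half_flat[OF h(1) _ h(2,3)]) (simp add: dim_UNIV)
    ultimately show ?thesis using h(1,4) by blast
  qed
  show ?thesis using 21 13 32 by blast
qed

end
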